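(* Fix $\hat t\in\mathbb{R}_+\cup\{+\infty\}$ and let $\underline{p}=(p_k)_{k\ge1}$ satisfy $p_k\ge0$ for all $k$ and $\sum_{k=1}^\infty p_k=1$. Then the multi-type branching process tree $\mathcal{M}_{\underline{p}}(\hat t)$ with its vertex types $T_{\mathbf{i}}$ and edge labels $\tau^{\mathbf{i}}$ has the same distribution as $G^\infty_{\underline{p}}(\hat t)$ (the component of the root at time $\hat t$ in the random degree constrained process on the PWIT) with its phantom saturation times $T_{\mathbf{i}}$ and edge labels $\tau^{\mathbf{i}}$. (Both are regarded as random rooted trees with vertex decorations and edge labels, up to root-preserving isomorphism; equivalently, the children of each vertex are re-indexed in increasing order of edge label.)
   Context: **PWIT.** The Poisson weighted infinite tree is the infinite rooted tree whose vertices are all finite strings of positive integers; the root is the empty string $\varnothing$ and the children of the vertex $\mathbf{i}$ are $\mathbf{i}j$, $j=1,2,\dots$. Independently for each vertex $\mathbf{i}$, let $\tau^{\mathbf{i}1}<\tau^{\mathbf{i}2}<\cdots$ be the points of a unit intensity Poisson point process on $[0,\infty)$; $\tau^{\mathbf{i}j}$ is the label (activation time) of the edge $\{\mathbf{i},\mathbf{i}j\}$. **RDCP on the PWIT.** The vertices of the PWIT get i.i.d. degree constraints $d(\mathbf{i})\sim\underline{p}$, independent of the labels. Edges are tried in increasing order of their labels, and an edge is added at its activation time if and only if both its end-vertices then have degree strictly less than their degree constraint. (This is almost surely well-defined: almost surely there is exactly one set $A$ of edges such that an edge $e=\{v,w\}$ is in $A$ if and only if for each $u\in\{v,w\}$ fewer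 than $d(u)$ edges of $A$ incident to $u$ have label smaller than that of $e$; $A$ is the set of added edges.) For $t\in\mathbb{R}_+\cup\{+\infty\}$, $G^\infty_{\underline{p}}(t)$ is the connected component of the root $\varnothing$ in the subgraph consisting of the edges added by time $t$. A vertex saturates at the time when its degree reaches its degree constraint. The **phantom saturation time** $T_{\mathbf{i}}$ of a vertex $\mathbf{i}$ of the PWIT is the time when $\mathbf{i}$ saturates in the RDCP run on the subtree consisting of $\mathbf{i}$ and all its descendants (i.e. after deleting the edge between $\mathbf{i}$ and its parent), with the same labels and degree constraints. **Auxiliary functions.** $q_k=\sum_{d=k}^\infty p_d$ for $k\ge1$; $\lambda:\mathbb{R}_+\to\mathbb{R}_+$ is the solution of $\lambda'(t)=\mathrm{e}^{-\lambda(t)}\sum_{k=0}^\infty\frac{\lambda(t)^k}{k!}q_{k+1}$, $\lambda(0)=0$; $z_k^t=\mathrm{e}^{-\lambda(t)}\frac{\lambda(t)^k}{k!}p_{k+1}$ for $k\ge0$; $f(t)=-\lambda''(t)=\lambda'(t)\sum_{k=0}^\infty z_k^t$, which is a probability density on $\mathbb{R}_+$ (it is the density of $T_\varnothing$ in the RDCP on the PWIT). For $t_0\in\mathbb{R}_+$ let $A_{t_0}=\{(t,s)\in\mathbb{R}_+^2: 0\le t\le t_0,\ t\le s\}$. **The edge-labelled MTBP.** Vertices are finite strings of positive integers; each vertex $\mathbf{i}$ has a type $T_{\mathbf{i}}>0$ and a degree constraint $d(\mathbf{i})\in\mathbb{N}_+$, and the edge between $\mathbf{i}$ and its child $\mathbf{i}j$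 has label $\tau^{\mathbf{i}j}>0$. - The type $T_\varnothing$ of the root has density $f$. - Given that the type of a vertex $\mathbf{i}$ is $t_0$, its degree constraint is $k$ with probability $p_k^{t_0}=z_{k-1}^{t_0}/\sum_{l=0}^\infty z_l^{t_0}$, $k=1,2,\dots$. - Root: given $T_\varnothing=t_0$ and $d(\varnothing)=d$, the root has $d$ children. The $d$-th child has edge label $\tau^d=t_0$ and its type $T_d$ has density $s\mapsto \frac{f(s)}{\int_{t_0}^\infty f(u)\,\mathrm{d}u}\mathbf{1}\{s>t_0\}$. Independently of $T_d$, let $(\breve\tau^j,\breve T_j)$, $j=1,\dots,d-1$, be conditionally i.i.d. with joint density $g_{t_0}(t,s)=\frac{f(s)}{\lambda(t_0)}\mathbf{1}\{(t,s)\in A_{t_0}\}$; rearranging these pairs in increasing order of the first coordinate gives the pairs (edge label, type) $(\tau^j,T_j)$, $j=1,\dots,d-1$, of the first $d-1$ children. - Non-root vertex $\mathbf{i}$ of type $t_0$: it has $d(\mathbf{i})-1$ children, whose pairs (edge label, type) $(\tau^{\mathbf{i}j},T_{\mathbf{i}j})$, $j=1,\dots,d(\mathbf{i})-1$, are obtained by taking $d(\mathbf{i})-1$ i.i.d. pairs with density $g_{t_0}$, independent of everything generated earlier, and ordering them by first coordinate. $\mathcal{M}_{\underline{p}}(\hat t)$ is the connected component of the root in the subgraph of this tree formed by the edges with label less than $\hat t$, decorated with types, degree constraints and edge labels. *)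

theory Defs
  imports "HOL-Probability.Probability" "HOL-Library.Sublist"
begin

section \<open>Auxiliary functions\<close>

text \<open>The sequence \<open>p\<close> is indexed from 1; the value \<open>p 0\<close> is never used.\<close>

definition degree_tail :: "(nat \<Rightarrow> real) \<Rightarrow> nat \<Rightarrow> real" where
  "degree_tail p k = (\<Sum>d. p (k + d))"

definition solves_rdcp_ode :: "(nat \<Rightarrow> real) \<Rightarrow> (real \<Rightarrow> real) \<Rightarrow> bool" where
  "solves_rdcp_ode p lam \<longleftrightarrow>
     lam 0 = 0 \<and>
     (\<forall>t\<ge>0. 0 \<le> lam t \<and>
        (lam has_real_derivative
           exp (- lam t) * (\<Sum>k. lam t ^ k / fact k * degree_tail p (k + 1)))
          (at t within {0..}))"

definition zfun :: "(nat \<Rightarrow> real) \<Rightarrow> (real \<Rightarrow> real) \<Rightarrow> real \<Rightarrow> nat \<Rightarrow> real" where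
  "zfun p lam t k = exp (- lam t) * (lam t ^ k / fact k) * p (k + 1)"

text \<open>The value of the density at \<open>t = 0\<close> is irrelevant; excluding it avoids the one-sided
  derivative there.\<close>

definition sat_density :: "(nat \<Rightarrow> real) \<Rightarrow> (real \<Rightarrow> real) \<Rightarrow> real \<Rightarrow> real" where
  "sat_density p lam t = (if 0 < t then deriv lam t * (\<Sum>k. zfun p lam t k) else 0)"

definition degree_prob :: "(nat \<Rightarrow> real) \<Rightarrow> (real \<Rightarrow> real) \<Rightarrow> real \<Rightarrow> nat \<Rightarrow> real" where
  "degree_prob p lam t k = zfun p lam t (k - 1) / (\<Sum>l. zfun p lam t l)"

text \<open>Density of a pair (edge label, type).\<close>

definition pair_density :: "(nat \<Rightarrow> real) \<Rightarrow> (real \<Rightarrow> real) \<Rightarrow> real \<Rightarrow> real \<times> real \<Rightarrow> real" where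
  "pair_density p lam t0 =
     (\<lambda>(t, s). sat_density p lam s / lam t0 * indicator {(t, s). 0 \<le> t \<and> t \<le> t0 \<and> t \<le> s} (t, s))"

definition tail_density :: "(nat \<Rightarrow> real) \<Rightarrow> (real \<Rightarrow> real) \<Rightarrow> real \<Rightarrow> real \<Rightarrow> real" where
  "tail_density p lam t0 s =
     sat_density p lam s / (LBINT u:{t0..}. sat_density p lam u) * indicator {t0<..} s"


section \<open>Edge-labelled, decorated trees of strings\<close>

text \<open>Vertices are strings over \<open>nat\<close>, so the children of \<open>v\<close> are \<open>v @ [0], v @ [1], \<dots>\<close>
  (indices start at 0). An edge is named by its end-vertex further from the root: the edge between
  \<open>v\<close> and \<open>v @ [j]\<close> is \<open>v @ [j]\<close>.\<close>

type_synonym vertex = "nat list"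

definition root_component :: "vertex set \<Rightarrow> vertex set" where
  "root_component S =
     {v. ([], v) \<in> ((\<Union>e\<in>S - {[]}. {(butlast e, e), (e, butlast e)})\<^sup>*)}"

text \<open>The address of a vertex of the tree \<open>C\<close> after re-indexing the children of every vertex in
  increasing order of edge label: each step is replaced by the number of siblings in \<open>C\<close> with
  smaller edge label.\<close>

definition address :: "vertex set \<Rightarrow> (vertex \<Rightarrow> real) \<Rightarrow> vertex \<Rightarrow> nat list" where
  "address C lab v =
     map (\<lambda>m. card {j. take m v @ [j] \<in> C \<and> lab (take m v @ [j]) < lab (take (Suc m) v)})
       [0..<length v]"

text \<open>Canonical representative of the isomorphism class of the rooted tree \<open>C\<close> with edge labels
  \<open>lab\<close> and vertex decorations \<open>ty\<close>. The entry at \<open>w\<close> consists of a flag telling whether \<open>w\<close> is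
  a vertex of the re-indexed tree, its decoration, and the label of the edge to its parent (0 for
  the root). Off the tree the entry is a dummy.\<close>

definition canonical_tree ::
    "vertex set \<Rightarrow> (vertex \<Rightarrow> real) \<Rightarrow> (vertex \<Rightarrow> ereal) \<Rightarrow> nat list \<Rightarrow> bool \<times> ereal \<times> real" where
  "canonical_tree C lab ty w =
     (if \<exists>!v. v \<in> C \<and> address C lab v = w
      then let v = (THE v. v \<in> C \<and> address C lab v = w)
           in (True, ty v, if v = [] then 0 else lab v)
      else (False, 0, 0))"

definition tree_space :: "(nat list \<Rightarrow> bool \<times> ereal \<times> real) measure" where
  "tree_space = (\<Pi>\<^sub>M w\<in>UNIV. count_space UNIV \<Otimes>\<^sub>M borel \<Otimes>\<^sub>M borel)"


section \<open>The random degree constrained process on the PWIT\<close>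

text \<open>\<open>X 0 < X 1 < \<dots>\<close> are the points of a unit intensity Poisson point process on \<open>[0, \<infinity>)\<close>: the
  numbers of points in disjoint Borel sets of finite Lebesgue measure are independent and Poisson
  distributed, with the Lebesgue measure of the set as mean. Finiteness is explicit because
  \<open>card\<close> of an infinite set is 0.\<close>

definition (in prob_space) poisson_points :: "(nat \<Rightarrow> 'a \<Rightarrow> real) \<Rightarrow> bool" where
  "poisson_points X \<longleftrightarrow>
     (\<forall>j. random_variable borel (X j)) \<and>
     (AE \<omega> in M. \<forall>j. 0 \<le> X j \<omega> \<and> X j \<omega> < X (Suc j) \<omega>) \<and>
     (\<forall>F k. finite F \<and> disjoint F \<and>
        (\<forall>B\<in>F. B \<in> sets borel \<and> B \<subseteq> {0..} \<and> emeasure lborel B < \<infinity>) \<longrightarrow>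
        prob {\<omega>\<in>space M. \<forall>B\<in>F. finite {j. X j \<omega> \<in> B} \<and> card {j. X j \<omega> \<in> B} = k B} =
        (\<Prod>B\<in>F. exp (- measure lborel B) * measure lborel B ^ k B / fact (k B)))"

locale pwit_rdcp = prob_space M
  for M :: "'a measure" and p :: "nat \<Rightarrow> real"
    and \<tau> :: "vertex \<Rightarrow> 'a \<Rightarrow> real" and d :: "vertex \<Rightarrow> 'a \<Rightarrow> nat" +
  assumes labels: "poisson_points (\<lambda>j. \<tau> (v @ [j]))"
    and degrees_measurable: "random_variable (count_space UNIV) (d v)"
    and degrees: "1 \<le> k \<Longrightarrow> prob {\<omega>\<in>space M. d v \<omega> = k} = p k"
    and independence:
      "indep_sets
         (\<lambda>i. case i of
            Inl v \<Rightarrow> {(\<lambda>\<omega> j. \<tau> (v @ [j]) \<omega>) -` B \<inter> space M |B. B \<in> sets (\<Pi>\<^sub>M j\<in>UNIV. borel)}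
          | Inr v \<Rightarrow> {d v -` B \<inter> space M |B. B \<in> sets (count_space UNIV)})
         (UNIV :: (vertex + vertex) set)"

text \<open>\<open>A\<close> is the set of added edges of the process on the subtree of \<open>r\<close> and its descendants (the
  edge between \<open>r\<close> and its parent is not in this subtree).\<close>

definition incident :: "vertex \<Rightarrow> vertex \<Rightarrow> bool" where
  "incident e u \<longleftrightarrow> e \<noteq> [] \<and> (u = e \<or> u = butlast e)"

definition is_rdcp_edges ::
    "vertex \<Rightarrow> (vertex \<Rightarrow> real) \<Rightarrow> (vertex \<Rightarrow> nat) \<Rightarrow> vertex set \<Rightarrow> bool" where
  "is_rdcp_edges r lab d A \<longleftrightarrow>
     A \<subseteq> {e. strict_prefix r e} \<and>
     (\<forall>e. strict_prefix r e \<longrightarrow>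
        (e \<in> A \<longleftrightarrow>
          (\<forall>u\<in>{butlast e, e}. finite {e'\<in>A. incident e' u \<and> lab e' < lab e} \<and>
             card {e'\<in>A. incident e' u \<and> lab e' < lab e} < d u)))"

text \<open>Existence and uniqueness hold almost surely for the random labels and degree constraints.
  On the exceptional null set the value is unspecified.\<close>

definition rdcp_edges ::
    "vertex \<Rightarrow> (vertex \<Rightarrow> real) \<Rightarrow> (vertex \<Rightarrow> nat) \<Rightarrow> vertex set" where
  "rdcp_edges r lab d = (THE A. is_rdcp_edges r lab d A)"

definition rdcp_component ::
    "(vertex \<Rightarrow> real) \<Rightarrow> (vertex \<Rightarrow> nat) \<Rightarrow> ereal \<Rightarrow> vertex set" where
  "rdcp_component lab d t = root_component {e \<in> rdcp_edges [] lab d. ereal (lab e) \<le> t}"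

text \<open>Infinite if the vertex never saturates, which has probability 0.\<close>

definition phantom_time :: "(vertex \<Rightarrow> real) \<Rightarrow> (vertex \<Rightarrow> nat) \<Rightarrow> vertex \<Rightarrow> ereal" where
  "phantom_time lab d v =
     Inf {ereal t |t. 0 \<le> t \<and> d v \<le> card {e \<in> rdcp_edges v lab d. incident e v \<and> lab e \<le> t}}"

definition rdcp_tree ::
    "(vertex \<Rightarrow> real) \<Rightarrow> (vertex \<Rightarrow> nat) \<Rightarrow> ereal \<Rightarrow> nat list \<Rightarrow> bool \<times> ereal \<times> real" where
  "rdcp_tree lab d t = canonical_tree (rdcp_component lab d t) lab (phantom_time lab d)"


section \<open>The edge-labelled multi-type branching process\<close>

definition num_children :: "vertex \<Rightarrow> nat \<Rightarrow> nat" where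
  "num_children v k = (if v = [] then k else k - 1)"

definition mtbp_vertices :: "(vertex \<Rightarrow> nat) \<Rightarrow> vertex set" where
  "mtbp_vertices d = {v. \<forall>u j. prefix (u @ [j]) v \<longrightarrow> j < num_children u (d u)}"

definition order_pairs :: "nat \<Rightarrow> (nat \<Rightarrow> real \<times> real) \<Rightarrow> nat \<Rightarrow> real \<times> real" where
  "order_pairs m x = (\<lambda>j\<in>{..<m}. sort_key fst (map x [0..<m]) ! j)"

text \<open>Law of the family of pairs (edge label, type) of the children of a vertex \<open>v\<close> of type \<open>t0\<close>
  and degree constraint \<open>k \<ge> 1\<close>. The vertex matters only through being the root or not.\<close>

definition children_law ::
    "(nat \<Rightarrow> real) \<Rightarrow> (real \<Rightarrow> real) \<Rightarrow> vertex \<Rightarrow> real \<Rightarrow> nat \<Rightarrow> (nat \<Rightarrow> real \<times> real) measure" where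
  "children_law p lam v t0 k =
     (let iid = (\<Pi>\<^sub>M j\<in>{..<k - 1}. density lborel (\<lambda>x. ennreal (pair_density p lam t0 x)))
      in if v = []
         then distr (density lborel (\<lambda>s. ennreal (tail_density p lam t0 s)) \<Otimes>\<^sub>M iid)
                (\<Pi>\<^sub>M j\<in>{..<k}. borel)
                (\<lambda>(s, x). (order_pairs (k - 1) x)(k - 1 := (t0, s)))
         else distr iid (\<Pi>\<^sub>M j\<in>{..<k - 1}. borel) (order_pairs (k - 1)))"

text \<open>Everything generated before the degree constraints of generation \<open>n\<close>: the labels and types
  up to generation \<open>n\<close> and the degree constraints of the earlier generations. The random
  variables attached to strings that are not vertices of the tree are masked, so they are
  irrelevant; so is the label at the root.\<close>

definition mtbp_history ::
    "nat \<Rightarrow> (vertex \<Rightarrow> real) \<Rightarrow> (vertex \<Rightarrow> nat) \<Rightarrow> (vertex \<Rightarrow> real) \<Rightarrow> vertex \<Rightarrow> real \<times> real \<times> nat" where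
  "mtbp_history n T d \<tau> v =
     (if v \<in> mtbp_vertices d \<and> length v \<le> n
      then (if v = [] then 0 else \<tau> v, T v, if length v < n then d v else 0)
      else (0, 0, 0))"

text \<open>The assumption \<open>generation\<close> says: given the history up to generation \<open>n\<close>, the vertices \<open>v\<close>
  of generation \<open>n\<close> independently get their degree constraint, equal to \<open>k\<close> with probability
  \<open>degree_prob p lam (T v) k\<close>, and then, given that it is \<open>k\<close>, the labels and types of their
  children with law \<open>children_law p lam v (T v) k\<close>. The conditional law is expressed by
  integrating over an arbitrary event of the history.\<close>

locale edge_labelled_mtbp = prob_space M
  for M :: "'a measure" and p :: "nat \<Rightarrow> real" and lam :: "real \<Rightarrow> real"
    and T :: "vertex \<Rightarrow> 'a \<Rightarrow> real" and d :: "vertex \<Rightarrow> 'a \<Rightarrow> nat"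
    and \<tau> :: "vertex \<Rightarrow> 'a \<Rightarrow> real" +
  assumes types_measurable: "random_variable borel (T v)"
    and degrees_measurable: "random_variable (count_space UNIV) (d v)"
    and labels_measurable: "random_variable borel (\<tau> v)"
    and root_type: "distributed M lborel (T []) (\<lambda>t. ennreal (sat_density p lam t))"
    and generation:
      "\<lbrakk>finite I; I \<subseteq> {v. length v = n};
        \<And>v. v \<in> I \<Longrightarrow> 1 \<le> k v;
        \<And>v. v \<in> I \<Longrightarrow> B v \<in> sets (\<Pi>\<^sub>M j\<in>{..<num_children v (k v)}. borel);
        E \<in> sets (\<Pi>\<^sub>M v\<in>UNIV. borel \<Otimes>\<^sub>M borel \<Otimes>\<^sub>M count_space UNIV)\<rbrakk> \<Longrightarrow>
       emeasure M {\<omega>\<in>space M.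
         mtbp_history n (\<lambda>v. T v \<omega>) (\<lambda>v. d v \<omega>) (\<lambda>v. \<tau> v \<omega>) \<in> E \<and>
         (\<forall>v\<in>I. v \<in> mtbp_vertices (\<lambda>v. d v \<omega>) \<and> d v \<omega> = k v \<and>
            (\<lambda>j\<in>{..<num_children v (k v)}. (\<tau> (v @ [j]) \<omega>, T (v @ [j]) \<omega>)) \<in> B v)} =
       (\<integral>\<^sup>+\<omega>.
          indicator {\<omega>. mtbp_history n (\<lambda>v. T v \<omega>) (\<lambda>v. d v \<omega>) (\<lambda>v. \<tau> v \<omega>) \<in> E \<and>
                        I \<subseteq> mtbp_vertices (\<lambda>v. d v \<omega>)} \<omega> *
          (\<Prod>v\<in>I. ennreal (degree_prob p lam (T v \<omega>) (k v)) *
             emeasure (children_law p lam v (T v \<omega>) (k v)) (B v)) \<partial>M)"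

definition mtbp_component ::
    "(vertex \<Rightarrow> nat) \<Rightarrow> (vertex \<Rightarrow> real) \<Rightarrow> ereal \<Rightarrow> vertex set" where
  "mtbp_component d lab t =
     root_component {e \<in> mtbp_vertices d. e \<noteq> [] \<and> ereal (lab e) < t}"

definition mtbp_tree ::
    "(vertex \<Rightarrow> real) \<Rightarrow> (vertex \<Rightarrow> nat) \<Rightarrow> (vertex \<Rightarrow> real) \<Rightarrow> ereal \<Rightarrow>
       nat list \<Rightarrow> bool \<times> ereal \<times> real" where
  "mtbp_tree T d lab t = canonical_tree (mtbp_component d lab t) lab (\<lambda>v. ereal (T v))"

end

theory Submission
  imports Defs
begin

text \<open>
  Call the process on the subtree of a vertex \<open>v\<close> its phantom process. An edge from \<open>v\<close> to a child is
  tried successfully in it iff the child has not yet saturated in its own phantom process, so the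
  phantom saturation times solve the recursion ``\<open>T v\<close> is the \<open>d v\<close>-th of the labels \<open>\<tau> (v @ [j])\<close>
  that are at most \<open>T (v @ [j])\<close>''. Iterating this antitone recursion from the constant \<open>\<infinity>\<close> gives upper
  and lower bounds at alternate steps. A Poisson process whose points are kept with probability
  \<open>v t\<close> at time \<open>t\<close> is a Poisson process of intensity \<open>v\<close>, so the laws of the iterates are the Picard
  iterates of the differential equation of \<open>lam\<close>, which converge; hence the two bounds agree almost
  surely and \<open>T v\<close> has density \<open>f\<close>.

  Keep only the children with label at most their phantom saturation time, in increasing order
  of label. A vertex \<open>v\<close> of the component of the root uses exactly its first \<open>d v - 1\<close> such children
  (\<open>d v\<close> for the root, where the last one is reached at time \<open>T v\<close>). The joint density of the labels and
  times of the first \<open>d\<close> kept children, conditioned on the last label being \<open>t\<close>, is the one of the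
  branching process, and subtrees of different vertices are independent. The generation
  property characterises the law of the branching process tree.
\<close>

text \<open>The infinite tree has no edge that is tried first, so the edge set, given only by a
  fixed-point condition, cannot be built step by step; every solution is instead squeezed between
  truncations of the recursion for saturation times. The differential equation enters because a
  vertex with a Poisson number of usable children, of mean \<open>u t\<close>, before
  \<open>t\<close> is unsaturated iff this number is below its constraint: averaging over the
  constraint gives \<open>F (u t)\<close>, so one step of the recursion turns a survival function
  \<open>v\<close> with integral \<open>u\<close> into \<open>F\<close> composed with
  \<open>u\<close>. The other obstacle is that the position in the PWIT of a vertex of the
  re-indexed tree is random and depends on the subtrees below it, because a child is kept according
  to its own phantom time. Conditioning is therefore done at fixed positions: the space is split by
  the values of \<open>place\<close>, and on each piece the history up to generation
  \<open>n\<close> is a function of the environment before generation \<open>n\<close> and of the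
  phantom times in generation \<open>n\<close>. Then the vertices of generation \<open>n\<close> are
  treated one at a time by resampling their subtrees.\<close>

abbreviation seq_space :: "(nat => 'a :: topological_space) measure" where
  "seq_space \<equiv> \<Pi>\<^sub>M i\<in>UNIV. borel"

abbreviation pair_seqs :: "nat => (nat => real \<times> real) measure" where
  "pair_seqs m \<equiv> \<Pi>\<^sub>M j\<in>{..<m}. borel"

abbreviation bmeas :: "'a measure => ('a => 'b :: topological_space) set" where
  "bmeas M \<equiv> borel_measurable M"

section \<open>Saturation times on the tree\<close>

text \<open>One step of the recursion: \<open>x j\<close> are the labels of the edges to the
  children, \<open>s j\<close> the phantom saturation times of the children, \<open>k\<close> the
  degree constraint. If \<open>k\<close> usable edges never appear, the infimum over the empty set
  makes the value infinite.\<close>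

definition sat_time :: "(nat => real) => (nat => ereal) => nat => ereal" where
 "sat_time x s k = Inf {ereal t |t. 0 <= t & k <= card {j. ereal (x j) <= s j & x j <= t}}"

type_synonym env = "vertex => (nat => real) \<times> nat"

text \<open>The recursion cut off \<open>n\<close> generations below \<open>v\<close>, where every
  vertex is treated as never saturating. Only finitely many generations are read, so laws can be
  computed by induction on \<open>n\<close>.\<close>

primrec approx :: "nat => env => vertex => ereal" where
 "approx 0 z v = \<infinity>"
| "approx (Suc n) z v = sat_time (fst (z v)) (%j. approx n z (v @ [j])) (snd (z v))"

text \<open>The even iterates are the upper bounds, so this is the best of them. That the odd
  iterates reach the same value is a property of the environment (\<open>lims\<close> in
  \<open>good_env\<close>).\<close>

definition ptime :: "env => vertex => ereal" where
 "ptime z v = (INF n. approx (2 * n) z v)"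

definition avail :: "env => vertex => nat set" where
 "avail z v = {j. ereal (fst (z v) j) <= ptime z (v @ [j])}"

text \<open>An iterated LEAST is at once a measurable function of a random set. On infinite sets it
  is \<open>enumerate\<close>; on finite sets the values beyond the last element carry no meaning,
  which \<open>has_nth\<close> keeps track of.\<close>

primrec nth_elt :: "nat set => nat => nat" where
 "nth_elt A 0 = (LEAST i. i \<in> A)"
| "nth_elt A (Suc k) = (LEAST i. i \<in> A & nth_elt A k < i)"

lemma nth_elt_eq_enumerate:
 assumes "infinite A" shows "nth_elt A k = enumerate A k"
 by (induction k) (simp_all add: enumerate_0 enumerate_Suc''[OF assms])

lemma sat_time_nonneg: "0 <= sat_time x s k"
 unfolding sat_time_def by (auto intro!: Inf_greatest)

text \<open>Labels are locally finite, so a saturation that occurs before \<open>t\<close> occurs at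
  a label before \<open>t\<close>; hence the strict \<open>x j < t\<close> here against the weak
  inequality in \<open>sat_time\<close>. This form turns comparisons of times into comparisons of
  degrees, as in \<open>is_rdcp_edges\<close>.\<close>

lemma sat_time_ge_iff:
 assumes fin: "\<And>t. finite {j. x j <= t}" and pos: "\<And>j. 0 < x j" and k: "1 <= k"
 shows "ereal t <= sat_time x s k \<longleftrightarrow> card {j. ereal (x j) <= s j & x j < t} < k"
proof
 assume le: "ereal t <= sat_time x s k"
 show "card {j. ereal (x j) <= s j & x j < t} < k"
 proof (rule ccontr)
  let ?J = "{j. ereal (x j) <= s j & x j < t}"
  assume "\<not> card ?J < k"
  then have c: "k <= card ?J" by simp
  have fJ: "finite ?J" by (rule finite_subset[OF _ fin[of t]]) auto
  have ne: "?J ~= {}" using c k by (metis card.empty not_one_le_zero le_trans)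
  \<comment> \<open>\<open>r\<close> is the last usable label before \<open>t\<close>: all
    \<open>k\<close> usable edges are present at time \<open>r\<close>, and \<open>r < t\<close>
    because the maximum of a finite set is attained.\<close>
  define r where "r = Max (x ` ?J)"
  have r: "r \<in> x ` ?J" unfolding r_def using fJ ne by (intro Max_in) auto
  then have rt: "r < t" "0 <= r" using pos by (auto simp: less_imp_le)
  have "?J \<subseteq> {j. ereal (x j) <= s j & x j <= r}"
   using fJ by (auto simp: r_def)
  moreover have "finite {j. ereal (x j) <= s j & x j <= r}"
   by (rule finite_subset[OF _ fin[of r]]) auto
  ultimately have "k <= card {j. ereal (x j) <= s j & x j <= r}"
   using c card_mono le_trans by blast
  then have "sat_time x s k <= ereal r"
   unfolding sat_time_def using rt by (intro Inf_lower) auto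
  with le rt show False
   by (metis ereal_less_eq(3) leD order.trans)
 qed
next
 assume c: "card {j. ereal (x j) <= s j & x j < t} < k"
 show "ereal t <= sat_time x s k"
  unfolding sat_time_def
 proof (rule Inf_greatest, clarify)
  fix r assume r: "0 <= r" "k <= card {j. ereal (x j) <= s j & x j <= r}"
  show "ereal t <= ereal r"
  proof (rule ccontr)
   assume "\<not> ereal t <= ereal r"
   then have "r < t" by simp
   then have "{j. ereal (x j) <= s j & x j <= r} \<subseteq> {j. ereal (x j) <= s j & x j < t}" by auto
   moreover have "finite {j. ereal (x j) <= s j & x j < t}"
    by (rule finite_subset[OF _ fin[of t]]) auto
   ultimately show False using r c card_mono by (meson leD le_trans)
  qed
 qed
qed

text \<open>Children that saturate later offer more usable edges, so the vertex itself saturates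
  earlier. This reversal is the source of the alternating bounds.\<close>

lemma sat_time_antimono:
 assumes fin: "\<And>t. finite {j. x j <= t}" and le: "\<And>j. s j <= s' j"
 shows "sat_time x s' k <= sat_time x s k"
 unfolding sat_time_def
proof (rule Inf_superset_mono, clarify)
 fix t assume t: "0 <= t" "k <= card {j. ereal (x j) <= s j & x j <= t}"
 have "{j. ereal (x j) <= s j & x j <= t} \<subseteq> {j. ereal (x j) <= s' j & x j <= t}"
  using le by (auto intro: order_trans)
 moreover have "finite {j. ereal (x j) <= s' j & x j <= t}"
  by (rule finite_subset[OF _ fin[of t]]) auto
 ultimately have "k <= card {j. ereal (x j) <= s' j & x j <= t}"
  using t card_mono le_trans by blast
 then show "\<exists>ta. ereal t = ereal ta & 0 <= ta & k <= card {j. ereal (x j) <= s' j & x j <= ta}"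
  using t by auto
qed

lemma card_below_nth_elt:
 assumes "infinite A" shows "card {j\<in>A. j < nth_elt A k} = k"
proof -
 have "{j\<in>A. j < nth_elt A k} = enumerate A ` {..<k}"
  unfolding nth_elt_eq_enumerate[OF assms]
  using assms by (auto simp: enumerate_in_set enumerate_mono)
   (metis enumerate_Ex enumerate_mono_iff imageI lessThan_iff)
 moreover have "inj_on (enumerate A) {..<k}"
  using assms by (simp add: inj_enumerate inj_on_subset[OF _ subset_UNIV])
 ultimately show ?thesis by (simp add: card_image)
qed

lemma sat_time_nth_elt:
 assumes mono: "strict_mono x" and fin: "\<And>t. finite {j. x j <= t}" and pos: "\<And>j. 0 < x j" and k: "1 <= k"
  and inf: "infinite {j. ereal (x j) <= s j}"
 shows "sat_time x s k = ereal (x (nth_elt {j. ereal (x j) <= s j} (k - 1)))"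
proof -
 let ?A = "{j. ereal (x j) <= s j}"
 define i where "i = nth_elt ?A (k - 1)"
 have iA: "i \<in> ?A" using inf by (simp add: i_def nth_elt_eq_enumerate enumerate_in_set del: mem_Collect_eq)
 have lt: "x j < x i \<longleftrightarrow> j < i" and le: "x j <= x i \<longleftrightarrow> j <= i" for j
  using mono by (simp_all add: strict_mono_less strict_mono_less_eq)
 show ?thesis
  unfolding i_def[symmetric]
 proof (rule antisym)
  have "{j. ereal (x j) <= s j & x j <= x i} = insert i {j\<in>?A. j < i}"
   using iA by (simp only: le) (auto simp: order_le_less)
  then have "card {j. ereal (x j) <= s j & x j <= x i} = Suc (k - 1)"
   using card_below_nth_elt[OF inf, of "k - 1", folded i_def] by simp
  then show "sat_time x s k <= ereal (x i)"
   unfolding sat_time_def using pos[of i] by (intro Inf_lower) (auto simp: less_imp_le)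
  have "{j. ereal (x j) <= s j & x j < x i} = {j\<in>?A. j < i}" by (auto simp: lt)
  then show "ereal (x i) <= sat_time x s k"
   using card_below_nth_elt[OF inf, of "k - 1", folded i_def] k
   by (subst sat_time_ge_iff[OF fin pos k]) simp
 qed
qed

text \<open>The almost sure properties under which all deterministic arguments are carried out;
  \<open>AE_good_env\<close> establishes them together. \<open>lims\<close> says that the two
  families of bounds meet, and \<open>noties\<close> makes weak and strict comparison of a label
  with the child's time equivalent.\<close>

locale good_env =
 fixes z :: env
 assumes mono: "strict_mono (fst (z v))" and pos: "0 < fst (z v) j"
  and fin: "finite {j. fst (z v) j <= t}" and deg: "1 <= snd (z v)"
  and lims: "(SUP n. approx (Suc (2 * n)) z v) = ptime z v"
  and avail_inf: "infinite (avail z v)"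
  and noties: "ereal (fst (z v) j) ~= ptime z (v @ [j])"
begin

lemma approx_odd_le: "approx (Suc (2 * n)) z v <= ptime z v"
 unfolding lims[symmetric] by (intro SUP_upper) auto

lemma approx_even_ge: "ptime z v <= approx (2 * n) z v"
 unfolding ptime_def by (intro INF_lower) auto

text \<open>The antitone step exchanges upper and lower bounds: applied to \<open>ptime\<close> it
  gives something above every odd iterate and below every even one, and by \<open>lims\<close> the
  two families leave room for one value only.\<close>

lemma ptime_fixpoint: "ptime z v = sat_time (fst (z v)) (%j. ptime z (v @ [j])) (snd (z v))"
proof (rule antisym)
 have "approx (Suc (2 * n)) z v <= sat_time (fst (z v)) (%j. ptime z (v @ [j])) (snd (z v))" for n
  by (simp, intro sat_time_antimono fin approx_even_ge)
 then show "ptime z v <= sat_time (fst (z v)) (%j. ptime z (v @ [j])) (snd (z v))"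
  unfolding lims[symmetric] by (intro SUP_least)
 have "sat_time (fst (z v)) (%j. ptime z (v @ [j])) (snd (z v)) <= approx (2 * n) z v" for n
 proof (cases n)
  case (Suc m)
  then have e: "approx (2 * n) z v = sat_time (fst (z v)) (%j. approx (Suc (2 * m)) z (v @ [j])) (snd (z v))"
   by simp
  show ?thesis unfolding e by (intro sat_time_antimono fin approx_odd_le)
 qed simp
 then show "sat_time (fst (z v)) (%j. ptime z (v @ [j])) (snd (z v)) <= ptime z v"
  unfolding ptime_def by (intro INF_greatest)
qed

definition ix :: "vertex => nat => nat" where "ix v k = nth_elt (avail z v) k"

lemma ix_avail: "ix v k \<in> avail z v"
 using avail_inf by (simp add: ix_def nth_elt_eq_enumerate enumerate_in_set)

lemma ix_less_iff: "ix v k < ix v l \<longleftrightarrow> k < l"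
 using avail_inf by (simp add: ix_def nth_elt_eq_enumerate)

lemma ix_inj: "ix v k = ix v l \<longleftrightarrow> k = l"
 using ix_less_iff by (metis linorder_neq_iff)

lemma ix_surj: "j \<in> avail z v ==> \<exists>k. j = ix v k"
 using avail_inf[of v] enumerate_Ex by (simp add: ix_def nth_elt_eq_enumerate) blast

lemma x_less_iff: "fst (z v) i < fst (z v) j \<longleftrightarrow> i < j"
 and x_le_iff: "fst (z v) i <= fst (z v) j \<longleftrightarrow> i <= j"
 using mono[of v] by (simp_all add: strict_mono_less strict_mono_less_eq)

lemma ptime_eq: "ptime z v = ereal (fst (z v) (ix v (snd (z v) - 1)))"
 unfolding ix_def avail_def
 by (subst ptime_fixpoint, rule sat_time_nth_elt)
  (use mono fin pos deg avail_inf[of v] in \<open>simp_all add: avail_def\<close>)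

definition rt :: "vertex => real" where "rt v = fst (z v) (ix v (snd (z v) - 1))"

lemma ptime_rt: "ptime z v = ereal (rt v)" by (simp add: ptime_eq rt_def)

lemma avail_iff: "j \<in> avail z v \<longleftrightarrow> fst (z v) j < rt (v @ [j])"
 using noties[of v j] by (auto simp: avail_def ptime_rt)

text \<open>Counting from 0, \<open>rt v\<close> is usable label number
  \<open>snd (z v) - 1\<close>. So \<open>snd (z v) - 1\<close> usable labels lie strictly before it
  and \<open>snd (z v)\<close> at or before it: the numbers of children of a non-root vertex and of
  the root in the branching process.\<close>

lemma x_ix_less_rt: "fst (z v) (ix v k) < rt v \<longleftrightarrow> Suc k < snd (z v)"
 using deg[of v] by (auto simp: rt_def x_less_iff ix_less_iff)

lemma x_ix_le_rt: "fst (z v) (ix v k) <= rt v \<longleftrightarrow> k < snd (z v)"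
 using deg[of v] ix_less_iff[of v] unfolding rt_def x_le_iff by (auto simp flip: not_less)

lemma avail_less_eq:
 "{j \<in> avail z v. fst (z v) j < rt v} = ix v ` {..<snd (z v) - 1}"
proof -
 have "j \<in> ix v ` {..<snd (z v) - 1}" if "j \<in> avail z v" "fst (z v) j < rt v" for j
  using ix_surj[OF that(1)] that(2) by (auto simp: x_ix_less_rt)
 then show ?thesis by (auto simp: ix_avail x_ix_less_rt)
qed

lemma avail_le_eq:
 "{j \<in> avail z v. fst (z v) j <= rt v} = ix v ` {..<snd (z v)}"
proof -
 have "j \<in> ix v ` {..<snd (z v)}" if "j \<in> avail z v" "fst (z v) j <= rt v" for j
  using ix_surj[OF that(1)] that(2) by (auto simp: x_ix_le_rt)
 then show ?thesis by (auto simp: ix_avail x_ix_le_rt)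
qed

lemma card_avail_less: "card {j \<in> avail z v. fst (z v) j < rt v} = snd (z v) - 1"
 unfolding avail_less_eq by (subst card_image) (auto simp: inj_on_def ix_inj)

lemma card_avail_le: "card {j \<in> avail z v. fst (z v) j <= rt v} = snd (z v)"
 unfolding avail_le_eq by (subst card_image) (auto simp: inj_on_def ix_inj)

end

section \<open>The added edges in terms of phantom saturation times\<close>

text \<open>The explicit solution of the fixed-point condition for the subtree of \<open>r\<close>.
  The lower end-vertex must still be free in its own phantom process. At the upper end-vertex the
  comparison is strict if the edge to its parent is itself added, since that edge takes the last
  free place, and weak otherwise.\<close>

function edge_in :: "(vertex => real) => (vertex => real) => vertex => vertex => bool" where
 "edge_in lab T r e =
   (if strict_prefix r e then
    lab e <= T e & (if edge_in lab T r (butlast e) then lab e < T (butlast e) else lab e <= T (butlast e))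
   else False)"
 by auto
termination
 by (relation "Wellfounded.measure (%(lab, T, r, e). length e)") (auto dest!: prefix_length_less)

declare edge_in.simps [simp del]

lemma strict_prefix_snoc: "prefix r v ==> strict_prefix r (v @ [j])"
 by (auto simp: strict_prefix_def dest: prefix_length_le)

lemma strict_prefix_snocE:
 assumes "strict_prefix r e" obtains v j where "e = v @ [j]" "prefix r v"
proof -
 have "e ~= []" using assms by auto
 then obtain v j where "e = v @ [j]" by (metis append_butlast_last_id)
 then show thesis using that assms by (auto simp: strict_prefix_def)
qed

locale good_tree = good_env +
 fixes lab :: "vertex => real" and d :: "vertex => nat"
 assumes lab: "lab (v @ [j]) = fst (z v) j" and d: "d v = snd (z v)"
begin

definition cnt :: "vertex set => vertex => real => nat" where
 "cnt A v t = card {i. v @ [i] \<in> A & lab (v @ [i]) < t}"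

lemma finite_children: "finite {i. P i & lab (v @ [i]) < t}" "finite {i. P i & lab (v @ [i]) <= t}"
 by (rule finite_subset[OF _ fin[of v t]], auto simp: lab)+

lemma incident_eq:
 assumes "[] \<notin> A"
 shows "{e'\<in>A. incident e' u & Q e'} =
  (%i. u @ [i]) ` {i. u @ [i] \<in> A & Q (u @ [i])} \<union> (if u \<in> A & Q u then {u} else {})"
proof -
 have "e' \<in> (%i. u @ [i]) ` {i. u @ [i] \<in> A & Q (u @ [i])}" if "e' \<in> A" "Q e'" "u = butlast e'" for e'
 proof -
  have "e' ~= []" using that assms by auto
  then have "e' = u @ [last e']" using that by simp
  then show ?thesis using that by (intro image_eqI[where x="last e'"]) auto
 qed
 then show ?thesis using assms unfolding incident_def by (intro set_eqI iffI) (auto split: if_splits)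
qed

lemma card_incident:
 assumes "[] \<notin> A" "finite {i. u @ [i] \<in> A & Q (u @ [i])}"
 shows "finite {e'\<in>A. incident e' u & Q e'}"
  and "card {e'\<in>A. incident e' u & Q e'} =
   card {i. u @ [i] \<in> A & Q (u @ [i])} + (if u \<in> A & Q u then 1 else 0)"
proof -
 let ?S = "{i. u @ [i] \<in> A & Q (u @ [i])}"
 have c: "card ((%i. u @ [i]) ` ?S) = card ?S" by (rule card_image) (simp add: inj_on_def)
 show "finite {e'\<in>A. incident e' u & Q e'}" unfolding incident_eq[OF assms(1)] using assms(2) by simp
 have "u \<notin> (%i. u @ [i]) ` ?S" by auto
 then show "card {e'\<in>A. incident e' u & Q e'} = card ?S + (if u \<in> A & Q u then 1 else 0)"
  unfolding incident_eq[OF assms(1)] using c assms(2) by auto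
qed

text \<open>The edges at a vertex are those to its children and the one to its parent. Local
  finiteness of the labels settles the finiteness clauses, and at the lower end-vertex the parent
  edge is the tried edge itself, which is not earlier than itself.\<close>

lemma is_rdcp_edges_iff:
 "is_rdcp_edges r lab d A \<longleftrightarrow> A \<subseteq> {e. strict_prefix r e} \<and>
   (\<forall>v j. prefix r v --> (v @ [j] \<in> A \<longleftrightarrow>
    cnt A v (lab (v @ [j])) + (if v \<in> A & lab v < lab (v @ [j]) then 1 else 0) < d v \<and>
    cnt A (v @ [j]) (lab (v @ [j])) < d (v @ [j])))"
  (is "_ = (?sub & ?C)")
proof (cases ?sub)
 case True
 then have nil: "[] \<notin> A" by auto
 have split: "(\<forall>e. strict_prefix r e --> P e) \<longleftrightarrow> (\<forall>v j. prefix r v --> P (v @ [j]))" for P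
 proof
  assume *: "\<forall>v j. prefix r v --> P (v @ [j])"
  show "\<forall>e. strict_prefix r e --> P e"
   using * by (auto elim: strict_prefix_snocE)
 qed (auto intro: strict_prefix_snoc)
 have fin': "finite {e'\<in>A. incident e' u & lab e' < t}" for u t
  by (rule card_incident(1)[OF nil finite_children(1)])
 have card': "card {e'\<in>A. incident e' u & lab e' < t} = cnt A u t + (if u \<in> A & lab u < t then 1 else 0)" for u t
  using card_incident(2)[OF nil finite_children(1)] unfolding cnt_def by simp
 show ?thesis
  unfolding is_rdcp_edges_def split using True by (simp add: fin' card')
qed (simp add: is_rdcp_edges_def)

text \<open>The lower end-vertex of \<open>e\<close> has a free place when \<open>e\<close> is
  tried. Only edges to its children are counted, so this condition lives in the subtree of
  \<open>e\<close>.\<close>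

definition ok :: "vertex set => vertex => bool" where
 "ok A e \<longleftrightarrow> cnt A e (lab e) < d e"

text \<open>For an arbitrary solution \<open>A\<close>, the edges that are \<open>ok\<close> are
  bracketed by the truncated recursion: labels of \<open>ok\<close> edges lie below all even
  iterates, and labels below an odd iterate are \<open>ok\<close>. The induction is on the depth of
  truncation, and \<open>lims\<close> with \<open>noties\<close> closes the bracket.\<close>

lemma ok_iff:
 assumes A: "is_rdcp_edges r lab d A" and e: "strict_prefix r e"
 shows "ok A e \<longleftrightarrow> lab e < rt e"
proof -
 have mem: "v @ [j] \<in> A \<longleftrightarrow> cnt A v (lab (v @ [j])) + (if v \<in> A & lab v < lab (v @ [j]) then 1 else 0) < d v
   & ok A (v @ [j])" if "prefix r v" for v j
  using A that unfolding is_rdcp_edges_iff ok_def by blast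
 have step: "ereal (lab e) <= approx (Suc n) z e \<longleftrightarrow>
   card {i. ereal (lab (e @ [i])) <= approx n z (e @ [i]) & lab (e @ [i]) < lab e} < d e" for n e
  using sat_time_ge_iff[where x="fst (z e)" and k="snd (z e)" and t="lab e" and s="%j. approx n z (e @ [j])",
    OF fin pos deg] by (simp add: lab d)
 \<comment> \<open>If iterate \<open>n\<close> bounds the labels of all \<open>ok\<close> edges from
   above, then the added children of \<open>e\<close> are among those counted by iterate
   \<open>n + 1\<close>, so the true degree is at most the counted one.\<close>
 have up: "ok A e" if IH: "\<And>f. strict_prefix r f ==> ok A f ==> ereal (lab f) <= approx n z f"
  and e: "strict_prefix r e" and le: "ereal (lab e) <= approx (Suc n) z e" for n e
 proof -
  have "{i. e @ [i] \<in> A & lab (e @ [i]) < lab e}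
    \<subseteq> {i. ereal (lab (e @ [i])) <= approx n z (e @ [i]) & lab (e @ [i]) < lab e}"
  proof safe
   have pe: "prefix r e" using e by (simp add: strict_prefix_def)
   show "ereal (lab (e @ [i])) <= approx n z (e @ [i])" if "e @ [i] \<in> A" for i
    using IH[OF strict_prefix_snoc[OF pe]] mem[OF pe] that by blast
  qed
  then have "cnt A e (lab e) <= card {i. ereal (lab (e @ [i])) <= approx n z (e @ [i]) & lab (e @ [i]) < lab e}"
   unfolding cnt_def by (intro card_mono finite_children)
  with le show "ok A e" unfolding step ok_def by simp
 qed
 \<comment> \<open>The reverse comparison: if labels below iterate \<open>n\<close> are
   \<open>ok\<close>, then the children counted by iterate \<open>n + 1\<close> before
   \<open>lab e\<close> really are added.\<close>
 have down: "ereal (lab e) <= approx (Suc n) z e"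
  if IH: "\<And>f. strict_prefix r f ==> ereal (lab f) <= approx n z f ==> ok A f"
   and e: "strict_prefix r e" and ok: "ok A e" for n e
 proof -
  have pe: "prefix r e" using e by (simp add: strict_prefix_def)
  have "{i. ereal (lab (e @ [i])) <= approx n z (e @ [i]) & lab (e @ [i]) < lab e}
    \<subseteq> {i. e @ [i] \<in> A & lab (e @ [i]) < lab e}"
  proof safe
   fix i assume i: "ereal (lab (e @ [i])) <= approx n z (e @ [i])" "lab (e @ [i]) < lab e"
   have "ok A (e @ [i])" using IH[OF _ i(1)] strict_prefix_snoc[OF pe] by simp
   \<comment> \<open>The child edge is tried before \<open>e\<close>, so the parent edge of
     \<open>e\<close> occupies no place yet; as \<open>e\<close> has a free place even at the later
     time \<open>lab e\<close>, it has one when the child edge is tried.\<close>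
   moreover have "cnt A e (lab (e @ [i])) <= cnt A e (lab e)"
    unfolding cnt_def using i(2) by (intro card_mono finite_children) auto
   ultimately show "e @ [i] \<in> A"
    using ok i(2) unfolding mem[OF pe] ok_def[of A e] by simp
  qed
  then have "card {i. ereal (lab (e @ [i])) <= approx n z (e @ [i]) & lab (e @ [i]) < lab e} <= cnt A e (lab e)"
   unfolding cnt_def by (intro card_mono finite_children)
  with ok show ?thesis unfolding step ok_def by simp
 qed
 \<comment> \<open>Even iterates bound from above, odd ones from below; the start is the infinite
   iterate 0.\<close>
 have ev: "(\<forall>f. strict_prefix r f --> ok A f --> ereal (lab f) <= approx (2 * n) z f) \<and>
  (\<forall>f. strict_prefix r f --> ereal (lab f) <= approx (Suc (2 * n)) z f --> ok A f)" for n
 proof (induction n)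
  case 0
  show ?case using up[of 0] by (auto simp del: approx.simps(2))
 next
  case (Suc n)
  have 1: "\<forall>f. strict_prefix r f --> ok A f --> ereal (lab f) <= approx (2 * Suc n) z f"
   using down[of "Suc (2 * n)"] Suc by (auto simp del: approx.simps(2))
  moreover have "\<forall>f. strict_prefix r f --> ereal (lab f) <= approx (Suc (2 * Suc n)) z f --> ok A f"
   using up[of "2 * Suc n"] 1 by (auto simp del: approx.simps(2))
  ultimately show ?case by blast
 qed
 obtain v j where ev_j: "e = v @ [j]" using e by (rule strict_prefix_snocE)
 have ne: "ereal (lab e) ~= ptime z e" using noties ev_j by (simp add: lab)
 show ?thesis
 proof
  assume "ok A e"
  then have "ereal (lab e) <= ptime z e"
   unfolding ptime_def using ev e by (intro INF_greatest) auto
  with ne show "lab e < rt e" by (simp add: ptime_rt)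
 next
  assume "lab e < rt e"
  then have "ereal (lab e) < (SUP n. approx (Suc (2 * n)) z e)" unfolding lims by (simp add: ptime_rt)
  then obtain n where "ereal (lab e) < approx (Suc (2 * n)) z e" unfolding less_SUP_iff by blast
  then show "ok A e" using ev[of n] e less_imp_le by blast
 qed
qed

definition edges :: "vertex => vertex set" where
 "edges r = {e. edge_in lab rt r e}"

lemma avail_lab: "j \<in> avail z v \<longleftrightarrow> lab (v @ [j]) < rt (v @ [j])"
 by (simp add: avail_iff lab)

lemma edges_iff:
 assumes "prefix r v"
 shows "v @ [j] \<in> edges r \<longleftrightarrow> j \<in> avail z v \<and>
  (if v \<in> edges r then lab (v @ [j]) < rt v else lab (v @ [j]) <= rt v)"
proof -
 have "lab (v @ [j]) <= rt (v @ [j]) \<longleftrightarrow> lab (v @ [j]) < rt (v @ [j])"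
  using noties[of v j] by (auto simp: lab ptime_rt)
 then show ?thesis
  unfolding edges_def avail_lab mem_Collect_eq
  by (subst edge_in.simps) (simp add: strict_prefix_snoc[OF assms])
qed

lemma edges_sub: "edges r \<subseteq> {e. strict_prefix r e}"
proof
 fix e assume "e \<in> edges r"
 then have "edge_in lab rt r e" by (simp add: edges_def)
 then show "e \<in> {e. strict_prefix r e}" by (subst (asm) edge_in.simps) (auto split: if_splits)
qed

lemma not_edges_self: "r \<notin> edges r"
 using edges_sub by fastforce

lemma edges_lab_less:
 assumes "v \<in> edges r" shows "lab v < rt v"
proof -
 have "strict_prefix r v" using assms edges_sub by auto
 then obtain u j where "v = u @ [j]" "prefix r u" by (rule strict_prefix_snocE)
 with assms show ?thesis by (simp add: edges_iff avail_lab)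
qed

text \<open>Each vertex \<open>u\<close> fills up exactly at \<open>rt u\<close>: without a parent
  edge it takes its \<open>d u\<close> usable children up to and including \<open>rt u\<close>, with
  one it takes the \<open>d u - 1\<close> children strictly before, and the parent edge was added
  earlier than \<open>rt u\<close> as well.\<close>

lemma is_rdcp_edges_edges: "is_rdcp_edges r lab d (edges r)"
 unfolding is_rdcp_edges_iff
proof (intro conjI allI impI)
 show "edges r \<subseteq> {e. strict_prefix r e}" by (rule edges_sub)
next
 fix v j assume pv: "prefix r v"
 let ?e = "v @ [j]" let ?A = "edges r"
 have pe: "prefix r ?e" using pv by simp
 have cntav: "cnt ?A u t = card {i \<in> avail z u. lab (u @ [i]) < t \<and>
   (if u \<in> ?A then lab (u @ [i]) < rt u else lab (u @ [i]) <= rt u)}" if "prefix r u" for u t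
  unfolding cnt_def edges_iff[OF that] by (rule arg_cong[where f=card]) auto
 have less: "card {i \<in> avail z u. lab (u @ [i]) < rt u} = d u - 1" for u
  using card_avail_less[of u] by (simp add: lab d)
 have le: "card {i \<in> avail z u. lab (u @ [i]) <= rt u} = d u" for u
  using card_avail_le[of u] by (simp add: lab d)
 have d1: "1 <= d u" for u using deg by (simp add: d)
 \<comment> \<open>Up to \<open>rt u\<close> at least one place is left for the edge under trial,
   whether or not the parent edge is present.\<close>
 have small: "cnt ?A u t <= d u - 1" if "prefix r u" "t <= rt u" for u t
  unfolding cntav[OF that(1)] less[symmetric] using that(2)
  by (intro card_mono) (auto intro: finite_subset[OF _ finite_children(1)])
 \<comment> \<open>Without a parent edge, all places have been taken by children once
   \<open>rt u\<close> has passed.\<close>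
 have big: "cnt ?A u t = d u" if "prefix r u" "rt u < t" "u \<notin> ?A" for u t
  unfolding cntav[OF that(1)] le[symmetric] using that(2,3)
  by (intro arg_cong[where f=card]) auto
 have e_iff: "cnt ?A ?e (lab ?e) < d ?e \<longleftrightarrow> j \<in> avail z v"
 proof (cases "lab ?e <= rt ?e")
  case True
  then have "lab ?e < rt ?e" using noties[of v j] by (auto simp: lab ptime_rt)
  then show ?thesis using small[OF pe, of "lab ?e"] d1[of ?e] by (simp add: avail_lab)
 next
  case False
  then have "?e \<notin> ?A" unfolding edges_iff[OF pv] by (simp add: avail_lab)
  then show ?thesis using big[OF pe, of "lab ?e"] False by (simp add: avail_lab)
 qed
 have v_iff: "cnt ?A v (lab ?e) + (if v \<in> ?A & lab v < lab ?e then 1 else 0) < d v \<longleftrightarrow>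
   (if v \<in> ?A then lab ?e < rt v else lab ?e <= rt v)" if av: "j \<in> avail z v"
 proof (cases "v \<in> ?A")
  case False
  then show ?thesis using small[OF pv, of "lab ?e"] d1[of v] big[OF pv, of "lab ?e"]
   by (cases "lab ?e <= rt v") auto
 next
  case True
  have lv: "lab v < rt v" by (rule edges_lab_less[OF True])
  show ?thesis
  proof (cases "lab ?e < rt v")
   case lt: True
   \<comment> \<open>With the parent edge counted, the earlier children must number at most
     \<open>d v - 2\<close>; this holds because child \<open>j\<close> itself is one of the
     \<open>d v - 1\<close> usable children before \<open>rt v\<close> but is not earlier than
     itself.\<close>
   have fl: "finite {i \<in> avail z v. lab (v @ [i]) < rt v}" by (rule finite_subset[OF _ finite_children(1)]) auto
   have "cnt ?A v (lab ?e) < card {i \<in> avail z v. lab (v @ [i]) < rt v}"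
    unfolding cntav[OF pv] using True lt av by (intro psubset_card_mono fl) auto
   then show ?thesis using True lt less[of v] by auto
  next
   case ge: False
   then have "cnt ?A v (lab ?e) = card {i \<in> avail z v. lab (v @ [i]) < rt v}"
    unfolding cntav[OF pv] using True by (intro arg_cong[where f=card]) auto
   then show ?thesis using True ge less[of v] lv by auto
  qed
 qed
 show "(?e \<in> ?A) = (cnt ?A v (lab ?e) + (if v \<in> ?A & lab v < lab ?e then 1 else 0) < d v
   & cnt ?A ?e (lab ?e) < d ?e)"
  unfolding edges_iff[OF pv] e_iff using v_iff by blast
qed

text \<open>By \<open>ok_iff\<close> the condition at the lower end-vertex is common to both
  solutions. The condition at the upper end-vertex refers only to its parent edge and to siblings
  with smaller label, hence smaller index, so induction on depth and then on the sibling index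
  applies.\<close>

lemma is_rdcp_edges_unique:
 assumes A: "is_rdcp_edges r lab d A" and B: "is_rdcp_edges r lab d B"
 shows "A = B"
proof -
 have sub: "A \<subseteq> {e. strict_prefix r e}" "B \<subseteq> {e. strict_prefix r e}"
  using A B unfolding is_rdcp_edges_iff by auto
 have *: "prefix r v ==> v @ [j] \<in> A \<longleftrightarrow> v @ [j] \<in> B" for v j
 proof (induction "length v" arbitrary: v j rule: less_induct)
  case (less v)
  note IH = less.hyps and pv = less.prems
  show ?case
  proof (induction j rule: less_induct)
   case (less j)
   have vAB: "v \<in> A \<longleftrightarrow> v \<in> B"
   proof (cases "strict_prefix r v")
    case True
    then obtain u i where ui: "v = u @ [i]" "prefix r u" by (rule strict_prefix_snocE)
    then show ?thesis using IH[of u i] ui by auto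
   next
    case False
    then show ?thesis using sub by auto
   qed
   have "{i. v @ [i] \<in> A & lab (v @ [i]) < lab (v @ [j])} = {i. v @ [i] \<in> B & lab (v @ [i]) < lab (v @ [j])}"
    using less by (auto simp: lab x_less_iff)
   then have c: "cnt A v (lab (v @ [j])) = cnt B v (lab (v @ [j]))" by (simp add: cnt_def)
   have "ok A (v @ [j]) = ok B (v @ [j])"
    using ok_iff[OF A] ok_iff[OF B] strict_prefix_snoc[OF pv] by simp
   moreover have "v @ [j] \<in> A \<longleftrightarrow> cnt A v (lab (v @ [j])) + (if v \<in> A & lab v < lab (v @ [j]) then 1 else 0) < d v
     & ok A (v @ [j])"
    "v @ [j] \<in> B \<longleftrightarrow> cnt B v (lab (v @ [j])) + (if v \<in> B & lab v < lab (v @ [j]) then 1 else 0) < d v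
     & ok B (v @ [j])"
    using A B pv unfolding is_rdcp_edges_iff ok_def by blast+
   ultimately show ?case by (simp add: c vAB)
  qed
 qed
 have "e \<in> A \<longleftrightarrow> e \<in> B" if "strict_prefix r e" for e
  using that * by (auto elim: strict_prefix_snocE)
 then show ?thesis using sub by blast
qed

lemma rdcp_edges_eq: "rdcp_edges r lab d = edges r"
 unfolding rdcp_edges_def
proof (rule the_equality)
 show "A = edges r" if "is_rdcp_edges r lab d A" for A
  using that is_rdcp_edges_edges by (rule is_rdcp_edges_unique)
qed (rule is_rdcp_edges_edges)

text \<open>The root \<open>v\<close> of the subtree has no parent edge there, so it accepts the
  usable children up to \<open>rt v\<close>. Cutting off at \<open>rt v\<close> does not change when
  the count first reaches \<open>d v\<close>, and what remains is the fixed-point equation.\<close>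

lemma phantom_time_eq: "phantom_time lab d v = ptime z v"
proof -
 have nil: "[] \<notin> edges v" using edges_sub by fastforce
 have "card {e \<in> edges v. incident e v & lab e <= t} = card {i \<in> avail z v. fst (z v) i <= rt v & fst (z v) i <= t}" for t
  using not_edges_self[of v]
  by (subst card_incident(2)[OF nil finite_children(2)]) (simp add: edges_iff lab)
 moreover have "(d v <= card {i \<in> avail z v. fst (z v) i <= rt v & fst (z v) i <= t}) \<longleftrightarrow>
   (d v <= card {i \<in> avail z v. fst (z v) i <= t})" for t
 proof (cases "rt v <= t")
  case True
  then have "{i \<in> avail z v. fst (z v) i <= rt v & fst (z v) i <= t} = {i \<in> avail z v. fst (z v) i <= rt v}" by auto
  then have e: "card {i \<in> avail z v. fst (z v) i <= rt v & fst (z v) i <= t} = d v" using card_avail_le[of v] d by simp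
  also have "d v = card {i \<in> avail z v. fst (z v) i <= rt v}" using card_avail_le[of v] d by simp
  also have "... <= card {i \<in> avail z v. fst (z v) i <= t}"
   using True by (intro card_mono finite_subset[OF _ fin[of v t]]) auto
  finally show ?thesis using e card_avail_le[of v] d by simp
 next
  case False
  then have "{i \<in> avail z v. fst (z v) i <= rt v & fst (z v) i <= t} = {i \<in> avail z v. fst (z v) i <= t}" by auto
  then show ?thesis by simp
 qed
 ultimately show ?thesis
  unfolding phantom_time_def rdcp_edges_eq
  by (subst ptime_fixpoint[of v]) (simp add: sat_time_def d avail_def)
qed

end

section \<open>Components of the root and re-indexed trees\<close>

lemma root_component_snoc:
 "v @ [j] \<in> root_component S \<longleftrightarrow> v \<in> root_component S & v @ [j] \<in> S"
 and root_component_Nil: "[] \<in> root_component S"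
proof -
 let ?R = "\<Union>e\<in>S - {[]}. {(butlast e, e), (e, butlast e)}"
 \<comment> \<open>Edges join strings to their immediate prefixes, so a walk from the root to
   \<open>v\<close> must use every edge on the path, that is, every nonempty prefix of
   \<open>v\<close>.\<close>
 have iff: "v \<in> root_component S \<longleftrightarrow> (\<forall>u. prefix u v --> u ~= [] --> u \<in> S)" for v
 proof
  assume "v \<in> root_component S"
  then have "([], v) \<in> ?R\<^sup>*" by (simp add: root_component_def)
  then show "\<forall>u. prefix u v --> u ~= [] --> u \<in> S"
  proof (induction rule: rtrancl_induct)
   case (step y w)
   then obtain e where e: "e \<in> S" "e ~= []" "(y = butlast e & w = e) \<or> (y = e & w = butlast e)" by auto
   then obtain b l where bl: "e = b @ [l]" by (metis append_butlast_last_id)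
   show ?case using e step.IH unfolding bl by auto
  qed simp
 next
  assume "\<forall>u. prefix u v --> u ~= [] --> u \<in> S"
  then show "v \<in> root_component S"
  proof (induction v rule: rev_induct)
   case (snoc x xs)
   then have "([], xs) \<in> ?R\<^sup>*" by (simp add: root_component_def)
   moreover have "(xs, xs @ [x]) \<in> ?R" using snoc.prems
    by (intro UN_I[of "xs @ [x]"]) auto
   ultimately have "([], xs @ [x]) \<in> ?R\<^sup>*" by (rule rtrancl_into_rtrancl)
   then show ?case by (simp add: root_component_def)
  qed (simp add: root_component_def)
 qed
 show "v @ [j] \<in> root_component S \<longleftrightarrow> v \<in> root_component S & v @ [j] \<in> S"
  unfolding iff by auto
 show "[] \<in> root_component S" unfolding iff by simp
qed

lemma mtbp_vertices_snoc:
 "v @ [j] \<in> mtbp_vertices d \<longleftrightarrow> v \<in> mtbp_vertices d & j < num_children v (d v)"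
 and mtbp_vertices_Nil: "[] \<in> mtbp_vertices d"
 by (auto simp: mtbp_vertices_def)

lemma mtbp_component_snoc:
 "v @ [j] \<in> mtbp_component d lab t \<longleftrightarrow>
   v \<in> mtbp_component d lab t & j < num_children v (d v) & ereal (lab (v @ [j])) < t"
 and mtbp_component_Nil: "[] \<in> mtbp_component d lab t"
 and mtbp_component_sub: "mtbp_component d lab t \<subseteq> mtbp_vertices d"
proof -
 have sub: "v \<in> mtbp_component d lab t ==> v \<in> mtbp_vertices d" for v
  by (cases v rule: rev_cases) (auto simp: mtbp_component_def root_component_snoc mtbp_vertices_Nil)
 then show "mtbp_component d lab t \<subseteq> mtbp_vertices d" by auto
 show "v @ [j] \<in> mtbp_component d lab t \<longleftrightarrow>
   v \<in> mtbp_component d lab t & j < num_children v (d v) & ereal (lab (v @ [j])) < t"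
  using sub[of v] by (auto simp: mtbp_component_def root_component_snoc mtbp_vertices_snoc)
 show "[] \<in> mtbp_component d lab t" by (simp add: mtbp_component_def root_component_Nil)
qed

lemma mtbp_component_take: "v \<in> mtbp_component d lab t ==> take m v \<in> mtbp_component d lab t"
proof (induction v rule: rev_induct)
 case (snoc x xs)
 then show ?case by (cases "m <= length xs") (auto simp: mtbp_component_snoc)
qed simp

text \<open>A bijection that respects prefixes and labels maps siblings to siblings with the same
  label order, so the counts that make up \<open>address\<close> agree, and the canonical tree
  depends on the vertices through their addresses only.\<close>

lemma canonical_tree_iso:
 fixes C C' :: "vertex set"
 assumes bij: "bij_betw h C C'"
  and len: "\<And>w. w \<in> C ==> length (h w) = length w"
  and tk: "\<And>w m. w \<in> C ==> take m w \<in> C" "\<And>w m. w \<in> C ==> h (take m w) = take m (h w)"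
  and lab: "\<And>w. w \<in> C ==> w ~= [] ==> lab' (h w) = lab w"
  and ty: "\<And>w. w \<in> C ==> ty' (h w) = ty w"
 shows "canonical_tree C' lab' ty' = canonical_tree C lab ty"
proof -
 have inj: "h x = h y ==> x = y" if "x \<in> C" "y \<in> C" for x y
  using bij that by (auto simp: bij_betw_def inj_on_def)
 have mem: "h x \<in> C'" if "x \<in> C" for x using bij that by (auto simp: bij_betw_def)
 have surj: "\<exists>x\<in>C. y = h x" if "y \<in> C'" for y using bij that by (auto simp: bij_betw_def)
 have child: "h (u @ [i]) = h u @ [last (h (u @ [i]))]" if "u @ [i] \<in> C" for u i
 proof -
  have "take (length u) (h (u @ [i])) = h u" using tk(2)[OF that, of "length u"] by simp
  moreover have "length (h (u @ [i])) = Suc (length u)" using len[OF that] by simp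
  ultimately show ?thesis
   by (metis append_butlast_last_id butlast_conv_take diff_Suc_1 length_0_conv nat.distinct(1))
 qed
 have ent: "card {j. take m (h w) @ [j] \<in> C' & lab' (take m (h w) @ [j]) < lab' (take (Suc m) (h w))} =
   card {j. take m w @ [j] \<in> C & lab (take m w @ [j]) < lab (take (Suc m) w)}"
  (is "card ?A' = card ?A") if w: "w \<in> C" and m: "m < length w" for w m
 proof -
  define u where "u = take m w"
  have uC: "u \<in> C" and hu: "h u = take m (h w)" using tk w by (auto simp: u_def)
  have sC: "take (Suc m) w \<in> C" and hs: "h (take (Suc m) w) = take (Suc m) (h w)" using tk w by auto
  have sne: "take (Suc m) w ~= []" using m by auto
  have ls: "lab' (take (Suc m) (h w)) = lab (take (Suc m) w)" using lab[OF sC sne] hs by simp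
  have "bij_betw (%i. last (h (u @ [i]))) ?A ?A'"
   unfolding bij_betw_def
  proof
   show "inj_on (%i. last (h (u @ [i]))) ?A"
   proof (rule inj_onI)
    fix i j assume "i \<in> ?A" "j \<in> ?A" "last (h (u @ [i])) = last (h (u @ [j]))"
    then have "u @ [i] \<in> C" "u @ [j] \<in> C" "h (u @ [i]) = h (u @ [j])"
     using child[of u i] child[of u j] by (auto simp: u_def)
    then show "i = j" using inj by blast
   qed
   show "(%i. last (h (u @ [i]))) ` ?A = ?A'"
   proof safe
    fix i assume i: "take m w @ [i] \<in> C" "lab (take m w @ [i]) < lab (take (Suc m) w)"
    then have ui: "u @ [i] \<in> C" by (simp add: u_def)
    have e: "take m (h w) @ [last (h (u @ [i]))] = h (u @ [i])" using child[OF ui] hu by simp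
    show "take m (h w) @ [last (h (u @ [i]))] \<in> C'" unfolding e by (rule mem[OF ui])
    show "lab' (take m (h w) @ [last (h (u @ [i]))]) < lab' (take (Suc m) (h w))"
     unfolding e ls using lab[OF ui] i by (simp add: u_def)
   next
    fix j assume j: "take m (h w) @ [j] \<in> C'" "lab' (take m (h w) @ [j]) < lab' (take (Suc m) (h w))"
    then obtain y where y: "y \<in> C" "h u @ [j] = h y" using surj hu by metis
    have ly: "length y = Suc (length u)" using len[OF y(1)] len[OF uC] y(2) by (metis length_append_singleton)
    have "h (take (length u) y) = h u" using tk(2)[OF y(1), of "length u"] y(2)[symmetric] len[OF uC] by simp
    then have "take (length u) y = u" using inj tk(1)[OF y(1)] uC by blast
    then have yu: "y = u @ [last y]" using ly
     by (metis append_butlast_last_id butlast_conv_take diff_Suc_1 length_0_conv nat.distinct(1))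
    have "last (h (u @ [last y])) = j" using y(2) yu by (metis last_snoc)
    moreover have "last y \<in> ?A"
     using y(1) yu j(2) lab[OF y(1)] ly ls y(2) hu by (simp add: u_def) (metis length_0_conv nat.distinct(1))
    ultimately show "j \<in> (%i. last (h (u @ [i]))) ` ?A" by (rule image_eqI[OF sym])
   qed
  qed
  then show ?thesis by (rule bij_betw_same_card[symmetric])
 qed
 have addr: "address C' lab' (h w) = address C lab w" if "w \<in> C" for w
  unfolding address_def len[OF that] by (rule map_cong) (auto simp: ent[OF that])
 have ex1: "(\<exists>!v. v \<in> C' & address C' lab' v = w) \<longleftrightarrow> (\<exists>!v. v \<in> C & address C lab v = w)" for w
 proof
  assume "\<exists>!v. v \<in> C' & address C' lab' v = w"
  then show "\<exists>!v. v \<in> C & address C lab v = w" using surj mem inj addr by (metis (no_types))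
 next
  assume "\<exists>!v. v \<in> C & address C lab v = w"
  then show "\<exists>!v. v \<in> C' & address C' lab' v = w" using surj mem inj addr by (metis (no_types))
 qed
 show ?thesis
 proof
  fix w
  show "canonical_tree C' lab' ty' w = canonical_tree C lab ty w"
  proof (cases "\<exists>!v. v \<in> C & address C lab v = w")
   case True
   define x where "x = (THE v. v \<in> C & address C lab v = w)"
   have x: "x \<in> C" "address C lab x = w" using theI'[OF True] by (auto simp: x_def)
   have "(THE v. v \<in> C' & address C' lab' v = w) = h x"
    using True ex1 x mem addr by (intro the1_equality) auto
   moreover have "h x = [] \<longleftrightarrow> x = []" using len[OF x(1)] by (metis length_0_conv)
   ultimately show ?thesis using True ex1[of w] x lab[OF x(1)] ty[OF x(1)]
    by (simp add: canonical_tree_def x_def[symmetric])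
  next
   case False
   then show ?thesis using ex1[of w] by (simp add: canonical_tree_def)
  qed
 qed
qed

text \<open>Makes the variables attached to strings outside the tree irrelevant, so that the masked
  history determines the tree.\<close>

lemma mtbp_tree_cong:
 assumes d: "\<And>v. v \<in> mtbp_vertices d ==> d' v = d v"
  and lab: "\<And>v. v \<in> mtbp_vertices d ==> v ~= [] ==> lab' v = lab v"
  and T: "\<And>v. v \<in> mtbp_vertices d ==> T' v = T v"
 shows "mtbp_tree T' d' lab' t = mtbp_tree T d lab t"
proof -
 have "v \<in> mtbp_component d' lab' t \<longleftrightarrow> v \<in> mtbp_component d lab t" for v
 proof (induction v rule: rev_induct)
  case (snoc x xs)
  show ?case
  proof (cases "xs \<in> mtbp_component d lab t")
   case True
   then have xs: "xs \<in> mtbp_vertices d" using mtbp_component_sub by auto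
   have "x < num_children xs (d xs) ==> lab' (xs @ [x]) = lab (xs @ [x])"
    using xs by (intro lab) (auto simp: mtbp_vertices_snoc)
   then show ?thesis using snoc d[OF xs] by (auto simp: mtbp_component_snoc)
  qed (use snoc in \<open>simp add: mtbp_component_snoc\<close>)
 qed (simp add: mtbp_component_Nil)
 then have C: "mtbp_component d' lab' t = mtbp_component d lab t" by auto
 show ?thesis
  unfolding mtbp_tree_def C using mtbp_component_sub[of d lab t]
  by (intro canonical_tree_iso[where h=id]) (auto simp: mtbp_component_take lab T)
qed

section \<open>Embedding the branching process tree in the PWIT\<close>

text \<open>A string is read as an address among usable children only: step \<open>j\<close> goes to
  usable child number \<open>j\<close> in increasing order of label. The decorations found at the
  resulting vertices of the PWIT are the candidate branching process.\<close>

fun place_from :: "env => vertex => nat list => vertex" where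
 "place_from z v [] = v"
| "place_from z v (j # w) = place_from z (v @ [nth_elt (avail z v) j]) w"

definition place :: "env => nat list => vertex" where
 "place z w = place_from z [] w"

lemma place_Nil [simp]: "place z [] = []"
 by (simp add: place_def)

lemma place_snoc: "place z (w @ [j]) = place z w @ [nth_elt (avail z (place z w)) j]"
proof -
 have "place_from z v (w @ [j]) = place_from z v w @ [nth_elt (avail z (place_from z v w)) j]" for v
  by (induction w arbitrary: v) auto
 then show ?thesis by (simp add: place_def)
qed

lemma length_place [simp]: "length (place z w) = length w"
 by (induction w rule: rev_induct) (auto simp: place_snoc)

definition placed_type :: "env => vertex => real" where
 "placed_type z w = real_of_ereal (ptime z (place z w))"

definition placed_degree :: "env => vertex => nat" where
 "placed_degree z w = snd (z (place z w))"

definition placed_label :: "env => vertex => real" where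
 "placed_label z w =
   (if w = [] then 0 else fst (z (place z (butlast w))) (nth_elt (avail z (place z (butlast w))) (last w)))"

lemma placed_label_snoc:
 "placed_label z (w @ [j]) = fst (z (place z w)) (nth_elt (avail z (place z w)) j)"
 by (simp add: placed_label_def)

context good_env begin

lemma place_inj: "place z w = place z w' ==> w = w'"
proof (induction w arbitrary: w' rule: rev_induct)
 case Nil
 then show ?case by (metis length_place length_0_conv place_Nil)
next
 case (snoc x xs)
 then obtain y ys where w': "w' = ys @ [y]"
  by (metis length_0_conv length_append_singleton length_place nat.distinct(1) rev_exhaust)
 with snoc.prems have "place z xs = place z ys" "ix (place z xs) x = ix (place z ys) y"
  by (auto simp: place_snoc ix_def)
 then show ?case using snoc.IH[of ys] w' by (simp add: ix_inj)
qed

end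

context good_tree begin

lemma rdcp_component_snoc:
 "v @ [j] \<in> rdcp_component lab d t \<longleftrightarrow>
   v \<in> rdcp_component lab d t & v @ [j] \<in> edges [] & ereal (lab (v @ [j])) <= t"
 by (simp add: rdcp_component_def root_component_snoc rdcp_edges_eq)

text \<open>\<open>place z\<close> is an isomorphism between the two components. The hypothesis
  \<open>nt\<close> reconciles the weak cut-off \<open><= t\<close> of the random degree constrained
  process with the strict one of the branching process.\<close>

lemma rdcp_tree_eq:
 assumes nt: "\<And>v j. ereal (fst (z v) j) ~= t"
 shows "rdcp_tree lab d t = mtbp_tree (placed_type z) (placed_degree z) (placed_label z) t"
proof -
 let ?C = "mtbp_component (placed_degree z) (placed_label z) t" and ?C' = "rdcp_component lab d t"
 have lab_place: "lab (place z w) = placed_label z w" if "w ~= []" for w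
  using that by (cases w rule: rev_cases) (auto simp: place_snoc placed_label_snoc lab)
 \<comment> \<open>Inside the component every vertex except the root is joined to its parent; this
   is what decides between all \<open>d v\<close> usable children and all but the last.\<close>
 have memE: "v \<in> edges [] \<longleftrightarrow> v ~= []" if "v \<in> ?C'" for v
  using that not_edges_self by (cases v rule: rev_cases) (auto simp: rdcp_component_snoc)
 have mem: "place z w \<in> ?C' \<longleftrightarrow> w \<in> ?C" for w
 proof (induction w rule: rev_induct)
  case Nil
  then show ?case by (simp add: rdcp_component_def root_component_Nil mtbp_component_Nil)
 next
  case (snoc x xs)
  let ?v = "place z xs"
  have "?v @ [ix ?v x] \<in> edges [] \<longleftrightarrow> x < num_children xs (placed_degree z xs)" if "?v \<in> ?C'"
  proof -
   have "?v = [] \<longleftrightarrow> xs = []" by (metis length_place length_0_conv)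
   then have "?v @ [ix ?v x] \<in> edges [] \<longleftrightarrow> (if xs = [] then x < snd (z ?v) else Suc x < snd (z ?v))"
    using edges_iff[of "[]" ?v "ix ?v x"] memE[OF that] ix_avail[of ?v x] x_ix_less_rt[of ?v x] x_ix_le_rt[of ?v x]
    unfolding lab by (cases "xs = []") simp_all
   then show ?thesis by (auto simp: num_children_def placed_degree_def)
  qed
  moreover have "ereal (lab (?v @ [ix ?v x])) <= t \<longleftrightarrow> ereal (placed_label z (xs @ [x])) < t"
   using nt[of ?v "ix ?v x"] by (auto simp: lab placed_label_snoc ix_def order_le_less)
  ultimately show ?case
   using snoc by (auto simp: place_snoc rdcp_component_snoc mtbp_component_snoc ix_def[symmetric])
 qed
 have surj: "\<exists>w. place z w = v" if "v \<in> ?C'" for v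
  using that
 proof (induction v rule: rev_induct)
  case (snoc x xs)
  then obtain w where w: "place z w = xs" by (auto simp: rdcp_component_snoc)
  have "x \<in> avail z xs" using snoc.prems by (auto simp: rdcp_component_snoc edges_iff)
  then obtain k where "x = ix xs k" using ix_surj by blast
  then have "place z (w @ [k]) = xs @ [x]" using w by (simp add: place_snoc ix_def)
  then show ?case ..
 qed (metis place_Nil)
 have tk: "place z (take m w) = take m (place z w)" for m w
 proof (induction w rule: rev_induct)
  case (snoc x xs)
  then show ?case by (cases "m <= length xs") (auto simp: place_snoc)
 qed simp
 have "bij_betw (place z) ?C ?C'"
  unfolding bij_betw_def
 proof
  show "inj_on (place z) ?C" by (rule inj_onI) (rule place_inj)
  show "place z ` ?C = ?C'" using mem surj by fast
 qed
 then show ?thesis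
  unfolding rdcp_tree_def mtbp_tree_def
  by (rule canonical_tree_iso)
   (auto simp: mtbp_component_take tk lab_place phantom_time_eq placed_type_def ptime_rt)
qed

end

section \<open>The differential equation\<close>

text \<open>A version with derivatives within the interval, since at 0 the solution of the
  differential equation has a one-sided derivative only.\<close>

lemma nn_integral_FTC_within:
 fixes f F :: "real => real"
 assumes ab: "a <= b" and nn: "\<And>x. a <= x ==> x <= b ==> 0 <= f x"
  and D: "\<And>x. a <= x ==> x <= b ==> (F has_real_derivative f x) (at x within {a..b})"
  and [measurable]: "f \<in> bmeas borel"
 shows "(\<integral>\<^sup>+x. ennreal (f x) * indicator {a..b} x \<partial>lborel) = ennreal (F b - F a)"
proof -
 have "(f has_integral (F b - F a)) {a..b}"
  using D by (intro fundamental_theorem_of_calculus ab) (auto simp: has_real_derivative_iff_has_vector_derivative)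
 then have "((%x. if x \<in> {a..b} then f x else 0) has_integral (F b - F a)) UNIV"
  by (subst has_integral_restrict_UNIV)
 then have "(\<integral>\<^sup>+x. ennreal (if x \<in> {a..b} then f x else 0) \<partial>lborel) = ennreal (F b - F a)"
  using nn by (intro nn_integral_has_integral_lborel) auto
 also have "(\<integral>\<^sup>+x. ennreal (if x \<in> {a..b} then f x else 0) \<partial>lborel) =
   (\<integral>\<^sup>+x. ennreal (f x) * indicator {a..b} x \<partial>lborel)"
  by (intro nn_integral_cong) (auto split: split_indicator)
 finally show ?thesis .
qed

lemma at_within_atLeast_0: "0 < (x::real) ==> at x within {0..} = at x"
 by (rule at_within_interior) simp

section \<open>The right-hand side of the differential equation\<close>

locale degree_dist =
 fixes p :: "nat => real"
 assumes p_nonneg: "\<And>k. 1 <= k ==> 0 <= p k" and p_sums: "(%k. p (Suc k)) sums 1"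
begin

abbreviation "q k \<equiv> degree_tail p (Suc k)"

text \<open>The differential equation reads \<open>lam' = F (lam)\<close>. For a Poisson variable of
  mean \<open>x\<close> and an independent degree constraint, \<open>F x\<close> is the probability
  that the constraint exceeds the variable, and \<open>Z x\<close> the probability that it exceeds
  it by exactly one. Since \<open>Z\<close> is minus the derivative of \<open>F\<close>, the density
  \<open>f\<close> is \<open>F (lam) * Z (lam)\<close>.\<close>

definition F :: "real => real" where "F x = exp (- x) * (\<Sum>k. x ^ k / fact k * q k)"
definition Z :: "real => real" where "Z x = exp (- x) * (\<Sum>k. x ^ k / fact k * p (Suc k))"

lemma p_summable: "summable (%d. p (Suc k + d))"
 using summable_ignore_initial_segment[OF sums_summable[OF p_sums], of k] by (simp add: add.commute add.left_commute)

lemma q_Suc: "q k = p (Suc k) + q (Suc k)"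
 unfolding degree_tail_def using suminf_split_initial_segment[OF p_summable[of k], of 1] by simp

lemma q_0: "q 0 = 1"
 unfolding degree_tail_def using sums_unique[OF p_sums] by simp

lemma q_nonneg: "0 <= q k"
 unfolding degree_tail_def by (intro suminf_nonneg p_summable p_nonneg) simp

lemma q_antimono: "q (Suc k) <= q k"
 using q_Suc[of k] p_nonneg[of "Suc k"] by simp

lemma q_le_1: "q k <= 1"
proof (induction k)
 case (Suc k)
 then show ?case using q_antimono order_trans by blast
qed (simp add: q_0)

lemma q_tendsto_0: "q \<longlonglongrightarrow> 0"
proof -
 have "q k = 1 - (\<Sum>i<k. p (Suc i))" for k
 proof (induction k)
  case (Suc k)
  then show ?case using q_Suc[of k] by simp
 qed (simp add: q_0)
 moreover have "(%k. 1 - (\<Sum>i<k. p (Suc i))) \<longlonglongrightarrow> 1 - 1"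
  using p_sums by (intro tendsto_diff tendsto_const) (simp add: sums_def)
 ultimately show ?thesis by simp
qed

lemma p_le_1: "p (Suc k) <= 1"
 using q_Suc[of k] q_nonneg[of "Suc k"] q_le_1[of k] by simp

lemma summable_exp_bounded:
 fixes x :: real
 assumes "\<And>k. \<bar>c k\<bar> <= 1" shows "summable (%k. x ^ k / fact k * c k)"
proof (rule summable_comparison_test)
 show "\<exists>N. \<forall>n\<ge>N. norm (x ^ n / fact n * c n) <= \<bar>x\<bar> ^ n / fact n"
  using assms by (auto simp: abs_mult power_abs divide_simps intro!: mult_left_le)
 show "summable (%n. \<bar>x\<bar> ^ n / fact n)" using summable_exp[of "\<bar>x\<bar>"] by (simp add: field_simps)
qed

lemma summable_q: "summable (%k. x ^ k / fact k * q k)" for x :: real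
 by (rule summable_exp_bounded) (use q_nonneg q_le_1 in auto)

lemma summable_p: "summable (%k. x ^ k / fact k * p (Suc k))" for x :: real
 by (rule summable_exp_bounded) (use p_nonneg p_le_1 in auto)

lemma exp_suminf: "(\<Sum>k. x ^ k / fact k) = exp x" for x :: real
 by (simp add: exp_def divide_inverse mult.commute)

lemma summable_exp': "summable (%k. x ^ k / fact k)" for x :: real
 using summable_exp[of x] by (simp add: field_simps)

text \<open>Termwise differentiation shifts the coefficients by one, and
  \<open>q k - q (Suc k)\<close> is \<open>p (Suc k)\<close>.\<close>

lemma DERIV_F: "(F has_real_derivative - Z x) (at x)"
proof -
 let ?c = "%k. q k / fact k"
 have s: "summable (%n. ?c n * y ^ n)" for y :: real using summable_q[of y] by (simp add: field_simps)
 have "((%y. \<Sum>n. ?c n * y ^ n) has_real_derivative (\<Sum>n. diffs ?c n * x ^ n)) (at x)"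
  by (rule termdiffs_strong_converges_everywhere[OF s])
 moreover have "diffs ?c n = q (Suc n) / fact n" for n
  by (simp add: diffs_def fact_Suc del: of_nat_Suc)
 ultimately have "((%y. \<Sum>n. y ^ n / fact n * q n) has_real_derivative (\<Sum>n. x ^ n / fact n * q (Suc n))) (at x)"
  by (simp add: field_simps)
 then have "(F has_real_derivative (exp (- x) * - 1 * (\<Sum>n. x ^ n / fact n * q n)
   + exp (- x) * (\<Sum>n. x ^ n / fact n * q (Suc n)))) (at x)"
  unfolding F_def by (auto intro!: derivative_eq_intros)
 moreover have "(\<Sum>n. x ^ n / fact n * q n) - (\<Sum>n. x ^ n / fact n * q (Suc n)) = (\<Sum>n. x ^ n / fact n * p (Suc n))"
 proof (subst suminf_diff)
  show "summable (%n. x ^ n / fact n * q (Suc n))"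
   by (rule summable_exp_bounded) (use q_nonneg q_le_1 in auto)
  have "x ^ n / fact n * q n - x ^ n / fact n * q (Suc n) = x ^ n / fact n * p (Suc n)" for n
   by (simp only: right_diff_distrib[symmetric] q_Suc[of n]) simp
  then show "(\<Sum>n. x ^ n / fact n * q n - x ^ n / fact n * q (Suc n)) = (\<Sum>n. x ^ n / fact n * p (Suc n))" by simp
 qed (rule summable_q)
 ultimately show ?thesis unfolding Z_def by (simp add: algebra_simps)
qed

lemma isCont_F: "isCont F x"
 using DERIV_F by (rule DERIV_isCont)

lemma continuous_on_F: "continuous_on A F"
 by (simp add: continuous_at_imp_continuous_on isCont_F)

lemma isCont_Z: "isCont Z x"
proof -
 let ?c = "%k. p (Suc k) / fact k"
 have s: "summable (%n. ?c n * y ^ n)" for y :: real using summable_p[of y] by (simp add: field_simps)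
 have "isCont (%y. \<Sum>n. ?c n * y ^ n) x"
  by (rule DERIV_isCont[OF termdiffs_strong_converges_everywhere[OF s]])
 then have "isCont (%y. \<Sum>n. y ^ n / fact n * p (Suc n)) x" by (simp add: field_simps)
 then show ?thesis unfolding Z_def by (intro continuous_intros)
qed

lemma Z_nonneg: "0 <= x ==> 0 <= Z x"
 unfolding Z_def by (intro mult_nonneg_nonneg suminf_nonneg summable_p) (auto simp: p_nonneg)

lemma Z_le_1: assumes "0 <= x" shows "Z x <= 1"
proof -
 have "(\<Sum>k. x ^ k / fact k * p (Suc k)) <= (\<Sum>k. x ^ k / fact k)"
 proof (intro suminf_le summable_p summable_exp')
  show "x ^ k / fact k * p (Suc k) <= x ^ k / fact k" for k
   using p_le_1 p_nonneg assms by (intro mult_left_le) auto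
 qed
 then have "Z x <= exp (- x) * exp x" unfolding Z_def exp_suminf by (intro mult_left_mono) auto
 then show ?thesis by (simp add: exp_minus_inverse mult.commute)
qed

lemma Z_pos: assumes "0 < x" shows "0 < Z x"
proof -
 obtain k where "p (Suc k) ~= 0"
  using p_sums sums_0[of "%k. p (Suc k)"] sums_unique2 by (metis zero_neq_one)
 then have "0 < p (Suc k)" using p_nonneg[of "Suc k"] by simp
 then have "0 < (\<Sum>k. x ^ k / fact k * p (Suc k))"
  using assms by (intro suminf_pos2[OF summable_p, of _ k]) (auto simp: p_nonneg)
 then show ?thesis unfolding Z_def by simp
qed

lemma F_0: "F 0 = 1"
proof -
 have "(\<Sum>k. 0 ^ k / fact k * q k) = (\<Sum>k\<in>{0}. 0 ^ k / fact k * q k)"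
  by (rule suminf_finite) auto
 then show ?thesis by (simp add: F_def q_0)
qed

lemma F_pos: assumes "0 <= x" shows "0 < F x"
proof -
 have "0 < (\<Sum>k. x ^ k / fact k * q k)"
  using assms q_0 by (intro suminf_pos2[OF summable_q, of _ 0]) (auto simp: q_nonneg)
 then show ?thesis unfolding F_def by simp
qed

lemma F_antimono: assumes "0 <= x" "x <= y" shows "F y <= F x"
proof (rule DERIV_nonpos_imp_nonincreasing[OF assms(2)])
 show "\<exists>D. (F has_real_derivative D) (at t) & D <= 0" if "x <= t" "t <= y" for t
  using DERIV_F[of t] Z_nonneg[of t] that assms by auto
qed

lemma F_le_1: "0 <= x ==> F x <= 1"
 using F_antimono[of 0 x] F_0 by simp

text \<open>The derivative is \<open>- Z\<close> with values of \<open>Z\<close> in [0, 1]. The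
  constant 1 is what yields the factorial bound in \<open>picard\<close>.\<close>

lemma F_lipschitz: assumes "0 <= x" "0 <= y" shows "\<bar>F x - F y\<bar> <= \<bar>x - y\<bar>"
proof -
 have "\<bar>F x - F y\<bar> <= y - x" if x: "0 <= x" and xy: "x < y" for x y
 proof -
  obtain c where c: "x < c" "c < y" "F y - F x = (y - x) * (- Z c)"
   using MVT2[OF xy, of F "%x. - Z x"] DERIV_F by auto
  have "0 <= Z c" "Z c <= 1" using Z_nonneg Z_le_1 c x by auto
  then have "0 <= (y - x) * Z c" "(y - x) * Z c <= y - x"
   using xy mult_left_le[of "Z c" "y - x"] by simp_all
  moreover have "F x - F y = (y - x) * Z c" using c(3) by simp
  ultimately show ?thesis unfolding abs_le_iff by linarith
 qed
 from this[of x y] this[of y x] show ?thesis using assms by (cases x y rule: linorder_cases) auto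
qed

text \<open>From an index \<open>N\<close> on, \<open>q\<close> is below \<open>e / 2\<close>, so
  this part of the series contributes at most \<open>e / 2\<close> after multiplication by
  \<open>exp (- x)\<close>; the finitely many earlier terms are polynomials, which
  \<open>exp (- x)\<close> kills. It makes the total mass of \<open>f\<close> equal to 1.\<close>

lemma F_tendsto_0: "(F \<longlongrightarrow> 0) at_top"
proof (rule order_tendstoI)
 fix e :: real assume "e < 0"
 then show "\<forall>\<^sub>F x in at_top. e < F x"
  using F_pos by (intro eventually_at_top_linorderI[of 0]) (meson less_trans)
next
 fix e :: real assume e: "0 < e"
 then have "\<forall>\<^sub>F k in sequentially. q k < e / 2"
  using q_tendsto_0 by (intro order_tendstoD) auto
 then obtain N where N: "q N < e / 2" by (auto simp: eventually_sequentially)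
 have qN: "q k < e / 2" if "N <= k" for k
  using lift_Suc_antimono_le[of q, OF q_antimono that] N by simp
 have "((%x::real. \<Sum>k<N. exp (- x) * (x ^ k / fact k)) \<longlongrightarrow> (\<Sum>k<N. 0)) at_top"
 proof (rule tendsto_sum)
  fix k
  have "((%x::real. x ^ k / exp x / fact k) \<longlongrightarrow> 0 / fact k) at_top"
   by (intro tendsto_divide tendsto_power_div_exp_0 tendsto_const) simp
  then show "((%x::real. exp (- x) * (x ^ k / fact k)) \<longlongrightarrow> 0) at_top"
   by (simp add: exp_minus field_simps)
 qed
 then have "\<forall>\<^sub>F x in at_top. (\<Sum>k<N. exp (- x) * (x ^ k / fact k)) < e / 2"
  using e by (intro order_tendstoD(2)[where y="\<Sum>k<N. 0"]) (simp_all only: sum.neutral_const half_gt_zero)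
 then show "\<forall>\<^sub>F x in at_top. F x < e"
  using eventually_ge_at_top[of 0]
 proof eventually_elim
  case (elim x)
  let ?h = "%k. (if k < N then x ^ k / fact k else 0)"
  have sh: "summable ?h" by (rule summable_finite[of "{..<N}"]) auto
  have "(\<Sum>k. x ^ k / fact k * q k) <= (\<Sum>k. ?h k + e / 2 * (x ^ k / fact k))"
  proof (intro suminf_le summable_q summable_add sh summable_mult summable_exp')
   fix k
   have "0 <= x ^ k / fact k" using elim by simp
   then have 1: "x ^ k / fact k * q k <= x ^ k / fact k" and 2: "N <= k ==> x ^ k / fact k * q k <= x ^ k / fact k * (e / 2)"
    using q_le_1[of k] qN[of k] by (intro mult_left_le mult_left_mono; simp)+
   show "x ^ k / fact k * q k <= ?h k + e / 2 * (x ^ k / fact k)"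
   proof (cases "k < N")
    case True
    have "0 <= e / 2 * (x ^ k / fact k)" using e \<open>0 <= x ^ k / fact k\<close> by (intro mult_nonneg_nonneg) auto
    with True 1 show ?thesis by simp
   next
    case False
    with 2 show ?thesis by (simp add: mult.commute)
   qed
  qed
  also have "... = (\<Sum>k. ?h k) + e / 2 * exp x"
   unfolding exp_suminf[symmetric] suminf_mult[OF summable_exp', symmetric]
   by (rule suminf_add[symmetric]) (intro sh summable_mult summable_exp')+
  also have "(\<Sum>k. ?h k) = (\<Sum>k<N. x ^ k / fact k)"
   by (subst suminf_finite[of "{..<N}"]) auto
  finally have "F x <= exp (- x) * ((\<Sum>k<N. x ^ k / fact k) + e / 2 * exp x)"
   unfolding F_def by (intro mult_left_mono) auto
  also have "... = (\<Sum>k<N. exp (- x) * (x ^ k / fact k)) + e / 2 * (exp (- x) * exp x)"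
   unfolding distrib_left sum_distrib_left by (simp only: mult.left_commute)
  also have "exp (- x) * exp x = 1" by (simp add: exp_minus_inverse mult.commute)
  finally show ?case using elim by simp
 qed
qed

end

section \<open>The solution of the differential equation and its densities\<close>

locale rdcp_ode = degree_dist +
 fixes lam :: "real => real"
 assumes ode: "solves_rdcp_ode p lam"
begin

abbreviation "f \<equiv> sat_density p lam"

lemma lam_0 [simp]: "lam 0 = 0" and lam_nonneg: "0 <= t ==> 0 <= lam t"
 using ode by (auto simp: solves_rdcp_ode_def)

lemma lam_deriv: "0 <= t ==> (lam has_real_derivative F (lam t)) (at t within {0..})"
 using ode by (simp add: solves_rdcp_ode_def F_def)

lemma lam_deriv_at: "0 < t ==> (lam has_real_derivative F (lam t)) (at t)"
 using lam_deriv[of t] by (simp add: at_within_atLeast_0)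

lemma lam_continuous: "continuous_on {0..} lam"
 by (rule DERIV_continuous_on) (use lam_deriv in auto)

text \<open>A continuous extension of \<open>lam\<close> to the whole line: nothing is known about
  \<open>lam\<close> at negative arguments, and measurability has to be global.\<close>

definition "L t = lam (max 0 t)"

lemma continuous_L: "continuous_on A L"
proof -
 have "continuous_on A (lam \<circ> (%t. max 0 t))"
  by (intro continuous_on_compose continuous_intros continuous_on_subset[OF lam_continuous]) auto
 then show ?thesis by (simp add: L_def o_def cong: continuous_on_cong)
qed

lemma L_eq: "0 <= t ==> L t = lam t" and L_nonneg: "0 <= L t"
 by (auto simp: L_def lam_nonneg)

lemma measurable_L [measurable]: "L \<in> bmeas borel"
 by (intro borel_measurable_continuous_onI continuous_L)

lemma measurable_F [measurable]: "F \<in> bmeas borel"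
 by (intro borel_measurable_continuous_onI continuous_on_F)

lemma measurable_Z [measurable]: "Z \<in> bmeas borel"
 by (intro borel_measurable_continuous_onI continuous_at_imp_continuous_on) (simp add: isCont_Z)

lemma lam_less: assumes "0 <= s" "s < t" shows "lam s < lam t"
proof (rule DERIV_pos_imp_increasing_open[OF assms(2)])
 show "\<exists>y. (lam has_real_derivative y) (at x) & 0 < y" if "s < x" "x < t" for x
  using lam_deriv_at[of x] F_pos[OF lam_nonneg, of x] that assms by auto
 show "continuous_on {s..t} lam" using assms by (intro continuous_on_subset[OF lam_continuous]) auto
qed

lemma lam_mono: "0 <= s ==> s <= t ==> lam s <= lam t"
 using lam_less[of s t] by (cases "s = t") auto

lemma lam_pos: "0 < t ==> 0 < lam t"
 using lam_less[of 0 t] by simp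

lemma lam_le: assumes "0 <= t" shows "lam t <= t"
proof -
 have "0 - lam 0 <= t - lam t"
 proof (rule DERIV_nonneg_imp_increasing_open[OF assms])
  show "\<exists>y. ((%t. t - lam t) has_real_derivative y) (at x) & 0 <= y" if "0 < x" "x < t" for x
   using lam_deriv_at[of x] F_le_1[OF lam_nonneg, of x] that
   by (intro exI[of _ "1 - F (lam x)"]) (auto intro!: derivative_eq_intros)
  show "continuous_on {0..t} (%t. t - lam t)"
   by (intro continuous_intros continuous_on_subset[OF lam_continuous]) auto
 qed
 then show ?thesis by simp
qed

text \<open>If \<open>lam\<close> stayed below \<open>B\<close>, its derivative would stay above the
  positive number \<open>F (max 0 B)\<close>, forcing linear growth beyond \<open>B\<close>.\<close>

lemma lam_tendsto: "filterlim lam at_top at_top"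
proof (rule filterlim_at_top[THEN iffD2], rule allI)
 fix B :: real
 define c where "c = F (max 0 B)"
 have c: "0 < c" unfolding c_def by (intro F_pos) simp
 show "\<forall>\<^sub>F t in at_top. B <= lam t"
 proof (rule ccontr)
  assume *: "\<not> (\<forall>\<^sub>F t in at_top. B <= lam t)"
  have below: "lam t < B" if "0 <= t" for t
  proof (rule ccontr)
   assume "\<not> lam t < B"
   then have "\<forall>s\<ge>t. B <= lam s" using lam_mono[OF that] by force
   with * show False by (auto simp: eventually_at_top_linorder)
  qed
  have "0 <= lam t - c * t" if "0 <= t" for t
  proof -
   have "lam 0 - c * 0 <= lam t - c * t"
   proof (rule DERIV_nonneg_imp_increasing_open[OF that])
    show "\<exists>y. ((%t. lam t - c * t) has_real_derivative y) (at x) & 0 <= y" if "0 < x" "x < t" for x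
     using lam_deriv_at[of x] F_antimono[of "lam x" "max 0 B"] lam_nonneg[of x] below[of x] that
     by (intro exI[of _ "F (lam x) - c"]) (auto intro!: derivative_eq_intros simp: c_def)
    show "continuous_on {0..t} (%t. lam t - c * t)"
     by (intro continuous_intros continuous_on_subset[OF lam_continuous]) auto
   qed
   then show ?thesis by simp
  qed
  from this[of "max 0 (B / c)"] have "c * max 0 (B / c) <= lam (max 0 (B / c))" by simp
  moreover have "B <= c * max 0 (B / c)"
   using c by (cases "0 <= B") (auto simp: max_def field_simps)
  ultimately show False using below[of "max 0 (B / c)"] by simp
 qed
qed

lemma F_lam_tendsto: "((%t. F (lam t)) \<longlongrightarrow> 0) at_top"
 by (rule filterlim_compose[OF F_tendsto_0 lam_tendsto])

lemma suminf_zfun: "(\<Sum>k. zfun p lam t k) = Z (lam t)"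
proof -
 have "zfun p lam t k = exp (- lam t) * (lam t ^ k / fact k * p (Suc k))" for k
  by (simp add: zfun_def)
 then show ?thesis unfolding Z_def by (simp only: suminf_mult[OF summable_p])
qed

lemma f_eq: "f t = (if 0 < t then F (L t) * Z (L t) else 0)"
 using DERIV_imp_deriv[OF lam_deriv_at, of t] by (simp add: sat_density_def suminf_zfun L_eq)

lemma f_nonneg: "0 <= f t"
 unfolding f_eq using F_pos[OF L_nonneg] Z_nonneg[OF L_nonneg] by (simp add: less_imp_le)

lemma measurable_f [measurable]: "f \<in> bmeas borel"
 unfolding f_eq[abs_def] by measurable

text \<open>\<open>f\<close> is the derivative of \<open>- F (lam)\<close>, which tends to 0. So the
  survival function of the density \<open>f\<close> is \<open>F (lam)\<close>, the derivative of
  \<open>lam\<close> itself: this is the self-consistency on which the recursion rests.\<close>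

lemma nn_f_tail: assumes "0 <= t" shows "(\<integral>\<^sup>+x. ennreal (f x) * indicator {t..} x \<partial>lborel) = ennreal (F (lam t))"
proof -
 let ?g = "%x. F (L x) * Z (L x)"
 have g0: "0 <= ?g x" for x using F_pos[OF L_nonneg] Z_nonneg[OF L_nonneg] by (simp add: less_imp_le)
 have D: "((%t. - F (lam t)) has_real_derivative ?g x) (at x within {0..})" if "0 <= x" for x
  using DERIV_chain2[OF DERIV_F lam_deriv[OF that]] that
  by (auto intro!: derivative_eq_intros simp: L_eq)
 have "(\<integral>\<^sup>+x. ennreal (f x) * indicator {t..} x \<partial>lborel) =
   (\<integral>\<^sup>+x. ennreal (?g x) * indicator {t..t+1} x + ennreal (?g x) * indicator {t+1..} x \<partial>lborel)"
 \<comment> \<open>The interval up to \<open>t + 1\<close> is split off because the improper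
   fundamental theorem asks for two-sided derivatives also at the left end, which fails for
   \<open>t = 0\<close>.\<close>
 proof (rule nn_integral_cong_AE)
  show "AE x in lborel. ennreal (f x) * indicator {t..} x =
    ennreal (?g x) * indicator {t..t+1} x + ennreal (?g x) * indicator {t+1..} x"
   using AE_lborel_singleton[of 0] AE_lborel_singleton[of "t + 1"]
   by eventually_elim (use assms in \<open>auto simp: f_eq split: split_indicator\<close>)
 qed
 also have "... = (\<integral>\<^sup>+x. ennreal (?g x) * indicator {t..t+1} x \<partial>lborel) + (\<integral>\<^sup>+x. ennreal (?g x) * indicator {t+1..} x \<partial>lborel)"
  by (rule nn_integral_add) auto
 also have "(\<integral>\<^sup>+x. ennreal (?g x) * indicator {t..t+1} x \<partial>lborel) = ennreal (- F (lam (t + 1)) - (- F (lam t)))"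
  using assms by (intro nn_integral_FTC_within g0 DERIV_subset[OF D]) auto
 also have "(\<integral>\<^sup>+x. ennreal (?g x) * indicator {t+1..} x \<partial>lborel) = ennreal (- 0 - (- F (lam (t + 1))))"
 proof (intro nn_integral_FTC_atLeast g0)
  show "((%t. - F (lam t)) has_real_derivative ?g x) (at x)" if "t + 1 <= x" for x
   using D[of x] that assms by (simp add: at_within_atLeast_0)
  show "((%t. - F (lam t)) \<longlongrightarrow> - 0) at_top"
   by (intro tendsto_minus F_lam_tendsto)
 qed measurable
 finally show ?thesis
  using F_antimono[of "lam t" "lam (t + 1)"] lam_mono[of t "t + 1"] assms F_pos[of "lam (t + 1)"] lam_nonneg
  by (simp add: ennreal_plus[symmetric] less_imp_le del: ennreal_plus)
qed

lemma nn_F_lam: assumes "0 <= t"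
 shows "(\<integral>\<^sup>+x. ennreal (F (L x)) * indicator {0..t} x \<partial>lborel) = ennreal (lam t)"
proof -
 have "(\<integral>\<^sup>+x. ennreal (F (L x)) * indicator {0..t} x \<partial>lborel) = ennreal (lam t - lam 0)"
  using F_pos[OF lam_nonneg] assms
  by (intro nn_integral_FTC_within DERIV_subset[OF lam_deriv, THEN DERIV_cong]) (auto simp: L_eq less_imp_le)
 then show ?thesis by simp
qed

lemma nn_f: "(\<integral>\<^sup>+x. ennreal (f x) \<partial>lborel) = 1"
proof -
 have "(\<integral>\<^sup>+x. ennreal (f x) \<partial>lborel) = (\<integral>\<^sup>+x. ennreal (f x) * indicator {0..} x \<partial>lborel)"
  by (intro nn_integral_cong) (auto simp: f_eq split: split_indicator)
 then show ?thesis using nn_f_tail[of 0] by (simp add: F_0)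
qed

lemma prob_space_f: "prob_space (density lborel (%x. ennreal (f x)))"
 by (rule prob_spaceI) (simp add: emeasure_density nn_f)

lemma LBINT_f_tail: assumes "0 <= t" shows "(LBINT u:{t..}. f u) = F (lam t)"
proof -
 have "(LBINT u:{t..}. f u) = enn2real (\<integral>\<^sup>+u. ennreal (indicator {t..} u *\<^sub>R f u) \<partial>lborel)"
  unfolding set_lebesgue_integral_def
  by (intro integral_eq_nn_integral) (auto simp: f_nonneg)
 also have "(\<integral>\<^sup>+u. ennreal (indicator {t..} u *\<^sub>R f u) \<partial>lborel) = (\<integral>\<^sup>+x. ennreal (f x) * indicator {t..} x \<partial>lborel)"
  by (intro nn_integral_cong) (auto split: split_indicator)
 also have "... = ennreal (F (lam t))" by (rule nn_f_tail[OF assms])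
 finally show ?thesis using F_pos[OF lam_nonneg[OF assms]] by simp
qed

lemma tail_density_eq: "0 <= t ==> tail_density p lam t s = f s / F (lam t) * indicator {t<..} s"
 by (simp add: tail_density_def LBINT_f_tail)

lemma pair_density_alt:
 "pair_density p lam t = (%x. f (snd x) / lam t * (if 0 <= fst x & fst x <= t & fst x <= snd x then 1 else 0))"
 by (auto simp: pair_density_def fun_eq_iff split: split_indicator)

lemma measurable_pair_density [measurable]: "pair_density p lam t \<in> bmeas borel"
 unfolding pair_density_alt borel_prod[symmetric] by measurable

text \<open>Integrating out the type leaves the label density \<open>F (lam x) / lam t\<close> on
  [0, t], and \<open>F (lam)\<close> integrates to \<open>lam\<close>.\<close>

lemma nn_pair_density: assumes "0 < t" shows "(\<integral>\<^sup>+x. ennreal (pair_density p lam t x) \<partial>lborel) = 1"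
proof -
 have lp: "0 < lam t" by (rule lam_pos[OF assms])
 have "(\<integral>\<^sup>+x. ennreal (pair_density p lam t x) \<partial>lborel)
   = (\<integral>\<^sup>+x. \<integral>\<^sup>+s. ennreal (pair_density p lam t (x, s)) \<partial>lborel \<partial>lborel)"
  unfolding lborel_prod[symmetric] by (subst lborel.nn_integral_fst[symmetric]) (auto simp: lborel_prod)
 also have "... = (\<integral>\<^sup>+x. ennreal (1 / lam t) * (ennreal (F (L x)) * indicator {0..t} x) \<partial>lborel)"
 proof (intro nn_integral_cong)
  fix x
  have "(\<integral>\<^sup>+s. ennreal (pair_density p lam t (x, s)) \<partial>lborel)
   = (\<integral>\<^sup>+s. ennreal (1 / lam t) * indicator {0..t} x * (ennreal (f s) * indicator {x..} s) \<partial>lborel)"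
   using lp by (intro nn_integral_cong)
    (auto simp: pair_density_alt ennreal_mult[symmetric] f_nonneg split: split_indicator)
  also have "... = ennreal (1 / lam t) * indicator {0..t} x * (\<integral>\<^sup>+s. ennreal (f s) * indicator {x..} s \<partial>lborel)"
   by (intro nn_integral_cmult) measurable
  also have "... = ennreal (1 / lam t) * (ennreal (F (L x)) * indicator {0..t} x)"
   using nn_f_tail[of x] by (auto simp: L_eq split: split_indicator)
  finally show "(\<integral>\<^sup>+s. ennreal (pair_density p lam t (x, s)) \<partial>lborel)
   = ennreal (1 / lam t) * (ennreal (F (L x)) * indicator {0..t} x)" .
 qed
 also have "... = ennreal (1 / lam t) * ennreal (lam t)"
  using assms by (subst nn_integral_cmult) (auto simp: nn_F_lam)
 also have "... = 1" using lp by (simp add: ennreal_mult[symmetric])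
 finally show ?thesis .
qed

lemma degree_prob_eq: "degree_prob p lam t k = zfun p lam t (k - 1) / Z (lam t)"
 by (simp add: degree_prob_def suminf_zfun)

lemma degree_prob_nonneg: assumes "0 <= t" "1 <= k" shows "0 <= degree_prob p lam t k"
 using assms lam_nonneg[of t] p_nonneg[of k] Z_nonneg[of "lam t"] by (simp add: degree_prob_eq zfun_def)

lemma degree_prob_sums: assumes "0 < t" shows "(%k. degree_prob p lam t (Suc k)) sums 1"
proof -
 have "(%k. exp (- lam t) * (lam t ^ k / fact k * p (Suc k)) / Z (lam t)) sums (Z (lam t) / Z (lam t))"
  unfolding Z_def by (intro sums_divide sums_mult summable_sums summable_p)
 then show ?thesis using Z_pos[OF lam_pos[OF assms]] by (simp add: degree_prob_eq zfun_def mult.assoc)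
qed

text \<open>Here \<open>u n\<close> is the integral of \<open>v n\<close>, and
  \<open>v (Suc n)\<close> is \<open>F\<close> of \<open>u n\<close>: Picard iteration in
  differential form, with \<open>v 0 = 1\<close> as the survival function of a time that is always
  infinite. The Lipschitz constant 1 gives the error bound \<open>t ^ Suc n / fact (Suc n)\<close>
  by induction.\<close>

lemma picard:
 fixes u v :: "nat => real => real"
 assumes u0: "\<And>n. u n 0 = 0" and v0: "\<And>t. 0 <= t ==> v 0 t = 1"
  and D: "\<And>n t. 0 <= t ==> (u n has_real_derivative v n t) (at t within {0..})"
  and nn: "\<And>n t. 0 <= t ==> 0 <= u n t"
  and v: "\<And>n t. 0 <= t ==> v (Suc n) t = F (u n t)"
  and t: "0 <= t"
 shows "(%n. v n t) \<longlonglongrightarrow> F (lam t)"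
proof -
 have cont: "continuous_on {0..} (u n)" for n
  by (rule DERIV_continuous_on) (use D in auto)
 have Dat: "(u n has_real_derivative v n t) (at t)" if "0 < t" for n t
  using D[of t n] that by (simp add: at_within_atLeast_0)
 have bound: "0 <= t ==> \<bar>u n t - lam t\<bar> <= t ^ Suc n / fact (Suc n)" for n t
 proof (induction n arbitrary: t)
  case 0
  have "u 0 0 - 0 = u 0 t - t"
  proof (cases "t = 0")
   case False
   show ?thesis
   proof (rule DERIV_isconst_end[symmetric, where f="%t. u 0 t - t"])
    show "0 < t" using 0 False by simp
    show "continuous_on {0..t} (%t. u 0 t - t)"
     by (intro continuous_intros continuous_on_subset[OF cont]) auto
    show "((%t. u 0 t - t) has_real_derivative 0) (at x)" if "0 < x" "x < t" for x
     using Dat[of x 0] v0[of x] that by (auto intro!: derivative_eq_intros)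
   qed
  qed (simp add: u0)
  then have "u 0 t = t" by (simp add: u0)
  then show ?case using lam_le[OF 0] lam_nonneg[OF 0] by simp
 next
  case (Suc n)
  \<comment> \<open>\<open>s\<close> stands for either sign; the two instances 1 and -1 together
    give the bound on the absolute value, each by monotonicity of \<open>?h\<close>.\<close>
  have *: "0 <= s * (u (Suc n) t - lam t) + t ^ Suc (Suc n) / fact (Suc (Suc n))" if s: "\<bar>s\<bar> = 1" for s
  proof -
   let ?h = "%t. s * (u (Suc n) t - lam t) + t ^ Suc (Suc n) / fact (Suc (Suc n))"
   have "?h 0 <= ?h t"
   proof (rule DERIV_nonneg_imp_increasing_open[OF Suc.prems])
    show "continuous_on {0..t} ?h"
     by (intro continuous_intros continuous_on_subset[OF cont] continuous_on_subset[OF lam_continuous]) auto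
    fix x assume x: "0 < x" "x < t"
    have "(?h has_real_derivative s * (v (Suc n) x - F (lam x)) + real (Suc (Suc n)) * x ^ Suc n / fact (Suc (Suc n))) (at x)"
     using x by (auto intro!: derivative_eq_intros Dat lam_deriv_at simp del: power_Suc of_nat_Suc fact_Suc)
    moreover have "real (Suc (Suc n)) * x ^ Suc n / fact (Suc (Suc n)) = x ^ Suc n / fact (Suc n)"
     unfolding fact_Suc[of "Suc n"] of_nat_mult by (simp del: of_nat_Suc fact_Suc)
    moreover have "\<bar>s * (v (Suc n) x - F (lam x))\<bar> <= x ^ Suc n / fact (Suc n)"
    proof -
     have "\<bar>s * (v (Suc n) x - F (lam x))\<bar> = \<bar>F (u n x) - F (lam x)\<bar>"
      using s v[of x n] x by (simp add: abs_mult)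
     also have "... <= \<bar>u n x - lam x\<bar>" using x by (intro F_lipschitz nn lam_nonneg) auto
     also have "... <= x ^ Suc n / fact (Suc n)" using Suc.IH[of x] x by simp
     finally show ?thesis .
    qed
    ultimately show "\<exists>y. (?h has_real_derivative y) (at x) & 0 <= y" by (intro exI conjI) auto
   qed
   then show ?thesis by (simp add: u0)
  qed
  from *[of 1] *[of "-1"] show ?case unfolding abs_le_iff by (simp del: fact_Suc power_Suc)
 qed
 have "(%n. u n t - lam t) \<longlonglongrightarrow> 0"
 proof (rule Lim_null_comparison)
  show "\<forall>\<^sub>F n in sequentially. norm (u n t - lam t) <= t ^ Suc n / fact (Suc n)"
   using bound[OF t] by (intro always_eventually allI) (simp del: fact_Suc power_Suc)
  show "(%n. t ^ Suc n / fact (Suc n)) \<longlonglongrightarrow> 0"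
   by (rule LIMSEQ_Suc[OF summable_LIMSEQ_zero[OF summable_exp']])
 qed
 then have "(%n. u n t) \<longlonglongrightarrow> lam t" by (simp add: LIM_zero_iff)
 then have "(%n. F (u n t)) \<longlonglongrightarrow> F (lam t)" by (rule isCont_tendsto_compose[OF isCont_F])
 then have "(%n. v (Suc n) t) \<longlonglongrightarrow> F (lam t)" using v[OF t] by simp
 then show ?thesis by (rule LIMSEQ_imp_Suc)
qed

end

section \<open>The branching process\<close>

lemma measurable_fst_borel [measurable]: "fst \<in> bmeas (borel :: (real \<times> real) measure)"
 and measurable_snd_borel [measurable]: "snd \<in> bmeas (borel :: (real \<times> real) measure)"
 by (intro borel_measurable_continuous_onI continuous_intros)+

lemma measurable_component_pair:
 assumes "j \<in> I"
 shows "(%c. fst (c j)) \<in> bmeas (\<Pi>\<^sub>M j\<in>I. (borel :: (real \<times> real) measure))"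
  and "(%c. snd (c j)) \<in> bmeas (\<Pi>\<^sub>M j\<in>I. (borel :: (real \<times> real) measure))"
 using measurable_component_singleton[OF assms, of "%_. borel :: (real \<times> real) measure"]
 by (auto intro: measurable_compose[OF _ measurable_fst_borel] measurable_compose[OF _ measurable_snd_borel])

text \<open>Sorting is handled entry by entry, on lists of measurable functions, so that no
  measurable structure on lists enters.\<close>

lemma measurable_insort_nth:
 fixes hs :: "('a => real \<times> real) list"
 assumes [measurable]: "g \<in> bmeas N"
  and hs: "\<And>h. h \<in> set hs ==> h \<in> bmeas N" and j: "j <= length hs"
 shows "(%x. insort_key fst (g x) (map (%h. h x) hs) ! j) \<in> bmeas N"
 using hs j
proof (induction hs arbitrary: j)
 case (Cons h hs)
 have [measurable]: "h \<in> bmeas N" using Cons.prems by simp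
 have 1: "(%x. (g x # h x # map (%h. h x) hs) ! j) \<in> bmeas N"
 proof (cases j)
  case (Suc i)
  then show ?thesis using Cons.prems by (cases i) auto
 qed simp
 have 2: "(%x. (h x # insort_key fst (g x) (map (%h. h x) hs)) ! j) \<in> bmeas N"
  using Cons by (cases j) auto
 have "(%x. insort_key fst (g x) (map (%h. h x) (h # hs)) ! j) =
   (%x. if fst (g x) <= fst (h x) then (g x # h x # map (%h. h x) hs) ! j
      else (h x # insort_key fst (g x) (map (%h. h x) hs)) ! j)"
  by (simp add: fun_eq_iff)
 also have "... \<in> bmeas N"
 proof (rule measurable_If[OF 1 2])
  have "(%x. fst (g x)) \<in> bmeas N" "(%x. fst (h x)) \<in> bmeas N" by measurable
  then show "{x \<in> space N. fst (g x) <= fst (h x)} \<in> sets N" by measurable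
 qed
 finally show ?case .
qed simp

lemma measurable_sort_nth:
 fixes gs :: "('a => real \<times> real) list"
 assumes "\<And>g. g \<in> set gs ==> g \<in> bmeas N" and "j < length gs"
 shows "(%x. sort_key fst (map (%g. g x) gs) ! j) \<in> bmeas N"
 using assms
proof (induction gs arbitrary: j)
 case (Cons g gs)
 define hs where "hs = map (%i x. sort_key fst (map (%g. g x) gs) ! i) [0..<length gs]"
 have "map (%h. h x) hs = sort_key fst (map (%g. g x) gs)" for x
  by (rule nth_equalityI) (auto simp: hs_def)
 then have "(%x. sort_key fst (map (%g. g x) (g # gs)) ! j) =
   (%x. insort_key fst (g x) (map (%h. h x) hs) ! j)"
  by simp
 moreover have "(%x. insort_key fst (g x) (map (%h. h x) hs) ! j) \<in> bmeas N"
  using Cons by (intro measurable_insort_nth) (auto simp: hs_def)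
 ultimately show ?case by simp
qed simp

lemma measurable_order_pairs [measurable]:
 "order_pairs m \<in> measurable (pair_seqs m) (pair_seqs m)"
 unfolding order_pairs_def
proof (rule measurable_restrict)
 fix j assume j: "j \<in> {..<m}"
 have "(%x. sort_key fst (map (%g. g x) (map (%i x. x i) [0..<m])) ! j)
   \<in> bmeas (pair_seqs m)"
  using j by (intro measurable_sort_nth) auto
 then show "(%x. sort_key fst (map x [0..<m]) ! j)
   \<in> bmeas (pair_seqs m)"
  by (simp add: comp_def)
qed

lemma order_pairs_in:
 assumes "j < m" shows "\<exists>i<m. order_pairs m x j = x i"
proof -
 have "sort_key fst (map x [0..<m]) ! j \<in> set (sort_key fst (map x [0..<m]))"
  using assms by (intro nth_mem) simp
 then show ?thesis using assms by (auto simp: order_pairs_def)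
qed

section \<open>The laws of the children as measures and as kernels\<close>

context rdcp_ode begin

definition pair_law :: "real => (real \<times> real) measure" where
 "pair_law t = density lborel (%x. ennreal (pair_density p lam t x))"

definition tail_law :: "real => real measure" where
 "tail_law t = density lborel (%s. ennreal (tail_density p lam t s))"

lemma sets_pair_law [simp, measurable_cong]: "sets (pair_law t) = sets borel"
 and space_pair_law [simp]: "space (pair_law t) = UNIV"
 and sets_tail_law [simp, measurable_cong]: "sets (tail_law t) = sets borel"
 and space_tail_law [simp]: "space (tail_law t) = UNIV"
 by (simp_all add: pair_law_def tail_law_def)

lemma prob_space_pair_law: "0 < t ==> prob_space (pair_law t)"
 unfolding pair_law_def by (rule prob_spaceI) (simp add: emeasure_density nn_pair_density)

lemma measurable_tail_density: "0 <= t ==> tail_density p lam t \<in> bmeas borel"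
 by (subst measurable_cong[OF tail_density_eq]) auto

lemma nn_tail: assumes "0 <= t" shows "(\<integral>\<^sup>+s. ennreal (tail_density p lam t s) \<partial>lborel) = 1"
proof -
 have Fp: "0 < F (lam t)" using F_pos lam_nonneg assms by auto
 have "(\<integral>\<^sup>+s. ennreal (tail_density p lam t s) \<partial>lborel) =
   (\<integral>\<^sup>+s. ennreal (1 / F (lam t)) * (ennreal (f s) * indicator {t..} s) \<partial>lborel)"
  using AE_lborel_singleton[of t]
  by (intro nn_integral_cong_AE, eventually_elim)
   (use Fp assms in \<open>auto simp: tail_density_eq ennreal_mult[symmetric] f_nonneg split: split_indicator\<close>)
 also have "... = ennreal (1 / F (lam t)) * ennreal (F (lam t))"
  using assms by (subst nn_integral_cmult) (auto simp: nn_f_tail)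
 also have "... = 1" using Fp by (simp add: ennreal_mult[symmetric])
 finally show ?thesis .
qed

lemma prob_space_tail_law: "0 <= t ==> prob_space (tail_law t)"
 unfolding tail_law_def
 using measurable_tail_density[of t] by (intro prob_spaceI) (simp add: emeasure_density nn_tail)

definition iid_law :: "real => nat => (nat => real \<times> real) measure" where
 "iid_law t m = (\<Pi>\<^sub>M j\<in>{..<m}. pair_law t)"

lemma sets_iid_law [simp, measurable_cong]: "sets (iid_law t m) = sets (pair_seqs m)"
 unfolding iid_law_def by (rule sets_PiM_cong) auto

lemma prob_space_iid_law: "0 < t ==> prob_space (iid_law t m)"
 unfolding iid_law_def by (intro prob_space_PiM prob_space_pair_law)

lemma measurable_root_children [measurable]:
 assumes "1 <= k"
 shows "(%(s, x). (order_pairs (k - 1) x)(k - 1 := (t, s)))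
  \<in> measurable (borel \<Otimes>\<^sub>M (pair_seqs (k - 1))) (pair_seqs k)"
proof -
 have e: "{..<k} = insert (k - 1) {..<k - 1}" using assms by auto
 show ?thesis
  unfolding e borel_prod[symmetric] split_beta'
  by (intro measurable_fun_upd[where J="{..<k - 1}"] measurable_Pair measurable_const
    measurable_compose[OF measurable_snd measurable_order_pairs, unfolded borel_prod[symmetric]]) auto
qed

lemma children_law_root:
 "children_law p lam [] t k = distr (tail_law t \<Otimes>\<^sub>M iid_law t (k - 1)) (pair_seqs k)
   (%(s, x). (order_pairs (k - 1) x)(k - 1 := (t, s)))"
 by (simp add: children_law_def tail_law_def iid_law_def pair_law_def Let_def)

lemma children_law_nonroot:
 "v ~= [] ==> children_law p lam v t k = distr (iid_law t (k - 1)) (pair_seqs (k - 1)) (order_pairs (k - 1))"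
 by (simp add: children_law_def iid_law_def pair_law_def Let_def)

lemma sets_children_law: "sets (children_law p lam v t k) = sets (pair_seqs (num_children v k))"
 by (cases "v = []") (simp_all add: children_law_root children_law_nonroot num_children_def)

lemma prob_space_children_law:
 assumes "0 < t" "1 <= k" shows "prob_space (children_law p lam v t k)"
proof (cases "v = []")
 case True
 interpret A: prob_space "tail_law t" using assms by (intro prob_space_tail_law) simp
 interpret B: prob_space "iid_law t (k - 1)" by (rule prob_space_iid_law[OF assms(1)])
 interpret pair_prob_space "tail_law t" "iid_law t (k - 1)" ..
 show ?thesis unfolding True children_law_root
  using measurable_root_children[OF assms(2), of t] by (intro prob_space_distr) simp
next
 case False
 interpret B: prob_space "iid_law t (k - 1)" by (rule prob_space_iid_law[OF assms(1)])
 show ?thesis unfolding children_law_nonroot[OF False]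
  by (intro B.prob_space_distr) simp
qed

lemma AE_iid_law_pos: assumes "0 < t" shows "AE x in iid_law t m. \<forall>i<m. 0 < snd (x i)"
proof -
 have "AE x in pair_law t. 0 < snd x"
  unfolding pair_law_def
  by (subst AE_density) (auto simp: pair_density_alt f_eq split: if_splits)
 then have "AE x in iid_law t m. 0 < snd (x i)" if "i \<in> {..<m}" for i
  unfolding iid_law_def using that prob_space_pair_law[OF assms]
  by (intro AE_PiM_component[where P="%x. 0 < snd x"]) auto
 then have "AE x in iid_law t m. \<forall>i\<in>{..<m}. 0 < snd (x i)"
  by (intro AE_finite_allI) auto
 then show ?thesis by (simp only: Ball_def lessThan_iff)
qed

lemma AE_tail_law_pos: assumes "0 < t" shows "AE s in tail_law t. 0 < s"
 unfolding tail_law_def using assms measurable_tail_density[of t]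
 by (subst AE_density) (auto simp: tail_density_eq split: split_indicator)

text \<open>Serves to propagate positivity of the types down the tree; the laws of the children are
  probability measures for positive types.\<close>

lemma children_law_pos:
 assumes t: "0 < t" and k: "1 <= k" and j: "j < num_children v k"
 shows "emeasure (children_law p lam v t k) {c \<in> space (pair_seqs (num_children v k)). \<not> 0 < snd (c j)} = 0"
proof -
 let ?S = "\<Pi>\<^sub>M j\<in>{..<num_children v k}. (borel :: (real \<times> real) measure)"
 have [measurable]: "(%c. snd (c j)) \<in> bmeas ?S"
  using j by (intro measurable_component_pair) auto
 have meas: "{c \<in> space ?S. \<not> 0 < snd (c j)} \<in> sets ?S" and measp: "{c \<in> space ?S. 0 < snd (c j)} \<in> sets ?S"
  by measurable
 have "AE c in children_law p lam v t k. 0 < snd (c j)"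
 proof (cases "v = []")
  case True
  interpret A: prob_space "tail_law t" using t by (intro prob_space_tail_law) simp
  interpret B: prob_space "iid_law t (k - 1)" by (rule prob_space_iid_law[OF t])
  interpret pair_prob_space "tail_law t" "iid_law t (k - 1)" ..
  have "AE x in tail_law t \<Otimes>\<^sub>M iid_law t (k - 1). 0 < fst x & (\<forall>i<k - 1. 0 < snd (snd x i))"
  proof (rule AE_pair_measure)
   show "AE x in tail_law t. AE y in iid_law t (k - 1). 0 < fst (x, y) & (\<forall>i<k - 1. 0 < snd (snd (x, y) i))"
    using AE_tail_law_pos[OF t] by eventually_elim (use AE_iid_law_pos[OF t, of "k - 1"] in auto)
   have [measurable]: "(%x. snd (snd x i)) \<in> bmeas (tail_law t \<Otimes>\<^sub>M iid_law t (k - 1))" if "i < k - 1" for i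
    using that by (intro measurable_compose[OF measurable_snd]
      measurable_component_pair(2)[THEN measurable_cong_sets[OF sets_iid_law refl, THEN equalityD2, THEN subsetD]]) auto
   have "Measurable.pred (tail_law t \<Otimes>\<^sub>M iid_law t (k - 1)) (%x. \<forall>i\<in>{..<k - 1}. 0 < snd (snd x i))"
    by (intro pred_intros_finite) (auto intro!: borel_measurable_less)
   moreover have "Measurable.pred (tail_law t \<Otimes>\<^sub>M iid_law t (k - 1)) (%x. 0 < fst x)" by measurable
   ultimately have "Measurable.pred (tail_law t \<Otimes>\<^sub>M iid_law t (k - 1))
     (%x. 0 < fst x & (\<forall>i\<in>{..<k - 1}. 0 < snd (snd x i)))"
    by (intro pred_intros_logic)
   then show "{x \<in> space (tail_law t \<Otimes>\<^sub>M iid_law t (k - 1)). 0 < fst x & (\<forall>i<k - 1. 0 < snd (snd x i))}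
    \<in> sets (tail_law t \<Otimes>\<^sub>M iid_law t (k - 1))"
    by (simp only: pred_def Ball_def lessThan_iff)
  qed
  then have "AE x in tail_law t \<Otimes>\<^sub>M iid_law t (k - 1). 0 < snd ((case x of (s, x) => (order_pairs (k - 1) x)(k - 1 := (t, s))) j)"
  proof eventually_elim
   case (elim x)
   show ?case
   proof (cases "j = k - 1")
    case False
    then have "j < k - 1" using j True by (simp add: num_children_def)
    then obtain i where "i < k - 1" "order_pairs (k - 1) (snd x) j = snd x i" using order_pairs_in by blast
    then show ?thesis using elim False by (simp add: split_beta)
   qed (use elim in \<open>simp add: split_beta\<close>)
  qed
  then show ?thesis
   unfolding True children_law_root using measurable_root_children[OF k, of t] measp True
   by (subst AE_distr_iff) (auto simp: num_children_def)
 next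
  case False
  have "AE x in iid_law t (k - 1). 0 < snd (order_pairs (k - 1) x j)"
   using AE_iid_law_pos[OF t, of "k - 1"]
  proof eventually_elim
   case (elim x)
   have "j < k - 1" using j False by (simp add: num_children_def)
   then obtain i where "i < k - 1" "order_pairs (k - 1) x j = x i" using order_pairs_in by blast
   then show ?case using elim by simp
  qed
  then show ?thesis
   unfolding children_law_nonroot[OF False] using measp False
   by (subst AE_distr_iff) (auto simp: num_children_def)
 qed
 then show ?thesis
  by (subst (asm) AE_iff_measurable[OF _ refl])
   (use meas in \<open>auto simp: sets_children_law sets_eq_imp_space_eq[OF sets_children_law]\<close>)
qed

end

context rdcp_ode begin

text \<open>\<open>lam t\<close> is a denominator and vanishes at 0, so kernels in the type are
  considered on the open half-line.\<close>

abbreviation "pos_borel \<equiv> restrict_space borel {0::real<..}"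

text \<open>Rectangles generate the product algebra, and the mass of a rectangle is a finite product
  of integrals depending measurably on \<open>t\<close>. Replacing \<open>lam\<close> by
  \<open>L\<close> makes these integrals measurable on the whole line.\<close>

lemma iid_law_kernel:
 "(%t. iid_law t m) \<in> measurable pos_borel (subprob_algebra (pair_seqs m))"
proof (rule measurable_prob_algebraD, rule measurable_prob_algebra_generated[OF sets_PiM Int_stable_prod_algebra prod_algebra_sets_into_space])
 fix t assume t: "t \<in> space pos_borel"
 then show "prob_space (iid_law t m)" by (intro prob_space_iid_law) (simp add: space_restrict_space)
 show "sets (iid_law t m) = sets (pair_seqs m)" by simp
next
 fix A :: "(nat => real \<times> real) set" assume "A \<in> prod_algebra {..<m} (%_. borel)"
 then obtain X where A: "A = (\<Pi>\<^sub>E j\<in>{..<m}. X j)" and X: "\<And>j. j < m ==> X j \<in> sets borel"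
  by (auto simp: prod_algebra_eq_finite)
 have "emeasure (iid_law t m) A = (\<Prod>j<m. \<integral>\<^sup>+x. ennreal (f (snd x) / L t * (if 0 <= fst x & fst x <= t & fst x <= snd x then 1 else 0)) * indicator (X j) x \<partial>lborel)"
  if "t \<in> space pos_borel" for t
 proof -
  have t: "0 < t" using that by (simp add: space_restrict_space)
  interpret product_sigma_finite "%_. pair_law t"
   by (intro product_sigma_finite.intro prob_space_imp_sigma_finite prob_space_pair_law t)
  have "emeasure (iid_law t m) A = (\<Prod>j<m. emeasure (pair_law t) (X j))"
   unfolding A iid_law_def by (rule emeasure_PiM) (auto simp: X)
  also have "... = (\<Prod>j<m. \<integral>\<^sup>+x. ennreal (f (snd x) / L t * (if 0 <= fst x & fst x <= t & fst x <= snd x then 1 else 0)) * indicator (X j) x \<partial>lborel)"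
   using t X by (intro prod.cong refl) (simp add: pair_law_def emeasure_density pair_density_alt L_eq)
  finally show ?thesis .
 qed
 moreover have "(%t. \<Prod>j<m. \<integral>\<^sup>+x. ennreal (f (snd x) / L t * (if 0 <= fst x & fst x <= t & fst x <= snd x then 1 else 0)) * indicator (X j) x \<partial>lborel) \<in> bmeas pos_borel"
 proof (intro borel_measurable_prod_ennreal measurable_restrict_space1)
  fix j assume "j \<in> {..<m}"
  then have [measurable]: "X j \<in> sets (borel \<Otimes>\<^sub>M borel)" unfolding borel_prod using X by simp
  show "(%t. \<integral>\<^sup>+x. ennreal (f (snd x) / L t * (if 0 <= fst x & fst x <= t & fst x <= snd x then 1 else 0)) * indicator (X j) x \<partial>lborel) \<in> bmeas borel"
   unfolding lborel_prod[symmetric] by measurable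
 qed
 ultimately show "(%t. emeasure (iid_law t m) A) \<in> bmeas pos_borel"
  by (rule measurable_cong[THEN iffD2])
qed

lemma emeasure_children_nonroot:
 assumes "v ~= []" "B \<in> sets (pair_seqs (k - 1))"
 shows "emeasure (children_law p lam v t k) B = (\<integral>\<^sup>+x. indicator B (order_pairs (k - 1) x) \<partial>iid_law t (k - 1))"
proof -
 have "emeasure (children_law p lam v t k) B = (\<integral>\<^sup>+x. indicator B x \<partial>children_law p lam v t k)"
  using assms by (simp add: children_law_nonroot)
 also have "... = (\<integral>\<^sup>+x. indicator B (order_pairs (k - 1) x) \<partial>iid_law t (k - 1))"
  unfolding children_law_nonroot[OF assms(1)] using assms by (intro nn_integral_distr) auto
 finally show ?thesis .
qed

lemma emeasure_children_root:
 assumes t: "0 < t" and k: "1 <= k" and B: "B \<in> sets (pair_seqs k)"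
 shows "emeasure (children_law p lam [] t k) B =
  (\<integral>\<^sup>+s. ennreal (tail_density p lam t s) *
    (\<integral>\<^sup>+x. indicator B ((order_pairs (k - 1) x)(k - 1 := (t, s))) \<partial>iid_law t (k - 1)) \<partial>lborel)"
proof -
 let ?g = "%(s, x). (order_pairs (k - 1) x)(k - 1 := (t, s))"
 interpret A: prob_space "tail_law t" using t by (intro prob_space_tail_law) simp
 interpret I: prob_space "iid_law t (k - 1)" by (rule prob_space_iid_law[OF t])
 interpret pair_prob_space "tail_law t" "iid_law t (k - 1)" ..
 have g: "?g \<in> measurable (tail_law t \<Otimes>\<^sub>M iid_law t (k - 1)) (pair_seqs k)"
  using measurable_root_children[OF k, of t] by simp
 have gB: "(%x. indicator B (?g x) :: ennreal) \<in> bmeas (tail_law t \<Otimes>\<^sub>M iid_law t (k - 1))"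
  using g B by measurable
 have "emeasure (children_law p lam [] t k) B = (\<integral>\<^sup>+x. indicator B x \<partial>children_law p lam [] t k)"
  using B by (simp add: children_law_root)
 also have "... = (\<integral>\<^sup>+x. indicator B (?g x) \<partial>(tail_law t \<Otimes>\<^sub>M iid_law t (k - 1)))"
  unfolding children_law_root using B by (intro nn_integral_distr g) simp
 also have "... = (\<integral>\<^sup>+s. (\<integral>\<^sup>+x. indicator B (?g (s, x)) \<partial>iid_law t (k - 1)) \<partial>tail_law t)"
  by (rule I.nn_integral_fst[symmetric, OF gB])
 also have "... = (\<integral>\<^sup>+s. ennreal (tail_density p lam t s) * (\<integral>\<^sup>+x. indicator B (?g (s, x)) \<partial>iid_law t (k - 1)) \<partial>lborel)"
 proof -
  have "(%s. \<integral>\<^sup>+x. indicator B (?g (s, x)) \<partial>iid_law t (k - 1)) \<in> bmeas (tail_law t)"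
   by (rule I.borel_measurable_nn_integral_fst[OF gB])
  then show ?thesis unfolding tail_law_def using measurable_tail_density[of t] t
   by (subst nn_integral_density) auto
 qed
 finally show ?thesis by simp
qed

lemma children_law_kernel:
 assumes k: "1 <= k" and B: "B \<in> sets (pair_seqs (num_children v k))"
 shows "(%t. emeasure (children_law p lam v t k) B) \<in> bmeas pos_borel"
proof (cases "v = []")
 case False
 then have "emeasure (children_law p lam v t k) B = (\<integral>\<^sup>+x. indicator B (order_pairs (k - 1) x) \<partial>iid_law t (k - 1))" for t
  using B by (intro emeasure_children_nonroot) (auto simp: num_children_def)
 moreover have "(%t. \<integral>\<^sup>+x. indicator B (order_pairs (k - 1) x) \<partial>iid_law t (k - 1)) \<in> bmeas pos_borel"
 proof (rule nn_integral_measurable_subprob_algebra2[OF _ iid_law_kernel])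
  have [measurable]: "B \<in> sets (pair_seqs (k - 1))" using B False by (simp add: num_children_def)
  show "(%(t, x). indicator B (order_pairs (k - 1) x) :: ennreal) \<in> bmeas (pos_borel \<Otimes>\<^sub>M (pair_seqs (k - 1)))"
   by measurable
 qed
 ultimately show ?thesis by simp
next
 case True
 then have B': "B \<in> sets (pair_seqs k)" using B by (simp add: num_children_def)
 let ?P = "\<Pi>\<^sub>M j\<in>{..<k - 1}. (borel :: (real \<times> real) measure)"
 have e: "{..<k} = insert (k - 1) {..<k - 1}" using k by auto
 have upd: "(%((t, s), x). (order_pairs (k - 1) x)(k - 1 := (t, s))) \<in> measurable ((pos_borel \<Otimes>\<^sub>M lborel) \<Otimes>\<^sub>M ?P) (pair_seqs k)"
 proof -
  have [measurable]: "id \<in> measurable pos_borel borel"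
   by (simp add: measurable_restrict_space1)
  have 1: "(%x. (id (fst (fst x)), snd (fst x))) \<in> measurable ((pos_borel \<Otimes>\<^sub>M lborel) \<Otimes>\<^sub>M ?P) (borel \<Otimes>\<^sub>M borel)" by measurable
  have 2: "(%x. order_pairs (k - 1) (snd x)) \<in> measurable ((pos_borel \<Otimes>\<^sub>M lborel) \<Otimes>\<^sub>M ?P) ?P" by measurable
  show ?thesis unfolding e split_beta' using 1 2
   by (intro measurable_fun_upd[where J="{..<k - 1}"]) (auto simp: borel_prod)
 qed
 have Fpos: "F (L t) ~= 0" for t using F_pos[OF L_nonneg, of t] by simp
 have "emeasure (children_law p lam v t k) B =
   (\<integral>\<^sup>+s. ennreal (f s / F (L t) * indicator {t<..} s) *
    (\<integral>\<^sup>+x. indicator B ((order_pairs (k - 1) x)(k - 1 := (t, s))) \<partial>iid_law t (k - 1)) \<partial>lborel)"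
  if "t \<in> space pos_borel" for t
  using that emeasure_children_root[OF _ k B', of t] True by (simp add: space_restrict_space tail_density_eq L_eq)
 moreover have "(%t. \<integral>\<^sup>+s. ennreal (f s / F (L t) * indicator {t<..} s) *
    (\<integral>\<^sup>+x. indicator B ((order_pairs (k - 1) x)(k - 1 := (t, s))) \<partial>iid_law t (k - 1)) \<partial>lborel) \<in> bmeas pos_borel"
 proof -
  have "(%ts. \<integral>\<^sup>+x. indicator B ((order_pairs (k - 1) x)(k - 1 := (fst ts, snd ts))) \<partial>iid_law (fst ts) (k - 1)) \<in> bmeas (pos_borel \<Otimes>\<^sub>M lborel)"
  proof (rule nn_integral_measurable_subprob_algebra2[where N="?P"])
   show "(%(ts, x). indicator B ((order_pairs (k - 1) x)(k - 1 := (fst ts, snd ts))) :: ennreal)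
     \<in> bmeas ((pos_borel \<Otimes>\<^sub>M lborel) \<Otimes>\<^sub>M ?P)"
    using upd B' by (auto simp: split_beta' intro!: borel_measurable_indicator' measurable_sets_Collect)
   show "(%ts. iid_law (fst ts) (k - 1)) \<in> measurable (pos_borel \<Otimes>\<^sub>M lborel) (subprob_algebra ?P)"
    by (rule measurable_compose[OF measurable_fst iid_law_kernel])
  qed
  then have 1: "(%(t, s). \<integral>\<^sup>+x. indicator B ((order_pairs (k - 1) x)(k - 1 := (t, s))) \<partial>iid_law t (k - 1)) \<in> bmeas (pos_borel \<Otimes>\<^sub>M lborel)"
   by (simp add: split_beta')
  have [measurable]: "id \<in> measurable pos_borel borel"
   by (simp add: measurable_restrict_space1)
  have "(%(t, s). ennreal (f s / F (L (id t)) * (if id t < s then 1 else 0))) \<in> bmeas (pos_borel \<Otimes>\<^sub>M lborel)"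
   by measurable
  then have 2: "(%(t, s). ennreal (f s / F (L t) * indicator {t<..} s)) \<in> bmeas (pos_borel \<Otimes>\<^sub>M lborel)"
   by (simp add: indicator_def[abs_def] of_bool_def)
  have "(%(t, s). ennreal (f s / F (L t) * indicator {t<..} s) * (\<integral>\<^sup>+x. indicator B ((order_pairs (k - 1) x)(k - 1 := (t, s))) \<partial>iid_law t (k - 1)))
    \<in> bmeas (pos_borel \<Otimes>\<^sub>M lborel)"
   using borel_measurable_times_ennreal[OF 2 1] by (simp add: split_beta')
  then show ?thesis by (intro lborel.borel_measurable_nn_integral)
 qed
 ultimately show ?thesis by (rule measurable_cong[THEN iffD2])
qed

lemma degree_prob_measurable: "(%t. ennreal (degree_prob p lam t k)) \<in> bmeas pos_borel"
proof -
 have "ennreal (degree_prob p lam t k) = ennreal (exp (- L t) * (L t ^ (k - 1) / fact (k - 1)) * p (k - 1 + 1) / Z (L t))"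
  if "t \<in> space pos_borel" for t
  using that by (simp add: space_restrict_space degree_prob_eq zfun_def L_eq)
 moreover have "(%t. ennreal (exp (- L t) * (L t ^ (k - 1) / fact (k - 1)) * p (k - 1 + 1) / Z (L t))) \<in> bmeas pos_borel"
  by (rule measurable_restrict_space1) measurable
 ultimately show ?thesis by (rule measurable_cong[THEN iffD2])
qed

end

section \<open>Measurability of the decorated trees\<close>

lemma mtbp_component_measurable:
 assumes [measurable]: "\<And>v. d v \<in> measurable M (count_space UNIV)" "\<And>v. \<tau> v \<in> bmeas M"
 shows "Measurable.pred M (%w. v \<in> mtbp_component (%u. d u w) (%u. \<tau> u w) t)"
proof (induction v rule: rev_induct)
 case (snoc x xs)
 have [measurable]: "Measurable.pred M (%w. x < num_children xs (d xs w))"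
  by (rule measurable_compose[OF assms(1)]) simp
 show ?case unfolding mtbp_component_snoc using snoc by measurable
qed (simp add: mtbp_component_Nil)

lemma mtbp_tree_measurable:
 assumes [measurable]: "\<And>v. T v \<in> bmeas M" "\<And>v. d v \<in> measurable M (count_space UNIV)" "\<And>v. \<tau> v \<in> bmeas M"
 shows "(%\<omega>. mtbp_tree (%v. T v \<omega>) (%v. d v \<omega>) (%v. \<tau> v \<omega>) t) \<in> measurable M tree_space"
 unfolding tree_space_def
proof (rule measurable_PiM_single')
 fix w :: "nat list"
 define C where "C \<omega> = mtbp_component (%v. d v \<omega>) (%v. \<tau> v \<omega>) t" for \<omega>
 have [measurable]: "Measurable.pred M (%\<omega>. v \<in> C \<omega>)" for v
  unfolding C_def by (rule mtbp_component_measurable) measurable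
 define P where "P v \<omega> \<longleftrightarrow> v \<in> C \<omega> & address (C \<omega>) (%v. \<tau> v \<omega>) v = w" for v \<omega>
 have addr: "address X l v = w \<longleftrightarrow> length v = length w & (\<forall>m\<in>{..<length w}.
   card {j. take m v @ [j] \<in> X & l (take m v @ [j]) < l (take (Suc m) v)} = w ! m)" for X l v
  unfolding address_def list_eq_iff_nth_eq by auto
 have P[measurable]: "Measurable.pred M (P v)" for v
  unfolding P_def addr by measurable
 define U where "U \<omega> \<longleftrightarrow> (\<exists>!v. P v \<omega>)" for \<omega>
 have U[measurable]: "Measurable.pred M U"
 proof -
  have "U \<omega> \<longleftrightarrow> (\<exists>v. P v \<omega> & (\<forall>u. P u \<omega> --> u = v))" for \<omega> unfolding U_def by (auto simp: Ex1_def)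
  then have "U = (%\<omega>. \<exists>v. P v \<omega> & (\<forall>u. P u \<omega> --> u = v))" by (intro ext)
  then show ?thesis by simp
 qed
 \<comment> \<open>The extra conjunct \<open>U \<omega>\<close> makes the description hold for at
   most one \<open>v\<close> at every \<omega>, also where several vertices share the address
   \<open>w\<close>.\<close>
 have THE: "(%\<omega>. THE v. U \<omega> & P v \<omega>) \<in> measurable M (count_space UNIV)"
 proof (rule measurable_THE[where I=UNIV])
  show "Measurable.pred M (%\<omega>. U \<omega> & P v \<omega>)" for v by measurable
  show "i = j" if "U \<omega> & P i \<omega>" "U \<omega> & P j \<omega>" for \<omega> i j
   using that unfolding U_def by blast
 qed simp_all
 define N where "N \<omega> = (THE v. U \<omega> & P v \<omega>)" for \<omega>
 have N: "N \<in> measurable M (count_space UNIV)" using THE by (simp add: N_def[abs_def])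
 define h where "h v \<omega> = (True, ereal (T v \<omega>), if v = [] then 0 else \<tau> v \<omega>)" for v \<omega>
 have h: "h v \<in> measurable M (count_space UNIV \<Otimes>\<^sub>M borel \<Otimes>\<^sub>M borel)" for v
  unfolding h_def[abs_def] by (cases "v = []") simp_all
 have "(%\<omega>. if U \<omega> then h (N \<omega>) \<omega> else (False, 0, 0)) \<in> measurable M (count_space UNIV \<Otimes>\<^sub>M borel \<Otimes>\<^sub>M borel)"
  by (rule measurable_If[OF measurable_compose_countable[OF h N]]) simp_all
 also have "(%\<omega>. if U \<omega> then h (N \<omega>) \<omega> else (False, 0, 0))
   = (%\<omega>. mtbp_tree (%v. T v \<omega>) (%v. d v \<omega>) (%v. \<tau> v \<omega>) t w)"
 proof
  fix \<omega>
  show "(if U \<omega> then h (N \<omega>) \<omega> else (False, 0, 0)) = mtbp_tree (%v. T v \<omega>) (%v. d v \<omega>) (%v. \<tau> v \<omega>) t w"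
  proof (cases "U \<omega>")
   case True
   then have "N \<omega> = (THE v. v \<in> C \<omega> & address (C \<omega>) (%v. \<tau> v \<omega>) v = w)" by (simp add: N_def P_def)
   with True show ?thesis
    unfolding mtbp_tree_def canonical_tree_def C_def[symmetric] by (simp add: U_def P_def h_def Let_def)
  next
   case False
   then show ?thesis
    unfolding mtbp_tree_def canonical_tree_def C_def[symmetric] by (simp add: U_def P_def)
  qed
 qed
 finally show "(%\<omega>. mtbp_tree (%v. T v \<omega>) (%v. d v \<omega>) (%v. \<tau> v \<omega>) t w) \<in> measurable M (count_space UNIV \<Otimes>\<^sub>M borel \<Otimes>\<^sub>M borel)" .
qed (auto simp: space_pair_measure)

section \<open>Histories determine the law of the branching process tree\<close>

abbreviation hist_space :: "(vertex => real \<times> real \<times> nat) measure" where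
 "hist_space \<equiv> \<Pi>\<^sub>M v\<in>UNIV. borel \<Otimes>\<^sub>M borel \<Otimes>\<^sub>M count_space UNIV"

definition hist_vertices :: "(vertex => real \<times> real \<times> nat) => vertex set" where
 "hist_vertices h = mtbp_vertices (%v. snd (snd (h v)))"

lemma mtbp_vertices_measurable:
 assumes [measurable]: "\<And>v. d v \<in> measurable M (count_space UNIV)"
 shows "Measurable.pred M (%w. v \<in> mtbp_vertices (%u. d u w))"
proof (induction v rule: rev_induct)
 case (snoc x xs)
 have [measurable]: "Measurable.pred M (%w. x < num_children xs (d xs w))"
  by (rule measurable_compose[OF assms(1)]) simp
 show ?case unfolding mtbp_vertices_snoc using snoc by measurable
qed (simp add: mtbp_vertices_Nil)

lemma hist_vertices_measurable [measurable]: "Measurable.pred hist_space (%h. v \<in> hist_vertices h)"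
 unfolding hist_vertices_def by (rule mtbp_vertices_measurable) measurable

lemma space_hist_space [simp]: "space hist_space = UNIV"
 by (auto simp: space_PiM space_pair_measure)

context rdcp_ode begin

text \<open>The joint weight of degree constraint \<open>k\<close> and children in \<open>B\<close>
  for type \<open>t\<close>. The value 0 for nonpositive \<open>t\<close> makes it measurable on the
  whole line.\<close>

definition kern :: "vertex => nat => (nat => real \<times> real) set => real => ennreal" where
 "kern v k B t = (if t \<in> {0<..} then ennreal (degree_prob p lam t k) * emeasure (children_law p lam v t k) B else 0)"

lemma kern_measurable:
 assumes "1 <= k" "B \<in> sets (pair_seqs (num_children v k))"
 shows "kern v k B \<in> bmeas borel"
 unfolding kern_def[abs_def]
 by (subst measurable_restrict_space_iff[symmetric])
  (use children_law_kernel[OF assms] degree_prob_measurable[of k] in \<open>auto intro!: borel_measurable_times_ennreal\<close>)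

lemma kern_space: "0 < t ==> 1 <= k ==> kern v k (space (pair_seqs (num_children v k))) t = ennreal (degree_prob p lam t k)"
 using prob_space.emeasure_space_1[OF prob_space_children_law[of t k v]]
 by (simp add: kern_def sets_eq_imp_space_eq[OF sets_children_law])

end

context rdcp_ode begin

text \<open>The event that the next history lies in a finite-dimensional cylinder is split according to
 the degree constraints of the vertices of generation \<open>n\<close>, with \<open>0\<close> recording that a string is
 not a vertex.\<close>

definition cyl_event :: "nat => vertex set => (vertex => (real \<times> real \<times> nat) set) => vertex set \<Rightarrow>
  (vertex => nat) => (vertex => real \<times> real \<times> nat) set" where
 "cyl_event n J A I kk = {h. (\<forall>v\<in>I. v \<in> hist_vertices h \<longleftrightarrow> 1 <= kk v) \<and>
   (\<forall>v\<in>J. if length v = n then (if 1 <= kk v then (fst (h v), fst (snd (h v)), kk v) \<in> A v else (0, 0, 0) \<in> A v)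
    else if length v = Suc n then (kk (butlast v) = 0 --> (0, 0, 0) \<in> A v) else h v \<in> A v)}"

text \<open>The part of the cylinder condition that concerns the children of \<open>u\<close> once
  its degree constraint is fixed. Their own degree entry is 0, as constraints of generation
  \<open>Suc n\<close> do not yet belong to the history; strings that are not children must satisfy
  the condition at the dummy entry.\<close>

definition cyl_children :: "nat => vertex set => (vertex => (real \<times> real \<times> nat) set) \<Rightarrow>
  (vertex => nat) => vertex => (nat => real \<times> real) set" where
 "cyl_children n J A kk u = {c \<in> space (pair_seqs (num_children u (kk u))).
   \<forall>v\<in>J. length v = Suc n & butlast v = u -->
    (if last v < num_children u (kk u) then (fst (c (last v)), snd (c (last v)), 0) \<in> A v else (0, 0, 0) \<in> A v)}"

definition cyl_integrand where
 "cyl_integrand n J A I kk h = indicator (cyl_event n J A I kk \<inter> {h. {v\<in>I. 1 <= kk v} \<subseteq> hist_vertices h}) h *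
   (\<Prod>v\<in>{v\<in>I. 1 <= kk v}. kern v (kk v) (cyl_children n J A kk v) (fst (snd (h v))))"

text \<open>The strings of length \<open>n\<close> whose degree constraint a cylinder over
  \<open>J\<close> in the next history can see: members of \<open>J\<close>, and parents of members
  of \<open>J\<close>.\<close>

definition level_part :: "nat => vertex set => vertex set" where
 "level_part n J = {v \<in> J \<union> butlast ` J. length v = n}"

end

locale rdcp_mtbp = rdcp_ode p lam + edge_labelled_mtbp M p lam T d \<tau>
 for M :: "'a measure" and p lam T d \<tau>
begin

definition hist :: "nat => 'a => vertex => real \<times> real \<times> nat" where
 "hist n w = mtbp_history n (%v. T v w) (%v. d v w) (%v. \<tau> v w)"

definition vert :: "'a => vertex set" where "vert w = mtbp_vertices (%v. d v w)"

definition chld :: "vertex => nat => 'a => nat => real \<times> real" where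
 "chld v k w = (\<lambda>j\<in>{..<num_children v k}. (\<tau> (v @ [j]) w, T (v @ [j]) w))"

lemmas [measurable] = types_measurable degrees_measurable labels_measurable

lemma hist_eq: "hist n w v = (if v \<in> vert w & length v <= n
  then (if v = [] then 0 else \<tau> v w, T v w, if length v < n then d v w else 0) else (0, 0, 0))"
 by (simp add: hist_def mtbp_history_def vert_def)

lemma vert_measurable [measurable]: "Measurable.pred M (%w. v \<in> vert w)"
 unfolding vert_def by (rule mtbp_vertices_measurable) measurable

lemma hist_measurable [measurable]: "hist n \<in> measurable M hist_space"
proof (rule measurable_PiM_single')
 show "(%w. hist n w v) \<in> measurable M (borel \<Otimes>\<^sub>M borel \<Otimes>\<^sub>M count_space UNIV)" for v
  unfolding hist_eq by measurable
qed (auto simp: space_pair_measure)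

lemma chld_measurable [measurable]: "chld v k \<in> measurable M (pair_seqs (num_children v k))"
 unfolding chld_def[abs_def] borel_prod[symmetric] by measurable

lemma hist_vertices_hist: "length v <= n ==> v \<in> hist_vertices (hist n w) \<longleftrightarrow> v \<in> vert w"
proof (induction v rule: rev_induct)
 case (snoc x xs)
 then show ?case by (auto simp: hist_vertices_def vert_def mtbp_vertices_snoc hist_eq)
qed (simp add: hist_vertices_def vert_def mtbp_vertices_Nil)

lemma generation':
 assumes "finite I" "I \<subseteq> {v. length v = n}" "\<And>v. v \<in> I ==> 1 <= k v"
  "\<And>v. v \<in> I ==> B v \<in> sets (pair_seqs (num_children v (k v)))" "E \<in> sets hist_space"
 shows "emeasure M {w\<in>space M. hist n w \<in> E & (\<forall>v\<in>I. v \<in> vert w & d v w = k v & chld v (k v) w \<in> B v)} =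
  (\<integral>\<^sup>+w. indicator {w. hist n w \<in> E & I \<subseteq> vert w} w *
    (\<Prod>v\<in>I. ennreal (degree_prob p lam (T v w) (k v)) * emeasure (children_law p lam v (T v w) (k v)) (B v)) \<partial>M)"
 using generation[OF assms] unfolding hist_def vert_def chld_def .

text \<open>Induction along the string: the root has a density supported on positive times, and for
  a child the generation property with the single vertex \<open>u\<close> reduces the claim to
  \<open>children_law_pos\<close>, for each of the countably many degree constraints.\<close>

lemma AE_type_pos: "AE w in M. v \<in> vert w --> 0 < T v w"
proof (induction v rule: rev_induct)
 case Nil
 have D: "distr M lborel (T []) = density lborel (%t. ennreal (f t))"
  using root_type by (simp add: distributed_def)
 have "AE t in density lborel (%t. ennreal (f t)). 0 < t"
  by (subst AE_density) (auto simp: f_eq split: if_splits)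
 then have "AE t in distr M lborel (T []). 0 < t" unfolding D .
 then show ?case by (subst (asm) AE_distr_iff) auto
next
 case (snoc j u)
 have "AE w in M. \<not> (u \<in> vert w & d u w = k & \<not> 0 < T (u @ [j]) w)"
  if k: "1 <= k" and j: "j < num_children u k" for k
 proof -
  let ?S = "\<Pi>\<^sub>M j\<in>{..<num_children u k}. (borel :: (real \<times> real) measure)"
  let ?B = "{c \<in> space ?S. \<not> 0 < snd (c j)}"
  have [measurable]: "(%c. snd (c j)) \<in> bmeas ?S"
   using j by (intro measurable_component_pair) auto
  have B: "?B \<in> sets ?S" by measurable
  have "emeasure M {w\<in>space M. hist (length u) w \<in> UNIV & (\<forall>v\<in>{u}. v \<in> vert w & d v w = k & chld v k w \<in> ?B)} =
   (\<integral>\<^sup>+w. indicator {w. hist (length u) w \<in> UNIV & {u} \<subseteq> vert w} w *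
    (\<Prod>v\<in>{u}. ennreal (degree_prob p lam (T v w) k) * emeasure (children_law p lam v (T v w) k) ?B) \<partial>M)"
   using k B sets.top[of hist_space] by (intro generation'[where k="%_. k" and B="%_. ?B"]) auto
  also have "... = (\<integral>\<^sup>+w. 0 \<partial>M)"
  proof (rule nn_integral_cong_AE)
   show "AE w in M. indicator {w. hist (length u) w \<in> UNIV & {u} \<subseteq> vert w} w *
    (\<Prod>v\<in>{u}. ennreal (degree_prob p lam (T v w) k) * emeasure (children_law p lam v (T v w) k) ?B) = 0"
    using snoc by eventually_elim (use children_law_pos[OF _ k j] in \<open>auto split: split_indicator\<close>)
  qed
  finally have z: "emeasure M {w\<in>space M. u \<in> vert w & d u w = k & chld u k w \<in> ?B} = 0" by simp
  have "{w\<in>space M. u \<in> vert w & d u w = k & chld u k w \<in> ?B} = {w\<in>space M. \<not> \<not> (u \<in> vert w & d u w = k & \<not> 0 < T (u @ [j]) w)}"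
   using j measurable_space[OF chld_measurable, of _ u k] by (auto simp: chld_def)
  with z show ?thesis by (subst AE_iff_measurable[OF _ refl]) auto
 qed
 then have "AE w in M. \<forall>k. 1 <= k --> j < num_children u k --> \<not> (u \<in> vert w & d u w = k & \<not> 0 < T (u @ [j]) w)"
  by (intro AE_all_countable[THEN iffD2] allI) (auto simp: AE_conj_iff)
 then show ?case
 proof eventually_elim
  case (elim w)
  show ?case
  proof
   assume "u @ [j] \<in> vert w"
   then have "u \<in> vert w" "j < num_children u (d u w)" by (auto simp: vert_def mtbp_vertices_snoc)
   moreover from this have "1 <= d u w" by (cases "d u w") (auto simp: num_children_def split: if_splits)
   ultimately show "0 < T (u @ [j]) w" using elim by blast
  qed
 qed
qed

text \<open>The generation property speaks only of constraints \<open>k >= 1\<close>. Its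
  probabilities sum to 1 for positive types, so nothing is left for the value 0.\<close>

lemma AE_degree_pos: "AE w in M. v \<in> vert w --> 1 <= d v w"
proof -
 let ?X = "%k. {w\<in>space M. v \<in> vert w & d v w = Suc k}"
 let ?S = "%k. \<Pi>\<^sub>M j\<in>{..<num_children v k}. (borel :: (real \<times> real) measure)"
 let ?V = "{w\<in>space M. v \<in> vert w}"
 let ?g = "%k w. indicator ?V w * kern v (Suc k) (space (?S (Suc k))) (T v w)"
 have [measurable]: "kern v (Suc k) (space (?S (Suc k))) \<in> bmeas borel" for k
  by (rule kern_measurable) auto
 have X: "emeasure M (?X k) = (\<integral>\<^sup>+w. ?g k w \<partial>M)" for k
 proof -
  have Xe: "?X k = {w\<in>space M. hist (length v) w \<in> UNIV & (\<forall>v\<in>{v}. v \<in> vert w & d v w = Suc k & chld v (Suc k) w \<in> space (?S (Suc k)))}"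
   using measurable_space[OF chld_measurable, of _ v "Suc k"] by auto
  have "emeasure M (?X k) =
   (\<integral>\<^sup>+w. indicator {w. hist (length v) w \<in> UNIV & {v} \<subseteq> vert w} w *
    (\<Prod>v\<in>{v}. ennreal (degree_prob p lam (T v w) (Suc k)) * emeasure (children_law p lam v (T v w) (Suc k)) (space (?S (Suc k)))) \<partial>M)"
   unfolding Xe using sets.top[of hist_space] sets.top[of "?S (Suc k)"]
   by (intro generation'[where k="%_. Suc k" and B="%_. space (?S (Suc k))"]) auto
  also have "... = (\<integral>\<^sup>+w. ?g k w \<partial>M)"
  proof (rule nn_integral_cong_AE, use AE_type_pos[of v] AE_space[of M] in eventually_elim)
   case (elim w)
   then show ?case by (cases "v \<in> vert w") (simp_all add: kern_def)
  qed
  finally show ?thesis .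
 qed
 have "emeasure M (\<Union>k. ?X k) = (\<Sum>k. emeasure M (?X k))"
  by (rule suminf_emeasure[symmetric]) (auto simp: disjoint_family_on_def)
 also have "... = (\<integral>\<^sup>+w. (\<Sum>k. ?g k w) \<partial>M)"
  unfolding X by (rule nn_integral_suminf[symmetric]) measurable
 also have "... = (\<integral>\<^sup>+w. indicator ?V w \<partial>M)"
 proof (rule nn_integral_cong_AE, use AE_type_pos[of v] in eventually_elim)
  case (elim w)
  show ?case
  proof (cases "w \<in> ?V")
   case True
   with elim have "0 < T v w" by simp
   moreover have "(\<Sum>k. ennreal (degree_prob p lam (T v w) (Suc k))) = ennreal 1"
    using calculation by (intro suminf_ennreal_eq degree_prob_sums degree_prob_nonneg) auto
   ultimately show ?thesis using True by (simp add: kern_space)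
  qed simp
 qed
 also have "... = emeasure M ?V" by simp
 finally have e: "emeasure M (\<Union>k. ?X k) = emeasure M ?V" .
 have [measurable]: "(\<Union>k. ?X k) \<in> sets M" by measurable
 have "emeasure M (?V - (\<Union>k. ?X k)) = emeasure M ?V - emeasure M (\<Union>k. ?X k)"
  by (rule emeasure_Diff) auto
 also have "... = 0" unfolding e by simp
 finally have z: "emeasure M (?V - (\<Union>k. ?X k)) = 0" .
 show ?thesis
 proof (rule AE_I[OF _ z])
  show "{w \<in> space M. \<not> (v \<in> vert w --> 1 <= d v w)} \<subseteq> ?V - (\<Union>k. ?X k)" by auto
 qed measurable
qed

lemma cyl_event_measurable:
 assumes J: "finite J" and A: "\<And>v. v \<in> J ==> A v \<in> sets (borel \<Otimes>\<^sub>M borel \<Otimes>\<^sub>M count_space UNIV)" and I: "finite I"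
 shows "cyl_event n J A I kk \<in> sets hist_space"
proof -
 define P where "P v h \<longleftrightarrow> (if length v = n then (if 1 <= kk v then (fst (h v), fst (snd (h v)), kk v) \<in> A v else (0, 0, 0) \<in> A v)
    else if length v = Suc n then (kk (butlast v) = 0 --> (0, 0, 0) \<in> A v) else h v \<in> A v)"
  for v and h :: "vertex => real \<times> real \<times> nat"
 have P: "Measurable.pred hist_space (P v)" if "v \<in> J" for v
 proof -
  have [measurable]: "A v \<in> sets (borel \<Otimes>\<^sub>M borel \<Otimes>\<^sub>M count_space UNIV)" using A that .
  show ?thesis unfolding P_def[abs_def] by measurable
 qed
 have "{h \<in> space hist_space. (\<forall>v\<in>I. v \<in> hist_vertices h \<longleftrightarrow> 1 <= kk v) & (\<forall>v\<in>J. P v h)} \<in> sets hist_space"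
  by (intro sets.sets_Collect_conj sets.sets_Collect_finite_All I J P[unfolded pred_def]) measurable
 then show ?thesis unfolding cyl_event_def P_def by simp
qed

lemma cyl_children_measurable:
 assumes J: "finite J" and A: "\<And>v. v \<in> J ==> A v \<in> sets (borel \<Otimes>\<^sub>M borel \<Otimes>\<^sub>M count_space UNIV)"
 shows "cyl_children n J A kk u \<in> sets (pair_seqs (num_children u (kk u)))"
proof -
 let ?S = "\<Pi>\<^sub>M j\<in>{..<num_children u (kk u)}. (borel :: (real \<times> real) measure)"
 define P where "P v c \<longleftrightarrow> (length v = Suc n & butlast v = u -->
    (if last v < num_children u (kk u) then (fst (c (last v)), snd (c (last v)), 0) \<in> A v else (0, 0, 0) \<in> A v))"
  for v and c :: "nat => real \<times> real"
 have "Measurable.pred ?S (P v)" if "v \<in> J" for v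
 proof (cases "last v < num_children u (kk u)")
  case True
  have [measurable]: "A v \<in> sets (borel \<Otimes>\<^sub>M borel \<Otimes>\<^sub>M count_space UNIV)" using A that .
  have [measurable]: "(%c. fst (c (last v))) \<in> bmeas ?S" "(%c. snd (c (last v))) \<in> bmeas ?S"
   using True by (intro measurable_component_pair; simp)+
  show ?thesis unfolding P_def[abs_def] by measurable
 qed (simp add: P_def[abs_def])
 then have "{c \<in> space ?S. \<forall>v\<in>J. P v c} \<in> sets ?S"
  using J unfolding pred_def by (intro sets.sets_Collect_finite_All) auto
 then show ?thesis unfolding cyl_children_def P_def .
qed

lemma cyl_integrand_measurable:
 assumes "finite J" "\<And>v. v \<in> J ==> A v \<in> sets (borel \<Otimes>\<^sub>M borel \<Otimes>\<^sub>M count_space UNIV)" "finite I"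
 shows "cyl_integrand n J A I kk \<in> bmeas hist_space"
proof -
 have "Measurable.pred hist_space (%h. \<forall>v\<in>{v\<in>I. 1 <= kk v}. v \<in> hist_vertices h)"
  using assms(3) by (intro pred_intros_finite) measurable
 then have "{h. {v\<in>I. 1 <= kk v} \<subseteq> hist_vertices h} \<in> sets hist_space"
  by (simp add: pred_def subset_eq)
 then show ?thesis
  unfolding cyl_integrand_def[abs_def]
  by (intro borel_measurable_times_ennreal borel_measurable_indicator sets.Int cyl_event_measurable[OF assms]
    borel_measurable_prod_ennreal measurable_compose[OF _ kern_measurable] cyl_children_measurable[OF assms(1,2)]) auto
qed

text \<open>After splitting by the degree constraints in generation \<open>n\<close>, each piece is
  an event of the form treated by the generation property. The resulting expression involves the
  process only through the law of \<open>hist n\<close>, so it can serve as an induction step in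
  \<open>n\<close>.\<close>

lemma emeasure_hist_cylinder:
 fixes n :: nat
 assumes J: "finite J" and A: "\<And>v. v \<in> J ==> A v \<in> sets (borel \<Otimes>\<^sub>M borel \<Otimes>\<^sub>M count_space UNIV)"
 defines "I \<equiv> level_part n J"
 shows "emeasure M {w\<in>space M. \<forall>v\<in>J. hist (Suc n) w v \<in> A v} =
  (\<integral>\<^sup>+kk. (\<integral>\<^sup>+h. cyl_integrand n J A I kk h \<partial>distr M hist_space (hist n)) \<partial>count_space (PiE I (%_. UNIV)))"
proof -
 let ?K = "PiE I (%_. UNIV :: nat set)"
 have fI: "finite I" unfolding I_def level_part_def using J by simp
 have lI: "I \<subseteq> {v. length v = n}" by (auto simp: I_def level_part_def)
 define X where "X = {w\<in>space M. \<forall>v\<in>J. hist (Suc n) w v \<in> A v}"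
 define Y where "Y kk = {w\<in>X. \<forall>v\<in>I. kk v = (if v \<in> vert w then d v w else 0)}" for kk
 have X: "X \<in> sets M"
 proof -
  have "Measurable.pred M (%w. hist (Suc n) w v \<in> A v)" if "v \<in> J" for v
  proof -
   have [measurable]: "A v \<in> sets (borel \<Otimes>\<^sub>M borel \<Otimes>\<^sub>M count_space UNIV)" using A that .
   have "(%w. hist (Suc n) w v) \<in> measurable M (borel \<Otimes>\<^sub>M borel \<Otimes>\<^sub>M count_space UNIV)"
    by (rule measurable_compose[OF hist_measurable measurable_component_singleton]) simp
   then show ?thesis by measurable
  qed
  then show ?thesis using J unfolding X_def pred_def by (intro sets.sets_Collect_finite_All) auto
 qed
 have Y: "Y kk \<in> sets M" for kk
 proof -
  have "Measurable.pred M (%w. \<forall>v\<in>I. kk v = (if v \<in> vert w then d v w else 0))"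
   by (intro pred_intros_finite[OF fI]) measurable
  then have "X \<inter> {w\<in>space M. \<forall>v\<in>I. kk v = (if v \<in> vert w then d v w else 0)} \<in> sets M"
   using X by (intro sets.Int) (auto simp: pred_def)
  moreover have "Y kk = X \<inter> {w\<in>space M. \<forall>v\<in>I. kk v = (if v \<in> vert w then d v w else 0)}"
   by (auto simp: Y_def X_def)
  ultimately show ?thesis by simp
 qed
 have XY: "X = (\<Union>kk\<in>?K. Y kk)"
 proof
  show "X \<subseteq> (\<Union>kk\<in>?K. Y kk)"
  proof
   fix w assume "w \<in> X"
   then show "w \<in> (\<Union>kk\<in>?K. Y kk)"
    by (intro UN_I[of "\<lambda>v\<in>I. if v \<in> vert w then d v w else 0"]) (auto simp: Y_def)
  qed
 qed (auto simp: Y_def)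
 have "emeasure M X = (\<integral>\<^sup>+kk. emeasure M (Y kk) \<partial>count_space ?K)"
  unfolding XY
 proof (rule emeasure_UN_countable)
  show "disjoint_family_on Y ?K"
   unfolding disjoint_family_on_def
  proof (intro ballI impI)
   fix k1 k2 assume k: "k1 \<in> ?K" "k2 \<in> ?K" "k1 ~= k2"
   then obtain v where "v \<in> I" "k1 v ~= k2 v" by (meson PiE_ext)
   moreover have "k1 v = k2 v" if "x \<in> Y k1" "x \<in> Y k2" for x
    using that \<open>v \<in> I\<close> by (simp add: Y_def)
   ultimately show "Y k1 \<inter> Y k2 = {}" by blast
  qed
 qed (auto intro: Y countable_PiE fI)
 also have "... = (\<integral>\<^sup>+kk. (\<integral>\<^sup>+h. cyl_integrand n J A I kk h \<partial>distr M hist_space (hist n)) \<partial>count_space ?K)"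
 proof (rule nn_integral_cong)
  fix kk :: "vertex => nat"
  let ?I = "{v\<in>I. 1 <= kk v}"
  let ?R = "{w\<in>space M. hist n w \<in> cyl_event n J A I kk \<and>
   (\<forall>v\<in>?I. v \<in> vert w & d v w = kk v & chld v (kk v) w \<in> cyl_children n J A kk v)}"
  \<comment> \<open>Positive degree constraints are essential here: they make the recorded value 0
    mean exactly that the string is not a vertex.\<close>
  have iff: "w \<in> Y kk \<longleftrightarrow> w \<in> ?R" if sp: "w \<in> space M" and pos: "\<forall>v. v \<in> vert w --> 1 <= d v w" for w
  proof -
   define Q where "Q \<longleftrightarrow> (\<forall>v\<in>I. kk v = (if v \<in> vert w then d v w else 0))"
   have hv: "v \<in> hist_vertices (hist n w) \<longleftrightarrow> v \<in> vert w" if "v \<in> I" for v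
    using that lI by (intro hist_vertices_hist) auto
   have Q: "Q \<longleftrightarrow> (\<forall>v\<in>I. v \<in> hist_vertices (hist n w) \<longleftrightarrow> 1 <= kk v) & (\<forall>v\<in>?I. v \<in> vert w & d v w = kk v)"
    unfolding Q_def using pos hv by (auto split: if_splits)
   let ?E = "%v. if length v = n then (if 1 <= kk v then (fst (hist n w v), fst (snd (hist n w v)), kk v) \<in> A v else (0, 0, 0) \<in> A v)
     else if length v = Suc n then (kk (butlast v) = 0 --> (0, 0, 0) \<in> A v) else hist n w v \<in> A v"
   let ?C = "%v. length v = Suc n --> 1 <= kk (butlast v) -->
     (if last v < num_children (butlast v) (kk (butlast v))
     then (fst (chld (butlast v) (kk (butlast v)) w (last v)), snd (chld (butlast v) (kk (butlast v)) w (last v)), 0) \<in> A v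
     else (0, 0, 0) \<in> A v)"
   \<comment> \<open>The condition at \<open>v\<close> splits into \<open>?E\<close>, readable from
     \<open>hist n\<close> and \<open>kk\<close>, and \<open>?C\<close>, a condition on the newly
     generated children. Length \<open>n\<close> adds a degree constraint, length
     \<open>Suc n\<close> adds a child, all other entries are unchanged.\<close>
   have step: "hist (Suc n) w v \<in> A v \<longleftrightarrow> ?E v & ?C v" if QQ: Q and v: "v \<in> J" for v
   proof (cases "length v = n")
    case True
    then have "v \<in> I" using v by (auto simp: I_def level_part_def)
    then have "kk v = (if v \<in> vert w then d v w else 0)" using QQ by (auto simp: Q_def)
    then show ?thesis using True pos by (auto simp: hist_eq)
   next
    case ln: False
    show ?thesis
    proof (cases "length v = Suc n")
     case True
     then obtain u j where uj: "v = u @ [j]" "length u = n" by (cases v rule: rev_cases) auto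
     then have "u \<in> I" using v by (force simp: I_def level_part_def)
     then have ku: "kk u = (if u \<in> vert w then d u w else 0)" using QQ by (auto simp: Q_def)
     have "v \<in> vert w \<longleftrightarrow> u \<in> vert w & j < num_children u (d u w)"
      by (simp add: uj vert_def mtbp_vertices_snoc)
     then show ?thesis using True pos ku uj by (auto simp: hist_eq chld_def)
    next
     case False
     have "hist (Suc n) w v = hist n w v" using ln False by (auto simp: hist_eq)
     then show ?thesis using ln False by simp
    qed
   qed
   have chl: "(\<forall>v\<in>?I. chld v (kk v) w \<in> cyl_children n J A kk v) \<longleftrightarrow> (\<forall>v\<in>J. ?C v)"
   proof -
    have c: "chld v (kk v) w \<in> space (pair_seqs (num_children v (kk v)))" for v
     by (rule measurable_space[OF chld_measurable sp])
    have bI: "butlast v \<in> I" if "v \<in> J" "length v = Suc n" for v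
     using that by (auto simp: I_def level_part_def)
    show ?thesis
    proof
     assume *: "\<forall>v\<in>?I. chld v (kk v) w \<in> cyl_children n J A kk v"
     show "\<forall>v\<in>J. ?C v"
     proof (intro ballI impI)
      fix v assume v: "v \<in> J" "length v = Suc n" "1 <= kk (butlast v)"
      then have "chld (butlast v) (kk (butlast v)) w \<in> cyl_children n J A kk (butlast v)"
       using * bI[OF v(1,2)] by blast
      then show "if last v < num_children (butlast v) (kk (butlast v))
       then (fst (chld (butlast v) (kk (butlast v)) w (last v)), snd (chld (butlast v) (kk (butlast v)) w (last v)), 0) \<in> A v
       else (0, 0, 0) \<in> A v"
       using v by (auto simp: cyl_children_def)
     qed
    next
     assume *: "\<forall>v\<in>J. ?C v"
     show "\<forall>v\<in>?I. chld v (kk v) w \<in> cyl_children n J A kk v"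
      unfolding cyl_children_def using c * by auto
    qed
   qed
   have "w \<in> Y kk \<longleftrightarrow> Q & (\<forall>v\<in>J. hist (Suc n) w v \<in> A v)"
    using sp by (auto simp: Y_def X_def Q_def)
   also have "... \<longleftrightarrow> Q & (\<forall>v\<in>J. ?E v) & (\<forall>v\<in>J. ?C v)" using step by blast
   also have "... \<longleftrightarrow> w \<in> ?R" unfolding chl[symmetric] Q cyl_event_def using sp by blast
   finally show ?thesis .
  qed
  have R_eq: "emeasure M ?R = (\<integral>\<^sup>+w. indicator {w. hist n w \<in> cyl_event n J A I kk & ?I \<subseteq> vert w} w *
    (\<Prod>v\<in>?I. ennreal (degree_prob p lam (T v w) (kk v)) * emeasure (children_law p lam v (T v w) (kk v)) (cyl_children n J A kk v)) \<partial>M)"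
   using fI lI by (intro generation' cyl_children_measurable cyl_event_measurable J A) auto
  have Rm: "?R \<in> sets M"
  proof -
   have [measurable]: "cyl_event n J A I kk \<in> sets hist_space"
    by (intro cyl_event_measurable J A fI)
   have [measurable]: "cyl_children n J A kk v \<in> sets (pair_seqs (num_children v (kk v)))" for v
    by (intro cyl_children_measurable J A)
   have 1: "{w\<in>space M. v \<in> vert w & d v w = kk v & chld v (kk v) w \<in> cyl_children n J A kk v} \<in> sets M" for v
    by measurable
   have 2: "{w\<in>space M. hist n w \<in> cyl_event n J A I kk} \<in> sets M" by measurable
   show ?thesis using fI by (intro sets.sets_Collect_conj sets.sets_Collect_finite_All 1 2) auto
  qed
  have "AE w in M. \<forall>v. v \<in> vert w --> 1 <= d v w"
   unfolding AE_all_countable using AE_degree_pos by blast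
  then have "emeasure M (Y kk) = emeasure M ?R"
   using AE_space[of M] by (intro emeasure_eq_AE Y Rm, eventually_elim) (use iff in blast)
  also have "... = (\<integral>\<^sup>+w. cyl_integrand n J A I kk (hist n w) \<partial>M)"
   unfolding R_eq
  proof (rule nn_integral_cong_AE)
   have "AE w in M. \<forall>v. v \<in> vert w --> 0 < T v w"
    unfolding AE_all_countable using AE_type_pos by blast
   then show "AE w in M. indicator {w. hist n w \<in> cyl_event n J A I kk & ?I \<subseteq> vert w} w *
    (\<Prod>v\<in>?I. ennreal (degree_prob p lam (T v w) (kk v)) * emeasure (children_law p lam v (T v w) (kk v)) (cyl_children n J A kk v))
     = cyl_integrand n J A I kk (hist n w)"
   proof eventually_elim
    case (elim w)
    have iff: "?I \<subseteq> hist_vertices (hist n w) \<longleftrightarrow> ?I \<subseteq> vert w"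
     using hist_vertices_hist lI by (auto simp: subset_eq)
    show ?case
    proof (cases "?I \<subseteq> vert w")
     case True
     have "(\<Prod>v\<in>?I. ennreal (degree_prob p lam (T v w) (kk v)) * emeasure (children_law p lam v (T v w) (kk v)) (cyl_children n J A kk v))
      = (\<Prod>v\<in>?I. kern v (kk v) (cyl_children n J A kk v) (fst (snd (hist n w v))))"
     proof (rule prod.cong[OF refl])
      fix v assume v: "v \<in> ?I"
      then have "v \<in> vert w" "length v = n" using True lI by auto
      then show "ennreal (degree_prob p lam (T v w) (kk v)) * emeasure (children_law p lam v (T v w) (kk v)) (cyl_children n J A kk v)
       = kern v (kk v) (cyl_children n J A kk v) (fst (snd (hist n w v)))"
       using elim by (simp add: kern_def hist_eq)
     qed
     then show ?thesis using True iff unfolding cyl_integrand_def by (simp add: indicator_def)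
    qed (use iff in \<open>simp add: cyl_integrand_def indicator_def\<close>)
   qed
  qed
  also have "... = (\<integral>\<^sup>+h. cyl_integrand n J A I kk h \<partial>distr M hist_space (hist n))"
   by (rule nn_integral_distr[symmetric]) (auto intro: cyl_integrand_measurable J A fI)
  finally show "emeasure M (Y kk) = (\<integral>\<^sup>+h. cyl_integrand n J A I kk h \<partial>distr M hist_space (hist n))" .
 qed
 finally show ?thesis unfolding X_def .
qed

text \<open>The entry at \<open>v\<close> no longer changes with \<open>n\<close> once
  \<open>n\<close> exceeds \<open>length v\<close>, so this is the limit of the histories.\<close>

definition full_hist :: "'a => vertex => real \<times> real \<times> nat" where
 "full_hist w v = hist (Suc (length v)) w v"

lemma full_hist_eq: "length v < n ==> full_hist w v = hist n w v"
 by (simp add: full_hist_def hist_eq)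

lemma full_hist_measurable [measurable]: "full_hist \<in> measurable M hist_space"
proof (rule measurable_PiM_single')
 show "(%w. full_hist w v) \<in> measurable M (borel \<Otimes>\<^sub>M borel \<Otimes>\<^sub>M count_space UNIV)" for v
  unfolding full_hist_def
  by (rule measurable_compose[OF hist_measurable measurable_component_singleton]) simp
qed (auto simp: space_pair_measure)

lemma hist_0: "hist 0 w = (%v. if v = [] then (0, T [] w, 0) else (0, 0, 0))"
 by (rule ext) (auto simp: hist_eq vert_def mtbp_vertices_Nil)

lemma distr_hist_0: "distr M hist_space (hist 0) =
 distr (density lborel (%t. ennreal (f t))) hist_space (%t v. if v = [] then (0, t, 0) else (0, 0, 0))"
proof -
 have D: "distr M lborel (T []) = density lborel (%t. ennreal (f t))"
  using root_type by (simp add: distributed_def)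
 have m: "(%t v. if v = [] then (0, t, 0) else (0, 0, 0)) \<in> measurable lborel hist_space"
 proof (rule measurable_PiM_single')
  show "(%t. if v = [] then (0, t, 0) else (0, 0, 0)) \<in> measurable lborel (borel \<Otimes>\<^sub>M borel \<Otimes>\<^sub>M count_space UNIV)" for v :: vertex
   by (cases "v = []") simp_all
 qed (auto simp: space_pair_measure)
 show ?thesis unfolding D[symmetric] by (subst distr_distr[OF m]) (auto simp: comp_def hist_0[abs_def])
qed

lemma mtbp_tree_full_hist:
 "mtbp_tree (%v. T v w) (%v. d v w) (%v. \<tau> v w) t =
  mtbp_tree (%v. fst (snd (full_hist w v))) (%v. snd (snd (full_hist w v))) (%v. fst (full_hist w v)) t"
 by (rule mtbp_tree_cong[symmetric]) (auto simp: full_hist_def hist_eq vert_def)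

lemma distr_mtbp_tree:
 "distr M tree_space (%w. mtbp_tree (%v. T v w) (%v. d v w) (%v. \<tau> v w) t) =
  distr (distr M hist_space full_hist) tree_space
   (%h. mtbp_tree (%v. fst (snd (h v))) (%v. snd (snd (h v))) (%v. fst (h v)) t)"
proof -
 have "(%h. mtbp_tree (%v. fst (snd (h v))) (%v. snd (snd (h v))) (%v. fst (h v)) t) \<in> measurable hist_space tree_space"
  by (rule mtbp_tree_measurable) measurable
 then show ?thesis by (subst distr_distr) (auto simp: comp_def mtbp_tree_full_hist)
qed

end

lemma prod_emb_hist_space:
 "prod_emb UNIV (%_. borel \<Otimes>\<^sub>M borel \<Otimes>\<^sub>M count_space UNIV) J (Pi\<^sub>E J A) = {h :: vertex => real \<times> real \<times> nat. \<forall>v\<in>J. h v \<in> A v}"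
 by (auto simp: prod_emb_def space_pair_measure PiE_iff restrict_def extensional_def)

text \<open>By the cylinder formula the law of \<open>hist (Suc n)\<close> is a function of the law
  of \<open>hist n\<close>, and the law of \<open>hist 0\<close> is fixed by \<open>f\<close>. A
  finite-dimensional cylinder of \<open>full_hist\<close> is seen by some finite
  \<open>hist n\<close>, and the tree is a measurable function of \<open>full_hist\<close>.\<close>

lemma mtbp_tree_distr_unique:
 assumes "rdcp_mtbp M1 p lam T1 d1 \<tau>1" and "rdcp_mtbp M2 p lam T2 d2 \<tau>2"
 shows "distr M1 tree_space (%w. mtbp_tree (%v. T1 v w) (%v. d1 v w) (%v. \<tau>1 v w) t) =
  distr M2 tree_space (%w. mtbp_tree (%v. T2 v w) (%v. d2 v w) (%v. \<tau>2 v w) t)"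
proof -
 interpret A: rdcp_mtbp M1 p lam T1 d1 \<tau>1 by fact
 interpret B: rdcp_mtbp M2 p lam T2 d2 \<tau>2 by fact
 have step: "distr M1 hist_space (A.hist n) = distr M2 hist_space (B.hist n)" for n
 proof (induction n)
  case 0
  show ?case unfolding A.distr_hist_0 B.distr_hist_0 ..
 next
  case (Suc n)
  show ?case
  proof (rule measure_eqI_PiM_infinite)
   fix A :: "vertex => (real \<times> real \<times> nat) set" and J :: "vertex set"
   assume J: "finite J" and A: "\<And>i. i \<in> J ==> A i \<in> sets (borel \<Otimes>\<^sub>M borel \<Otimes>\<^sub>M count_space UNIV)"
   let ?E = "prod_emb UNIV (%_. borel \<Otimes>\<^sub>M borel \<Otimes>\<^sub>M count_space UNIV) J (Pi\<^sub>E J A)"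
   have E: "?E \<in> sets hist_space" using J A by (intro sets_PiM_I) auto
   have "emeasure (distr M1 hist_space (A.hist (Suc n))) ?E = emeasure M1 {w\<in>space M1. \<forall>v\<in>J. A.hist (Suc n) w v \<in> A v}"
    by (subst emeasure_distr[OF A.hist_measurable E]) (auto simp: prod_emb_hist_space intro!: arg_cong[where f="emeasure M1"])
   moreover have "emeasure (distr M2 hist_space (B.hist (Suc n))) ?E = emeasure M2 {w\<in>space M2. \<forall>v\<in>J. B.hist (Suc n) w v \<in> A v}"
    by (subst emeasure_distr[OF B.hist_measurable E]) (auto simp: prod_emb_hist_space intro!: arg_cong[where f="emeasure M2"])
   ultimately show "emeasure (distr M1 hist_space (A.hist (Suc n))) ?E = emeasure (distr M2 hist_space (B.hist (Suc n))) ?E"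
    using A.emeasure_hist_cylinder[where n=n, OF J A] B.emeasure_hist_cylinder[where n=n, OF J A] Suc by simp
  qed (auto intro: A.finite_measure_distr)
 qed
 have "distr M1 hist_space A.full_hist = distr M2 hist_space B.full_hist"
 proof (rule measure_eqI_PiM_infinite)
  fix A :: "vertex => (real \<times> real \<times> nat) set" and J :: "vertex set"
  assume J: "finite J" and A: "\<And>i. i \<in> J ==> A i \<in> sets (borel \<Otimes>\<^sub>M borel \<Otimes>\<^sub>M count_space UNIV)"
  let ?E = "prod_emb UNIV (%_. borel \<Otimes>\<^sub>M borel \<Otimes>\<^sub>M count_space UNIV) J (Pi\<^sub>E J A)"
  have E: "?E \<in> sets hist_space" using J A by (intro sets_PiM_I) auto
  define n where "n = Suc (Max (length ` J))"
  have n: "length v < n" if "v \<in> J" for v using J that by (simp add: n_def less_Suc_eq_le)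
  have eA: "(\<forall>v\<in>J. A.full_hist w v \<in> A v) \<longleftrightarrow> (\<forall>v\<in>J. A.hist n w v \<in> A v)" for w
   using A.full_hist_eq[OF n] by simp
  have eB: "(\<forall>v\<in>J. B.full_hist w v \<in> A v) \<longleftrightarrow> (\<forall>v\<in>J. B.hist n w v \<in> A v)" for w
   using B.full_hist_eq[OF n] by simp
  have "emeasure (distr M1 hist_space A.full_hist) ?E = emeasure (distr M1 hist_space (A.hist n)) ?E"
   using E n by (simp add: emeasure_distr prod_emb_hist_space vimage_def eA)
  also have "... = emeasure (distr M2 hist_space (B.hist n)) ?E" by (simp add: step)
  also have "... = emeasure (distr M2 hist_space B.full_hist) ?E"
   using E n by (simp add: emeasure_distr prod_emb_hist_space vimage_def eB)
  finally show "emeasure (distr M1 hist_space A.full_hist) ?E = emeasure (distr M2 hist_space B.full_hist) ?E" .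
 qed (auto intro: A.finite_measure_distr)
 then show ?thesis unfolding A.distr_mtbp_tree B.distr_mtbp_tree by simp
qed

section \<open>Poisson points have independent exponential gaps\<close>

text \<open>Peels off the first member of an i.i.d. sequence; all inductions along a Poisson process
  go through this step.\<close>

lemma (in sequence_space) nn_integral_iter:
 assumes [measurable]: "h \<in> bmeas (\<Pi>\<^sub>M i\<in>UNIV. M)"
 shows "(\<integral>\<^sup>+w. h w \<partial>(\<Pi>\<^sub>M i\<in>UNIV. M)) = (\<integral>\<^sup>+s. \<integral>\<^sup>+w. h (case_nat s w) \<partial>(\<Pi>\<^sub>M i\<in>UNIV. M) \<partial>M)"
proof -
 have "(\<integral>\<^sup>+w. h w \<partial>(\<Pi>\<^sub>M i\<in>UNIV. M)) =
   (\<integral>\<^sup>+w. h w \<partial>distr (M \<Otimes>\<^sub>M (\<Pi>\<^sub>M i\<in>UNIV. M)) (\<Pi>\<^sub>M i\<in>UNIV. M) (%(s, w). case_nat s w))"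
  by (simp add: PiM_iter)
 also have "... = (\<integral>\<^sup>+x. h (case x of (s, w) => case_nat s w) \<partial>(M \<Otimes>\<^sub>M (\<Pi>\<^sub>M i\<in>UNIV. M)))"
  by (rule nn_integral_distr) measurable
 also have "... = (\<integral>\<^sup>+s. \<integral>\<^sup>+w. h (case_nat s w) \<partial>(\<Pi>\<^sub>M i\<in>UNIV. M) \<partial>M)"
  by (subst nn_integral_fst[symmetric]) auto
 finally show ?thesis .
qed

definition expo :: "real measure" where "expo = density lborel (exponential_density 1)"

lemma sets_expo [simp, measurable_cong]: "sets expo = sets borel" and space_expo [simp]: "space expo = UNIV"
 by (simp_all add: expo_def)

lemma prob_space_expo: "prob_space expo"
 unfolding expo_def by (rule prob_space_exponential_density) simp

definition gaps :: "(nat => real) measure" where "gaps = (\<Pi>\<^sub>M i\<in>UNIV. expo)"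

lemma sets_gaps [simp, measurable_cong]: "sets gaps = sets (seq_space :: (nat => real) measure)"
 unfolding gaps_def by (rule sets_PiM_cong) auto

interpretation expo: prob_space expo by (rule prob_space_expo)
interpretation gaps_seq: sequence_space expo ..

lemma space_gaps [simp]: "space gaps = UNIV"
 by (simp add: gaps_def space_PiM)

lemma prob_space_gaps: "prob_space gaps"
 unfolding gaps_def by (rule gaps_seq.P.prob_space_axioms)

lemma nn_integral_gaps_iter:
 assumes "h \<in> bmeas (seq_space :: (nat => real) measure)"
 shows "(\<integral>\<^sup>+w. h w \<partial>gaps) = (\<integral>\<^sup>+s. \<integral>\<^sup>+w. h (case_nat s w) \<partial>gaps \<partial>expo)"
 unfolding gaps_def using assms
 by (intro gaps_seq.nn_integral_iter) (simp add: measurable_cong_sets[OF sets_gaps[unfolded gaps_def] refl])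

lemma nn_integral_expo:
 assumes [measurable]: "h \<in> bmeas borel"
 shows "(\<integral>\<^sup>+s. h s \<partial>expo) = (\<integral>\<^sup>+s. ennreal (exp (- s)) * indicator {0..} s * h s \<partial>lborel)"
 unfolding expo_def
 by (subst nn_integral_density) (auto simp: exponential_density_def intro!: nn_integral_cong split: split_indicator)

text \<open>The starting point \<open>x\<close> is a parameter so that the process can be restarted
  at one of its own points.\<close>

definition psum :: "real => (nat => real) => nat => real" where
 "psum x w j = x + (\<Sum>i\<le>j. w i)"

lemma psum_case_nat [simp]:
 "psum x (case_nat s w) 0 = x + s"
 "psum x (case_nat s w) (Suc j) = psum (x + s) w j"
 unfolding psum_def sum.atMost_Suc_shift by simp_all

lemma psum_Suc: "psum x w (Suc j) = psum x w j + w (Suc j)" and psum_0: "psum x w 0 = x + w 0"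
 by (simp_all add: psum_def)

lemma psum_measurable [measurable]: "(%w. psum x w j) \<in> bmeas seq_space"
 unfolding psum_def by measurable

lemma psum_measurable' [measurable]: "psum x \<in> measurable seq_space seq_space"
 by (rule measurable_PiM_single') auto

definition arrivals :: "(nat => real) measure" where
 "arrivals = distr gaps seq_space (psum 0)"

lemma sets_arrivals [simp, measurable_cong]: "sets arrivals = sets (seq_space :: (nat => real) measure)"
 by (simp add: arrivals_def)

lemma space_arrivals [simp]: "space arrivals = UNIV"
 by (simp add: arrivals_def space_PiM)

lemma prob_space_arrivals: "prob_space arrivals"
 unfolding arrivals_def by (rule prob_space.prob_space_distr[OF prob_space_gaps]) simp

definition increasing_seqs :: "(nat => real) set" where
 "increasing_seqs = {x. 0 < x 0 & (\<forall>j. x j < x (Suc j))}"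

lemma increasing_seqs_strict_mono: "x \<in> increasing_seqs ==> strict_mono x"
 by (simp add: increasing_seqs_def strict_mono_Suc_iff)

lemma AE_gaps_pos: "AE w in gaps. \<forall>i. 0 < w i"
proof -
 have "AE s in expo. 0 < s"
  unfolding expo_def using AE_lborel_singleton[of 0]
  by (subst AE_density) (auto simp: exponential_density_def split: if_splits elim!: eventually_mono)
 then have "AE w in gaps. 0 < w i" for i
  unfolding gaps_def by (intro AE_PiM_component) (auto intro: prob_space_expo)
 then show ?thesis by (simp add: AE_all_countable)
qed

lemma AE_arrivals_increasing: "AE x in arrivals. x \<in> increasing_seqs"
proof -
 have m: "{x \<in> space seq_space. x \<in> increasing_seqs} \<in> sets (seq_space :: (nat => real) measure)"
  unfolding increasing_seqs_def mem_Collect_eq by measurable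
 have "AE w in gaps. psum 0 w \<in> increasing_seqs"
  using AE_gaps_pos by eventually_elim (simp add: increasing_seqs_def psum_0 psum_Suc)
 then show ?thesis unfolding arrivals_def by (subst AE_distr_iff[OF _ m]) auto
qed

text \<open>Events that can be read both from the gaps and from counts in disjoint Borel sets: point
  number \<open>i\<close> lies in interval number \<open>i\<close> for \<open>i < n\<close>, and
  there is no further point up to \<open>c\<close>.\<close>

definition abox :: "nat => (nat => real) => (nat => real) => real => (nat => real) set" where
 "abox n a b c = {x \<in> increasing_seqs. (\<forall>i<n. a i < x i & x i <= b i) & c < x n}"

text \<open>The intervals follow one another inside [0, c]. Empty intervals are allowed, so that the
  class of boxes is closed under intersection.\<close>

definition ordered_box :: "nat => (nat => real) => (nat => real) => real => bool" where
 "ordered_box n a b c \<longleftrightarrow> 0 <= c & (\<forall>i<n. 0 <= a i & b i <= c & (Suc i < n --> b i <= a (Suc i)))"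

lemma increasing_seqs_measurable: "increasing_seqs \<in> sets (seq_space :: (nat => real) measure)"
proof -
 have "{x \<in> space seq_space. 0 < x 0 & (\<forall>j. x j < x (Suc j))} \<in> sets (seq_space :: (nat => real) measure)"
  by measurable
 then show ?thesis by (simp add: increasing_seqs_def space_PiM)
qed

lemma box_measurable: "abox n a b c \<in> sets (seq_space :: (nat => real) measure)"
proof -
 have "{x \<in> space seq_space. (\<forall>i\<in>{..<n}. a i < x i & x i <= b i) & c < x n} \<in> sets (seq_space :: (nat => real) measure)"
  by measurable
 then have "increasing_seqs \<inter> {x. (\<forall>i\<in>{..<n}. a i < x i & x i <= b i) & c < x n} \<in> sets (seq_space :: (nat => real) measure)"
  by (intro sets.Int increasing_seqs_measurable) (simp add: space_PiM)
 also have "increasing_seqs \<inter> {x. (\<forall>i\<in>{..<n}. a i < x i & x i <= b i) & c < x n} = abox n a b c"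
  by (auto simp: abox_def)
 finally show ?thesis .
qed

text \<open>The first gap is peeled off and the process restarted at \<open>x + s\<close>. The
  exponential density \<open>exp (- s)\<close> cancels against \<open>exp (x + s - c)\<close>, so
  every point contributes only the length of its interval.\<close>

lemma gaps_box:
 assumes "\<And>i. i < n ==> x <= a i & a i < b i & b i <= c & (Suc i < n --> b i <= a (Suc i))" and "x <= c"
 shows "(\<integral>\<^sup>+w. of_bool ((\<forall>i<n. a i < psum x w i & psum x w i <= b i) & c < psum x w n) \<partial>gaps) =
  ennreal (exp (x - c) * (\<Prod>i<n. b i - a i))"
 using assms
proof (induction n arbitrary: x a b)
 case 0
 have "(\<integral>\<^sup>+w. of_bool (c < psum x w 0) \<partial>gaps) = (\<integral>\<^sup>+s. \<integral>\<^sup>+w. of_bool (c < x + s) \<partial>gaps \<partial>expo)"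
  by (subst nn_integral_gaps_iter) (auto simp: of_bool_def)
 also have "... = (\<integral>\<^sup>+s. of_bool (c < x + s) \<partial>expo)"
  by (simp add: prob_space.emeasure_space_1[OF prob_space_gaps, simplified])
 also have "... = (\<integral>\<^sup>+s. ennreal (exp (- s)) * indicator {c - x..} s \<partial>lborel)"
  using AE_lborel_singleton[of "c - x"] 0
  by (subst nn_integral_expo) (auto simp: of_bool_def intro!: nn_integral_cong_AE split: split_indicator elim!: eventually_mono)
 also have "... = ennreal (0 - (- exp (- (c - x))))"
 proof (rule nn_integral_FTC_atLeast)
  show "((%s::real. - exp (- s)) \<longlongrightarrow> 0) at_top"
   using tendsto_minus[OF filterlim_compose[OF exp_at_bot filterlim_uminus_at_bot_at_top]] by simp
 qed (auto intro!: derivative_eq_intros)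
 finally show ?case by simp
next
 case (Suc n)
 have a0: "x <= a 0" "a 0 < b 0" "b 0 <= c" using Suc.prems(1)[of 0] by auto
 have IH: "(\<integral>\<^sup>+w. of_bool ((\<forall>i<n. a (Suc i) < psum y w i & psum y w i <= b (Suc i)) & c < psum y w n) \<partial>gaps) =
  ennreal (exp (y - c) * (\<Prod>i<n. b (Suc i) - a (Suc i)))" if "y <= b 0" for y
 proof (rule Suc.IH)
  have "b 0 <= a (Suc i)" if "i < n" for i using that
  proof (induction i)
   case 0
   then show ?case using Suc.prems(1)[of 0] by auto
  next
   case (Suc i)
   then show ?case using Suc.prems Suc.IH \<open>\<And>i. i < Suc n ==> x <= a i & a i < b i & b i <= c & (Suc i < Suc n --> b i <= a (Suc i))\<close>[of "Suc i"] by auto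
  qed
  then show "y <= a (Suc i) & a (Suc i) < b (Suc i) & b (Suc i) <= c & (Suc i < n --> b (Suc i) <= a (Suc (Suc i)))" if "i < n" for i
   using Suc.prems(1)[of "Suc i"] that \<open>y <= b 0\<close> by (auto intro: order_trans)
  show "y <= c" using that a0 by simp
 qed
 have P0: "0 <= (\<Prod>i<n. b (Suc i) - a (Suc i))" using Suc.prems(1) by (intro prod_nonneg) (auto simp: less_imp_le)
 have all: "(\<forall>i<Suc n. P i) \<longleftrightarrow> P 0 & (\<forall>i<n. P (Suc i))" for P by (auto simp: less_Suc_eq_0_disj)
 have "(\<integral>\<^sup>+w. of_bool ((\<forall>i<Suc n. a i < psum x w i & psum x w i <= b i) & c < psum x w (Suc n)) \<partial>gaps) =
   (\<integral>\<^sup>+s. \<integral>\<^sup>+w. of_bool ((\<forall>i<Suc n. a i < psum x (case_nat s w) i & psum x (case_nat s w) i <= b i) & c < psum x (case_nat s w) (Suc n)) \<partial>gaps \<partial>expo)"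
 proof (rule nn_integral_gaps_iter)
  have "Measurable.pred seq_space (%w. (\<forall>i\<in>{..<Suc n}. a i < psum x w i & psum x w i <= b i) & c < psum x w (Suc n))"
   by measurable
  then show "(%w. of_bool ((\<forall>i<Suc n. a i < psum x w i & psum x w i <= b i) & c < psum x w (Suc n)) :: ennreal) \<in> bmeas seq_space"
   unfolding of_bool_def by (simp add: Ball_def)
 qed
 also have "... = (\<integral>\<^sup>+s. of_bool (a 0 < x + s & x + s <= b 0) *
   ennreal (exp (x + s - c) * (\<Prod>i<n. b (Suc i) - a (Suc i))) \<partial>expo)"
  unfolding all psum_case_nat
 proof (intro nn_integral_cong)
  show "(\<integral>\<^sup>+w. of_bool (((a 0 < x + s & x + s <= b 0) & (\<forall>i<n. a (Suc i) < psum (x + s) w i & psum (x + s) w i <= b (Suc i))) & c < psum (x + s) w n) \<partial>gaps) =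
   of_bool (a 0 < x + s & x + s <= b 0) * ennreal (exp (x + s - c) * (\<Prod>i<n. b (Suc i) - a (Suc i)))" for s
   by (cases "a 0 < x + s & x + s <= b 0") (auto simp: IH)
 qed
 also have "... = (\<integral>\<^sup>+s. ennreal (exp (x - c) * (\<Prod>i<n. b (Suc i) - a (Suc i))) * indicator {a 0 - x<..b 0 - x} s \<partial>lborel)"
  using a0 P0 by (subst nn_integral_expo)
   (auto simp: of_bool_def ennreal_mult[symmetric] exp_add[symmetric] mult.assoc[symmetric] intro!: nn_integral_cong split: split_indicator)
 also have "... = ennreal (exp (x - c) * (\<Prod>i<n. b (Suc i) - a (Suc i))) * ennreal (b 0 - a 0)"
  using a0 by (subst nn_integral_cmult_indicator) auto
 also have "... = ennreal (exp (x - c) * (\<Prod>i<Suc n. b i - a i))"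
  using a0 P0 unfolding prod.lessThan_Suc_shift by (simp add: ennreal_mult[symmetric] mult_ac)
 finally show ?case .
qed

lemma arrivals_box:
 assumes "ordered_box n a b c" and ab: "\<And>i. i < n ==> a i < b i"
 shows "emeasure arrivals (abox n a b c) = ennreal (exp (- c) * (\<Prod>i<n. b i - a i))"
proof -
 have "emeasure arrivals (abox n a b c) = emeasure gaps (psum 0 -` abox n a b c \<inter> space gaps)"
  unfolding arrivals_def by (rule emeasure_distr) (auto simp: box_measurable)
 also have "... = (\<integral>\<^sup>+w. indicator (psum 0 -` abox n a b c \<inter> space gaps) w \<partial>gaps)"
  using measurable_sets[OF psum_measurable' box_measurable, of 0 n a b c] by (simp add: space_PiM)
 also have "... = (\<integral>\<^sup>+w. of_bool ((\<forall>i<n. a i < psum 0 w i & psum 0 w i <= b i) & c < psum 0 w n) \<partial>gaps)"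
 proof (rule nn_integral_cong_AE, use AE_gaps_pos in eventually_elim)
  case (elim w)
  then have "psum 0 w \<in> increasing_seqs" by (simp add: increasing_seqs_def psum_0 psum_Suc)
  then show ?case by (simp add: abox_def indicator_def)
 qed
 also have "... = ennreal (exp (0 - c) * (\<Prod>i<n. b i - a i))"
  using assms by (intro gaps_box) (auto simp: ordered_box_def)
 finally show ?thesis by simp
qed

text \<open>Without points outside the intervals and with one point in each, the increasing order of
  the points must match the order of the intervals.\<close>

lemma box_counts:
 assumes ord: "ordered_box n a b c" and ab: "\<And>i. i < n ==> a i < b i"
  and x: "strict_mono x" "\<And>j. 0 <= x j"
 shows "((\<forall>i<n. card {j. x j \<in> {a i<..b i}} = 1) & {j. x j \<in> {0..c} - (\<Union>i<n. {a i<..b i})} = {}) \<longleftrightarrow>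
  (\<forall>i<n. a i < x i & x i <= b i) & c < x n"
proof -
 have bc: "b i <= c" if "i < n" for i using ord that by (auto simp: ordered_box_def)
 have sep: "b i <= a m" if "i < m" "m < n" for i m
  using that
 proof (induction m)
  case (Suc m)
  have "b m <= a (Suc m)" using ord Suc.prems by (auto simp: ordered_box_def)
  then show ?case using Suc ab[of m] by (cases "i = m") auto
 qed simp
 have xl: "x i < x j \<longleftrightarrow> i < j" for i j using x(1) by (rule strict_mono_less)
 show ?thesis
 proof
  assume R: "(\<forall>i<n. a i < x i & x i <= b i) & c < x n"
  have big: "c < x j" if "n <= j" for j using R xl[of n j] that by (cases "j = n") auto
  have uniq: "j = i" if "i < n" "a i < x j" "x j <= b i" for i j
  proof (rule ccontr)
   assume "j ~= i"
   have "j < n" using big[of j] bc[OF that(1)] that(3) by (meson leI le_less_trans less_irrefl order_less_le_trans)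
   then have "x j <= b j" "a j < x j" using R by auto
   then show False using sep[of i j] sep[of j i] \<open>j < n\<close> that \<open>j ~= i\<close>
    by (cases i j rule: linorder_cases) auto
  qed
  have "{j. x j \<in> {a i<..b i}} = {i}" if "i < n" for i using R that uniq by auto
  moreover have "x j \<notin> {0..c} - (\<Union>i<n. {a i<..b i})" for j
   using R big[of j] by (cases "j < n") auto
  ultimately show "(\<forall>i<n. card {j. x j \<in> {a i<..b i}} = 1) & {j. x j \<in> {0..c} - (\<Union>i<n. {a i<..b i})} = {}" by auto
 next
  assume Lh: "(\<forall>i<n. card {j. x j \<in> {a i<..b i}} = 1) & {j. x j \<in> {0..c} - (\<Union>i<n. {a i<..b i})} = {}"
  have ex1: "\<exists>j. {j. x j \<in> {a i<..b i}} = {j}" if "i < n" for i using Lh that by (simp add: card_1_singleton_iff)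
  have cov: "\<exists>m<n. a m < x j & x j <= b m" if "x j <= c" for j using Lh x(2)[of j] that by auto
  \<comment> \<open>Let \<open>x j\<close> be the only point in interval \<open>i\<close>. If
    \<open>j < i\<close>, it already lies in interval \<open>j\<close>. If \<open>i < j\<close>,
    then \<open>x i\<close> is below \<open>c\<close> and lies in some interval \<open>m\<close>:
    for \<open>m < i\<close> that interval has a second point, for \<open>m = i\<close> uniqueness
    fails, and for \<open>i < m\<close> the point \<open>x i\<close> exceeds
    \<open>x j\<close>.\<close>
  have in_box: "a i < x i & x i <= b i" if "i < n" for i
   using that
  proof (induction i rule: less_induct)
   case (less i)
   obtain j where j: "{j. x j \<in> {a i<..b i}} = {j}" using ex1[OF less.prems] by auto
   then have jx: "a i < x j" "x j <= b i" by auto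
   have "\<not> j < i"
   proof
    assume "j < i"
    then have "x j <= b j" using less by auto
    then show False using sep[OF \<open>j < i\<close> less.prems] jx by simp
   qed
   moreover have "\<not> i < j"
   proof
    assume "i < j"
    then have xij: "x i < x j" by (simp add: xl)
    then have "x i <= c" using jx bc[OF less.prems] by simp
    then obtain m where m: "m < n" "a m < x i" "x i <= b m" using cov by blast
    consider "m < i" | "m = i" | "i < m" by linarith
    then show False
    proof cases
     case 1
     then have "x m \<in> {a m<..b m}" "x i \<in> {a m<..b m}" using less m by auto
     then have "m = i" using ex1[OF m(1)] by (metis (mono_tags, lifting) mem_Collect_eq singletonD)
     with 1 show False by simp
    next
     case 2
     then have "i \<in> {j. x j \<in> {a i<..b i}}" using m by auto
     with j \<open>i < j\<close> show False by auto
    next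
     case 3
     then show False using sep[OF 3 m(1)] m jx xij by simp
    qed
   qed
   ultimately show ?case using jx by (cases i j rule: linorder_cases) auto
  qed
  have "c < x n"
  proof (rule ccontr)
   assume "\<not> c < x n"
   then obtain m where m: "m < n" "a m < x n" "x n <= b m" using cov[of n] by auto
   then have "n = m" using ex1[OF m(1)] in_box[OF m(1)] by (metis (mono_tags, lifting) greaterThanAtMost_iff mem_Collect_eq singletonD)
   with m show False by simp
  qed
  with in_box show "(\<forall>i<n. a i < x i & x i <= b i) & c < x n" by blast
 qed
qed

text \<open>Equal lengths intersect coordinatewise. For different lengths the longer list of
  intervals governs.\<close>

lemma box_Int:
 assumes "ordered_box n a b c" "ordered_box m a' b' c'"
 shows "\<exists>k a'' b'' c''. abox n a b c \<inter> abox m a' b' c' = abox k a'' b'' c'' & ordered_box k a'' b'' c''"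
proof -
 have lt: "\<exists>k a'' b'' c''. abox n a b c \<inter> abox m a' b' c' = abox k a'' b'' c'' & ordered_box k a'' b'' c''"
  if nm: "n < m" and o: "ordered_box n a b c" "ordered_box m a' b' c'" for n m a b c a' b' c'
 proof -
  \<comment> \<open>The condition \<open>c < x n\<close> of the shorter box becomes a lower bound
    for point number \<open>n\<close> of the longer one.\<close>
  let ?a = "%i. if i < n then max (a i) (a' i) else if i = n then max (a' n) c else a' i"
  let ?b = "%i. if i < n then min (b i) (b' i) else b' i"
  have "abox n a b c \<inter> abox m a' b' c' = abox m ?a ?b c'"
   unfolding abox_def using nm by (auto split: if_splits)
  moreover have "ordered_box m ?a ?b c'"
   unfolding ordered_box_def
  proof (intro conjI allI impI)
   show "0 <= c'" using o by (simp add: ordered_box_def)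
   fix i assume i: "i < m"
   have "0 <= a' i" "b' i <= c'" "Suc i < m ==> b' i <= a' (Suc i)" using o i by (auto simp: ordered_box_def)
   moreover have "a' j <= ?a j" "?b j <= b' j" for j by auto
   ultimately show "0 <= ?a i" "?b i <= c'" "Suc i < m ==> ?b i <= ?a (Suc i)"
    by (meson order_trans)+
  qed
  ultimately show ?thesis by blast
 qed
 consider "n < m" | "m < n" | "n = m" by linarith
 then show ?thesis
 proof cases
  case 1
  then show ?thesis using lt assms by blast
 next
  case 2
  then show ?thesis using lt assms by (subst Int_commute) blast
 next
  case 3
  let ?a = "%i. max (a i) (a' i)" and ?b = "%i. min (b i) (b' i)"
  have "abox n a b c \<inter> abox m a' b' c' = abox n ?a ?b (max c c')"
   unfolding abox_def 3 by auto
  moreover have "ordered_box n ?a ?b (max c c')"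
   using assms unfolding ordered_box_def 3 by (auto simp: min_le_iff_disj le_max_iff_disj)
  ultimately show ?thesis by blast
 qed
qed

definition boxes :: "(nat => real) set set" where
 "boxes = {abox n a b c |n a b c. ordered_box n a b c}"

text \<open>The event that \<open>x n\<close> exceeds \<open>c\<close> is a countable union of
  boxes, since consecutive points of an increasing sequence can be separated by rationals.\<close>

lemma sigma_boxes: "sets (restrict_space seq_space increasing_seqs) = sigma_sets increasing_seqs boxes"
proof -
 have sub: "boxes \<subseteq> Pow increasing_seqs" by (auto simp: boxes_def abox_def)
 let ?N = "sigma increasing_seqs boxes"
 have sN: "space ?N = increasing_seqs" "sets ?N = sigma_sets increasing_seqs boxes" using sub by auto
 have coord: "(%x. x n) \<in> bmeas ?N" for n
 proof (rule borel_measurable_iff_greater[THEN iffD2], rule allI)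
  fix c :: real
  let ?Q = "PiE {..<n} (%_. \<rat> :: real set)"
  \<comment> \<open>The threshold also has to lie above the last separator, as
    \<open>ordered_box\<close> demands; the last separator is below \<open>x n\<close> anyway, so no
    sequence is lost.\<close>
  let ?c = "%q. if n = 0 then max 0 c else max c (q (n - 1))"
  let ?B = "%q :: nat => real. abox n (%i. if i = 0 then 0 else q (i - 1)) q (?c q)"
  let ?Q' = "{q \<in> ?Q. ordered_box n (%i. if i = 0 then 0 else q (i - 1)) q (?c q)}"
  have "countable ?Q'" by (rule countable_subset[OF _ countable_PiE[of "{..<n}" "%_. \<rat>"]]) (auto simp: countable_rat)
  then have "(\<Union>q\<in>?Q'. ?B q) \<in> sigma_sets increasing_seqs boxes"
   using sub by (intro sigma_sets_UNION) (auto simp: boxes_def intro!: sigma_sets.Basic)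
  moreover have "{x \<in> increasing_seqs. c < x n} = (\<Union>q\<in>?Q'. ?B q)"
  proof
   show "(\<Union>q\<in>?Q'. ?B q) \<subseteq> {x \<in> increasing_seqs. c < x n}" by (auto simp: abox_def split: if_splits)
   show "{x \<in> increasing_seqs. c < x n} \<subseteq> (\<Union>q\<in>?Q'. ?B q)"
   proof
    fix x assume "x \<in> {x \<in> increasing_seqs. c < x n}"
    then have x: "x \<in> increasing_seqs" "c < x n" by auto
    have pos: "0 < x j" for j
     using x(1) by (induction j) (auto simp: increasing_seqs_def intro: less_trans)
    have "\<exists>q\<in>\<rat>. x i < q & q < x (Suc i)" for i
     using x(1) by (intro Rats_dense_in_real) (simp add: increasing_seqs_def)
    then obtain q0 where q0: "q0 i \<in> \<rat>" "x i < q0 i" "q0 i < x (Suc i)" for i by metis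
    define q where "q = restrict q0 {..<n}"
    have qQ: "q \<in> ?Q" using q0 by (auto simp: q_def)
    have m: "q0 i <= q0 j" if "i <= j" for i j
    proof (rule lift_Suc_mono_le[OF _ that])
     show "q0 k <= q0 (Suc k)" for k using q0(3)[of k] q0(2)[of "Suc k"] by simp
    qed
    have q0pos: "0 <= q0 i" for i using pos[of i] q0(2)[of i] by simp
    have "ordered_box n (%i. if i = 0 then 0 else q (i - 1)) q (?c q)"
     unfolding ordered_box_def using m q0pos by (auto simp: q_def le_max_iff_disj)
    moreover have "x \<in> ?B q"
    proof -
     have "(if i = 0 then 0 else q (i - 1)) < x i & x i <= q i" if "i < n" for i
      using that pos[of 0] q0(2)[of i] q0(3)[of "i - 1"] by (cases i) (auto simp: q_def less_imp_le)
     moreover have "?c q < x n"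
      using x(2) pos[of 0] q0(3)[of "n - 1"] by (cases n) (auto simp: q_def)
     ultimately show ?thesis using x(1) unfolding abox_def by blast
    qed
    ultimately show "x \<in> (\<Union>q\<in>?Q'. ?B q)" using qQ by blast
   qed
  qed
  ultimately show "{x \<in> space ?N. c < x n} \<in> sets ?N" by (simp add: sN)
 qed
 then have id: "(%x. x) \<in> measurable ?N seq_space"
  by (intro measurable_PiM_single') auto
 show ?thesis
 proof
  show "sigma_sets increasing_seqs boxes \<subseteq> sets (restrict_space seq_space increasing_seqs)"
  proof -
   have "boxes \<subseteq> sets (restrict_space seq_space increasing_seqs)"
   proof
    fix B assume "B \<in> boxes"
    then obtain n a b c where B: "B = abox n a b c" by (auto simp: boxes_def)
    show "B \<in> sets (restrict_space seq_space increasing_seqs)"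
     unfolding sets_restrict_space B by (rule image_eqI[OF _ box_measurable[of n a b c]]) (auto simp: abox_def)
   qed
   then show ?thesis
    using sets.sigma_sets_subset[of boxes "restrict_space seq_space increasing_seqs"]
    by (simp add: space_restrict_space space_PiM)
  qed
  show "sets (restrict_space seq_space increasing_seqs) \<subseteq> sigma_sets increasing_seqs boxes"
  proof
   fix B assume "B \<in> sets (restrict_space (seq_space :: (nat => real) measure) increasing_seqs)"
   then obtain S where S: "S \<in> sets (seq_space :: (nat => real) measure)" "B = increasing_seqs \<inter> S"
    unfolding sets_restrict_space by blast
   have "(%x. x) -` S \<inter> space ?N \<in> sets ?N" by (rule measurable_sets[OF id S(1)])
   moreover have "(%x. x) -` S \<inter> space ?N = B" using S(2) sN(1) by auto
   ultimately show "B \<in> sigma_sets increasing_seqs boxes" using sN(2) by simp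
  qed
 qed
qed

text \<open>The counts determine the probabilities of all boxes, and these agree with the ones
  computed from the exponential gaps. Boxes are stable under intersection and generate the product
  algebra on increasing sequences, so the laws agree.\<close>

lemma (in prob_space) poisson_points_distr:
 assumes X: "poisson_points X"
 shows "distr M seq_space (%w j. X j w) = arrivals"
proof -
 have [measurable]: "X j \<in> bmeas M" for j using X by (auto simp: poisson_points_def)
 have Xm: "(%w j. X j w) \<in> measurable M seq_space"
  by (rule measurable_PiM_single') auto
 have inc: "AE w in M. \<forall>j. 0 <= X j w & X j w < X (Suc j) w" using X by (simp add: poisson_points_def)
 have counts: "prob {w\<in>space M. \<forall>B\<in>F. finite {j. X j w \<in> B} & card {j. X j w \<in> B} = k B} =
    (\<Prod>B\<in>F. exp (- measure lborel B) * measure lborel B ^ k B / fact (k B))"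
  if "finite F" "disjoint F" "\<And>B. B \<in> F ==> B \<in> sets borel & B \<subseteq> {0..} & emeasure lborel B < \<infinity>" for F k
  using X that unfolding poisson_points_def by blast
 \<comment> \<open>The singleton 0 has measure 0, so no point sits there and the first point is
   strictly positive.\<close>
 have "prob {w\<in>space M. \<forall>B\<in>{{0}}. finite {j. X j w \<in> B} & card {j. X j w \<in> B} = 0} = 1"
  by (subst counts) auto
 then have "AE w in M. finite {j. X j w = 0} & card {j. X j w = 0} = 0"
  by (subst (asm) prob_Collect_eq_1) simp_all
 with inc have inc': "AE w in M. (%j. X j w) \<in> increasing_seqs"
 proof eventually_elim
  case (elim w)
  then have "X 0 w ~= 0" by auto
  with elim show ?case by (simp add: increasing_seqs_def less_le)
 qed
 have box_eq: "emeasure (distr M seq_space (%w j. X j w)) (abox n a b c) = emeasure arrivals (abox n a b c)"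
  if ord: "ordered_box n a b c" for n a b c
 proof (cases "\<forall>i<n. a i < b i")
  case False
  then have "abox n a b c = {}" by (force simp: abox_def)
  then show ?thesis by simp
 next
  case True
  then have ab: "a i < b i" if "i < n" for i using that by simp
  have c0: "0 <= c" and a0: "0 <= a i" and bc: "b i <= c" if "i < n" for i using ord that by (auto simp: ordered_box_def)
  have c0: "0 <= c" using ord by (simp add: ordered_box_def)
  have sep: "b i <= a m" if "i < m" "m < n" for i m
   using that
  proof (induction m)
   case (Suc m)
   have "b m <= a (Suc m)" using ord Suc.prems by (auto simp: ordered_box_def)
   then show ?case using Suc ab[of m] by (cases "i = m") auto
  qed simp
  define I where "I i = {a i<..b i}" for i
  \<comment> \<open>\<open>G\<close> collects what the intervals leave uncovered in [0, c]. A box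
    asks for one point in each interval and none in \<open>G\<close>, hence the counts
    \<open>?k\<close> below.\<close>
  define G where "G = {0..c} - (\<Union>i<n. I i)"
  have disjI: "I i \<inter> I m = {}" if "i < n" "m < n" "i ~= m" for i m
   using sep[of i m] sep[of m i] that by (cases i m rule: linorder_cases) (auto simp: I_def)
  have neI: "I i ~= {}" if "i < n" for i using ab[OF that] by (auto simp: I_def)
  have GI: "G \<notin> I ` {..<n}" using neI by (auto simp: G_def)
  have injI: "inj_on I {..<n}" using disjI neI by (auto simp: inj_on_def) (metis inf.idem)
  let ?F = "insert G (I ` {..<n})"
  let ?k = "%B. if B = G then 0 else (1 :: nat)"
  have mI: "measure lborel (I i) = b i - a i" if "i < n" for i using ab[OF that] by (simp add: I_def)
  have mU: "measure lborel (\<Union>i<n. I i) = (\<Sum>i<n. b i - a i)"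
  proof -
   have fm: "I i \<in> fmeasurable lborel" if "i < n" for i
    using ab[OF that] by (auto simp: fmeasurable_def I_def)
   have "measure lborel (\<Union>i<n. I i) = (\<Sum>i<n. measure lborel (I i))"
    using disjI fm by (intro measure_UNION') (auto simp: pairwise_def disjnt_def)
   then show ?thesis by (simp add: mI)
  qed
  have subU: "(\<Union>i<n. I i) \<subseteq> {0..c}" using a0 bc by (fastforce simp: I_def)
  have mG: "measure lborel G = c - (\<Sum>i<n. b i - a i)"
  proof -
   have "(\<Union>i<n. I i) \<in> sets lborel" by (auto simp: I_def)
   then show ?thesis unfolding G_def using c0 subU by (subst measure_Diff) (simp_all add: mU)
  qed
  have "prob {w\<in>space M. \<forall>B\<in>?F. finite {j. X j w \<in> B} & card {j. X j w \<in> B} = ?k B} =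
    (\<Prod>B\<in>?F. exp (- measure lborel B) * measure lborel B ^ ?k B / fact (?k B))"
  proof (rule counts)
   show "disjoint ?F"
    using disjI by (auto simp: disjoint_def G_def)
   fix B assume "B \<in> ?F"
   then consider "B = G" | i where "i < n" "B = I i" by blast
   then have "B \<in> sets borel & B \<subseteq> {0..c}"
   proof cases
    case 1
    then show ?thesis by (auto simp: G_def I_def)
   next
    case 2
    then have "B \<subseteq> {0..c}" using subU by blast
    with 2 show ?thesis by (simp add: I_def)
   qed
   then have "B \<in> sets borel & B \<subseteq> {0..} & emeasure lborel B <= emeasure lborel {0..c}"
    by (auto intro: emeasure_mono)
   then show "B \<in> sets borel & B \<subseteq> {0..} & emeasure lborel B < \<infinity>" using c0 by (auto simp: le_less_trans)
  qed simp
  also have "... = exp (- measure lborel G) * (\<Prod>B\<in>I ` {..<n}. exp (- measure lborel B) * measure lborel B)"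
   using GI by (subst prod.insert) (auto intro!: prod.cong)
  also have "(\<Prod>B\<in>I ` {..<n}. exp (- measure lborel B) * measure lborel B) = (\<Prod>i<n. exp (- (b i - a i)) * (b i - a i))"
   by (subst prod.reindex[OF injI]) (auto simp: mI intro!: prod.cong)
  also have "exp (- measure lborel G) * (\<Prod>i<n. exp (- (b i - a i)) * (b i - a i)) = exp (- c) * (\<Prod>i<n. b i - a i)"
  proof -
   have "(\<Prod>i<n. exp (- (b i - a i))) = exp (- (\<Sum>i<n. b i - a i))"
    by (simp only: exp_sum[symmetric, OF finite_lessThan] sum_negf)
   then have "exp (- measure lborel G) * (\<Prod>i<n. exp (- (b i - a i)) * (b i - a i)) =
     (exp (- (c - (\<Sum>i<n. b i - a i))) * exp (- (\<Sum>i<n. b i - a i))) * (\<Prod>i<n. b i - a i)"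
    unfolding prod.distrib mG by (simp only: mult.assoc)
   also have "exp (- (c - (\<Sum>i<n. b i - a i))) * exp (- (\<Sum>i<n. b i - a i)) = exp (- c)"
    by (simp only: exp_add[symmetric]) simp
   finally show ?thesis .
  qed
  finally have pr: "prob {w\<in>space M. \<forall>B\<in>?F. finite {j. X j w \<in> B} & card {j. X j w \<in> B} = ?k B} = exp (- c) * (\<Prod>i<n. b i - a i)" .
  have meas: "{w\<in>space M. \<forall>B\<in>?F. finite {j. X j w \<in> B} & card {j. X j w \<in> B} = ?k B} \<in> sets M"
  proof (rule sets.sets_Collect_finite_All)
   fix B assume "B \<in> ?F"
   then have [measurable]: "B \<in> sets borel" by (auto simp: G_def I_def)
   show "{w\<in>space M. finite {j. X j w \<in> B} & card {j. X j w \<in> B} = ?k B} \<in> sets M" by measurable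
  qed simp
  have "emeasure (distr M seq_space (%w j. X j w)) (abox n a b c) = emeasure M {w\<in>space M. (%j. X j w) \<in> abox n a b c}"
   by (subst emeasure_distr[OF Xm box_measurable]) (auto intro!: arg_cong[where f="emeasure M"])
  also have "... = emeasure M {w\<in>space M. \<forall>B\<in>?F. finite {j. X j w \<in> B} & card {j. X j w \<in> B} = ?k B}"
  proof (rule emeasure_eq_AE[OF _ _ meas])
   show "{w\<in>space M. (%j. X j w) \<in> abox n a b c} \<in> sets M"
    using measurable_sets[OF Xm box_measurable, of n a b c] by (simp add: vimage_def Int_def conj_commute)
   show "AE w in M. (w \<in> {w\<in>space M. (%j. X j w) \<in> abox n a b c}) =
     (w \<in> {w\<in>space M. \<forall>B\<in>?F. finite {j. X j w \<in> B} & card {j. X j w \<in> B} = ?k B})"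
    using inc inc'
   proof eventually_elim
    case (elim w)
    let ?x = "%j. X j w"
    have "(\<forall>B\<in>?F. finite {j. ?x j \<in> B} & card {j. ?x j \<in> B} = ?k B) \<longleftrightarrow>
     ((\<forall>i<n. card {j. ?x j \<in> I i} = 1) & {j. ?x j \<in> G} = {})"
     using GI by (auto simp: image_iff intro: card_ge_0_finite)
    also have "... \<longleftrightarrow> (\<forall>i<n. a i < ?x i & ?x i <= b i) & c < ?x n"
     unfolding I_def G_def using elim by (intro box_counts ord ab increasing_seqs_strict_mono) auto
    finally show ?case using elim by (simp add: abox_def)
   qed
  qed
  also have "... = ennreal (exp (- c) * (\<Prod>i<n. b i - a i))" by (simp only: emeasure_eq_measure pr)
  also have "... = emeasure arrivals (abox n a b c)" by (rule arrivals_box[symmetric, OF ord ab])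
  finally show ?thesis .
 qed
 have full: "abox 0 (%_. 0) (%_. 0) 0 = increasing_seqs" by (auto simp: abox_def increasing_seqs_def)
 show ?thesis
 proof (rule measure_eqI_restrict_generator[where E=boxes and \<Omega>=increasing_seqs and A="{increasing_seqs}"])
  show "Int_stable boxes" unfolding Int_stable_def
  proof (intro ballI)
   fix A B assume "A \<in> boxes" "B \<in> boxes"
   then obtain n a b c m a' b' c' where "A = abox n a b c" "B = abox m a' b' c'"
    "ordered_box n a b c" "ordered_box m a' b' c'"
    unfolding boxes_def by blast
   then show "A \<inter> B \<in> boxes" unfolding boxes_def using box_Int[of n a b c m a' b' c'] by auto
  qed
  show "boxes \<subseteq> Pow increasing_seqs" by (auto simp: boxes_def abox_def)
  show "emeasure (distr M seq_space (%w j. X j w)) B = emeasure arrivals B" if "B \<in> boxes" for B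
   using that box_eq by (auto simp: boxes_def)
  show "AE x in distr M seq_space (%w j. X j w). x \<in> increasing_seqs"
   using inc' increasing_seqs_measurable by (subst AE_distr_iff[OF Xm]) (auto simp: space_PiM)
  show "{increasing_seqs} \<subseteq> boxes"
  proof -
   have "ordered_box 0 (%_. 0) (%_. 0) 0" by (simp add: ordered_box_def)
   then show ?thesis unfolding boxes_def using full by blast
  qed
  show "sets (restrict_space arrivals increasing_seqs) = sigma_sets increasing_seqs boxes"
   using sigma_boxes by (simp add: sets_restrict_space)
  show "sets (restrict_space (distr M seq_space (%w j. X j w)) increasing_seqs) = sigma_sets increasing_seqs boxes"
   using sigma_boxes by (simp add: sets_restrict_space)
 qed (auto simp: AE_arrivals_increasing increasing_seqs_measurable emeasure_distr[OF Xm] )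
qed

section \<open>A vertex with independent marks on its children\<close>

lemma nn_integral_expo_shift:
 fixes x :: real
 assumes [measurable]: "h \<in> bmeas borel"
 shows "(\<integral>\<^sup>+s. h (x + s) \<partial>expo) = (\<integral>\<^sup>+y. ennreal (exp (- (y - x))) * of_bool (x <= y) * h y \<partial>lborel)"
proof -
 have "(\<integral>\<^sup>+s. h (x + s) \<partial>expo) = (\<integral>\<^sup>+s. ennreal (exp (- s)) * indicator {0..} s * h (x + s) \<partial>lborel)"
  by (rule nn_integral_expo) measurable
 also have "... = (\<integral>\<^sup>+s. (%y. ennreal (exp (- (y - x))) * of_bool (x <= y) * h y) (x + 1 * s) \<partial>lborel)"
  by (intro nn_integral_cong) (auto simp: indicator_def)
 also have "... = (\<integral>\<^sup>+y. ennreal (exp (- (y - x))) * of_bool (x <= y) * h y \<partial>lborel)"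
  by (subst nn_integral_real_affine[where c=1 and t=x, of "%y. ennreal (exp (- (y - x))) * of_bool (x <= y) * h y"]) auto
 finally show ?thesis .
qed

definition shift :: "nat => (nat => 'a) => nat => 'a" where "shift m w i = w (m + i)"

lemma shift_case_nat [simp]: "shift (Suc m) (case_nat x w) = shift m w" "shift 0 w = w"
 by (auto simp: shift_def)

lemma shift_measurable [measurable]: "shift m \<in> measurable (\<Pi>\<^sub>M i\<in>UNIV. N) (\<Pi>\<^sub>M i\<in>UNIV. N)"
 by (rule measurable_PiM_single') (auto simp: shift_def space_PiM)

abbreviation seqs :: "((nat => real) \<times> (nat => ereal)) measure" where
 "seqs \<equiv> seq_space \<Otimes>\<^sub>M seq_space"

definition av :: "real => (nat => real) \<times> (nat => ereal) => nat => bool" where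
 "av x e j \<longleftrightarrow> ereal (psum x (fst e) j) <= snd e j"

lemma av_case_nat: "av x (case_nat s w, case_nat r m) 0 \<longleftrightarrow> ereal (x + s) <= r"
 "av x (case_nat s w, case_nat r m) (Suc j) \<longleftrightarrow> av (x + s) (w, m) j"
 by (simp_all add: av_def)

lemma psum_measurable2 [measurable (raw)]:
 assumes [measurable]: "f \<in> bmeas N" and g: "g \<in> measurable N seq_space"
 shows "(%z. psum (f z) (g z) j) \<in> bmeas N"
proof -
 have [measurable]: "(%z. g z i) \<in> bmeas N" for i
  by (rule measurable_compose[OF g measurable_component_singleton]) simp
 show ?thesis unfolding psum_def by measurable
qed

lemma component_measurable2:
 assumes g: "g \<in> measurable N seq_space"
 shows "(%z. g z j) \<in> bmeas N"
 by (rule measurable_compose[OF g measurable_component_singleton]) simp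

lemma av_measurable [measurable (raw)]:
 assumes [measurable]: "f \<in> bmeas N" "g \<in> measurable N seqs"
 shows "Measurable.pred N (%z. av (f z) (g z) j)"
proof -
 have [measurable]: "(%z. psum (f z) (fst (g z)) j) \<in> bmeas N" by (rule psum_measurable2) measurable
 have [measurable]: "(%z. snd (g z) j) \<in> bmeas N" by (rule component_measurable2) measurable
 show ?thesis unfolding av_def by measurable
qed

definition at_pos :: "real => (nat => real) \<times> (nat => ereal) => nat => real \<times> ereal" where
 "at_pos x e j = (psum x (fst e) j, snd e j)"

lemma at_pos_measurable [measurable (raw)]:
 assumes [measurable]: "f \<in> bmeas N" "g \<in> measurable N seqs"
 shows "(%z. at_pos (f z) (g z) j) \<in> measurable N (borel \<Otimes>\<^sub>M borel)"
proof -
 have [measurable]: "(%z. psum (f z) (fst (g z)) j) \<in> bmeas N" by (rule psum_measurable2) measurable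
 have [measurable]: "(%z. snd (g z) j) \<in> bmeas N" by (rule component_measurable2) measurable
 show ?thesis unfolding at_pos_def by measurable
qed

definition shift2 :: "nat => (nat => real) \<times> (nat => ereal) => (nat => real) \<times> (nat => ereal)" where
 "shift2 m e = (shift m (fst e), shift m (snd e))"

lemma shift2_measurable [measurable]: "shift2 m \<in> measurable seqs seqs"
 unfolding shift2_def[abs_def] by measurable

text \<open>A unit Poisson process whose points carry i.i.d. marks of law \<nu>; a point at
  \<open>t\<close> is kept iff its mark is at least \<open>t\<close>, which has probability
  \<open>v t\<close>. So \<open>u\<close>, the integral of \<open>v\<close>, is the mean number of
  kept points. The instances are marks with the law of the phantom times, with the law of an
  iterate, and constantly infinite marks.\<close>

locale marked =
 fixes \<nu> :: "ereal measure" and u :: "real => real" and v :: "real => real"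
 assumes prob_\<nu>: "prob_space \<nu>" and sets_\<nu> [simp, measurable_cong]: "sets \<nu> = sets borel"
  and v: "\<And>t. 0 <= t ==> v t = measure \<nu> {ereal t..}" and v_meas [measurable]: "v \<in> bmeas borel"
  and u_0: "u 0 = 0" and u_deriv: "\<And>t. 0 <= t ==> (u has_real_derivative v t) (at t within {0..})"
  and u_meas [measurable]: "u \<in> bmeas borel"
begin

sublocale N: prob_space \<nu> by (rule prob_\<nu>)
sublocale N_seq: sequence_space \<nu> ..

lemma space_\<nu> [simp]: "space \<nu> = UNIV"
 using sets_eq_imp_space_eq[OF sets_\<nu>] by simp

definition marks :: "(nat => ereal) measure" where "marks = (\<Pi>\<^sub>M i\<in>UNIV. \<nu>)"

lemma sets_marks [simp, measurable_cong]: "sets marks = sets (seq_space :: (nat => ereal) measure)"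
 unfolding marks_def by (rule sets_PiM_cong) auto

lemma prob_marks: "prob_space marks"
 unfolding marks_def by (rule N_seq.P.prob_space_axioms)

definition env_law :: "((nat => real) \<times> (nat => ereal)) measure" where "env_law = gaps \<Otimes>\<^sub>M marks"

lemma sets_env_law [simp, measurable_cong]: "sets env_law = sets seqs"
 unfolding env_law_def by (rule sets_pair_measure_cong) auto

sublocale G: prob_space gaps by (rule prob_space_gaps)
sublocale K: prob_space marks by (rule prob_marks)
sublocale GK: pair_prob_space gaps marks ..
sublocale E: prob_space env_law unfolding env_law_def by (rule GK.prob_space_axioms)

lemma nn_integral_env_law:
 assumes [measurable]: "h \<in> bmeas seqs"
 shows "(\<integral>\<^sup>+e. h e \<partial>env_law) = (\<integral>\<^sup>+w. \<integral>\<^sup>+m. h (w, m) \<partial>marks \<partial>gaps)"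
 unfolding env_law_def by (subst K.nn_integral_fst[symmetric]) auto

lemma nn_integral_marks_iter:
 assumes "h \<in> bmeas (seq_space :: (nat => ereal) measure)"
 shows "(\<integral>\<^sup>+m. h m \<partial>marks) = (\<integral>\<^sup>+r. \<integral>\<^sup>+m. h (case_nat r m) \<partial>marks \<partial>\<nu>)"
 unfolding marks_def using assms
 by (intro N_seq.nn_integral_iter) (simp add: measurable_cong_sets[OF sets_marks[unfolded marks_def] refl])

lemma nn_integral_env_iter:
 assumes [measurable]: "h \<in> bmeas seqs"
 shows "(\<integral>\<^sup>+e. h e \<partial>env_law) =
  (\<integral>\<^sup>+s. \<integral>\<^sup>+r. \<integral>\<^sup>+e. h (case_nat s (fst e), case_nat r (snd e)) \<partial>env_law \<partial>\<nu> \<partial>expo)"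
proof -
 interpret KN: pair_sigma_finite gaps \<nu> ..
 have "(\<integral>\<^sup>+e. h e \<partial>env_law) = (\<integral>\<^sup>+w. \<integral>\<^sup>+m. h (w, m) \<partial>marks \<partial>gaps)"
  by (rule nn_integral_env_law) measurable
 also have "... = (\<integral>\<^sup>+s. \<integral>\<^sup>+w. \<integral>\<^sup>+m. h (case_nat s w, m) \<partial>marks \<partial>gaps \<partial>expo)"
  by (rule nn_integral_gaps_iter) measurable
 also have "... = (\<integral>\<^sup>+s. \<integral>\<^sup>+w. \<integral>\<^sup>+r. \<integral>\<^sup>+m. h (case_nat s w, case_nat r m) \<partial>marks \<partial>\<nu> \<partial>gaps \<partial>expo)"
 proof (intro nn_integral_cong nn_integral_marks_iter)
  fix s :: real and w :: "nat => real"
  have "case_nat s w \<in> space (seq_space :: (nat => real) measure)" by (simp add: space_PiM)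
  then show "(%m. h (case_nat s w, m)) \<in> bmeas seq_space"
   by (rule measurable_compose[OF measurable_Pair1' assms])
 qed
 also have "... = (\<integral>\<^sup>+s. \<integral>\<^sup>+r. \<integral>\<^sup>+w. \<integral>\<^sup>+m. h (case_nat s w, case_nat r m) \<partial>marks \<partial>gaps \<partial>\<nu> \<partial>expo)"
  by (intro nn_integral_cong KN.Fubini'[symmetric]) measurable
 also have "... = (\<integral>\<^sup>+s. \<integral>\<^sup>+r. \<integral>\<^sup>+e. h (case_nat s (fst e), case_nat r (snd e)) \<partial>env_law \<partial>\<nu> \<partial>expo)"
  by (intro nn_integral_cong, subst nn_integral_env_law) auto
 finally show ?thesis .
qed

lemma v_nonneg: "0 <= t ==> 0 <= v t" and v_le_1: "0 <= t ==> v t <= 1"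
 by (simp_all add: v N.prob_le_1)

lemma nn_v: assumes "0 <= t" shows "(\<integral>\<^sup>+r. of_bool (ereal t <= r) \<partial>\<nu>) = ennreal (v t)"
proof -
 have "(\<integral>\<^sup>+r. of_bool (ereal t <= r) \<partial>\<nu>) = (\<integral>\<^sup>+r. indicator {ereal t..} r \<partial>\<nu>)"
  by (intro nn_integral_cong) (auto simp: indicator_def)
 then show ?thesis by (simp add: v[OF assms] N.emeasure_eq_measure)
qed

lemma nn_not_v: assumes "0 <= t" shows "(\<integral>\<^sup>+r. of_bool (\<not> ereal t <= r) \<partial>\<nu>) = ennreal (1 - v t)"
proof -
 have "(\<integral>\<^sup>+r. of_bool (\<not> ereal t <= r) \<partial>\<nu>) = (\<integral>\<^sup>+r. indicator (space \<nu> - {ereal t..}) r \<partial>\<nu>)"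
  by (intro nn_integral_cong) (auto simp: indicator_def)
 also have "... = emeasure \<nu> (space \<nu> - {ereal t..})" by (intro nn_integral_indicator) auto
 finally show ?thesis by (simp add: v[OF assms] N.emeasure_eq_measure N.prob_compl del: space_\<nu>)
qed

lemma u_mono: assumes "0 <= s" "s <= t" shows "u s <= u t"
proof (rule DERIV_nonneg_imp_increasing_open[OF assms(2)])
 show "\<exists>y. (u has_real_derivative y) (at x) & 0 <= y" if "s < x" "x < t" for x
  using u_deriv[of x] v_nonneg[of x] that assms by (auto simp: at_within_atLeast_0)
 show "continuous_on {s..t} u"
  by (rule continuous_on_subset[OF DERIV_continuous_on[OF u_deriv]]) (use assms in auto)
qed

text \<open>The mean number of rejected points up to time \<open>t\<close>.\<close>

definition W :: "real => real" where "W t = t - u t"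

lemma W_mono: assumes "0 <= s" "s <= t" shows "W s <= W t"
proof (rule DERIV_nonneg_imp_increasing_open[OF assms(2)])
 show "\<exists>y. (W has_real_derivative y) (at x) & 0 <= y" if "s < x" "x < t" for x
  using u_deriv[of x] v_le_1[of x] that assms unfolding W_def[abs_def]
  by (intro exI[of _ "1 - v x"]) (auto simp: at_within_atLeast_0 intro!: derivative_eq_intros)
 have "continuous_on {s..t} u"
  by (rule continuous_on_subset[OF DERIV_continuous_on[OF u_deriv]]) (use assms in auto)
 then show "continuous_on {s..t} W" unfolding W_def[abs_def] by (intro continuous_intros)
qed

lemma W_meas [measurable]: "W \<in> bmeas borel"
 unfolding W_def[abs_def] by measurable

lemma W_power_integral:
 assumes "0 <= x" "x <= y"
 shows "(\<integral>\<^sup>+z. ennreal ((1 - v z) * ((W y - W z) ^ c / fact c)) * indicator {x..y} z \<partial>lborel) = ennreal ((W y - W x) ^ Suc c / fact (Suc c))"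
proof -
 have "(\<integral>\<^sup>+z. ennreal ((1 - v z) * ((W y - W z) ^ c / fact c)) * indicator {x..y} z \<partial>lborel) =
   ennreal (- ((W y - W y) ^ Suc c / fact (Suc c)) - (- ((W y - W x) ^ Suc c / fact (Suc c))))"
 proof (rule nn_integral_FTC_within[OF assms(2)])
  fix z assume z: "x <= z" "z <= y"
  show "0 <= (1 - v z) * ((W y - W z) ^ c / fact c)"
   using z assms v_le_1[of z] W_mono[of z y] by (intro mult_nonneg_nonneg divide_nonneg_nonneg zero_le_power) auto
  have D: "(u has_real_derivative v z) (at z within {x..y})"
   using z assms by (intro DERIV_subset[OF u_deriv]) auto
  have "((%z. - ((W y - W z) ^ Suc c / fact (Suc c))) has_real_derivative
    - (real (Suc c) * (- (1 - v z)) * (W y - W z) ^ c / fact (Suc c))) (at z within {x..y})"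
   unfolding W_def[abs_def] by (auto intro!: derivative_eq_intros D simp del: power_Suc of_nat_Suc fact_Suc)
  moreover have "- (real (Suc c) * (- (1 - v z)) * (W y - W z) ^ c / fact (Suc c)) = (1 - v z) * ((W y - W z) ^ c / fact c)"
   unfolding fact_Suc of_nat_mult by (simp add: field_simps del: of_nat_Suc)
  ultimately show "((%z. - ((W y - W z) ^ Suc c / fact (Suc c))) has_real_derivative
    (1 - v z) * ((W y - W z) ^ c / fact c)) (at z within {x..y})" by simp
 qed measurable
 then show ?thesis by simp
qed

text \<open>The contribution of a kept point at \<open>y\<close>: average over its mark, restricted
  to marks that keep it, and over a fresh environment afterwards.\<close>

definition cont :: "((real \<times> ereal) \<times> (nat => real) \<times> (nat => ereal) => ennreal) => real => ennreal" where
 "cont \<Phi> y = (\<integral>\<^sup>+r. of_bool (ereal y <= r) * (\<integral>\<^sup>+e. \<Phi> ((y, r), e) \<partial>env_law) \<partial>\<nu>)"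

lemma cont_measurable [measurable]:
 assumes [measurable]: "\<Phi> \<in> bmeas ((borel \<Otimes>\<^sub>M borel) \<Otimes>\<^sub>M seqs)"
 shows "cont \<Phi> \<in> bmeas borel"
 unfolding cont_def[abs_def] by measurable

text \<open>Exactly \<open>c\<close> rejected points in increasing order between \<open>x\<close>
  and \<open>y\<close> contribute the volume \<open>(W y - W x) ^ c / fact c\<close> of an ordered
  simplex for the measure with density \<open>1 - v\<close>. The induction peels off the first
  rejected point.\<close>

lemma nn_integral_first_available:
 assumes [measurable]: "\<Phi> \<in> bmeas ((borel \<Otimes>\<^sub>M borel) \<Otimes>\<^sub>M seqs)" and "0 <= x"
 shows "(\<integral>\<^sup>+e. of_bool ((\<forall>i<c. \<not> av x e i) & av x e c) * \<Phi> (at_pos x e c, shift2 (Suc c) e) \<partial>env_law) =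
  (\<integral>\<^sup>+y. ennreal (exp (- (y - x)) * ((W y - W x) ^ c / fact c)) * of_bool (x <= y) * cont \<Phi> y \<partial>lborel)"
 using assms(2)
proof (induction c arbitrary: x)
 case 0
 have "(\<integral>\<^sup>+e. of_bool (av x e 0) * \<Phi> (at_pos x e 0, shift2 (Suc 0) e) \<partial>env_law) =
  (\<integral>\<^sup>+s. \<integral>\<^sup>+r. \<integral>\<^sup>+e. of_bool (ereal (x + s) <= r) * \<Phi> ((x + s, r), e) \<partial>env_law \<partial>\<nu> \<partial>expo)"
  by (subst nn_integral_env_iter) (auto simp: av_case_nat at_pos_def shift2_def)
 also have "... = (\<integral>\<^sup>+s. cont \<Phi> (x + s) \<partial>expo)"
  unfolding cont_def by (intro nn_integral_cong nn_integral_cmult) measurable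
 also have "... = (\<integral>\<^sup>+y. ennreal (exp (- (y - x))) * of_bool (x <= y) * cont \<Phi> y \<partial>lborel)"
  by (rule nn_integral_expo_shift) measurable
 finally show ?case by simp
next
 case (Suc c)
 let ?H = "%x. \<integral>\<^sup>+y. ennreal (exp (- (y - x)) * ((W y - W x) ^ c / fact c)) * of_bool (x <= y) * cont \<Phi> y \<partial>lborel"
 have all: "(\<forall>i<Suc c. P i) \<longleftrightarrow> P 0 & (\<forall>i<c. P (Suc i))" for P by (auto simp: less_Suc_eq_0_disj)
 have sp: "AE s in expo. 0 <= s"
  unfolding expo_def by (subst AE_density) (auto simp: exponential_density_def split: if_splits)
 have pm[measurable]: "Measurable.pred seqs (%e. (\<forall>i<c. \<not> av x e i) & av x e c)" for x c
 proof -
  have "Measurable.pred seqs (%e. (\<forall>i\<in>{..<c}. \<not> av x e i) & av x e c)"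
   by measurable
  then show ?thesis by (simp add: Ball_def)
 qed
 have "(\<integral>\<^sup>+e. of_bool ((\<forall>i<Suc c. \<not> av x e i) & av x e (Suc c)) * \<Phi> (at_pos x e (Suc c), shift2 (Suc (Suc c)) e) \<partial>env_law) =
  (\<integral>\<^sup>+s. \<integral>\<^sup>+r. \<integral>\<^sup>+e. of_bool (\<not> ereal (x + s) <= r) * (of_bool ((\<forall>i<c. \<not> av (x + s) e i) & av (x + s) e c)
    * \<Phi> (at_pos (x + s) e c, shift2 (Suc c) e)) \<partial>env_law \<partial>\<nu> \<partial>expo)"
  by (subst nn_integral_env_iter)
   (auto simp: all av_case_nat at_pos_def shift2_def of_bool_conj mult_ac intro!: nn_integral_cong)
 also have "... = (\<integral>\<^sup>+s. \<integral>\<^sup>+r. of_bool (\<not> ereal (x + s) <= r) * ?H (x + s) \<partial>\<nu> \<partial>expo)"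
 proof (rule nn_integral_cong_AE, use sp in eventually_elim)
  case (elim s)
  then have "0 <= x + s" using Suc.prems by simp
  from Suc.IH[OF this] show ?case by (intro nn_integral_cong, subst nn_integral_cmult) auto
 qed
 also have "... = (\<integral>\<^sup>+s. ennreal (1 - v (x + s)) * ?H (x + s) \<partial>expo)"
 proof (rule nn_integral_cong_AE, use sp in eventually_elim)
  case (elim s)
  then have "0 <= x + s" using Suc.prems by simp
  then show ?case by (subst nn_integral_multc) (auto simp: nn_not_v)
 qed
 also have "... = (\<integral>\<^sup>+z. ennreal (exp (- (z - x))) * of_bool (x <= z) * (ennreal (1 - v z) * ?H z) \<partial>lborel)"
  by (rule nn_integral_expo_shift[where h="%z. ennreal (1 - v z) * ?H z"]) measurable
 also have "... = (\<integral>\<^sup>+z. \<integral>\<^sup>+y. ennreal (exp (- (y - x))) * of_bool (x <= y) * cont \<Phi> y *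
   (ennreal ((1 - v z) * ((W y - W z) ^ c / fact c)) * indicator {x..y} z) \<partial>lborel \<partial>lborel)"
 proof (rule nn_integral_cong)
  fix z :: real
  have "ennreal (exp (- (z - x))) * of_bool (x <= z) * (ennreal (1 - v z) * ?H z) =
   (\<integral>\<^sup>+y. ennreal (exp (- (z - x))) * of_bool (x <= z) * (ennreal (1 - v z) *
    (ennreal (exp (- (y - z)) * ((W y - W z) ^ c / fact c)) * of_bool (z <= y) * cont \<Phi> y)) \<partial>lborel)"
   by (simp add: nn_integral_cmult mult.assoc)
  also have "... = (\<integral>\<^sup>+y. ennreal (exp (- (y - x))) * of_bool (x <= y) * cont \<Phi> y *
   (ennreal ((1 - v z) * ((W y - W z) ^ c / fact c)) * indicator {x..y} z) \<partial>lborel)"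
  proof (rule nn_integral_cong)
   fix y :: real
   show "ennreal (exp (- (z - x))) * of_bool (x <= z) * (ennreal (1 - v z) *
    (ennreal (exp (- (y - z)) * ((W y - W z) ^ c / fact c)) * of_bool (z <= y) * cont \<Phi> y)) =
    ennreal (exp (- (y - x))) * of_bool (x <= y) * cont \<Phi> y *
   (ennreal ((1 - v z) * ((W y - W z) ^ c / fact c)) * indicator {x..y} z)"
   proof (cases "x <= z & z <= y")
    case True
    then have nn: "0 <= 1 - v z" "0 <= (W y - W z) ^ c / fact c"
     using Suc.prems v_le_1[of z] W_mono[of z y] by auto
    have "ennreal (exp (- (y - x))) = ennreal (exp (- (z - x))) * ennreal (exp (- (y - z)))"
     by (simp add: ennreal_mult[symmetric] exp_add[symmetric])
    then show ?thesis
     using True unfolding ennreal_mult[OF nn] ennreal_mult[OF exp_ge_zero nn(2)] by (simp only: indicator_def of_bool_def) (simp add: mult_ac)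
   qed (auto simp: indicator_def)
  qed
  finally show "ennreal (exp (- (z - x))) * of_bool (x <= z) * (ennreal (1 - v z) * ?H z) =
   (\<integral>\<^sup>+y. ennreal (exp (- (y - x))) * of_bool (x <= y) * cont \<Phi> y *
   (ennreal ((1 - v z) * ((W y - W z) ^ c / fact c)) * indicator {x..y} z) \<partial>lborel)" .
 qed
 also have "... = (\<integral>\<^sup>+y. \<integral>\<^sup>+z. ennreal (exp (- (y - x))) * of_bool (x <= y) * cont \<Phi> y *
   (ennreal ((1 - v z) * ((W y - W z) ^ c / fact c)) * indicator {x..y} z) \<partial>lborel \<partial>lborel)"
 \<comment> \<open>After the exchange the position \<open>z\<close> of the first rejected point is
   integrated over [x, y] with \<open>y\<close> fixed, which raises the power of \<open>W\<close> by
   one.\<close>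
 proof (rule lborel_pair.Fubini')
  have "(%(y, z). ennreal (exp (- (y - x))) * of_bool (x <= y) * cont \<Phi> y *
   (ennreal ((1 - v z) * ((W y - W z) ^ c / fact c)) * of_bool (x <= z & z <= y))) \<in> bmeas (lborel \<Otimes>\<^sub>M lborel)"
   by measurable
  then show "(%(y, z). ennreal (exp (- (y - x))) * of_bool (x <= y) * cont \<Phi> y *
   (ennreal ((1 - v z) * ((W y - W z) ^ c / fact c)) * indicator {x..y} z)) \<in> bmeas (lborel \<Otimes>\<^sub>M lborel)"
   by (simp add: indicator_def)
 qed
 also have "... = (\<integral>\<^sup>+y. ennreal (exp (- (y - x)) * ((W y - W x) ^ Suc c / fact (Suc c))) * of_bool (x <= y) * cont \<Phi> y \<partial>lborel)"
 proof (rule nn_integral_cong)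
  fix y :: real
  have "(\<integral>\<^sup>+z. ennreal (exp (- (y - x))) * of_bool (x <= y) * cont \<Phi> y *
   (ennreal ((1 - v z) * ((W y - W z) ^ c / fact c)) * indicator {x..y} z) \<partial>lborel) =
   ennreal (exp (- (y - x))) * of_bool (x <= y) * cont \<Phi> y *
   (\<integral>\<^sup>+z. ennreal ((1 - v z) * ((W y - W z) ^ c / fact c)) * indicator {x..y} z \<partial>lborel)"
   by (rule nn_integral_cmult) measurable
  also have "... = ennreal (exp (- (y - x)) * ((W y - W x) ^ Suc c / fact (Suc c))) * of_bool (x <= y) * cont \<Phi> y"
  proof (cases "x <= y")
   case True
   have nn: "0 <= (W y - W x) ^ Suc c / fact (Suc c)" using W_mono[OF Suc.prems True] by (intro divide_nonneg_nonneg zero_le_power) auto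
   show ?thesis unfolding W_power_integral[OF Suc.prems True] ennreal_mult[OF exp_ge_zero nn] by (simp only: mult_ac)
  qed simp
  finally show "(\<integral>\<^sup>+z. ennreal (exp (- (y - x))) * of_bool (x <= y) * cont \<Phi> y *
   (ennreal ((1 - v z) * ((W y - W z) ^ c / fact c)) * indicator {x..y} z) \<partial>lborel) =
   ennreal (exp (- (y - x)) * ((W y - W x) ^ Suc c / fact (Suc c))) * of_bool (x <= y) * cont \<Phi> y" .
 qed
 finally show ?case .
qed

end

section \<open>Successive kept points and the strong Markov property\<close>

definition first :: "real => (nat => real) \<times> (nat => ereal) => nat" where
 "first x e = (LEAST j. av x e j)"

lemma first_measurable [measurable (raw)]:
 assumes [measurable]: "f \<in> bmeas N" "g \<in> measurable N seqs"
 shows "(%z. first (f z) (g z)) \<in> measurable N (count_space UNIV)"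
 unfolding first_def by measurable

lemma av_first: "\<exists>j. av x e j ==> av x e (first x e)" and not_av_first: "i < first x e ==> \<not> av x e i"
 unfolding first_def by (auto intro: LeastI_ex dest: not_less_Least)

text \<open>The index at which the search for element number \<open>k\<close> begins: just after its
  predecessor.\<close>

definition ridx :: "nat set => nat => nat" where
 "ridx A k = (case k of 0 => 0 | Suc k => Suc (nth_elt A k))"

lemma nth_elt_Least: "nth_elt A k = (LEAST i. i \<in> A & ridx A k <= i)"
 by (cases k) (auto simp: ridx_def Suc_le_eq)

text \<open>The first \<open>k\<close> searches all succeed, that is, \<open>A\<close> has at least
  \<open>k\<close> elements; see \<open>below_ridx\<close> and \<open>not_has_nth\<close>. It also
  covers finite sets of kept points, whose probability is not yet known to vanish.\<close>

definition has_nth :: "nat set => nat => bool" where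
 "has_nth A k \<longleftrightarrow> (\<forall>i<k. \<exists>j\<in>A. ridx A i <= j)"

lemma has_nth_Suc: "has_nth A (Suc k) \<longleftrightarrow> has_nth A k & (\<exists>j\<in>A. ridx A k <= j)"
 by (auto simp: has_nth_def less_Suc_eq)

lemma has_nth_0 [simp]: "has_nth A 0" by (simp add: has_nth_def)

lemma nth_elt_in: assumes "has_nth A (Suc k)" shows "nth_elt A k \<in> A" "ridx A k <= nth_elt A k"
proof -
 have "\<exists>i. i \<in> A & ridx A k <= i" using assms by (auto simp: has_nth_Suc)
 from LeastI_ex[OF this] show "nth_elt A k \<in> A" "ridx A k <= nth_elt A k" unfolding nth_elt_Least by auto
qed

lemma below_ridx: "has_nth A k ==> finite {j\<in>A. j < ridx A k} & card {j\<in>A. j < ridx A k} = k"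
proof (induction k)
 case (Suc k)
 have in': "nth_elt A k \<in> A" "ridx A k <= nth_elt A k" using nth_elt_in[OF Suc.prems] by auto
 have "\<not> (j \<in> A & ridx A k <= j)" if "j < nth_elt A k" for j
  using that not_less_Least unfolding nth_elt_Least by blast
 then have "{j\<in>A. j < ridx A (Suc k)} = insert (nth_elt A k) {j\<in>A. j < ridx A k}"
  using in' by (auto simp: ridx_def[of A "Suc k"] less_Suc_eq not_le[symmetric])
 moreover have "nth_elt A k \<notin> {j\<in>A. j < ridx A k}" using in' by auto
 ultimately show ?case using Suc by (simp add: has_nth_Suc)
qed (simp add: ridx_def)

lemma not_has_nth: "\<not> has_nth A k ==> finite A & card A < k"
proof (induction k)
 case (Suc k)
 show ?case
 proof (cases "has_nth A k")
  case True
  then have "A = {j\<in>A. j < ridx A k}" using Suc.prems by (auto simp: has_nth_Suc not_le)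
  then show ?thesis using below_ridx[OF True] by (metis lessI)
 qed (use Suc in auto)
qed simp

definition avs :: "(nat => real) \<times> (nat => ereal) => nat set" where
 "avs e = {j. av 0 e j}"

definition pairs :: "(nat => real) \<times> (nat => ereal) => nat => nat => real \<times> ereal" where
 "pairs e k = (\<lambda>i\<in>{..<k}. at_pos 0 e (nth_elt (avs e) i))"

text \<open>The position from which the search for pair number \<open>k\<close> starts: the
  preceding label, or 0 at the beginning.\<close>

definition lp :: "nat => (nat => real \<times> 'b) => real" where
 "lp k y = (if k = 0 then 0 else fst (y (k - 1)))"

lemma psum_shift: "psum (if m = 0 then x else psum x w (m - 1)) (shift m w) j = psum x w (m + j)"
proof (induction j)
 case 0
 show ?case by (cases m) (simp_all add: psum_def shift_def)
qed (simp add: psum_Suc shift_def)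

lemma lp_pairs: "lp k (pairs e k) = (if ridx (avs e) k = 0 then 0 else psum 0 (fst e) (ridx (avs e) k - 1))"
 by (cases k) (simp_all add: lp_def pairs_def ridx_def at_pos_def)

text \<open>Restarting at the last examined point with the remaining gaps and marks reproduces the
  remaining points of the original process.\<close>

lemma at_pos_rest: "at_pos (lp k (pairs e k)) (shift2 (ridx (avs e) k) e) j = at_pos 0 e (ridx (avs e) k + j)"
 and av_rest: "av (lp k (pairs e k)) (shift2 (ridx (avs e) k) e) j \<longleftrightarrow> ridx (avs e) k + j \<in> avs e"
 using psum_shift[of "ridx (avs e) k" 0 "fst e" j]
 by (simp_all add: at_pos_def av_def shift2_def lp_pairs shift_def avs_def)

lemma ex_av_rest: "(\<exists>j. av (lp k (pairs e k)) (shift2 (ridx (avs e) k) e) j) \<longleftrightarrow> (\<exists>j\<in>avs e. ridx (avs e) k <= j)"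
 unfolding av_rest by (auto simp: le_iff_add)

lemma first_rest:
 assumes "\<exists>j\<in>avs e. ridx (avs e) k <= j"
 shows "ridx (avs e) k + first (lp k (pairs e k)) (shift2 (ridx (avs e) k) e) = nth_elt (avs e) k"
proof -
 let ?m = "ridx (avs e) k"
 have "(LEAST i. i \<in> avs e & ?m <= i) = ?m + (LEAST j. ?m + j \<in> avs e)"
 proof (rule Least_equality)
  from assms obtain j where j: "?m + j \<in> avs e" by (auto simp: le_iff_add)
  then show "?m + (LEAST j. ?m + j \<in> avs e) \<in> avs e & ?m <= ?m + (LEAST j. ?m + j \<in> avs e)"
   using LeastI[of "%j. ?m + j \<in> avs e" j] by simp
  show "?m + (LEAST j. ?m + j \<in> avs e) <= y" if "y \<in> avs e & ?m <= y" for y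
   using that Least_le[of "%j. ?m + j \<in> avs e" "y - ?m"] by auto
 qed
 then show ?thesis unfolding first_def av_rest nth_elt_Least[of "avs e" k] by simp
qed

lemma shift2_shift2: "shift2 a (shift2 b e) = shift2 (b + a) e"
 by (simp add: shift2_def shift_def fun_eq_iff add.assoc)

lemma pairs_Suc: "pairs e (Suc k) = (pairs e k)(k := at_pos 0 e (nth_elt (avs e) k))"
 by (auto simp: pairs_def fun_eq_iff)

lemma nth_elt_measurable:
 assumes "\<And>i. Measurable.pred N (%x. i \<in> A x)"
 shows "(%x. nth_elt (A x) k) \<in> measurable N (count_space UNIV)"
 using assms by (induction k) auto

lemma ridx_measurable:
 assumes "\<And>i. Measurable.pred N (%x. i \<in> A x)"
 shows "(%x. ridx (A x) k) \<in> measurable N (count_space UNIV)"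
proof (cases k)
 case (Suc l)
 have [measurable]: "(%x. nth_elt (A x) l) \<in> measurable N (count_space UNIV)" by (rule nth_elt_measurable[OF assms])
 show ?thesis unfolding Suc ridx_def by simp
qed (simp add: ridx_def)

lemma has_nth_measurable:
 assumes [measurable]: "\<And>i. Measurable.pred N (%x. i \<in> A x)"
 shows "Measurable.pred N (%x. has_nth (A x) k)"
proof -
 have [measurable]: "(%x. ridx (A x) i) \<in> measurable N (count_space UNIV)" for i by (rule ridx_measurable) measurable
 have "Measurable.pred N (%x. \<forall>i\<in>{..<k}. \<exists>j. j \<in> A x & ridx (A x) i <= j)" by measurable
 then show ?thesis by (simp add: has_nth_def Ball_def Bex_def)
qed

lemma avs_measurable [measurable]: "Measurable.pred seqs (%e. i \<in> avs e)"
 unfolding avs_def mem_Collect_eq by measurable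

abbreviation pair_space :: "nat => (nat => real \<times> ereal) measure" where
 "pair_space k \<equiv> \<Pi>\<^sub>M i\<in>{..<k}. borel \<Otimes>\<^sub>M borel"

lemma pairs_measurable: "(%e. pairs e k) \<in> measurable seqs (pair_space k)"
 unfolding pairs_def
proof (rule measurable_restrict)
 fix i
 have n: "(%e. nth_elt (avs e) i) \<in> measurable seqs (count_space UNIV)" by (rule nth_elt_measurable) measurable
 show "(%e. at_pos 0 e (nth_elt (avs e) i)) \<in> measurable seqs (borel \<Otimes>\<^sub>M borel)"
  by (rule measurable_compose_countable[OF _ n]) measurable
qed

lemma lp_measurable [measurable]: "lp k \<in> bmeas (pair_space k)"
proof (cases k)
 case (Suc l)
 have "(%y. fst (y l)) \<in> bmeas (pair_space (Suc l))" by measurable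
 then show ?thesis by (simp add: Suc lp_def[abs_def])
qed (simp add: lp_def[abs_def])

lemma rest_measurable: "(%e. shift2 (ridx (avs e) k) e) \<in> measurable seqs seqs"
proof -
 have n: "(%e. ridx (avs e) k) \<in> measurable seqs (count_space UNIV)" by (rule ridx_measurable) measurable
 show ?thesis by (rule measurable_compose_countable[OF _ n]) measurable
qed

context marked begin

text \<open>Summing over the number of rejected points turns \<open>exp (- (y - x))\<close> into
  \<open>exp (- (u y - u x))\<close>, because the exponential series of \<open>W y - W x\<close>
  compensates the rejected part. This is the thinning property of the Poisson process.\<close>

lemma one_step:
 assumes [measurable]: "\<Phi> \<in> bmeas ((borel \<Otimes>\<^sub>M borel) \<Otimes>\<^sub>M seqs)" and x: "0 <= x"
 shows "(\<integral>\<^sup>+e. of_bool (\<exists>j. av x e j) * \<Phi> (at_pos x e (first x e), shift2 (Suc (first x e)) e) \<partial>env_law) =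
  (\<integral>\<^sup>+y. ennreal (exp (- (u y - u x))) * of_bool (x <= y) * cont \<Phi> y \<partial>lborel)"
proof -
 let ?g = "%c e. of_bool ((\<forall>i<c. \<not> av x e i) & av x e c) * \<Phi> (at_pos x e c, shift2 (Suc c) e)"
 have gm: "?g c \<in> bmeas env_law" for c
 proof -
  have [measurable]: "(%e. at_pos x e c) \<in> measurable seqs (borel \<Otimes>\<^sub>M borel)" by measurable
  have "(%e. of_bool ((\<forall>i\<in>{..<c}. \<not> av x e i) & av x e c) * \<Phi> (at_pos x e c, shift2 (Suc c) e)) \<in> bmeas env_law"
   by measurable
  then show ?thesis by (simp add: Ball_def)
 qed
 have "of_bool (\<exists>j. av x e j) * \<Phi> (at_pos x e (first x e), shift2 (Suc (first x e)) e) = (\<Sum>c. ?g c e)" for e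
 proof (cases "\<exists>j. av x e j")
  case True
  have "?g c e = 0" if "c ~= first x e" for c
   using that not_av_first[of c x e] av_first[OF True] by (cases c "first x e" rule: linorder_cases) auto
  then have "(\<Sum>c. ?g c e) = (\<Sum>c\<in>{first x e}. ?g c e)" by (intro suminf_finite) auto
  also have "... = \<Phi> (at_pos x e (first x e), shift2 (Suc (first x e)) e)"
   using av_first[OF True] not_av_first[of _ x e] by simp
  finally show ?thesis using True by simp
 qed simp
 then have "(\<integral>\<^sup>+e. of_bool (\<exists>j. av x e j) * \<Phi> (at_pos x e (first x e), shift2 (Suc (first x e)) e) \<partial>env_law) =
   (\<integral>\<^sup>+e. (\<Sum>c. ?g c e) \<partial>env_law)" by simp
 also have "... = (\<Sum>c. \<integral>\<^sup>+e. ?g c e \<partial>env_law)" by (rule nn_integral_suminf[OF gm])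
 also have "... = (\<Sum>c. \<integral>\<^sup>+y. ennreal (exp (- (y - x)) * ((W y - W x) ^ c / fact c)) * of_bool (x <= y) * cont \<Phi> y \<partial>lborel)"
  by (simp only: nn_integral_first_available[OF assms])
 also have "... = (\<integral>\<^sup>+y. (\<Sum>c. ennreal (exp (- (y - x)) * ((W y - W x) ^ c / fact c)) * of_bool (x <= y) * cont \<Phi> y) \<partial>lborel)"
  by (rule nn_integral_suminf[symmetric]) measurable
 also have "... = (\<integral>\<^sup>+y. ennreal (exp (- (u y - u x))) * of_bool (x <= y) * cont \<Phi> y \<partial>lborel)"
 proof (rule nn_integral_cong)
  fix y :: real
  show "(\<Sum>c. ennreal (exp (- (y - x)) * ((W y - W x) ^ c / fact c)) * of_bool (x <= y) * cont \<Phi> y) =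
   ennreal (exp (- (u y - u x))) * of_bool (x <= y) * cont \<Phi> y"
  proof (cases "x <= y")
   case True
   have w: "0 <= W y - W x" using W_mono[OF x True] by simp
   have "(%c. exp (- (y - x)) * ((W y - W x) ^ c / fact c)) sums (exp (- (y - x)) * exp (W y - W x))"
    using exp_converges[of "W y - W x"] by (intro sums_mult) (simp add: field_simps)
   then have "(\<Sum>c. ennreal (exp (- (y - x)) * ((W y - W x) ^ c / fact c))) = ennreal (exp (- (y - x)) * exp (W y - W x))"
    using w by (intro suminf_ennreal_eq) auto
   moreover have "exp (- (y - x)) * exp (W y - W x) = exp (- (u y - u x))"
    by (simp add: exp_add[symmetric] W_def)
   ultimately show ?thesis using True by (simp add: ennreal_suminf_multc)
  qed simp
 qed
 finally show ?thesis .
qed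

definition base :: "(real \<times> ereal) measure" where "base = lborel \<Otimes>\<^sub>M \<nu>"

lemma sets_base [simp, measurable_cong]: "sets base = sets (borel \<Otimes>\<^sub>M borel)"
 unfolding base_def by (rule sets_pair_measure_cong) auto

sublocale base: sigma_finite_measure base
 unfolding base_def by (intro sigma_finite_pair_measure lborel.sigma_finite_measure_axioms N.sigma_finite_measure_axioms)

sublocale bases: product_sigma_finite "%_ :: nat. base" ..

lemma sets_bases [simp, measurable_cong]: "sets (\<Pi>\<^sub>M i\<in>I. base) = sets (\<Pi>\<^sub>M i\<in>I. borel \<Otimes>\<^sub>M borel)"
 by (rule sets_PiM_cong) auto

text \<open>The transition density, with respect to Lebesgue measure times \<nu>, from one kept
  point to the next; \<open>weight k\<close> is the resulting density of the first \<open>k\<close>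
  kept points with their marks.\<close>

definition factor :: "nat => (nat => real \<times> ereal) => ennreal" where
 "factor i y = ennreal (exp (- (u (fst (y i)) - u (lp i y)))) * of_bool (lp i y <= fst (y i)) * of_bool (ereal (fst (y i)) <= snd (y i))"

definition weight :: "nat => (nat => real \<times> ereal) => ennreal" where
 "weight k y = (\<Prod>i<k. factor i y)"

lemma factor_measurable: assumes "i < k" shows "factor i \<in> bmeas (pair_space k)"
proof -
 define a r l where "a = (%y :: nat => real \<times> ereal. fst (y i))"
  and "r = (%y :: nat => real \<times> ereal. snd (y i))" and "l = (lp i :: (nat => real \<times> ereal) => real)"
 have [measurable]: "a \<in> bmeas (pair_space k)" "r \<in> bmeas (pair_space k)"
 proof -
  have [measurable]: "(%y. y i) \<in> measurable (pair_space k) (borel \<Otimes>\<^sub>M borel)"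
   using assms by (intro measurable_component_singleton) simp
  show "a \<in> bmeas (pair_space k)" "r \<in> bmeas (pair_space k)"
   unfolding a_def r_def by (auto intro: measurable_compose[OF _ measurable_fst] measurable_compose[OF _ measurable_snd])
 qed
 have [measurable]: "l \<in> bmeas (pair_space k)"
  using assms unfolding l_def by (cases i) (simp_all add: lp_def[abs_def])
 have [measurable]: "Measurable.pred (pair_space k) (%y. l y <= a y)"
  unfolding pred_def by (rule borel_measurable_le) fact+
 have "(%y. ereal (a y)) \<in> bmeas (pair_space k)" by measurable
 then have [measurable]: "Measurable.pred (pair_space k) (%y. ereal (a y) <= r y)"
  unfolding pred_def by (rule borel_measurable_le) fact
 have "factor i = (%y. ennreal (exp (- (u (a y) - u (l y)))) * of_bool (l y <= a y) * of_bool (ereal (a y) <= r y))"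
  by (simp add: factor_def a_def r_def l_def fun_eq_iff)
 also have "... \<in> bmeas (pair_space k)" by measurable
 finally show ?thesis .
qed

lemma weight_measurable [measurable]: "weight k \<in> bmeas (pair_space k)"
 unfolding weight_def[abs_def] by (intro borel_measurable_prod_ennreal factor_measurable) auto

lemma lp_nonneg: "weight k y ~= 0 ==> 0 <= lp k y"
proof (induction k)
 case (Suc k)
 then have "weight k y ~= 0" "factor k y ~= 0" by (auto simp: weight_def)
 then show ?case using Suc.IH by (auto simp: factor_def lp_def[of "Suc k"])
qed (simp add: lp_def)

lemma lp_upd: "lp k (y(k := a)) = lp k y"
 by (cases k) (simp_all add: lp_def)

lemma weight_upd: "weight k (y(k := a)) = weight k y"
 unfolding weight_def by (intro prod.cong refl) (auto simp: factor_def lp_def)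

lemma weight_Suc_upd: "weight (Suc k) (y(k := a)) = weight k y * factor k (y(k := a))"
 using weight_upd[of k y a] by (simp add: weight_def)

text \<open>Given the first \<open>k\<close> kept points, the gaps and marks after the last of them
  form a fresh environment. The induction applies \<open>one_step\<close> to the restarted
  environment.\<close>

lemma strong_markov:
 "\<Phi> \<in> bmeas (pair_space k \<Otimes>\<^sub>M seqs) ==>
  (\<integral>\<^sup>+e. of_bool (has_nth (avs e) k) * \<Phi> (pairs e k, shift2 (ridx (avs e) k) e) \<partial>env_law) =
  (\<integral>\<^sup>+y. weight k y * (\<integral>\<^sup>+e. \<Phi> (y, e) \<partial>env_law) \<partial>(\<Pi>\<^sub>M i\<in>{..<k}. base))"
proof (induction k arbitrary: \<Phi>)
 case 0
 have "pairs e 0 = (%_. undefined)" for e by (simp add: pairs_def restrict_def)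
 then show ?case by (simp add: ridx_def weight_def shift2_def bases.nn_integral_empty)
next
 case (Suc k)
 note \<Phi> [measurable] = Suc.prems
 \<comment> \<open>\<open>\<Psi> c\<close> is the functional seen from the restart if
   \<open>c\<close> points are rejected before the next kept one.\<close>
 define \<Psi> where "\<Psi> c = (%(y, e). \<Phi> (y(k := at_pos (lp k y) e c), shift2 (Suc c) e))" for c
 have ins: "{..<Suc k} = insert k {..<k}" by auto
 have upd: "(%(y, a). y(k := a)) \<in> measurable (pair_space k \<Otimes>\<^sub>M (borel \<Otimes>\<^sub>M borel)) (pair_space (Suc k))"
  unfolding split_beta' ins by (intro measurable_fun_upd[where J="{..<k}"]) auto
 have \<Psi>: "\<Psi> c \<in> bmeas (pair_space k \<Otimes>\<^sub>M seqs)" for c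
 proof -
  have "(%z. (fst z, at_pos (lp k (fst z)) (snd z) c)) \<in> measurable (pair_space k \<Otimes>\<^sub>M seqs) (pair_space k \<Otimes>\<^sub>M (borel \<Otimes>\<^sub>M borel))"
   by measurable
  from measurable_compose[OF this upd]
  have [measurable]: "(%z. (fst z)(k := at_pos (lp k (fst z)) (snd z) c)) \<in> measurable (pair_space k \<Otimes>\<^sub>M seqs) (pair_space (Suc k))"
   by (simp add: split_beta')
  show ?thesis unfolding \<Psi>_def split_beta' by measurable
 qed
 define \<Phi>' where "\<Phi>' = (%z. of_bool (\<exists>j. av (lp k (fst z)) (snd z) j) * \<Psi> (first (lp k (fst z)) (snd z)) z)"
 have \<Phi>'m: "\<Phi>' \<in> bmeas (pair_space k \<Otimes>\<^sub>M seqs)"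
 proof -
  have f: "(%z. first (lp k (fst z)) (snd z)) \<in> measurable (pair_space k \<Otimes>\<^sub>M seqs) (count_space UNIV)" by measurable
  have [measurable]: "(%z. \<Psi> (first (lp k (fst z)) (snd z)) z) \<in> bmeas (pair_space k \<Otimes>\<^sub>M seqs)"
   by (rule measurable_compose_countable[OF \<Psi> f])
  show ?thesis unfolding \<Phi>'_def by measurable
 qed
 have "of_bool (has_nth (avs e) (Suc k)) * \<Phi> (pairs e (Suc k), shift2 (ridx (avs e) (Suc k)) e) =
   of_bool (has_nth (avs e) k) * \<Phi>' (pairs e k, shift2 (ridx (avs e) k) e)" for e
 proof (cases "\<exists>j\<in>avs e. ridx (avs e) k <= j")
  case True
  let ?m = "ridx (avs e) k"
  let ?f = "first (lp k (pairs e k)) (shift2 ?m e)"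
  have m: "?m + ?f = nth_elt (avs e) k" by (rule first_rest[OF True])
  have "ridx (avs e) (Suc k) = ?m + Suc ?f" using m by (simp add: ridx_def[of _ "Suc k"])
  then have "\<Psi> ?f (pairs e k, shift2 ?m e) = \<Phi> (pairs e (Suc k), shift2 (ridx (avs e) (Suc k)) e)"
   unfolding \<Psi>_def by (simp add: at_pos_rest m shift2_shift2 pairs_Suc)
  then show ?thesis using True by (simp add: \<Phi>'_def ex_av_rest has_nth_Suc)
 next
  case False
  then show ?thesis by (simp add: \<Phi>'_def ex_av_rest has_nth_Suc)
 qed
 then have "(\<integral>\<^sup>+e. of_bool (has_nth (avs e) (Suc k)) * \<Phi> (pairs e (Suc k), shift2 (ridx (avs e) (Suc k)) e) \<partial>env_law) =
   (\<integral>\<^sup>+e. of_bool (has_nth (avs e) k) * \<Phi>' (pairs e k, shift2 (ridx (avs e) k) e) \<partial>env_law)" by simp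
 also have "... = (\<integral>\<^sup>+y. weight k y * (\<integral>\<^sup>+e. \<Phi>' (y, e) \<partial>env_law) \<partial>(\<Pi>\<^sub>M i\<in>{..<k}. base))"
  by (rule Suc.IH[OF \<Phi>'m])
 also have "... = (\<integral>\<^sup>+y. (\<integral>\<^sup>+a. weight (Suc k) (y(k := a)) * (\<integral>\<^sup>+e. \<Phi> (y(k := a), e) \<partial>env_law) \<partial>base) \<partial>(\<Pi>\<^sub>M i\<in>{..<k}. base))"
 proof (rule nn_integral_cong)
  fix y assume "y \<in> space (\<Pi>\<^sub>M i\<in>{..<k}. base)"
  then have y: "y \<in> space (pair_space k)" using sets_eq_imp_space_eq[OF sets_bases] by blast
  show "weight k y * (\<integral>\<^sup>+e. \<Phi>' (y, e) \<partial>env_law) = (\<integral>\<^sup>+a. weight (Suc k) (y(k := a)) * (\<integral>\<^sup>+e. \<Phi> (y(k := a), e) \<partial>env_law) \<partial>base)"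
  proof (cases "weight k y = 0")
   case True
   then show ?thesis by (simp add: weight_Suc_upd)
  next
   case False
   have upd_y: "(%a. y(k := a)) \<in> measurable (borel \<Otimes>\<^sub>M borel) (pair_space (Suc k))"
    using measurable_compose[OF measurable_Pair1'[OF y] upd] by simp
   have \<Phi>y [measurable]: "(%(a, e). \<Phi> (y(k := a), e)) \<in> bmeas ((borel \<Otimes>\<^sub>M borel) \<Otimes>\<^sub>M seqs)"
   proof -
    have [measurable]: "(%z. y(k := fst z)) \<in> measurable ((borel \<Otimes>\<^sub>M borel) \<Otimes>\<^sub>M seqs) (pair_space (Suc k))"
     by (rule measurable_compose[OF measurable_fst upd_y])
    show ?thesis unfolding split_beta' by measurable
   qed
   have "(\<integral>\<^sup>+e. \<Phi>' (y, e) \<partial>env_law) =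
    (\<integral>\<^sup>+b. ennreal (exp (- (u b - u (lp k y)))) * of_bool (lp k y <= b) * cont (%(a, e). \<Phi> (y(k := a), e)) b \<partial>lborel)"
    using one_step[OF \<Phi>y lp_nonneg[OF False]] by (simp add: \<Phi>'_def \<Psi>_def)
   also have "... = (\<integral>\<^sup>+b. \<integral>\<^sup>+r. factor k (y(k := (b, r))) * (\<integral>\<^sup>+e. \<Phi> (y(k := (b, r)), e) \<partial>env_law) \<partial>\<nu> \<partial>lborel)"
    unfolding cont_def factor_def lp_upd by (simp add: nn_integral_cmult[symmetric] mult.assoc)
   also have "... = (\<integral>\<^sup>+a. factor k (y(k := a)) * (\<integral>\<^sup>+e. \<Phi> (y(k := a), e) \<partial>env_law) \<partial>base)"
   proof -
    have [measurable]: "(%a. factor k (y(k := a))) \<in> bmeas (borel \<Otimes>\<^sub>M borel)"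
     by (rule measurable_compose[OF upd_y factor_measurable]) simp
    have "(%a. \<integral>\<^sup>+e. (%(a, e). \<Phi> (y(k := a), e)) (a, e) \<partial>env_law) \<in> bmeas (borel \<Otimes>\<^sub>M borel)"
     by measurable
    then have "(%a. factor k (y(k := a)) * (\<integral>\<^sup>+e. \<Phi> (y(k := a), e) \<partial>env_law)) \<in> bmeas (lborel \<Otimes>\<^sub>M \<nu>)"
     by simp
    from N.nn_integral_fst[OF this] show ?thesis unfolding base_def by simp
   qed
   finally have e: "(\<integral>\<^sup>+e. \<Phi>' (y, e) \<partial>env_law) = (\<integral>\<^sup>+a. factor k (y(k := a)) * (\<integral>\<^sup>+e. \<Phi> (y(k := a), e) \<partial>env_law) \<partial>base)" .
   have [measurable]: "(%a. factor k (y(k := a)) * (\<integral>\<^sup>+e. \<Phi> (y(k := a), e) \<partial>env_law)) \<in> bmeas base"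
   proof -
    have [measurable]: "(%a. factor k (y(k := a))) \<in> bmeas (borel \<Otimes>\<^sub>M borel)"
     by (rule measurable_compose[OF upd_y factor_measurable]) simp
    have "(%a. \<integral>\<^sup>+e. (%(a, e). \<Phi> (y(k := a), e)) (a, e) \<partial>env_law) \<in> bmeas (borel \<Otimes>\<^sub>M borel)"
     by measurable
    then show ?thesis by simp
   qed
   show ?thesis unfolding e weight_Suc_upd by (simp add: nn_integral_cmult mult.assoc)
  qed
 qed
 also have "... = (\<integral>\<^sup>+y. weight (Suc k) y * (\<integral>\<^sup>+e. \<Phi> (y, e) \<partial>env_law) \<partial>(\<Pi>\<^sub>M i\<in>{..<Suc k}. base))"
 proof -
  have "(%y. weight (Suc k) y * (\<integral>\<^sup>+e. \<Phi> (y, e) \<partial>env_law)) \<in> bmeas (\<Pi>\<^sub>M i\<in>insert k {..<k}. base)"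
   unfolding ins[symmetric] by measurable
  from bases.product_nn_integral_insert[OF _ _ this] show ?thesis unfolding ins by simp
 qed
 finally show ?case .
qed

end

section \<open>The law of the saturation time\<close>

lemma nn_integral_of_bool:
 assumes "{x \<in> space M. P x} \<in> sets M"
 shows "(\<integral>\<^sup>+x. of_bool (P x) \<partial>M) = emeasure M {x \<in> space M. P x}"
proof -
 have "(\<integral>\<^sup>+x. of_bool (P x) \<partial>M) = (\<integral>\<^sup>+x. indicator {x \<in> space M. P x} x \<partial>M)"
  by (intro nn_integral_cong) (simp add: indicator_def)
 then show ?thesis using assms by simp
qed

text \<open>A count that reaches \<open>k\<close> first does so at time 0 or at a label, so
  countably many candidate times suffice; this form is visibly measurable.\<close>

lemma sat_time_alt:
 "sat_time x s k = (INF i. let t = (case i of 0 => 0 | Suc j => x j) in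
   if 0 <= t & k <= card {j. ereal (x j) <= s j & x j <= t} then ereal t else \<infinity>)"
  (is "_ = (INF i. ?h i)")
proof (rule antisym)
 show "sat_time x s k <= (INF i. ?h i)"
  unfolding sat_time_def by (rule INF_greatest) (auto simp: Let_def intro!: Inf_lower)
 show "(INF i. ?h i) <= sat_time x s k"
  unfolding sat_time_def
 proof (rule Inf_greatest, clarify)
  fix t assume t: "0 <= t" "k <= card {j. ereal (x j) <= s j & x j <= t}"
  define J where "J t = {j. ereal (x j) <= s j & x j <= t}" for t
  have t': "k <= card (J t)" using t by (simp add: J_def)
  show "(INF i. ?h i) <= ereal t"
  proof (cases "k <= card (J 0)")
   case True
   then have "?h 0 <= ereal t" using t by (simp add: J_def)
   then show ?thesis by (rule INF_lower2[OF UNIV_I])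
  next
   case False
   then have "card (J t) ~= 0" using t' by auto
   then have fin: "finite (J t)" and ne: "J t ~= {}" by (auto intro: card_ge_0_finite)
   have "Max (x ` J t) \<in> x ` J t" using fin ne by (intro Max_in) auto
   then obtain i where i: "i \<in> J t" "x i = Max (x ` J t)" by auto
   have xi: "x j <= x i" if "j \<in> J t" for j using fin i that by auto
   have eq: "J (x i) = J t" using xi i(1) by (auto simp: J_def)
   have "0 <= x i"
   proof (rule ccontr)
    assume "\<not> 0 <= x i"
    then have "J t = J 0" using xi t(1) by (force simp: J_def)
    then show False using False t' by simp
   qed
   then have "?h (Suc i) <= ereal t" using t' eq i(1) by (simp add: J_def)
   then show ?thesis by (rule INF_lower2[OF UNIV_I])
  qed
 qed
qed

lemma sat_time_measurable:
 assumes [measurable]: "\<And>j. (%z. x z j) \<in> bmeas N" "\<And>j. (%z. s z j) \<in> bmeas N"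
  "k \<in> measurable N (count_space UNIV)"
 shows "(%z. sat_time (x z) (s z) (k z)) \<in> bmeas N"
 unfolding sat_time_alt
proof (rule borel_measurable_INF)
 fix i :: nat
 have t: "(%z. case i of 0 => 0 | Suc j => x z j) \<in> bmeas N" by (cases i) auto
 define t where "t z = (case i of 0 => 0 | Suc j => x z j)" for z
 have [measurable]: "t \<in> bmeas N" using t unfolding t_def .
 have P: "{z \<in> space N. j \<in> {j. ereal (x z j) <= s z j & x z j <= t z}} \<in> sets N" for j
  unfolding mem_Collect_eq
  by (intro sets.sets_Collect_conj borel_measurable_le borel_measurable_ereal) (use assms in auto)
 define c where "c z = card {j. ereal (x z j) <= s z j & x z j <= t z}" for z
 have [measurable]: "c \<in> measurable N (count_space UNIV)"
  unfolding c_def[abs_def] by (rule measurable_card[OF P])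
 have "Measurable.pred N (%z. n <= c z)" for n
  by (rule measurable_compose[of c N "count_space UNIV" "%m. n <= m"]) auto
 then have [measurable]: "Measurable.pred N (%z. k z <= c z)"
  by (rule measurable_compose_countable[OF _ assms(3)])
 have "(%z. if 0 <= t z & k z <= c z then ereal (t z) else \<infinity>) \<in> bmeas N"
  by measurable
 then show "(%z. let t = case i of 0 => 0 | Suc j => x z j in
   if 0 <= t & k z <= card {j. ereal (x z j) <= s z j & x z j <= t} then ereal t else \<infinity>) \<in> bmeas N"
  unfolding c_def t_def Let_def .
qed simp

lemma sat_time_ge_nth:
 fixes x :: "nat => real" and s :: "nat => ereal"
 assumes x: "strict_mono x" and fin: "\<And>t. finite {j. x j <= t}" and pos: "\<And>j. 0 < x j"
 defines "A \<equiv> {j. ereal (x j) <= s j}"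
 shows "ereal t <= sat_time x s (Suc k) \<longleftrightarrow> \<not> (has_nth A (Suc k) & x (nth_elt A k) < t)"
proof -
 have xl: "x i < x j \<longleftrightarrow> i < j" for i j using x by (rule strict_mono_less)
 have fA: "finite {j\<in>A. x j < t}" by (rule finite_subset[OF _ fin[of t]]) auto
 have "card {j\<in>A. x j < t} < Suc k \<longleftrightarrow> \<not> (has_nth A (Suc k) & x (nth_elt A k) < t)"
 proof (cases "has_nth A (Suc k)")
  case True
  have b: "finite {j\<in>A. j < ridx A (Suc k)}" "card {j\<in>A. j < ridx A (Suc k)} = Suc k" using below_ridx[OF True] by auto
  have r: "ridx A (Suc k) = Suc (nth_elt A k)" by (simp add: ridx_def)
  have nA: "nth_elt A k \<in> A" by (rule nth_elt_in[OF True])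
  show ?thesis
  proof (cases "x (nth_elt A k) < t")
   case lt: True
   have "x j < t" if "j < ridx A (Suc k)" for j
    using that lt xl[of j "nth_elt A k"] unfolding r by (cases "j = nth_elt A k") auto
   then have "{j\<in>A. j < ridx A (Suc k)} \<subseteq> {j\<in>A. x j < t}" by auto
   then have "Suc k <= card {j\<in>A. x j < t}" using card_mono[OF fA] b by metis
   then show ?thesis using True lt by simp
  next
   case False
   have "j < nth_elt A k" if "x j < t" for j using that False xl[of j "nth_elt A k"] by simp
   then have s: "{j\<in>A. x j < t} \<subseteq> {j\<in>A. j < ridx A (Suc k)}" unfolding r by (auto simp: less_Suc_eq)
   have "nth_elt A k \<in> {j\<in>A. j < ridx A (Suc k)}" using nA by (simp add: r)
   moreover have "nth_elt A k \<notin> {j\<in>A. x j < t}" using False by simp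
   ultimately have "{j\<in>A. x j < t} \<subset> {j\<in>A. j < ridx A (Suc k)}" using s by blast
   then have "card {j\<in>A. x j < t} < Suc k" using psubset_card_mono[OF b(1)] b(2) by metis
   then show ?thesis using False by simp
  qed
 next
  case False
  then have "finite A" "card A < Suc k" using not_has_nth by auto
  moreover have "card {j\<in>A. x j < t} <= card A" using calculation by (intro card_mono) auto
  ultimately show ?thesis using False by simp
 qed
 then show ?thesis
  by (subst sat_time_ge_iff[OF fin pos]) (simp_all add: A_def)
qed

text \<open>The probability that a Poisson variable of mean \<open>x\<close> is at most
  \<open>k\<close>.\<close>

definition poisson_tail :: "nat => real => real" where
 "poisson_tail k x = (\<Sum>m\<le>k. exp (- x) * (x ^ m / fact m))"

text \<open>The sum of derivatives telescopes, leaving the last term only.\<close>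

lemma poisson_tail_deriv: "(poisson_tail k has_real_derivative - (exp (- x) * (x ^ k / fact k))) (at x)"
proof (induction k)
 case 0
 have "((%x. exp (- x)) has_real_derivative exp (- x) * - 1) (at x)" by (auto intro!: derivative_eq_intros)
 then show ?case by (simp add: poisson_tail_def[abs_def])
next
 case (Suc k)
 have D1: "((%x. exp (- x)) has_real_derivative - exp (- x)) (at x)" by (auto intro!: derivative_eq_intros)
 have "((%x. x ^ Suc k / fact (Suc k)) has_real_derivative real (Suc k) * x ^ k / fact (Suc k)) (at x)"
  by (auto intro!: derivative_eq_intros simp del: power_Suc fact_Suc of_nat_Suc)
 moreover have "real (Suc k) * x ^ k / fact (Suc k) = x ^ k / fact k"
  unfolding fact_Suc of_nat_mult by (simp del: of_nat_Suc)
 ultimately have D2: "((%x. x ^ Suc k / fact (Suc k)) has_real_derivative x ^ k / fact k) (at x)" by simp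
 have D: "((%x. exp (- x) * (x ^ Suc k / fact (Suc k))) has_real_derivative
   - (exp (- x) * (x ^ Suc k / fact (Suc k))) + exp (- x) * (x ^ k / fact k)) (at x)"
  by (rule DERIV_cong[OF DERIV_mult[OF D1 D2]]) (simp del: power_Suc fact_Suc)
 have "poisson_tail (Suc k) = (%x. poisson_tail k x + exp (- x) * (x ^ Suc k / fact (Suc k)))"
  by (simp add: poisson_tail_def fun_eq_iff del: power_Suc fact_Suc)
 then show ?case using DERIV_add[OF Suc D] by (simp del: power_Suc fact_Suc)
qed

lemma poisson_tail_0: "poisson_tail k 0 = 1"
 by (induction k) (simp_all add: poisson_tail_def)

lemma poisson_tail_tendsto: "(%k. poisson_tail k x) \<longlonglongrightarrow> 1"
proof -
 have "(%k. exp (- x) * (\<Sum>m\<le>k. x ^ m / fact m)) \<longlonglongrightarrow> exp (- x) * exp x"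
  using exp_converges[of x] by (intro tendsto_mult tendsto_const) (simp add: sums_def_le divide_inverse mult.commute)
 then show ?thesis by (simp add: poisson_tail_def sum_distrib_left exp_minus_inverse mult.commute)
qed

lemma poisson_tail_at_top: "(poisson_tail k \<longlongrightarrow> 0) at_top"
proof -
 have "((%x::real. \<Sum>m\<le>k. exp (- x) * (x ^ m / fact m)) \<longlongrightarrow> (\<Sum>m\<le>k. 0)) at_top"
 proof (rule tendsto_sum)
  fix m
  have "((%x::real. x ^ m / exp x / fact m) \<longlongrightarrow> 0 / fact m) at_top"
   by (intro tendsto_divide tendsto_power_div_exp_0 tendsto_const) simp
  then show "((%x::real. exp (- x) * (x ^ m / fact m)) \<longlongrightarrow> 0) at_top"
   by (simp add: exp_minus field_simps)
 qed
 then show ?thesis by (simp add: poisson_tail_def[abs_def])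
qed

lemma poisson_tail_nonneg: "0 <= x ==> 0 <= poisson_tail k x"
 unfolding poisson_tail_def by (intro sum_nonneg) auto

lemma poisson_tail_le_1: assumes "0 <= x" shows "poisson_tail k x <= 1"
proof -
 have "poisson_tail k x <= poisson_tail k 0"
 proof (rule DERIV_nonpos_imp_nonincreasing[OF assms])
  show "\<exists>D. (poisson_tail k has_real_derivative D) (at t) & D <= 0" if "0 <= t" for t
   using poisson_tail_deriv[of k t] that by (intro exI conjI) auto
 qed
 then show ?thesis by (simp add: poisson_tail_0)
qed

context marked begin

lemma pairs_law:
 assumes [measurable]: "\<Psi> \<in> bmeas (pair_space k)"
 shows "(\<integral>\<^sup>+e. of_bool (has_nth (avs e) k) * \<Psi> (pairs e k) \<partial>env_law) =
  (\<integral>\<^sup>+y. weight k y * \<Psi> y \<partial>(\<Pi>\<^sub>M i\<in>{..<k}. base))"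
 using strong_markov[of "%z. \<Psi> (fst z)" k] by (simp add: E.emeasure_space_1)

lemma u_nonneg: "0 <= t ==> 0 <= u t"
 using u_mono[of 0 t] by (simp add: u_0)

text \<open>Integrating out the mark of the last point replaces the condition that it is kept by its
  probability \<open>v b\<close>.\<close>

lemma weight_last_step:
 assumes [measurable]: "g \<in> bmeas borel"
 shows "(\<integral>\<^sup>+y. weight (Suc k) y * g (fst (y k)) \<partial>(\<Pi>\<^sub>M i\<in>{..<Suc k}. base)) =
  (\<integral>\<^sup>+y. weight k y * (\<integral>\<^sup>+b. ennreal (exp (- (u b - u (lp k y)))) * of_bool (lp k y <= b) * ennreal (v b) * g b \<partial>lborel) \<partial>(\<Pi>\<^sub>M i\<in>{..<k}. base))"
proof -
 have ins: "{..<Suc k} = insert k {..<k}" by auto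
 have [measurable]: "(%y. fst (y k)) \<in> bmeas (pair_space (Suc k))" by measurable
 have "(%y. weight (Suc k) y * g (fst (y k))) \<in> bmeas (\<Pi>\<^sub>M i\<in>insert k {..<k}. base)"
  unfolding ins[symmetric] by measurable
 from bases.product_nn_integral_insert[OF _ _ this]
 have "(\<integral>\<^sup>+y. weight (Suc k) y * g (fst (y k)) \<partial>(\<Pi>\<^sub>M i\<in>{..<Suc k}. base)) =
  (\<integral>\<^sup>+y. \<integral>\<^sup>+a. weight k y * (factor k (y(k := a)) * g (fst a)) \<partial>base \<partial>(\<Pi>\<^sub>M i\<in>{..<k}. base))"
  unfolding ins by (simp add: weight_Suc_upd mult.assoc)
 also have "... = (\<integral>\<^sup>+y. weight k y * (\<integral>\<^sup>+b. ennreal (exp (- (u b - u (lp k y)))) * of_bool (lp k y <= b) * ennreal (v b) * g b \<partial>lborel) \<partial>(\<Pi>\<^sub>M i\<in>{..<k}. base))"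
 proof (rule nn_integral_cong)
  fix y :: "nat => real \<times> ereal"
  define l where "l = lp k y"
  have f: "factor k (y(k := a)) = ennreal (exp (- (u (fst a) - u l))) * of_bool (l <= fst a) * of_bool (ereal (fst a) <= snd a)" for a
   by (simp add: factor_def lp_upd l_def)
  show "(\<integral>\<^sup>+a. weight k y * (factor k (y(k := a)) * g (fst a)) \<partial>base) =
   weight k y * (\<integral>\<^sup>+b. ennreal (exp (- (u b - u (lp k y)))) * of_bool (lp k y <= b) * ennreal (v b) * g b \<partial>lborel)"
  proof (cases "weight k y = 0")
   case False
   then have l: "0 <= l" using lp_nonneg by (simp add: l_def)
   have "(\<integral>\<^sup>+a. factor k (y(k := a)) * g (fst a) \<partial>base) =
    (\<integral>\<^sup>+b. \<integral>\<^sup>+r. ennreal (exp (- (u b - u l))) * of_bool (l <= b) * of_bool (ereal b <= r) * g b \<partial>\<nu> \<partial>lborel)"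
    unfolding base_def f by (subst N.nn_integral_fst[symmetric]) auto
   also have "... = (\<integral>\<^sup>+b. ennreal (exp (- (u b - u l))) * of_bool (l <= b) * ennreal (v b) * g b \<partial>lborel)"
   proof (rule nn_integral_cong)
    fix b :: real
    have "(\<integral>\<^sup>+r. ennreal (exp (- (u b - u l))) * of_bool (l <= b) * of_bool (ereal b <= r) * g b \<partial>\<nu>)
     = ennreal (exp (- (u b - u l))) * of_bool (l <= b) * (\<integral>\<^sup>+r. of_bool (ereal b <= r) \<partial>\<nu>) * g b"
     by (simp add: nn_integral_cmult nn_integral_multc)
    then show "(\<integral>\<^sup>+r. ennreal (exp (- (u b - u l))) * of_bool (l <= b) * of_bool (ereal b <= r) * g b \<partial>\<nu>)
     = ennreal (exp (- (u b - u l))) * of_bool (l <= b) * ennreal (v b) * g b"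
     using l nn_v[of b] by (cases "l <= b") auto
   qed
   finally have e: "(\<integral>\<^sup>+a. factor k (y(k := a)) * g (fst a) \<partial>base) =
    (\<integral>\<^sup>+b. ennreal (exp (- (u b - u l))) * of_bool (l <= b) * ennreal (v b) * g b \<partial>lborel)" .
   have "(%a. factor k (y(k := a)) * g (fst a)) \<in> bmeas base"
    unfolding f by measurable
   then show ?thesis using e by (simp add: nn_integral_cmult l_def)
  qed simp
 qed
 finally show ?thesis .
qed

lemma u_power_integral:
 assumes "0 <= b"
 shows "(\<integral>\<^sup>+x. ennreal (u x ^ k / fact k * v x) * indicator {0..b} x \<partial>lborel) = ennreal (u b ^ Suc k / fact (Suc k))"
proof -
 have "(\<integral>\<^sup>+x. ennreal (u x ^ k / fact k * v x) * indicator {0..b} x \<partial>lborel) =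
   ennreal (u b ^ Suc k / fact (Suc k) - u 0 ^ Suc k / fact (Suc k))"
 proof (rule nn_integral_FTC_within[OF assms])
  fix x assume x: "0 <= x" "x <= b"
  show "0 <= u x ^ k / fact k * v x" using x u_nonneg[of x] v_nonneg[of x] by auto
  have D: "(u has_real_derivative v x) (at x within {0..b})"
   using x by (intro DERIV_subset[OF u_deriv]) auto
  have D': "((%x. u x ^ Suc k / fact (Suc k)) has_real_derivative real (Suc k) * v x * u x ^ k / fact (Suc k)) (at x within {0..b})"
   by (auto intro!: derivative_eq_intros D simp del: power_Suc of_nat_Suc fact_Suc)
  show "((%x. u x ^ Suc k / fact (Suc k)) has_real_derivative u x ^ k / fact k * v x) (at x within {0..b})"
   by (rule DERIV_cong[OF D']) (simp add: fact_Suc field_simps del: of_nat_Suc)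
 qed measurable
 then show ?thesis by (simp add: u_0)
qed

text \<open>The position of kept point number \<open>k\<close> has a gamma density in the time scale
  \<open>u\<close>: integrating over the preceding kept point raises the power of \<open>u\<close>
  by one, while the exponentials telescope.\<close>

lemma weight_last:
 assumes [measurable]: "g \<in> bmeas borel"
 shows "(\<integral>\<^sup>+y. weight (Suc k) y * g (fst (y k)) \<partial>(\<Pi>\<^sub>M i\<in>{..<Suc k}. base)) =
  (\<integral>\<^sup>+b. of_bool (0 <= b) * ennreal (exp (- u b) * (u b ^ k / fact k * v b)) * g b \<partial>lborel)"
 using assms
proof (induction k arbitrary: g)
 case 0
 note [measurable] = 0
 show ?case
 proof -
  have P: "(\<integral>\<^sup>+y. c \<partial>(\<Pi>\<^sub>M i\<in>{..<0 :: nat}. base)) = c" for c :: ennreal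
   by (simp add: PiM_empty)
  have "ennreal (exp (- (u b - u 0))) * of_bool (0 <= b) * ennreal (v b) * g b =
    of_bool (0 <= b) * ennreal (exp (- u b) * (u b ^ 0 / fact 0 * v b)) * g b" for b
   by (cases "0 <= b") (simp_all add: u_0 ennreal_mult v_nonneg)
  then show ?thesis unfolding weight_last_step[OF 0] by (simp add: weight_def lp_def P[simplified])
 qed
next
 case (Suc k)
 note [measurable] = Suc.prems
 let ?H = "%x. \<integral>\<^sup>+b. ennreal (exp (- (u b - u x))) * of_bool (x <= b) * ennreal (v b) * g b \<partial>lborel"
 have "(\<integral>\<^sup>+y. weight (Suc (Suc k)) y * g (fst (y (Suc k))) \<partial>(\<Pi>\<^sub>M i\<in>{..<Suc (Suc k)}. base)) =
  (\<integral>\<^sup>+y. weight (Suc k) y * ?H (fst (y k)) \<partial>(\<Pi>\<^sub>M i\<in>{..<Suc k}. base))"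
  unfolding weight_last_step[OF Suc.prems] by (simp add: lp_def)
 also have "... = (\<integral>\<^sup>+x. of_bool (0 <= x) * ennreal (exp (- u x) * (u x ^ k / fact k * v x)) * ?H x \<partial>lborel)"
  by (rule Suc.IH) measurable
 also have "... = (\<integral>\<^sup>+x. \<integral>\<^sup>+b. of_bool (0 <= b) * ennreal (exp (- u b)) * ennreal (v b) * g b *
   (ennreal (u x ^ k / fact k * v x) * indicator {0..b} x) \<partial>lborel \<partial>lborel)"
 proof (rule nn_integral_cong)
  fix x :: real
  have "of_bool (0 <= x) * ennreal (exp (- u x) * (u x ^ k / fact k * v x)) * ?H x =
   (\<integral>\<^sup>+b. of_bool (0 <= x) * ennreal (exp (- u x) * (u x ^ k / fact k * v x)) *
    (ennreal (exp (- (u b - u x))) * of_bool (x <= b) * ennreal (v b) * g b) \<partial>lborel)"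
   by (rule nn_integral_cmult[symmetric]) measurable
  also have "... = (\<integral>\<^sup>+b. of_bool (0 <= b) * ennreal (exp (- u b)) * ennreal (v b) * g b *
   (ennreal (u x ^ k / fact k * v x) * indicator {0..b} x) \<partial>lborel)"
  proof (rule nn_integral_cong)
   fix b :: real
   show "of_bool (0 <= x) * ennreal (exp (- u x) * (u x ^ k / fact k * v x)) *
    (ennreal (exp (- (u b - u x))) * of_bool (x <= b) * ennreal (v b) * g b) =
    of_bool (0 <= b) * ennreal (exp (- u b)) * ennreal (v b) * g b *
   (ennreal (u x ^ k / fact k * v x) * indicator {0..b} x)"
   proof (cases "0 <= x & x <= b")
    case True
    then have nn: "0 <= u x ^ k / fact k * v x" using u_nonneg[of x] v_nonneg[of x] by auto
    have "ennreal (exp (- u b)) = ennreal (exp (- u x)) * ennreal (exp (- (u b - u x)))"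
     by (simp add: ennreal_mult[symmetric] exp_add[symmetric])
    then show ?thesis using True unfolding ennreal_mult[OF exp_ge_zero nn] by (simp only: indicator_def of_bool_def) (simp add: mult_ac)
   qed (auto simp: indicator_def)
  qed
  finally show "of_bool (0 <= x) * ennreal (exp (- u x) * (u x ^ k / fact k * v x)) * ?H x =
   (\<integral>\<^sup>+b. of_bool (0 <= b) * ennreal (exp (- u b)) * ennreal (v b) * g b *
   (ennreal (u x ^ k / fact k * v x) * indicator {0..b} x) \<partial>lborel)" .
 qed
 also have "... = (\<integral>\<^sup>+b. \<integral>\<^sup>+x. of_bool (0 <= b) * ennreal (exp (- u b)) * ennreal (v b) * g b *
   (ennreal (u x ^ k / fact k * v x) * indicator {0..b} x) \<partial>lborel \<partial>lborel)"
 proof (rule lborel_pair.Fubini')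
  have "(%(b, x). of_bool (0 <= b) * ennreal (exp (- u b)) * ennreal (v b) * g b *
   (ennreal (u x ^ k / fact k * v x) * of_bool (0 <= x & x <= b))) \<in> bmeas (lborel \<Otimes>\<^sub>M lborel)"
   by measurable
  then show "(%(b, x). of_bool (0 <= b) * ennreal (exp (- u b)) * ennreal (v b) * g b *
   (ennreal (u x ^ k / fact k * v x) * indicator {0..b} x)) \<in> bmeas (lborel \<Otimes>\<^sub>M lborel)"
   by (simp add: indicator_def)
 qed
 also have "... = (\<integral>\<^sup>+b. of_bool (0 <= b) * ennreal (exp (- u b) * (u b ^ Suc k / fact (Suc k) * v b)) * g b \<partial>lborel)"
 proof (rule nn_integral_cong)
  fix b :: real
  have "(\<integral>\<^sup>+x. of_bool (0 <= b) * ennreal (exp (- u b)) * ennreal (v b) * g b *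
   (ennreal (u x ^ k / fact k * v x) * indicator {0..b} x) \<partial>lborel) =
   of_bool (0 <= b) * ennreal (exp (- u b)) * ennreal (v b) * g b *
   (\<integral>\<^sup>+x. ennreal (u x ^ k / fact k * v x) * indicator {0..b} x \<partial>lborel)"
   by (rule nn_integral_cmult) measurable
  also have "... = of_bool (0 <= b) * ennreal (exp (- u b) * (u b ^ Suc k / fact (Suc k) * v b)) * g b"
  proof (cases "0 <= b")
   case True
   have nn: "0 <= u b ^ Suc k / fact (Suc k)" "0 <= v b" using True u_nonneg[of b] v_nonneg[of b] by auto
   show ?thesis
    unfolding u_power_integral[OF True] ennreal_mult[OF exp_ge_zero mult_nonneg_nonneg[OF nn]] ennreal_mult[OF nn]
    by (simp only: mult_ac)
  qed simp
  finally show "(\<integral>\<^sup>+x. of_bool (0 <= b) * ennreal (exp (- u b)) * ennreal (v b) * g b *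
   (ennreal (u x ^ k / fact k * v x) * indicator {0..b} x) \<partial>lborel) =
   of_bool (0 <= b) * ennreal (exp (- u b) * (u b ^ Suc k / fact (Suc k) * v b)) * g b" .
 qed
 finally show ?case .
qed

text \<open>The density in \<open>weight_last\<close> is the derivative of
  \<open>- poisson_tail k\<close> composed with \<open>u\<close>.\<close>

lemma nth_before_prob:
 assumes "0 <= t"
 shows "(\<integral>\<^sup>+e. of_bool (has_nth (avs e) (Suc k) & psum 0 (fst e) (nth_elt (avs e) k) < t) \<partial>env_law) = ennreal (1 - poisson_tail k (u t))"
proof -
 have m [measurable]: "(%y. of_bool (fst (y k) < t) :: ennreal) \<in> bmeas (pair_space (Suc k))"
  by measurable
 have "(\<integral>\<^sup>+e. of_bool (has_nth (avs e) (Suc k) & psum 0 (fst e) (nth_elt (avs e) k) < t) \<partial>env_law) =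
  (\<integral>\<^sup>+e. of_bool (has_nth (avs e) (Suc k)) * of_bool (fst (pairs e (Suc k) k) < t) \<partial>env_law)"
  by (intro nn_integral_cong) (auto simp: pairs_def at_pos_def)
 also have "... = (\<integral>\<^sup>+y. weight (Suc k) y * of_bool (fst (y k) < t) \<partial>(\<Pi>\<^sub>M i\<in>{..<Suc k}. base))"
  by (rule pairs_law[OF m])
 also have "... = (\<integral>\<^sup>+b. of_bool (0 <= b) * ennreal (exp (- u b) * (u b ^ k / fact k * v b)) * of_bool (b < t) \<partial>lborel)"
  by (rule weight_last) measurable
 also have "... = (\<integral>\<^sup>+b. ennreal (exp (- u b) * (u b ^ k / fact k * v b)) * indicator {0..t} b \<partial>lborel)"
  using AE_lborel_singleton[of t]
  by (intro nn_integral_cong_AE, eventually_elim) (auto simp: indicator_def)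
 also have "... = ennreal (- poisson_tail k (u t) - (- poisson_tail k (u 0)))"
 proof (rule nn_integral_FTC_within[OF assms])
  fix x assume x: "0 <= x" "x <= t"
  show "0 <= exp (- u x) * (u x ^ k / fact k * v x)" using x u_nonneg[of x] v_nonneg[of x] by auto
  have D: "(u has_real_derivative v x) (at x within {0..t})"
   using x by (intro DERIV_subset[OF u_deriv]) auto
  show "((%x. - poisson_tail k (u x)) has_real_derivative exp (- u x) * (u x ^ k / fact k * v x)) (at x within {0..t})"
   using DERIV_minus[OF DERIV_chain2[OF poisson_tail_deriv D]] by (simp add: mult_ac)
 qed measurable
 finally show ?thesis by (simp add: u_0 poisson_tail_0)
qed

end

text \<open>With infinite marks every point is kept and \<open>u t = t\<close>, so the thinned
  computation gives the law of the unthinned points: point number \<open>k\<close> lies before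
  \<open>n\<close> with probability \<open>1 - poisson_tail k n\<close>, which tends to 0 in
  \<open>k\<close>.\<close>

lemma AE_arrivals_finite: "AE w in gaps. \<forall>t. finite {j. psum 0 w j <= t}"
proof -
 interpret marked "return borel (\<infinity> :: ereal)" "%t. t" "%t. 1"
  by (rule marked.intro) (auto intro!: derivative_eq_intros prob_space_return simp: measure_return)
 have AEm: "AE e in env_law. \<forall>j. snd e j = \<infinity>"
 proof -
  have "AE m in marks. m j = \<infinity>" for j
   unfolding marks_def by (rule AE_PiM_component) (auto intro: prob_space_return simp: AE_return)
  then have "AE m in marks. \<forall>j. m j = \<infinity>" by (simp add: AE_all_countable)
  then have "AE w in gaps. AE m in marks. \<forall>j. snd (w, m) j = \<infinity>" by simp
  then show ?thesis unfolding env_law_def by (intro GK.AE_pair_measure) measurable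
 qed
 have nth: "has_nth UNIV k" "nth_elt UNIV k = k" for k
 proof -
  show e: "nth_elt UNIV k = k" for k by (induction k) (auto intro!: Least_equality)
  show "has_nth UNIV k" unfolding has_nth_def by auto
 qed
 have S: "{w. psum 0 w k < real n} \<in> sets (seq_space :: (nat => real) measure)" for k n
 proof -
  have "{w \<in> space seq_space. psum 0 w k < real n} \<in> sets (seq_space :: (nat => real) measure)" by measurable
  then show ?thesis by (simp add: space_PiM)
 qed
 have S': "{w. \<forall>k. psum 0 w k < real n} \<in> sets (seq_space :: (nat => real) measure)" for n
 proof -
  have "{w \<in> space seq_space. \<forall>k. psum 0 w k < real n} \<in> sets (seq_space :: (nat => real) measure)" by measurable
  then show ?thesis by (simp add: space_PiM)
 qed
 have P: "emeasure gaps {w\<in>space gaps. psum 0 w k < real n} = ennreal (1 - poisson_tail k (real n))" for k n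
 proof -
  have "emeasure gaps {w\<in>space gaps. psum 0 w k < real n} = (\<integral>\<^sup>+w. of_bool (psum 0 w k < real n) \<partial>gaps)"
   using S by (subst nn_integral_of_bool) auto
  also have "... = (\<integral>\<^sup>+e. of_bool (psum 0 (fst e) k < real n) \<partial>env_law)"
   by (subst nn_integral_env_law) (auto simp: K.emeasure_space_1)
  also have "... = (\<integral>\<^sup>+e. of_bool (has_nth (avs e) (Suc k) & psum 0 (fst e) (nth_elt (avs e) k) < real n) \<partial>env_law)"
  proof (rule nn_integral_cong_AE, use AEm in eventually_elim)
   case (elim e)
   then have "avs e = UNIV" by (auto simp: avs_def av_def)
   then show ?case by (simp add: nth del: nth_elt.simps)
  qed
  finally show ?thesis by (simp add: nth_before_prob)
 qed
 have "AE w in gaps. \<exists>k. real n <= psum 0 w k" for n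
 proof -
  let ?N = "{w\<in>space gaps. \<forall>k. psum 0 w k < real n}"
  have "emeasure gaps ?N <= ennreal (1 - poisson_tail k (real n))" for k
   unfolding P[symmetric] by (intro emeasure_mono) (auto simp: S)
  moreover have "(%k. ennreal (1 - poisson_tail k (real n))) \<longlonglongrightarrow> ennreal (1 - 1)"
   by (intro tendsto_ennrealI tendsto_diff tendsto_const poisson_tail_tendsto)
  ultimately have "emeasure gaps ?N <= ennreal (1 - 1)" by (intro LIMSEQ_le_const) auto
  then have "emeasure gaps ?N = 0" by simp
  then show ?thesis by (subst AE_iff_measurable[OF _ refl]) (auto simp: not_le S')
 qed
 then have "AE w in gaps. \<forall>n. \<exists>k. real n <= psum 0 w k" by (simp add: AE_all_countable)
 then show ?thesis using AE_gaps_pos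
 proof eventually_elim
  case (elim w)
  have sm: "strict_mono (psum 0 w)" using elim by (simp add: strict_mono_Suc_iff psum_Suc)
  show ?case
  proof
   fix t
   obtain n where n: "t < real n" using reals_Archimedean2 by blast
   obtain k where "real n <= psum 0 w k" using elim by blast
   then have "j < k" if "psum 0 w j <= t" for j
    using that n strict_mono_less[OF sm, of j k] by simp
   then have "{j. psum 0 w j <= t} \<subseteq> {..<k}" by blast
   then show "finite {j. psum 0 w j <= t}" using finite_lessThan by (rule finite_subset)
  qed
 qed
qed

lemma (in marked) AE_env_good:
 "AE e in env_law. strict_mono (psum 0 (fst e)) & (\<forall>j. 0 < psum 0 (fst e) j) & (\<forall>t. finite {j. psum 0 (fst e) j <= t})"
proof -
 have "AE w in gaps. strict_mono (psum 0 w) & (\<forall>j. 0 < psum 0 w j) & (\<forall>t. finite {j. psum 0 w j <= t})"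
  using AE_gaps_pos AE_arrivals_finite
 proof eventually_elim
  case (elim w)
  then have sm: "strict_mono (psum 0 w)" by (simp add: strict_mono_Suc_iff psum_Suc)
  have "0 < psum 0 w j" for j
   using elim by (induction j) (auto simp: psum_0 psum_Suc intro: add_pos_pos)
  with sm elim show ?case by blast
 qed
 \<comment> \<open>A measurable null set containing the exceptional sequences is used, so that the
   product argument needs measurability of \<open>S\<close> only.\<close>
 then obtain S where S: "S \<in> sets gaps" "emeasure gaps S = 0"
  "{w\<in>space gaps. \<not> (strict_mono (psum 0 w) & (\<forall>j. 0 < psum 0 w j) & (\<forall>t. finite {j. psum 0 w j <= t}))} \<subseteq> S"
  by (elim AE_E) auto
 have "AE w in gaps. w \<notin> S" using S by (intro AE_not_in) (auto simp: null_sets_def)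
 then have "AE w in gaps. AE m in marks. fst (w, m) \<notin> S" by eventually_elim simp
 then have "AE e in env_law. fst e \<notin> S"
 proof -
  have [measurable]: "S \<in> sets seq_space" using S(1) by simp
  assume "AE w in gaps. AE m in marks. fst (w, m) \<notin> S"
  then show ?thesis unfolding env_law_def by (intro GK.AE_pair_measure) measurable
 qed
 then show ?thesis by eventually_elim (use S(3) in auto)
qed

text \<open>The vertex survives until \<open>t\<close> iff at most \<open>k\<close> kept points lie
  before \<open>t\<close>, and their number is Poisson with mean \<open>u t\<close>.\<close>

lemma (in marked) sat_time_prob:
 assumes "0 <= t"
 shows "(\<integral>\<^sup>+e. of_bool (ereal t <= sat_time (psum 0 (fst e)) (snd e) (Suc k)) \<partial>env_law) = ennreal (poisson_tail k (u t))"
proof -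
 let ?P = "%e. has_nth (avs e) (Suc k) & psum 0 (fst e) (nth_elt (avs e) k) < t"
 have Pm [measurable]: "Measurable.pred seqs ?P"
 proof -
  have n: "(%e. nth_elt (avs e) k) \<in> measurable seqs (count_space UNIV)" by (rule nth_elt_measurable) measurable
  have [measurable]: "(%e. psum 0 (fst e) (nth_elt (avs e) k)) \<in> bmeas seqs"
   by (rule measurable_compose_countable[OF _ n]) measurable
  have [measurable]: "Measurable.pred seqs (%e. has_nth (avs e) (Suc k))" by (rule has_nth_measurable) measurable
  show ?thesis by measurable
 qed
 have "Measurable.pred env_law ?P" by measurable
 then have S: "{e\<in>space env_law. ?P e} \<in> sets env_law" by (simp only: pred_def)
 have pt: "0 <= poisson_tail k (u t)" by (rule poisson_tail_nonneg[OF u_nonneg[OF assms]])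
 have "(\<integral>\<^sup>+e. of_bool (ereal t <= sat_time (psum 0 (fst e)) (snd e) (Suc k)) \<partial>env_law) = (\<integral>\<^sup>+e. of_bool (\<not> ?P e) \<partial>env_law)"
 proof (rule nn_integral_cong_AE, use AE_env_good in eventually_elim)
  case (elim e)
  then show ?case using sat_time_ge_nth[of "psum 0 (fst e)" t "snd e" k] by (simp add: avs_def av_def)
 qed
 also have "... = emeasure env_law (space env_law - {e\<in>space env_law. ?P e})"
 proof -
  have "{e\<in>space env_law. \<not> ?P e} = space env_law - {e\<in>space env_law. ?P e}" by auto
  moreover have "space env_law - {e\<in>space env_law. ?P e} \<in> sets env_law" using S by (rule sets.compl_sets)
  ultimately show ?thesis by (subst nn_integral_of_bool) simp_all
 qed
 also have "... = 1 - emeasure env_law {e\<in>space env_law. ?P e}"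
  by (subst emeasure_compl[OF S]) (auto simp: E.emeasure_space_1)
 also have "emeasure env_law {e\<in>space env_law. ?P e} = ennreal (1 - poisson_tail k (u t))"
  unfolding nth_before_prob[OF assms, symmetric]
  by (rule nn_integral_of_bool[OF S, symmetric])
 also have "1 - ennreal (1 - poisson_tail k (u t)) = ennreal (poisson_tail k (u t))"
  using pt poisson_tail_le_1[OF u_nonneg[OF assms], of k]
  by (simp add: ennreal_1[symmetric] ennreal_minus del: ennreal_1)
 finally show ?thesis .
qed

section \<open>Order statistics and the joint law of a vertex and its children\<close>

text \<open>If \<open>B\<close> is the image under \<phi> of \<open>A\<close> weighted by
  \<open>w\<close>, the same holds coordinatewise for finite products. It rewrites products of
  marked base measures, and of densities, as integrals over Lebesgue measure.\<close>

lemma nn_integral_PiM_transfer: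
 fixes A :: "'a measure" and B :: "'b measure" and I :: "'i set"
 assumes A: "sigma_finite_measure A" and B: "sigma_finite_measure B"
  and \<phi> [measurable]: "\<phi> \<in> measurable A B" and w [measurable]: "w \<in> bmeas A"
  and tr: "\<And>g. g \<in> bmeas B ==> (\<integral>\<^sup>+b. g b \<partial>B) = (\<integral>\<^sup>+a. w a * g (\<phi> a) \<partial>A)"
  and I: "finite I" and G: "G \<in> bmeas (\<Pi>\<^sub>M i\<in>I. B)"
 shows "(\<integral>\<^sup>+y. G y \<partial>(\<Pi>\<^sub>M i\<in>I. B)) = (\<integral>\<^sup>+x. (\<Prod>i\<in>I. w (x i)) * G (\<lambda>i\<in>I. \<phi> (x i)) \<partial>(\<Pi>\<^sub>M i\<in>I. A))"
 using I G
proof (induction I arbitrary: G rule: finite_induct)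
 case empty
 then show ?case by (simp add: PiM_empty nn_integral_count_space_finite)
next
 case (insert i I)
 interpret A: sigma_finite_measure A by (rule A)
 interpret B: sigma_finite_measure B by (rule B)
 interpret PA: product_sigma_finite "%_ :: 'i. A" ..
 interpret PB: product_sigma_finite "%_ :: 'i. B" ..
 note [measurable] = insert.prems
 have upd: "(%(y, b). y(i := b)) \<in> measurable ((\<Pi>\<^sub>M i\<in>I. B) \<Otimes>\<^sub>M B) (\<Pi>\<^sub>M i\<in>insert i I. B)"
  unfolding split_beta' by (intro measurable_fun_upd[where J=I]) auto
 have G2 [measurable]: "(%(y, b). G (y(i := b))) \<in> bmeas ((\<Pi>\<^sub>M i\<in>I. B) \<Otimes>\<^sub>M B)"
  using measurable_compose[OF upd insert.prems] by (simp add: split_beta')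
 have "(%y. \<integral>\<^sup>+b. (%(y, b). G (y(i := b))) (y, b) \<partial>B) \<in> bmeas (\<Pi>\<^sub>M i\<in>I. B)"
  by (rule B.borel_measurable_nn_integral_fst[OF G2])
 then have G1: "(%y. \<integral>\<^sup>+b. G (y(i := b)) \<partial>B) \<in> bmeas (\<Pi>\<^sub>M i\<in>I. B)" by simp
 have "(\<integral>\<^sup>+y. G y \<partial>(\<Pi>\<^sub>M i\<in>insert i I. B)) = (\<integral>\<^sup>+y. \<integral>\<^sup>+b. G (y(i := b)) \<partial>B \<partial>(\<Pi>\<^sub>M i\<in>I. B))"
  by (rule PB.product_nn_integral_insert[OF insert.hyps(1,2) insert.prems])
 also have "... = (\<integral>\<^sup>+x. (\<Prod>i\<in>I. w (x i)) * (\<integral>\<^sup>+b. G ((\<lambda>i\<in>I. \<phi> (x i))(i := b)) \<partial>B) \<partial>(\<Pi>\<^sub>M i\<in>I. A))"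
  by (rule insert.IH[OF G1])
 also have "... = (\<integral>\<^sup>+x. \<integral>\<^sup>+a. (\<Prod>j\<in>insert i I. w ((x(i := a)) j)) * G (\<lambda>j\<in>insert i I. \<phi> ((x(i := a)) j)) \<partial>A \<partial>(\<Pi>\<^sub>M i\<in>I. A))"
 proof (rule nn_integral_cong)
  fix x assume x: "x \<in> space (\<Pi>\<^sub>M i\<in>I. A)"
  have "(\<lambda>i\<in>I. \<phi> (x i)) \<in> space (\<Pi>\<^sub>M i\<in>I. B)"
   using x measurable_space[OF \<phi>] by (auto simp: space_PiM)
  from measurable_compose[OF measurable_Pair1'[OF this] G2]
  have Gx [measurable]: "(%b. G ((\<lambda>i\<in>I. \<phi> (x i))(i := b))) \<in> bmeas B" by simp
  have pr: "(\<Prod>j\<in>insert i I. w ((x(i := a)) j)) = (\<Prod>j\<in>I. w (x j)) * w a" for a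
  proof -
   have "(\<Prod>j\<in>I. w ((x(i := a)) j)) = (\<Prod>j\<in>I. w (x j))" using insert.hyps by (intro prod.cong) auto
   then show ?thesis using insert.hyps by (simp add: mult.commute)
  qed
  have fe: "(\<lambda>j\<in>insert i I. \<phi> ((x(i := a)) j)) = (\<lambda>i\<in>I. \<phi> (x i))(i := \<phi> a)" for a
   using insert.hyps by (auto simp: fun_eq_iff)
  show "(\<Prod>i\<in>I. w (x i)) * (\<integral>\<^sup>+b. G ((\<lambda>i\<in>I. \<phi> (x i))(i := b)) \<partial>B) =
   (\<integral>\<^sup>+a. (\<Prod>j\<in>insert i I. w ((x(i := a)) j)) * G (\<lambda>j\<in>insert i I. \<phi> ((x(i := a)) j)) \<partial>A)"
   unfolding pr fe tr[OF Gx] mult.assoc by (rule nn_integral_cmult[symmetric]) measurable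
 qed
 also have "... = (\<integral>\<^sup>+x. (\<Prod>i\<in>insert i I. w (x i)) * G (\<lambda>i\<in>insert i I. \<phi> (x i)) \<partial>(\<Pi>\<^sub>M i\<in>insert i I. A))"
 proof (rule PA.product_nn_integral_insert[OF insert.hyps(1,2), symmetric])
  have [measurable]: "(%x. w (x j)) \<in> bmeas (\<Pi>\<^sub>M i\<in>insert i I. A)" if "j \<in> insert i I" for j
   by (rule measurable_compose[OF measurable_component_singleton[OF that, of "%_. A"] w])
  have "(%x. \<lambda>i\<in>insert i I. \<phi> (x i)) \<in> measurable (\<Pi>\<^sub>M i\<in>insert i I. A) (\<Pi>\<^sub>M i\<in>insert i I. B)"
  proof (rule measurable_restrict)
   show "(%x. \<phi> (x j)) \<in> measurable (\<Pi>\<^sub>M i\<in>insert i I. A) B" if "j \<in> insert i I" for j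
    by (rule measurable_compose[OF measurable_component_singleton[OF that, of "%_. A"] \<phi>])
  qed
  from measurable_compose[OF this insert.prems]
  show "(%x. (\<Prod>i\<in>insert i I. w (x i)) * G (\<lambda>i\<in>insert i I. \<phi> (x i))) \<in> bmeas (\<Pi>\<^sub>M i\<in>insert i I. A)"
   by (intro borel_measurable_times_ennreal borel_measurable_prod_ennreal) auto
 qed
 finally show ?case .
qed

definition reindex :: "nat => (nat => nat) => (nat => real \<times> real) => nat => real \<times> real" where
 "reindex m \<sigma> x = (\<lambda>j\<in>{..<m}. x (\<sigma> j))"

definition label_sorted :: "nat => (nat => real \<times> real) => bool" where
 "label_sorted m x \<longleftrightarrow> (\<forall>i. Suc i < m --> fst (x i) <= fst (x (Suc i)))"

text \<open>For distinct labels exactly one permutation sorts them, so all other summands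
  vanish.\<close>

lemma order_pairs_eq_sum:
 assumes inj: "inj_on (%i. fst (x i)) {..<m}"
 shows "\<Phi> (order_pairs m x) = (\<Sum>\<sigma>\<in>{\<sigma>. \<sigma> permutes {..<m}}. of_bool (label_sorted m (reindex m \<sigma> x)) * (\<Phi> (reindex m \<sigma> x) :: ennreal))"
proof -
 let ?xs = "map x [0..<m]"
 have "mset (sort_key fst ?xs) = mset ?xs" by simp
 then obtain \<rho> where \<rho>: "\<rho> permutes {..<length ?xs}" "permute_list \<rho> ?xs = sort_key fst ?xs"
  by (rule mset_eq_permutation)
 then have \<rho>p: "\<rho> permutes {..<m}" by simp
 have nth: "sort_key fst ?xs ! j = x (\<rho> j)" if "j < m" for j
 proof -
  have "\<rho> j < m" using permutes_in_image[OF \<rho>p, of j] that by simp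
  then show ?thesis unfolding \<rho>(2)[symmetric] using that by (simp add: permute_list_def)
 qed
 then have ord: "order_pairs m x = reindex m \<rho> x"
  by (auto simp: order_pairs_def reindex_def fun_eq_iff)
 have srt: "label_sorted m (reindex m \<rho> x)"
 proof -
  have "sorted (map fst (sort_key fst ?xs))" by simp
  then have "fst (sort_key fst ?xs ! i) <= fst (sort_key fst ?xs ! Suc i)" if "Suc i < m" for i
   using that sorted_nth_mono[of "map fst (sort_key fst ?xs)" i "Suc i"] by simp
  then show ?thesis by (auto simp: label_sorted_def reindex_def nth)
 qed
 have uniq: "\<sigma> = \<rho>" if \<sigma>: "\<sigma> permutes {..<m}" and s: "label_sorted m (reindex m \<sigma> x)" for \<sigma>
 proof -
  have len: "\<sigma> permutes {..<length ?xs}" using \<sigma> by simp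
  have "sort_key fst ?xs = permute_list \<sigma> ?xs"
  proof (rule sort_key_inj_key_eq)
   show "mset ?xs = mset (permute_list \<sigma> ?xs)" using len by simp
   show "inj_on fst (set ?xs)"
   proof (rule inj_onI)
    fix a b assume "a \<in> set ?xs" "b \<in> set ?xs" "fst a = fst b"
    then obtain i j where "i < m" "j < m" "a = x i" "b = x j" "fst (x i) = fst (x j)" by auto
    then show "a = b" using inj_onD[OF inj, of i j] by simp
   qed
   have lt: "\<sigma> j < m" if "j < m" for j using permutes_in_image[OF \<sigma>, of j] that by simp
   show "sorted (map fst (permute_list \<sigma> ?xs))"
    unfolding sorted_iff_nth_Suc using s lt by (auto simp: permute_list_def label_sorted_def reindex_def)
  qed
  then have "x (\<sigma> j) = x (\<rho> j)" if "j < m" for j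
  proof -
   have "\<sigma> j < m" using permutes_in_image[OF \<sigma>, of j] that by simp
   then show ?thesis using nth[OF that] that \<open>sort_key fst ?xs = permute_list \<sigma> ?xs\<close>
    by (simp add: permute_list_def)
  qed
  then have "\<sigma> j = \<rho> j" if "j < m" for j
   using inj_onD[OF inj, of "\<sigma> j" "\<rho> j"] that permutes_in_image[OF \<sigma>, of j] permutes_in_image[OF \<rho>p, of j] by simp
  moreover have "\<sigma> j = \<rho> j" if "\<not> j < m" for j
   using permutes_not_in[OF \<sigma>, of j] permutes_not_in[OF \<rho>p, of j] that by simp
  ultimately show "\<sigma> = \<rho>" by (metis ext)
 qed
 have "(\<Sum>\<sigma>\<in>{\<sigma>. \<sigma> permutes {..<m}}. of_bool (label_sorted m (reindex m \<sigma> x)) * \<Phi> (reindex m \<sigma> x)) =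
   (\<Sum>\<sigma>\<in>{\<rho>}. of_bool (label_sorted m (reindex m \<sigma> x)) * \<Phi> (reindex m \<sigma> x))"
  using uniq \<rho>p by (intro sum.mono_neutral_right) (auto simp: finite_permutations)
 then show ?thesis using srt ord by simp
qed

lemma label_sorted_measurable: "Measurable.pred (pair_seqs m) (label_sorted m)"
proof -
 let ?S = "\<Pi>\<^sub>M j\<in>{..<m}. (borel :: (real \<times> real) measure)"
 have "{x \<in> space ?S. \<forall>i\<in>{i. Suc i < m}. fst (x i) <= fst (x (Suc i))} \<in> sets ?S"
 proof (rule sets.sets_Collect_finite_All)
  show "finite {i. Suc i < m}" by (rule finite_subset[of _ "{..<m}"]) auto
  fix i assume "i \<in> {i. Suc i < m}"
  then show "{x \<in> space ?S. fst (x i) <= fst (x (Suc i))} \<in> sets ?S"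
   by (intro borel_measurable_le measurable_component_pair) auto
 qed
 then show ?thesis unfolding label_sorted_def[abs_def] pred_def by (simp only: Ball_def mem_Collect_eq)
qed

context rdcp_ode begin

text \<open>The label of one pair has a density, so it hits the label of another pair with
  probability 0, by integrating that one coordinate first.\<close>

lemma AE_iid_law_inj: assumes t: "0 < t" shows "AE x in iid_law t m. inj_on (%i. fst (x i)) {..<m}"
proof -
 interpret P: prob_space "pair_law t" by (rule prob_space_pair_law[OF t])
 interpret PP: product_sigma_finite "%_ :: nat. pair_law t" ..
 have null: "(\<integral>\<^sup>+b. of_bool (fst b = c) \<partial>pair_law t) = 0" for c
 proof -
  have "(\<integral>\<^sup>+b. of_bool (fst b = c) \<partial>pair_law t) = (\<integral>\<^sup>+b. ennreal (pair_density p lam t b) * of_bool (fst b = c) \<partial>lborel)"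
   unfolding pair_law_def by (rule nn_integral_density) auto
  also have "... = (\<integral>\<^sup>+a. \<integral>\<^sup>+s. ennreal (pair_density p lam t (a, s)) * of_bool (a = c) \<partial>lborel \<partial>lborel)"
   unfolding lborel_prod[symmetric] by (subst lborel.nn_integral_fst[symmetric]) (auto simp: lborel_prod)
  also have "... = (\<integral>\<^sup>+a. 0 \<partial>(lborel :: real measure))"
   using AE_lborel_singleton[of c] by (intro nn_integral_cong_AE, eventually_elim) auto
  finally show ?thesis by simp
 qed
 have "AE x in iid_law t m. i ~= j --> fst (x i) ~= fst (x j)" if ij: "i \<in> {..<m}" "j \<in> {..<m}" for i j
 proof (cases "i = j")
  case False
  have ins: "{..<m} = insert i ({..<m} - {i})" using ij by auto
  have ms: "(%x. of_bool (fst (x i) = fst (x j)) :: ennreal) \<in> bmeas (pair_seqs m)"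
  proof -
   have "{x \<in> space (pair_seqs m). fst (x i) = fst (x j)} \<in> sets (pair_seqs m)"
    using ij by (intro borel_measurable_eq measurable_component_pair) auto
   then show ?thesis by (simp add: pred_def)
  qed
  have ms': "(%x. of_bool (fst (x i) = fst (x j)) :: ennreal) \<in> bmeas (\<Pi>\<^sub>M j\<in>insert i ({..<m} - {i}). pair_law t)"
   using ms unfolding ins[symmetric] iid_law_def[symmetric] by simp
  have iid: "iid_law t m = (\<Pi>\<^sub>M j\<in>insert i ({..<m} - {i}). pair_law t)"
   unfolding iid_law_def by (rule arg_cong[where f="%I. PiM I (%_. pair_law t)", OF ins])
  have "(\<integral>\<^sup>+x. of_bool (fst (x i) = fst (x j)) \<partial>iid_law t m) =
   (\<integral>\<^sup>+x. \<integral>\<^sup>+b. of_bool (fst ((x(i := b)) i) = fst ((x(i := b)) j)) \<partial>pair_law t \<partial>(\<Pi>\<^sub>M j\<in>{..<m} - {i}. pair_law t))"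
   unfolding iid by (rule PP.product_nn_integral_insert[OF _ _ ms']) auto
  also have "... = (\<integral>\<^sup>+x. \<integral>\<^sup>+b. of_bool (fst b = fst (x j)) \<partial>pair_law t \<partial>(\<Pi>\<^sub>M j\<in>{..<m} - {i}. pair_law t))"
   using False by (intro nn_integral_cong) simp
  also have "... = 0" by (simp add: null)
  finally have "AE x in iid_law t m. of_bool (fst (x i) = fst (x j)) = (0 :: ennreal)"
   using ms by (subst (asm) nn_integral_0_iff_AE) auto
  then show ?thesis by eventually_elim (simp add: of_bool_def split: if_splits)
 qed simp
 then have "AE x in iid_law t m. \<forall>i\<in>{..<m}. \<forall>j\<in>{..<m}. i ~= j --> fst (x i) ~= fst (x j)"
  by (intro AE_finite_allI) auto
 then show ?thesis by eventually_elim (auto simp: inj_on_def)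
qed

lemma reindex_measurable [measurable]:
 assumes "\<sigma> permutes {..<m}"
 shows "reindex m \<sigma> \<in> measurable (pair_seqs m) (pair_seqs m)"
 unfolding reindex_def[abs_def]
proof (rule measurable_restrict)
 show "(%x. x (\<sigma> j)) \<in> bmeas (pair_seqs m)" if "j \<in> {..<m}" for j
  using permutes_in_image[OF assms, of j] that by (intro measurable_component_singleton) simp
qed

text \<open>By exchangeability every permutation contributes the same integral, hence the factor
  \<open>fact m\<close>.\<close>

lemma nn_integral_order_pairs:
 assumes t: "0 < t" and \<Phi>: "\<Phi> \<in> bmeas (pair_seqs m)"
 shows "(\<integral>\<^sup>+x. \<Phi> (order_pairs m x) \<partial>iid_law t m) = ennreal (fact m) * (\<integral>\<^sup>+x. of_bool (label_sorted m x) * \<Phi> x \<partial>iid_law t m)"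
proof -
 let ?\<Psi> = "%x. of_bool (label_sorted m x) * \<Phi> x"
 have \<Psi>: "?\<Psi> \<in> bmeas (pair_seqs m)"
  using label_sorted_measurable[of m] \<Phi> by (intro borel_measurable_times_ennreal) auto
 have "(\<integral>\<^sup>+x. \<Phi> (order_pairs m x) \<partial>iid_law t m) = (\<integral>\<^sup>+x. (\<Sum>\<sigma>\<in>{\<sigma>. \<sigma> permutes {..<m}}. ?\<Psi> (reindex m \<sigma> x)) \<partial>iid_law t m)"
 proof (rule nn_integral_cong_AE, use AE_iid_law_inj[OF t] in eventually_elim)
  case (elim x)
  then show ?case by (rule order_pairs_eq_sum)
 qed
 also have "... = (\<Sum>\<sigma>\<in>{\<sigma>. \<sigma> permutes {..<m}}. \<integral>\<^sup>+x. ?\<Psi> (reindex m \<sigma> x) \<partial>iid_law t m)"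
 proof (rule nn_integral_sum)
  fix \<sigma> assume "\<sigma> \<in> {\<sigma>. \<sigma> permutes {..<m}}"
  then have "(%x. ?\<Psi> (reindex m \<sigma> x)) \<in> bmeas (pair_seqs m)"
   by (intro measurable_compose[OF reindex_measurable \<Psi>]) simp
  then show "(%x. ?\<Psi> (reindex m \<sigma> x)) \<in> bmeas (iid_law t m)"
   unfolding measurable_cong_sets[OF sets_iid_law refl] .
 qed
 also have "... = (\<Sum>\<sigma>\<in>{\<sigma>. \<sigma> permutes {..<m}}. \<integral>\<^sup>+x. ?\<Psi> x \<partial>iid_law t m)"
 proof (rule sum.cong[OF refl])
  fix \<sigma> assume "\<sigma> \<in> {\<sigma>. \<sigma> permutes {..<m}}"
  then have \<sigma>: "\<sigma> permutes {..<m}" by simp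
  have D: "distr (iid_law t m) (iid_law t m) (reindex m \<sigma>) = iid_law t m"
   unfolding iid_law_def reindex_def[abs_def]
   using distr_PiM_reindex[of "{..<m}" "%_. pair_law t" \<sigma> "{..<m}"] prob_space_pair_law[OF t] permutes_inj[OF \<sigma>] permutes_in_image[OF \<sigma>]
   by (auto simp: inj_on_def inj_def)
  have "(\<integral>\<^sup>+x. ?\<Psi> x \<partial>iid_law t m) = (\<integral>\<^sup>+x. ?\<Psi> x \<partial>distr (iid_law t m) (iid_law t m) (reindex m \<sigma>))"
   unfolding D ..
  also have "... = (\<integral>\<^sup>+x. ?\<Psi> (reindex m \<sigma> x) \<partial>iid_law t m)"
   using reindex_measurable[OF \<sigma>] \<Psi> by (intro nn_integral_distr) auto
  finally show "(\<integral>\<^sup>+x. ?\<Psi> (reindex m \<sigma> x) \<partial>iid_law t m) = (\<integral>\<^sup>+x. ?\<Psi> x \<partial>iid_law t m)" ..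
 qed
 also have "... = of_nat (fact m) * (\<integral>\<^sup>+x. ?\<Psi> x \<partial>iid_law t m)"
  by (simp only: sum_constant card_permutations[OF card_lessThan finite_lessThan])
 also have "of_nat (fact m) = ennreal (fact m)"
  by (simp only: ennreal_of_nat_eq_real_of_nat of_nat_fact)
 finally show ?thesis .
qed

definition sat_law :: "ereal measure" where
 "sat_law = distr (density lborel (%t. ennreal (f t))) borel ereal"

lemma sat_law_tail: assumes "0 <= t" shows "emeasure sat_law {ereal t..} = ennreal (F (lam t))"
proof -
 have "emeasure sat_law {ereal t..} = emeasure (density lborel (%t. ennreal (f t))) {t..}"
  unfolding sat_law_def by (subst emeasure_distr) (auto intro!: arg_cong[where f="emeasure _"])
 also have "... = ennreal (F (lam t))" by (simp add: emeasure_density nn_f_tail[OF assms])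
 finally show ?thesis .
qed

lemma sets_sat_law [simp, measurable_cong]: "sets sat_law = sets borel"
 by (simp add: sat_law_def)

lemma prob_space_sat_law: "prob_space sat_law"
 unfolding sat_law_def by (rule prob_space.prob_space_distr[OF prob_space_f]) simp

lemma L_deriv: assumes "0 <= t" shows "(L has_real_derivative F (L t)) (at t within {0..})"
proof (rule has_field_derivative_transform_within[where d=1])
 show "(lam has_real_derivative F (L t)) (at t within {0..})" using lam_deriv[OF assms] assms by (simp add: L_eq)
qed (use assms in \<open>auto simp: L_eq\<close>)

text \<open>Marks with density \<open>f\<close> are kept with probability \<open>F (lam t)\<close>,
  which by the differential equation is the derivative of \<open>lam\<close>; so the kept points
  have mean \<open>lam\<close>.\<close>

sublocale mk: marked sat_law L "%t. F (L t)"
proof (rule marked.intro)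
 show "F (L t) = measure sat_law {ereal t..}" if "0 <= t" for t
  using sat_law_tail[OF that] that F_pos[OF lam_nonneg[OF that]] by (simp add: measure_def L_eq)
 show "prob_space sat_law" by (rule prob_space_sat_law)
 show "(%t. F (L t)) \<in> bmeas borel" "L \<in> bmeas borel" by measurable
 show "(L has_real_derivative F (L t)) (at t within {0..})" if "0 <= t" for t using that by (rule L_deriv)
qed (simp_all add: L_eq)

lemma nn_integral_base:
 assumes [measurable]: "g \<in> bmeas mk.base"
 shows "(\<integral>\<^sup>+b. g b \<partial>mk.base) = (\<integral>\<^sup>+a. ennreal (f (snd a)) * g (fst a, ereal (snd a)) \<partial>lborel)"
proof -
 have g [measurable]: "g \<in> bmeas (borel \<Otimes>\<^sub>M borel)" using assms by simp
 have "(\<integral>\<^sup>+b. g b \<partial>mk.base) = (\<integral>\<^sup>+x. \<integral>\<^sup>+r. g (x, r) \<partial>sat_law \<partial>lborel)"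
  unfolding mk.base_def by (subst mk.N.nn_integral_fst[symmetric]) auto
 also have "... = (\<integral>\<^sup>+x. \<integral>\<^sup>+s. ennreal (f s) * g (x, ereal s) \<partial>lborel \<partial>lborel)"
  unfolding sat_law_def by (intro nn_integral_cong) (simp add: nn_integral_distr nn_integral_density)
 also have "... = (\<integral>\<^sup>+a. ennreal (f (snd a)) * g (fst a, ereal (snd a)) \<partial>lborel)"
  unfolding lborel_prod[symmetric] by (subst lborel.nn_integral_fst[symmetric]) auto
 finally show ?thesis .
qed

text \<open>The increments of \<open>L\<close> in the exponents telescope to its value at the last
  label, starting from \<open>L 0 = 0\<close>.\<close>

lemma weight_closed:
 "mk.weight k y = ennreal (exp (- L (lp k y))) * (\<Prod>i<k. of_bool (lp i y <= fst (y i))) * (\<Prod>i<k. of_bool (ereal (fst (y i)) <= snd (y i)))"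
proof (induction k)
 case (Suc k)
 have "ennreal (exp (- L (lp (Suc k) y))) = ennreal (exp (- L (lp k y))) * ennreal (exp (- (L (fst (y k)) - L (lp k y))))"
  by (simp add: lp_def[of "Suc k"] ennreal_mult[symmetric] exp_add[symmetric])
 moreover have "mk.weight (Suc k) y = mk.weight k y * mk.factor k y" by (simp add: mk.weight_def)
 ultimately show ?case unfolding Suc by (simp add: mk.factor_def mult_ac)
qed (simp add: mk.weight_def lp_def L_eq)

text \<open>The last used pair \<open>a\<close> becomes child number \<open>m\<close> of the root;
  for other vertices this place belongs to the parent and \<open>a\<close> is dropped.\<close>

definition attach :: "vertex => nat => (nat => real \<times> real) => real \<times> real => nat => real \<times> real" where
 "attach v m x a = (if v = [] then x(m := a) else x)"

lemma attach_measurable: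
 "(%(x, a). attach v m x a) \<in> measurable ((pair_seqs m) \<Otimes>\<^sub>M borel) (pair_seqs (num_children v (Suc m)))"
proof (cases "v = []")
 case True
 have e: "{..<Suc m} = insert m {..<m}" by auto
 have "(%(x, a). x(m := a)) \<in> measurable ((pair_seqs m) \<Otimes>\<^sub>M borel) (pair_seqs (Suc m))"
  unfolding e split_beta' by (intro measurable_fun_upd[where J="{..<m}"]) auto
 then show ?thesis using True by (simp add: attach_def num_children_def)
next
 case False
 then show ?thesis by (simp add: attach_def num_children_def split_beta')
qed

text \<open>One formula for root and non-root: in the second case the integrand ignores
  \<open>s\<close>, and the tail density has mass 1.\<close>

lemma emeasure_children_law:
 assumes t: "0 < t" and B: "B \<in> sets (pair_seqs (num_children v (Suc m)))"
 shows "emeasure (children_law p lam v t (Suc m)) B =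
  (\<integral>\<^sup>+s. ennreal (tail_density p lam t s) * (\<integral>\<^sup>+x. indicator B (attach v m (order_pairs m x) (t, s)) \<partial>iid_law t m) \<partial>lborel)"
  and "(%s. \<integral>\<^sup>+x. indicator B (attach v m (order_pairs m x) (t, s)) \<partial>iid_law t m) \<in> bmeas borel"
proof -
 interpret I: prob_space "iid_law t m" by (rule prob_space_iid_law[OF t])
 let ?P = "\<Pi>\<^sub>M j\<in>{..<m}. (borel :: (real \<times> real) measure)"
 have "(%z. (order_pairs m (snd z), (t, fst z))) \<in> measurable ((borel :: real measure) \<Otimes>\<^sub>M ?P) (?P \<Otimes>\<^sub>M (borel \<Otimes>\<^sub>M borel))"
  by measurable
 from measurable_compose[OF this[unfolded borel_prod] attach_measurable, of v]
 have "(%z. attach v m (order_pairs m (snd z)) (t, fst z)) \<in> measurable (borel \<Otimes>\<^sub>M iid_law t m) (pair_seqs (num_children v (Suc m)))"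
  by simp
 from measurable_compose[OF this borel_measurable_indicator[OF B]]
 have "(%z. indicator B (attach v m (order_pairs m (snd z)) (t, fst z)) :: ennreal) \<in> bmeas (borel \<Otimes>\<^sub>M iid_law t m)" .
 from I.borel_measurable_nn_integral_fst[OF this]
 show "(%s. \<integral>\<^sup>+x. indicator B (attach v m (order_pairs m x) (t, s)) \<partial>iid_law t m) \<in> bmeas borel"
  by simp
 show "emeasure (children_law p lam v t (Suc m)) B =
  (\<integral>\<^sup>+s. ennreal (tail_density p lam t s) * (\<integral>\<^sup>+x. indicator B (attach v m (order_pairs m x) (t, s)) \<partial>iid_law t m) \<partial>lborel)"
 proof (cases "v = []")
  case True
  then show ?thesis using emeasure_children_root[OF t, of "Suc m" B] B by (simp add: attach_def num_children_def)
 next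
  case False
  have "(\<integral>\<^sup>+s. ennreal (tail_density p lam t s) * c \<partial>lborel) = c" for c
   using t measurable_tail_density[of t] nn_tail[of t] by (subst nn_integral_multc) auto
  then show ?thesis using emeasure_children_nonroot[OF False, of B "Suc m" t] B False
   by (simp add: attach_def num_children_def)
 qed
qed

text \<open>The density of \<open>m\<close> kept points in increasing order, all before
  \<open>t\<close>, without the exponential factor. Both sides of \<open>children_match\<close> are
  reduced to it.\<close>

definition order_weight :: "nat => real => (nat => real \<times> real) => ennreal" where
 "order_weight m t x = (\<Prod>i<m. ennreal (f (snd (x i)))) *
   ((\<Prod>i<m. of_bool (lp i x <= fst (x i))) * of_bool (lp m x <= t) * (\<Prod>i<m. of_bool (fst (x i) <= snd (x i))))"

lemma prod_of_bool: "finite I ==> (\<Prod>i\<in>I. of_bool (P i)) = (of_bool (\<forall>i\<in>I. P i) :: ennreal)"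
 by (induction I rule: finite_induct) auto

text \<open>Translates the chain of comparisons produced by successive kept points into the
  description by sorted points of [0, t] that belongs to \<open>pair_density\<close>.\<close>

lemma sorted_in_range_iff:
 assumes "0 <= t"
 shows "(\<forall>i\<in>{..<m}. lp i x <= fst (x i)) & lp m x <= t \<longleftrightarrow>
  label_sorted m x & (\<forall>i\<in>{..<m}. 0 <= fst (x i) & fst (x i) <= t)"
proof (induction m)
 case 0
 then show ?case using assms by (simp add: lp_def label_sorted_def)
next
 case (Suc m)
 have all: "(\<forall>i\<in>{..<Suc m}. P i) \<longleftrightarrow> (\<forall>i\<in>{..<m}. P i) & P m" for P by (auto simp: less_Suc_eq)
 have lS: "label_sorted (Suc m) x \<longleftrightarrow> label_sorted m x & (m ~= 0 --> fst (x (m - 1)) <= fst (x m))"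
  by (cases m) (auto simp: label_sorted_def less_Suc_eq)
 show ?case
 proof
  assume L: "(\<forall>i\<in>{..<Suc m}. lp i x <= fst (x i)) & lp (Suc m) x <= t"
  then have b: "lp m x <= fst (x m)" and c: "fst (x m) <= t" and d: "\<forall>i\<in>{..<m}. lp i x <= fst (x i)"
   unfolding all by (auto simp: lp_def[of "Suc m"])
  then have IH: "label_sorted m x & (\<forall>i\<in>{..<m}. 0 <= fst (x i) & fst (x i) <= t)"
   using Suc by (meson order_trans)
  then have "0 <= lp m x" by (cases m) (auto simp: lp_def)
  then show "label_sorted (Suc m) x & (\<forall>i\<in>{..<Suc m}. 0 <= fst (x i) & fst (x i) <= t)"
   unfolding lS all using b c IH by (auto simp: lp_def)
 next
  assume R: "label_sorted (Suc m) x & (\<forall>i\<in>{..<Suc m}. 0 <= fst (x i) & fst (x i) <= t)"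
  then have b: "m ~= 0 --> fst (x (m - 1)) <= fst (x m)" and c: "0 <= fst (x m)" "fst (x m) <= t"
   and d: "label_sorted m x & (\<forall>i\<in>{..<m}. 0 <= fst (x i) & fst (x i) <= t)"
   unfolding lS all by auto
  have e: "\<forall>i\<in>{..<m}. lp i x <= fst (x i)" using d Suc by blast
  have g: "lp m x <= fst (x m)" "lp (Suc m) x <= t" using b c by (auto simp: lp_def)
  show "(\<forall>i\<in>{..<Suc m}. lp i x <= fst (x i)) & lp (Suc m) x <= t"
   unfolding all using e g by blast
 qed
qed

lemma pair_density_prod:
 assumes t: "0 < t"
 shows "(\<Prod>i<m. ennreal (pair_density p lam t (x i))) * of_bool (label_sorted m x) = ennreal (1 / lam t ^ m) * order_weight m t x"
proof -
 have lp: "0 < lam t" by (rule lam_pos[OF t])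
 have "ennreal (pair_density p lam t (x i)) = ennreal (1 / lam t) * ennreal (f (snd (x i))) *
   (of_bool (0 <= fst (x i) & fst (x i) <= t) * of_bool (fst (x i) <= snd (x i)))" for i
  using lp by (auto simp: pair_density_alt ennreal_mult[symmetric] f_nonneg)
 then have e1: "(\<Prod>i<m. ennreal (pair_density p lam t (x i))) = ennreal (1 / lam t) ^ m * (\<Prod>i<m. ennreal (f (snd (x i)))) *
   ((\<Prod>i<m. of_bool (0 <= fst (x i) & fst (x i) <= t)) * (\<Prod>i<m. of_bool (fst (x i) <= snd (x i))))"
  by (simp add: prod.distrib)
 have e2: "ennreal (1 / lam t) ^ m = ennreal (1 / lam t ^ m)"
  using lp by (simp add: ennreal_power power_one_over)
 have e3: "(\<Prod>i<m. of_bool (0 <= fst (x i) & fst (x i) <= t)) * of_bool (label_sorted m x) =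
   ((\<Prod>i<m. of_bool (lp i x <= fst (x i))) * of_bool (lp m x <= t) :: ennreal)"
  unfolding prod_of_bool[OF finite_lessThan] of_bool_conj[symmetric]
  using sorted_in_range_iff[of t m x] t by (intro arg_cong[where f=of_bool]) auto
 have "(\<Prod>i<m. ennreal (pair_density p lam t (x i))) * of_bool (label_sorted m x) =
   ennreal (1 / lam t) ^ m * (\<Prod>i<m. ennreal (f (snd (x i)))) *
   (((\<Prod>i<m. of_bool (0 <= fst (x i) & fst (x i) <= t)) * of_bool (label_sorted m x)) * (\<Prod>i<m. of_bool (fst (x i) <= snd (x i))))"
  unfolding e1 by (simp only: mult_ac)
 then show ?thesis unfolding e3 e2 order_weight_def by (simp only: mult_ac)
qed

lemma order_weight_eq_0: assumes "t < 0" shows "order_weight m t x = 0"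
proof -
 have "(\<forall>i\<in>{..<m}. lp i x <= fst (x i)) ==> 0 <= lp m x"
 proof (induction m)
  case (Suc m)
  then have "0 <= lp m x" "lp m x <= fst (x m)" by auto
  then show ?case by (simp add: lp_def[of "Suc m"])
 qed (simp add: lp_def)
 then have "\<not> ((\<forall>i\<in>{..<m}. lp i x <= fst (x i)) & lp m x <= t)" using assms by force
 then show ?thesis unfolding order_weight_def prod_of_bool[OF finite_lessThan]
  by (cases "\<forall>i\<in>{..<m}. lp i x <= fst (x i)") simp_all
qed

lemma order_weight_measurable:
 "(%(x, a). order_weight m (fst a) x) \<in> bmeas ((pair_seqs m) \<Otimes>\<^sub>M (borel :: (real \<times> real) measure))"
proof -
 let ?P = "(pair_seqs m) \<Otimes>\<^sub>M (borel :: (real \<times> real) measure)"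
 have x: "(%z. fst z i) \<in> bmeas ?P" if "i < m" for i
  using that by (intro measurable_compose[OF measurable_fst measurable_component_singleton]) auto
 have x1 [measurable]: "(%z. fst (fst z i)) \<in> bmeas ?P" and x2 [measurable]: "(%z. snd (fst z i)) \<in> bmeas ?P" if "i < m" for i
  using measurable_compose[OF x[OF that] measurable_fst_borel] measurable_compose[OF x[OF that] measurable_snd_borel] by auto
 have l [measurable]: "(%z. lp i (fst z)) \<in> bmeas ?P" if "i <= m" for i
  using x1[of "i - 1"] that by (cases i) (simp_all add: lp_def)
 have s [measurable]: "(%z. fst (snd z)) \<in> bmeas ?P"
  by (rule measurable_compose[OF measurable_snd measurable_fst_borel])
 have ob: "(%z. of_bool (g z <= h z) :: ennreal) \<in> bmeas ?P"
  if "g \<in> bmeas ?P" "h \<in> bmeas ?P" for g h :: "_ => real"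
 proof -
  have "{z \<in> space ?P. g z <= h z} \<in> sets ?P" using that by (rule borel_measurable_le)
  then have "indicator {z \<in> space ?P. g z <= h z} \<in> bmeas ?P" by (rule borel_measurable_indicator)
  then show ?thesis by (rule measurable_cong[THEN iffD1, rotated]) (simp add: indicator_def)
 qed
 show ?thesis unfolding order_weight_def split_beta'
  by (intro borel_measurable_times_ennreal borel_measurable_prod_ennreal ob x1 l s
    measurable_compose[OF measurable_compose[OF x2 measurable_f] measurable_ennreal]) auto
qed

text \<open>The left side comes from the first \<open>Suc m\<close> kept points of a vertex with
  constraint \<open>Suc m\<close>, the right side from the branching process with type
  \<open>t\<close>, which is the last label. Both become integrals of the same density over the
  first \<open>m\<close> pairs and the last pair.\<close>

lemma children_match:
 assumes h [measurable]: "h \<in> bmeas borel"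
  and B: "B \<in> sets (pair_seqs (num_children v (Suc m)))"
 shows "ennreal (p (Suc m)) * (\<integral>\<^sup>+e. of_bool (has_nth (avs e) (Suc m)) * (h (psum 0 (fst e) (nth_elt (avs e) m)) *
   indicator B (\<lambda>j\<in>{..<num_children v (Suc m)}. (fst (pairs e (Suc m) j), real_of_ereal (snd (pairs e (Suc m) j))))) \<partial>mk.env_law) =
  (\<integral>\<^sup>+t. ennreal (f t) * (h t * kern v (Suc m) B t) \<partial>lborel)"
proof -
 let ?nc = "num_children v (Suc m)"
 let ?P = "%k. \<Pi>\<^sub>M i\<in>{..<k}. (borel :: (real \<times> real) measure)"
 let ?lb = "lborel :: (real \<times> real) measure"
 have nc: "?nc <= Suc m" by (simp add: num_children_def)
 interpret PL: product_sigma_finite "%_ :: nat. ?lb" ..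
 have setsP: "sets (\<Pi>\<^sub>M i\<in>I. ?lb) = sets (\<Pi>\<^sub>M i\<in>I. borel)" for I :: "nat set" by (rule sets_PiM_cong) auto
 define \<Psi> :: "(nat => real \<times> ereal) => ennreal" where
  "\<Psi> y = h (fst (y m)) * indicator B (\<lambda>j\<in>{..<?nc}. (fst (y j), real_of_ereal (snd (y j))))" for y
 have comp: "(%y. y j) \<in> measurable (pair_space (Suc m)) (borel \<Otimes>\<^sub>M borel)" if "j < Suc m" for j
  using that by (intro measurable_component_singleton) simp
 have \<Psi>: "\<Psi> \<in> bmeas (pair_space (Suc m))"
 proof -
  have "(%y. \<lambda>j\<in>{..<?nc}. (fst (y j), real_of_ereal (snd (y j)))) \<in> measurable (pair_space (Suc m)) (?P ?nc)"
  proof (rule measurable_restrict)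
   fix j assume "j \<in> {..<?nc}"
   then have "j < Suc m" using nc by simp
   note measurable_compose[OF comp[OF this], of "%b. (fst b, real_of_ereal (snd b))" borel]
   then show "(%y. (fst (y j), real_of_ereal (snd (y j)))) \<in> bmeas (pair_space (Suc m))"
    unfolding borel_prod[symmetric] by simp
  qed
  from measurable_compose[OF this borel_measurable_indicator[OF B]]
  show ?thesis unfolding \<Psi>_def
   by (intro borel_measurable_times_ennreal measurable_compose[OF measurable_compose[OF comp measurable_fst] h]) auto
 qed
 \<comment> \<open>The integral over the first \<open>m\<close> pairs when the last pair is
   \<open>a\<close>.\<close>
 define J where "J a = (\<integral>\<^sup>+x. order_weight m (fst a) x * indicator B (attach v m x a) \<partial>(\<Pi>\<^sub>M i\<in>{..<m}. ?lb))" for a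
 interpret PLm: sigma_finite_measure "\<Pi>\<^sub>M i\<in>{..<m}. ?lb" by (rule PL.sigma_finite) simp
 have Jin: "(%(x, a). order_weight m (fst a) x * indicator B (attach v m x a)) \<in> bmeas (?P m \<Otimes>\<^sub>M borel)"
  using order_weight_measurable[of m] measurable_compose[OF attach_measurable[of v m] borel_measurable_indicator[OF B]]
  unfolding split_beta' by (rule borel_measurable_times_ennreal)
 have "(%(a, x). order_weight m (fst a) x * indicator B (attach v m x a)) \<in> bmeas (borel \<Otimes>\<^sub>M ?P m)"
  using measurable_compose[OF measurable_pair_swap' Jin] by (simp add: split_beta')
 then have "(%(a, x). order_weight m (fst a) x * indicator B (attach v m x a)) \<in> bmeas (borel \<Otimes>\<^sub>M (\<Pi>\<^sub>M i\<in>{..<m}. ?lb))"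
  by (subst measurable_cong_sets[OF sets_pair_measure_cong[OF refl setsP] refl])
 from PLm.borel_measurable_nn_integral[OF this]
 have J [measurable]: "J \<in> bmeas borel" unfolding J_def[abs_def] .
 have Jx: "(%x. order_weight m (fst a) x * indicator B (attach v m x a)) \<in> bmeas (?P m)" for a
  using measurable_compose[OF measurable_Pair1'[of a borel], OF _ measurable_compose[OF measurable_pair_swap' Jin]]
  by (simp add: split_beta')
 define c where "c a = ennreal (f (snd a)) * (of_bool (fst a <= snd a) * (ennreal (exp (- L (fst a))) * h (fst a)))" for a
 have "(\<integral>\<^sup>+e. of_bool (has_nth (avs e) (Suc m)) * (h (psum 0 (fst e) (nth_elt (avs e) m)) *
   indicator B (\<lambda>j\<in>{..<?nc}. (fst (pairs e (Suc m) j), real_of_ereal (snd (pairs e (Suc m) j))))) \<partial>mk.env_law) =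
  (\<integral>\<^sup>+e. of_bool (has_nth (avs e) (Suc m)) * \<Psi> (pairs e (Suc m)) \<partial>mk.env_law)"
  unfolding \<Psi>_def by (simp add: pairs_def at_pos_def)
 also have "... = (\<integral>\<^sup>+y. mk.weight (Suc m) y * \<Psi> y \<partial>(\<Pi>\<^sub>M i\<in>{..<Suc m}. mk.base))"
  by (rule mk.pairs_law[OF \<Psi>])
 also have "... = (\<integral>\<^sup>+x. (\<Prod>i<Suc m. ennreal (f (snd (x i)))) *
   (mk.weight (Suc m) (\<lambda>i\<in>{..<Suc m}. (fst (x i), ereal (snd (x i)))) * \<Psi> (\<lambda>i\<in>{..<Suc m}. (fst (x i), ereal (snd (x i))))) \<partial>(\<Pi>\<^sub>M i\<in>{..<Suc m}. ?lb))"
 proof (rule nn_integral_PiM_transfer)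
  show "(%y. mk.weight (Suc m) y * \<Psi> y) \<in> bmeas (\<Pi>\<^sub>M i\<in>{..<Suc m}. mk.base)"
   unfolding measurable_cong_sets[OF mk.sets_bases refl] using mk.weight_measurable \<Psi> by (intro borel_measurable_times_ennreal)
  show "(%a. ennreal (f (snd a))) \<in> bmeas ?lb"
   using measurable_compose[OF measurable_snd_borel measurable_f] by simp
  show "(%a. (fst a, ereal (snd a))) \<in> measurable ?lb mk.base"
   unfolding lborel_prod[symmetric] by measurable
 qed (auto intro: nn_integral_base lborel.sigma_finite_measure_axioms mk.base.sigma_finite_measure_axioms)
 also have "... = (\<integral>\<^sup>+x. c (x m) * (order_weight m (fst (x m)) x * indicator B (attach v m (restrict x {..<m}) (x m))) \<partial>(\<Pi>\<^sub>M i\<in>{..<Suc m}. ?lb))"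
 proof (rule nn_integral_cong)
  fix x assume x: "x \<in> space (\<Pi>\<^sub>M i\<in>{..<Suc m}. ?lb)"
  let ?y = "\<lambda>i\<in>{..<Suc m}. (fst (x i), ereal (snd (x i)))"
  have lp: "lp i ?y = lp i x" if "i <= Suc m" for i using that by (cases i) (simp_all add: lp_def)
  have w: "mk.weight (Suc m) ?y = ennreal (exp (- L (fst (x m)))) * ((\<Prod>i<m. of_bool (lp i x <= fst (x i))) * of_bool (lp m x <= fst (x m))) *
    ((\<Prod>i<m. of_bool (fst (x i) <= snd (x i))) * of_bool (fst (x m) <= snd (x m)))"
   unfolding weight_closed by (simp add: lp lp_def[of "Suc m"])
  have at: "(\<lambda>j\<in>{..<?nc}. (fst (?y j), real_of_ereal (snd (?y j)))) = attach v m (restrict x {..<m}) (x m)"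
   by (auto simp: fun_eq_iff attach_def num_children_def)
  have \<Psi>y: "\<Psi> ?y = h (fst (x m)) * indicator B (attach v m (restrict x {..<m}) (x m))"
   unfolding \<Psi>_def at by simp
  show "(\<Prod>i<Suc m. ennreal (f (snd (x i)))) * (mk.weight (Suc m) ?y * \<Psi> ?y) =
    c (x m) * (order_weight m (fst (x m)) x * indicator B (attach v m (restrict x {..<m}) (x m)))"
   unfolding w \<Psi>y c_def order_weight_def prod.lessThan_Suc by (simp only: mult_ac)
 qed
 also have "... = (\<integral>\<^sup>+a. \<integral>\<^sup>+x. c a * (order_weight m (fst a) x * indicator B (attach v m x a)) \<partial>(\<Pi>\<^sub>M i\<in>{..<m}. ?lb) \<partial>?lb)"
 proof -
  let ?K = "%x. c (x m) * (order_weight m (fst (x m)) x * indicator B (attach v m (restrict x {..<m}) (x m)))"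
  have ins: "{..<Suc m} = insert m {..<m}" by (rule lessThan_Suc)
  have ow: "order_weight m t (restrict x {..<m}) = order_weight m t x" for t x
  proof -
   have "lp i (restrict x {..<m}) = lp i x" if "i <= m" for i using that by (cases i) (simp_all add: lp_def)
   then show ?thesis unfolding order_weight_def by (simp cong: prod.cong_simp)
  qed
  have km: "?K \<in> bmeas (\<Pi>\<^sub>M i\<in>insert m {..<m}. ?lb)"
  proof -
   have a: "(%x. x m) \<in> bmeas (\<Pi>\<^sub>M i\<in>insert m {..<m}. (borel :: (real \<times> real) measure))" by measurable
   have r: "(%x. restrict x {..<m}) \<in> measurable (\<Pi>\<^sub>M i\<in>insert m {..<m}. (borel :: (real \<times> real) measure)) (?P m)"
    by (rule measurable_restrict_subset) auto
   have "(%x. order_weight m (fst (x m)) (restrict x {..<m}) * indicator B (attach v m (restrict x {..<m}) (x m))) \<in> bmeas (\<Pi>\<^sub>M i\<in>insert m {..<m}. borel)"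
    using measurable_compose[OF measurable_Pair[OF r a] Jin] by simp
   moreover have "c \<in> bmeas borel"
    unfolding c_def[abs_def] borel_prod[symmetric] by measurable
   ultimately show ?thesis unfolding ow measurable_cong_sets[OF setsP refl]
    using a by (intro borel_measurable_times_ennreal[of "%x. c (x m)"]) (auto intro: measurable_compose)
  qed
  have "(\<integral>\<^sup>+x. ?K x \<partial>(\<Pi>\<^sub>M i\<in>insert m {..<m}. ?lb)) = (\<integral>\<^sup>+a. \<integral>\<^sup>+x. ?K (x(m := a)) \<partial>(\<Pi>\<^sub>M i\<in>{..<m}. ?lb) \<partial>?lb)"
   by (rule PL.product_nn_integral_insert_rev[OF _ _ km]) auto
  also have "... = (\<integral>\<^sup>+a. \<integral>\<^sup>+x. c a * (order_weight m (fst a) x * indicator B (attach v m x a)) \<partial>(\<Pi>\<^sub>M i\<in>{..<m}. ?lb) \<partial>?lb)"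
  proof (intro nn_integral_cong)
   fix a x assume "x \<in> space (\<Pi>\<^sub>M i\<in>{..<m}. ?lb)"
   then have "restrict x {..<m} = x" by (simp add: space_PiM PiE_def extensional_restrict)
   then have r: "restrict (x(m := a)) {..<m} = x" by (metis lessThan_iff less_irrefl restrict_fupd)
   show "?K (x(m := a)) = c a * (order_weight m (fst a) x * indicator B (attach v m x a))"
    using ow[of "fst a" "x(m := a)"] unfolding r by simp
  qed
  finally show ?thesis unfolding ins .
 qed
 also have "... = (\<integral>\<^sup>+a. c a * J a \<partial>?lb)"
  unfolding J_def using Jx by (intro nn_integral_cong nn_integral_cmult) (simp add: measurable_cong_sets[OF setsP refl])
 also have "... = (\<integral>\<^sup>+t. \<integral>\<^sup>+s. c (t, s) * J (t, s) \<partial>lborel \<partial>lborel)"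
 proof -
  have "(%a. c a * J a) \<in> bmeas (lborel \<Otimes>\<^sub>M lborel)"
  proof (intro borel_measurable_times_ennreal)
   show "c \<in> bmeas (lborel \<Otimes>\<^sub>M lborel)" unfolding c_def[abs_def] by measurable
   show "J \<in> bmeas (lborel \<Otimes>\<^sub>M lborel)" using J unfolding lborel_prod by simp
  qed
  then show ?thesis unfolding lborel_prod[symmetric] by (rule lborel.nn_integral_fst[symmetric])
 qed
 finally have L1: "(\<integral>\<^sup>+e. of_bool (has_nth (avs e) (Suc m)) * (h (psum 0 (fst e) (nth_elt (avs e) m)) *
   indicator B (\<lambda>j\<in>{..<?nc}. (fst (pairs e (Suc m) j), real_of_ereal (snd (pairs e (Suc m) j))))) \<partial>mk.env_law) =
   (\<integral>\<^sup>+t. \<integral>\<^sup>+s. c (t, s) * J (t, s) \<partial>lborel \<partial>lborel)" .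
 \<comment> \<open>The i.i.d. pairs have the factor \<open>1 / lam t ^ m\<close> in their density,
   and sorting contributes \<open>fact m\<close>.\<close>
 have inner: "(\<integral>\<^sup>+x. indicator B (attach v m (order_pairs m x) (t, s)) \<partial>iid_law t m) = ennreal (fact m / lam t ^ m) * J (t, s)"
  if t: "0 < t" for t s
 proof -
  have Bm: "(%x. indicator B (attach v m x (t, s)) :: ennreal) \<in> bmeas (?P m)"
   using measurable_compose[OF measurable_Pair2'[of "(t, s)" borel] measurable_compose[OF attach_measurable[of v m] borel_measurable_indicator[OF B]]] by simp
  have Bl: "(%x. of_bool (label_sorted m x) * indicator B (attach v m x (t, s)) :: ennreal) \<in> bmeas (?P m)"
   using label_sorted_measurable[of m] Bm by (intro borel_measurable_times_ennreal) auto
  have "(\<integral>\<^sup>+x. indicator B (attach v m (order_pairs m x) (t, s)) \<partial>iid_law t m) =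
   ennreal (fact m) * (\<integral>\<^sup>+x. of_bool (label_sorted m x) * indicator B (attach v m x (t, s)) \<partial>iid_law t m)"
   by (rule nn_integral_order_pairs[OF t Bm])
  also have "(\<integral>\<^sup>+x. of_bool (label_sorted m x) * indicator B (attach v m x (t, s)) \<partial>iid_law t m) =
   (\<integral>\<^sup>+x. (\<Prod>i<m. ennreal (pair_density p lam t (x i))) * (of_bool (label_sorted m (\<lambda>i\<in>{..<m}. x i)) * indicator B (attach v m (\<lambda>i\<in>{..<m}. x i) (t, s))) \<partial>(\<Pi>\<^sub>M i\<in>{..<m}. ?lb))"
   unfolding iid_law_def
  proof (rule nn_integral_PiM_transfer)
   show "sigma_finite_measure (pair_law t)"
    using prob_space_pair_law[OF t] by (simp add: prob_space.axioms finite_measure.axioms prob_space_imp_sigma_finite)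
   show "(\<integral>\<^sup>+b. g b \<partial>pair_law t) = (\<integral>\<^sup>+a. ennreal (pair_density p lam t a) * g a \<partial>?lb)" if "g \<in> bmeas (pair_law t)" for g
    unfolding pair_law_def using that by (intro nn_integral_density) auto
   show "(%x. of_bool (label_sorted m x) * indicator B (attach v m x (t, s)) :: ennreal) \<in> bmeas (\<Pi>\<^sub>M i\<in>{..<m}. pair_law t)"
    using Bl unfolding iid_law_def[symmetric] measurable_cong_sets[OF sets_iid_law refl] .
  qed (auto intro: lborel.sigma_finite_measure_axioms)
  also have "... = (\<integral>\<^sup>+x. ennreal (1 / lam t ^ m) * (order_weight m t x * indicator B (attach v m x (t, s))) \<partial>(\<Pi>\<^sub>M i\<in>{..<m}. ?lb))"
  proof (rule nn_integral_cong)
   fix x assume "x \<in> space (\<Pi>\<^sub>M i\<in>{..<m}. ?lb)"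
   then have r: "restrict x {..<m} = x" by (simp add: space_PiM PiE_def extensional_restrict)
   show "(\<Prod>i<m. ennreal (pair_density p lam t (x i))) * (of_bool (label_sorted m (\<lambda>i\<in>{..<m}. x i)) * indicator B (attach v m (\<lambda>i\<in>{..<m}. x i) (t, s))) =
    ennreal (1 / lam t ^ m) * (order_weight m t x * indicator B (attach v m x (t, s)))"
    unfolding r mult.assoc[symmetric] pair_density_prod[OF t] ..
  qed
  also have "... = ennreal (1 / lam t ^ m) * J (t, s)"
   unfolding J_def fst_conv using Jx[of "(t, s)"] by (intro nn_integral_cmult) (simp add: measurable_cong_sets[OF setsP refl])
  finally show ?thesis using lam_pos[OF t] by (simp add: mult.assoc[symmetric] ennreal_mult[symmetric])
 qed
 have pt: "ennreal (p (Suc m)) * (\<integral>\<^sup>+s. c (t, s) * J (t, s) \<partial>lborel) = ennreal (f t) * (h t * kern v (Suc m) B t)" if "t ~= 0" for t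
 proof (cases "0 < t")
  case False
  then have "t < 0" using that by simp
  then show ?thesis using False by (simp add: J_def order_weight_eq_0 kern_def)
 next
  case t: True
  have Fp: "0 < F (lam t)" by (rule F_pos[OF lam_nonneg]) (use t in simp)
  have Zp: "0 < Z (lam t)" by (rule Z_pos[OF lam_pos[OF t]])
  have lp: "0 < lam t" by (rule lam_pos[OF t])
  \<comment> \<open>The numerical heart: \<open>f t\<close> is \<open>F * Z\<close>, the degree
    probability divides by \<open>Z\<close>, the tail density by \<open>F\<close>, and its power
    \<open>lam t ^ m / fact m\<close> cancels the factor of the sorted pairs. What remains is
    \<open>p (Suc m)\<close> times the exponential of the kept points.\<close>
  have sc: "f t * degree_prob p lam t (Suc m) * (1 / F (lam t)) * (fact m / lam t ^ m) = p (Suc m) * exp (- lam t)"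
   using t Fp Zp lp by (simp add: f_eq L_eq degree_prob_eq zfun_def field_simps)
  have "kern v (Suc m) B t = ennreal (degree_prob p lam t (Suc m)) *
    (\<integral>\<^sup>+s. ennreal (tail_density p lam t s) * (ennreal (fact m / lam t ^ m) * J (t, s)) \<partial>lborel)"
   using t unfolding kern_def by (simp add: emeasure_children_law(1)[OF t B] inner[OF t])
  then have "ennreal (f t) * (h t * kern v (Suc m) B t) = (ennreal (f t) * h t * ennreal (degree_prob p lam t (Suc m))) *
    (\<integral>\<^sup>+s. ennreal (tail_density p lam t s) * (ennreal (fact m / lam t ^ m) * J (t, s)) \<partial>lborel)"
   by (simp add: mult_ac)
  also have "... = (\<integral>\<^sup>+s. (ennreal (f t) * h t * ennreal (degree_prob p lam t (Suc m))) * (ennreal (tail_density p lam t s) * (ennreal (fact m / lam t ^ m) * J (t, s))) \<partial>lborel)"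
  proof (rule nn_integral_cmult[symmetric])
   have "(%s. J (t, s)) \<in> bmeas borel"
    by (rule measurable_compose[OF _ J]) (simp add: borel_prod[symmetric])
   then show "(%s. ennreal (tail_density p lam t s) * (ennreal (fact m / lam t ^ m) * J (t, s))) \<in> bmeas lborel"
    using measurable_tail_density[of t] t by (intro borel_measurable_times_ennreal) auto
  qed
  also have "... = (\<integral>\<^sup>+s. ennreal (p (Suc m)) * (c (t, s) * J (t, s)) \<partial>lborel)"
  proof (rule nn_integral_cong_AE, use AE_lborel_singleton[of t] in eventually_elim)
   case (elim s)
   have "ennreal (f t) * ennreal (degree_prob p lam t (Suc m)) * (ennreal (tail_density p lam t s) * ennreal (fact m / lam t ^ m)) =
     ennreal (f t * degree_prob p lam t (Suc m) * (tail_density p lam t s * (fact m / lam t ^ m)))"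
    using f_nonneg degree_prob_nonneg[of t "Suc m"] t lp Fp
    by (subst ennreal_mult[symmetric] | simp add: tail_density_eq)+
   also have "f t * degree_prob p lam t (Suc m) * (tail_density p lam t s * (fact m / lam t ^ m)) =
     (f t * degree_prob p lam t (Suc m) * (1 / F (lam t)) * (fact m / lam t ^ m)) * (f s * of_bool (t <= s))"
    using t elim by (simp add: tail_density_eq indicator_def)
   also have "... = p (Suc m) * (f s * (of_bool (t <= s) * exp (- L t)))"
    unfolding sc using t by (simp add: L_eq)
   also have "ennreal ... = ennreal (p (Suc m)) * (ennreal (f s) * (of_bool (t <= s) * ennreal (exp (- L t))))"
    using f_nonneg[of s] p_nonneg[of "Suc m"] by (simp add: ennreal_mult)
   finally have e: "ennreal (f t) * ennreal (degree_prob p lam t (Suc m)) * (ennreal (tail_density p lam t s) * ennreal (fact m / lam t ^ m)) =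
     ennreal (p (Suc m)) * (ennreal (f s) * (of_bool (t <= s) * ennreal (exp (- L t))))" .
   have "(ennreal (f t) * h t * ennreal (degree_prob p lam t (Suc m))) * (ennreal (tail_density p lam t s) * (ennreal (fact m / lam t ^ m) * J (t, s))) =
     (ennreal (f t) * ennreal (degree_prob p lam t (Suc m)) * (ennreal (tail_density p lam t s) * ennreal (fact m / lam t ^ m))) * (h t * J (t, s))"
    by (simp only: mult_ac)
   then show ?case unfolding e c_def fst_conv snd_conv by (simp only: mult_ac)
  qed
  also have "... = ennreal (p (Suc m)) * (\<integral>\<^sup>+s. c (t, s) * J (t, s) \<partial>lborel)"
  proof (rule nn_integral_cmult)
   have m: "(%s :: real. (t, s)) \<in> bmeas borel" by (simp add: borel_prod[symmetric])
   have "c \<in> bmeas borel" unfolding c_def[abs_def] borel_prod[symmetric] by measurable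
   from measurable_compose[OF m this] measurable_compose[OF m J]
   show "(%s. c (t, s) * J (t, s)) \<in> bmeas lborel" by simp
  qed
  finally show ?thesis ..
 qed
 have cJ: "(%t. \<integral>\<^sup>+s. c (t, s) * J (t, s) \<partial>lborel) \<in> bmeas lborel"
 proof -
  have "(%a. c a * J a) \<in> bmeas (borel \<Otimes>\<^sub>M lborel)"
  proof (intro borel_measurable_times_ennreal)
   show "c \<in> bmeas (borel \<Otimes>\<^sub>M lborel)" unfolding c_def[abs_def] by measurable
   show "J \<in> bmeas (borel \<Otimes>\<^sub>M lborel)" using J unfolding borel_prod[symmetric] by simp
  qed
  from lborel.borel_measurable_nn_integral_fst[OF this] show ?thesis by simp
 qed
 show ?thesis unfolding L1 nn_integral_cmult[OF cJ, symmetric]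
  by (rule nn_integral_cong_AE, use AE_lborel_singleton[of 0] in eventually_elim) (rule pt)
qed

end

section \<open>The environment and its phantom saturation times\<close>

abbreviation local_space :: "((nat => real) \<times> nat) measure" where
 "local_space \<equiv> seq_space \<Otimes>\<^sub>M count_space UNIV"

abbreviation env_space :: "env measure" where
 "env_space \<equiv> \<Pi>\<^sub>M v\<in>UNIV. local_space"

abbreviation time_space :: "(vertex => ereal) measure" where
 "time_space \<equiv> \<Pi>\<^sub>M v\<in>UNIV. borel"

lemma space_local [simp]: "space local_space = UNIV" by (auto simp: space_pair_measure space_PiM)
lemma space_env [simp]: "space env_space = UNIV" by (auto simp: space_PiM)
lemma space_time [simp]: "space time_space = UNIV" by (auto simp: space_PiM)

lemma env_at_measurable: "g \<in> measurable N env_space ==> (%w. g w v) \<in> measurable N local_space"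
 by (rule measurable_compose[OF _ measurable_component_singleton]) auto

lemma env_pts_measurable: assumes "g \<in> measurable N env_space" shows "(%w. fst (g w v) j) \<in> bmeas N"
 by (rule measurable_compose[OF measurable_compose[OF env_at_measurable[OF assms] measurable_fst] measurable_component_singleton]) auto

lemma env_deg_measurable: assumes "g \<in> measurable N env_space" shows "(%w. snd (g w v)) \<in> measurable N (count_space UNIV)"
 by (rule measurable_compose[OF env_at_measurable[OF assms] measurable_snd])

lemma time_at_measurable: "T \<in> measurable N time_space ==> (%w. T w v) \<in> bmeas N"
 by (rule measurable_compose[OF _ measurable_component_singleton]) auto

lemma approx_measurable: assumes "g \<in> measurable N env_space" shows "(%w. approx n (g w) v) \<in> bmeas N"
proof (induction n arbitrary: v)
 case (Suc n)
 show ?case unfolding approx.simps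
  by (intro sat_time_measurable env_pts_measurable env_deg_measurable assms Suc)
qed simp

lemma ptime_measurable: assumes "g \<in> measurable N env_space" shows "(%w. ptime (g w) v) \<in> bmeas N"
 unfolding ptime_def by (rule borel_measurable_INF) (auto intro: approx_measurable[OF assms])

lemma ptimes_measurable: "g \<in> measurable N env_space ==> (%w. ptime (g w)) \<in> measurable N time_space"
 by (rule measurable_PiM_single') (auto intro: ptime_measurable)

lemma approx_cong: "(\<And>w. z (v @ w) = z' (v @ w)) ==> approx n z v = approx n z' v"
proof (induction n arbitrary: v)
 case (Suc n)
 have "approx n z (v @ [j]) = approx n z' (v @ [j])" for j
  by (rule Suc.IH) (use Suc.prems[of "j # _"] in simp)
 then show ?case using Suc.prems[of "[]"] by simp
qed simp

lemma ptime_cong: "(\<And>w. z (v @ w) = z' (v @ w)) ==> ptime z v = ptime z' v"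
 unfolding ptime_def by (intro INF_cong refl approx_cong)

section \<open>Histories as functions of finitely many generations\<close>

text \<open>Runs the recursion through \<open>m\<close> generations, with boundary values \<theta>
  at depth \<open>m\<close> below \<open>v\<close>.\<close>

primrec up :: "nat => env => (vertex => ereal) => vertex => ereal" where
 "up 0 y \<theta> v = \<theta> v"
| "up (Suc m) y \<theta> v = sat_time (fst (y v)) (%j. up m y \<theta> (v @ [j])) (snd (y v))"

lemma up_measurable:
 assumes "g \<in> measurable N env_space" "T \<in> measurable N time_space"
 shows "(%w. up m (g w) (T w) v) \<in> bmeas N"
proof (induction m arbitrary: v)
 case 0
 then show ?case using time_at_measurable[OF assms(2)] by simp
next
 case (Suc m)
 show ?case unfolding up.simps
  by (intro sat_time_measurable env_pts_measurable env_deg_measurable assms Suc)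
qed

lemma (in good_env) up_ptime: "up m z (ptime z) v = ptime z v"
 by (induction m arbitrary: v) (simp_all add: ptime_fixpoint[symmetric])

text \<open>Equality of the environments in generations before \<open>n\<close> and of the times in
  generations from \<open>l\<close> to \<open>n\<close>. With \<open>l = n\<close> it describes what
  a history may depend on before generation \<open>n\<close> is opened; with \<open>l = 0\<close> it
  is what the history literally reads.\<close>

definition agree :: "nat => nat => env => (vertex => ereal) => env => (vertex => ereal) => bool" where
 "agree l n y \<theta> y' \<theta>' \<longleftrightarrow> (\<forall>v. length v < n --> y v = y' v) & (\<forall>v. l <= length v & length v <= n --> \<theta> v = \<theta>' v)"

lemma up_cong: "agree n n y \<theta> y' \<theta>' ==> length v + m = n ==> up m y \<theta> v = up m y' \<theta>' v"
proof (induction m arbitrary: v)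
 case (Suc m)
 have "up m y \<theta> (v @ [j]) = up m y' \<theta>' (v @ [j])" for j by (rule Suc.IH) (use Suc.prems in auto)
 then show ?case using Suc.prems by (simp add: agree_def)
qed (simp add: agree_def)

text \<open>Recovers the times of the earlier generations from those of generation \<open>n\<close>,
  so that the history can be written without looking into the subtrees below generation
  \<open>n\<close> otherwise.\<close>

definition lift :: "nat => env => (vertex => ereal) => vertex => ereal" where
 "lift n y \<theta> v = up (n - length v) y \<theta> v"

lemma agree_lift: "agree n n y \<theta> y' \<theta>' ==> agree 0 n y (lift n y \<theta>) y' (lift n y' \<theta>')"
 unfolding agree_def[of 0] lift_def using up_cong[of n y \<theta> y' \<theta>'] by (auto simp: agree_def)

lemma (in good_env) lift_ptime: "lift n z (ptime z) = ptime z"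
 by (simp add: lift_def fun_eq_iff up_ptime)

text \<open>This and the following definitions repeat the placement with the family of times as a
  free argument, in order to feed in lifted times; with \<open>ptime z\<close> they give back the
  originals.\<close>

definition avail_of :: "env => (vertex => ereal) => vertex => nat set" where
 "avail_of y T v = {j. ereal (fst (y v) j) <= T (v @ [j])}"

lemma avail_of_ptime: "avail_of z (ptime z) = avail z"
 by (simp add: avail_of_def avail_def fun_eq_iff)

definition place_of :: "env => (vertex => ereal) => nat list => vertex" where
 "place_of y T w = fold (%j v. v @ [nth_elt (avail_of y T v) j]) w []"

lemma place_of_Nil [simp]: "place_of y T [] = []"
 and place_of_snoc: "place_of y T (w @ [j]) = place_of y T w @ [nth_elt (avail_of y T (place_of y T w)) j]"
 by (simp_all add: place_of_def)

lemma length_place_of [simp]: "length (place_of y T w) = length w"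
 by (induction w rule: rev_induct) (simp_all add: place_of_snoc)

lemma place_of_ptime: "place_of z (ptime z) w = place z w"
 by (induction w rule: rev_induct) (simp_all add: place_of_snoc place_snoc avail_of_ptime)

lemma agree_avail: "agree 0 n y T y' T' ==> length v < n ==> avail_of y T v = avail_of y' T' v"
 by (simp add: agree_def avail_of_def)

lemma agree_place: "agree 0 n y T y' T' ==> length w <= n ==> place_of y T w = place_of y' T' w"
proof (induction w rule: rev_induct)
 case (snoc x xs)
 then show ?case using agree_avail[OF snoc.prems(1), of "place_of y' T' xs"] by (simp add: place_of_snoc)
qed simp

definition label_of :: "env => (vertex => ereal) => vertex => real" where
 "label_of y T w = (if w = [] then 0 else fst (y (place_of y T (butlast w))) (nth_elt (avail_of y T (place_of y T (butlast w))) (last w)))"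

definition hist_of :: "nat => env => (vertex => ereal) => vertex => real \<times> real \<times> nat" where
 "hist_of n y T = mtbp_history n (%w. real_of_ereal (T (place_of y T w))) (%w. snd (y (place_of y T w))) (label_of y T)"

definition vert_of :: "env => (vertex => ereal) => vertex set" where
 "vert_of y T = mtbp_vertices (%w. snd (y (place_of y T w)))"

lemma hist_of_ptime: "hist_of n z (ptime z) = mtbp_history n (placed_type z) (placed_degree z) (placed_label z)"
proof -
 have "label_of z (ptime z) = placed_label z"
  by (simp add: label_of_def placed_label_def place_of_ptime avail_of_ptime fun_eq_iff)
 then show ?thesis
  by (simp add: hist_of_def place_of_ptime placed_type_def[abs_def] placed_degree_def[abs_def])
qed

lemma vert_of_ptime: "vert_of z (ptime z) = mtbp_vertices (placed_degree z)"
 by (simp add: vert_of_def place_of_ptime placed_degree_def[abs_def])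

lemma agree_vert:
 assumes "agree 0 n y T y' T'" "length v <= n"
 shows "v \<in> vert_of y T \<longleftrightarrow> v \<in> vert_of y' T'"
proof -
 have "snd (y (place_of y T u)) = snd (y' (place_of y' T' u))" if "prefix (u @ [j]) v" for u j
 proof -
  have "length u < n" using prefix_length_le[OF that] assms(2) by simp
  then show ?thesis using assms(1) agree_place[OF assms(1), of u] by (simp add: agree_def)
 qed
 then show ?thesis unfolding vert_of_def mtbp_vertices_def by auto
qed

lemma agree_hist:
 assumes a: "agree 0 n y T y' T'" shows "hist_of n y T = hist_of n y' T'"
proof
 fix w
 show "hist_of n y T w = hist_of n y' T' w"
 proof (cases "length w <= n")
  case True
  have p: "place_of y T w = place_of y' T' w" by (rule agree_place[OF a True])
  have b: "label_of y T w = label_of y' T' w" if "w ~= []"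
  proof -
   have l: "length (butlast w) < n" using True that by (cases w rule: rev_cases) auto
   have "place_of y T (butlast w) = place_of y' T' (butlast w)" using l by (intro agree_place[OF a]) simp
   then show ?thesis using l a agree_avail[OF a, of "place_of y' T' (butlast w)"] by (simp add: label_of_def agree_def)
  qed
  have "snd (y (place_of y T w)) = snd (y' (place_of y' T' w))" if "length w < n"
   using that a by (simp add: p agree_def)
  moreover have "T (place_of y T w) = T' (place_of y' T' w)" using True a by (simp add: p agree_def)
  ultimately show ?thesis
   using agree_vert[OF a True] b by (simp add: hist_of_def mtbp_history_def vert_of_def)
 qed (simp add: hist_of_def mtbp_history_def)
qed

lemma mtbp_history_measurable:
 assumes [measurable]: "\<And>v. T v \<in> bmeas N" "\<And>v. d v \<in> measurable N (count_space UNIV)" "\<And>v. l v \<in> bmeas N"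
 shows "(%w. mtbp_history n (%v. T v w) (%v. d v w) (%v. l v w)) \<in> measurable N hist_space"
proof (rule measurable_PiM_single')
 have [measurable]: "Measurable.pred N (%w. v \<in> mtbp_vertices (%v. d v w))" for v
  by (rule mtbp_vertices_measurable) measurable
 show "(%w. mtbp_history n (%v. T v w) (%v. d v w) (%v. l v w) v) \<in> measurable N (borel \<Otimes>\<^sub>M borel \<Otimes>\<^sub>M count_space UNIV)" for v
  unfolding mtbp_history_def by measurable
qed (auto simp: space_pair_measure)

context
 fixes g :: "'c => env" and T N
 assumes g: "g \<in> measurable N env_space" and T: "T \<in> measurable N time_space"
begin

lemma avail_of_measurable: "Measurable.pred N (%w. j \<in> avail_of (g w) (T w) v)"
 using borel_measurable_le[OF borel_measurable_ereal[OF env_pts_measurable[OF g, of v j]] time_at_measurable[OF T, of "v @ [j]"]]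
 by (simp add: avail_of_def pred_def)

lemma child_of_measurable: "(%w. nth_elt (avail_of (g w) (T w) v) j) \<in> measurable N (count_space UNIV)"
 by (rule nth_elt_measurable[OF avail_of_measurable])

lemma place_of_measurable: "(%\<omega>. place_of (g \<omega>) (T \<omega>) w) \<in> measurable N (count_space UNIV)"
proof (induction w rule: rev_induct)
 case (snoc x xs)
 show ?case unfolding place_of_snoc
 proof (rule measurable_compose_countable[OF _ snoc])
  show "(%\<omega>. v @ [nth_elt (avail_of (g \<omega>) (T \<omega>) v) x]) \<in> measurable N (count_space UNIV)" for v
   by (rule measurable_compose[OF child_of_measurable]) simp
 qed
qed simp

lemma type_of_measurable: "(%\<omega>. real_of_ereal (T \<omega> (place_of (g \<omega>) (T \<omega>) w))) \<in> bmeas N"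
 by (rule borel_measurable_real_of_ereal, rule measurable_compose_countable[OF time_at_measurable[OF T] place_of_measurable])

lemma degree_of_measurable: "(%\<omega>. snd (g \<omega> (place_of (g \<omega>) (T \<omega>) w))) \<in> measurable N (count_space UNIV)"
 by (rule measurable_compose_countable[OF env_deg_measurable[OF g] place_of_measurable])

lemma label_of_measurable: "(%\<omega>. label_of (g \<omega>) (T \<omega>) w) \<in> bmeas N"
proof (cases "w = []")
 case False
 have "(%\<omega>. fst (g \<omega> v) (nth_elt (avail_of (g \<omega>) (T \<omega>) v) (last w))) \<in> bmeas N" for v
  by (rule measurable_compose_countable[OF env_pts_measurable[OF g] child_of_measurable])
 from measurable_compose_countable[OF this place_of_measurable[of "butlast w"]] False
 show ?thesis by (simp add: label_of_def)
qed (simp add: label_of_def)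

lemma hist_of_measurable: "(%w. hist_of n (g w) (T w)) \<in> measurable N hist_space"
 unfolding hist_of_def
 by (intro mtbp_history_measurable type_of_measurable degree_of_measurable label_of_measurable)

lemma vert_of_measurable: "Measurable.pred N (%w. v \<in> vert_of (g w) (T w))"
 unfolding vert_of_def by (rule mtbp_vertices_measurable[OF degree_of_measurable])

lemma lift_measurable: "(%w. lift n (g w) (T w)) \<in> measurable N time_space"
 unfolding lift_def by (rule measurable_PiM_single') (auto intro: up_measurable[OF g T])

end

section \<open>Independence of subtrees by selection from copies\<close>

lemma emeasure_PiM_Collect':
 assumes "\<And>i. prob_space (M i)" "finite J" "\<And>i. i \<in> J ==> X i \<in> sets (M i)"
 shows "emeasure (\<Pi>\<^sub>M i\<in>UNIV. M i) {x \<in> space (\<Pi>\<^sub>M i\<in>UNIV. M i). \<forall>i\<in>J. x i \<in> X i} = (\<Prod>i\<in>J. emeasure (M i) (X i))"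
proof -
 interpret product_prob_space M UNIV
  using assms(1) by (simp add: product_prob_space_def product_prob_space_axioms_def product_sigma_finite_def prob_space_imp_sigma_finite)
 show ?thesis using assms by (intro emeasure_PiM_Collect) auto
qed

lemma distr_PiM_map:
 assumes M: "\<And>i. prob_space (M i)" and f: "\<And>i. f i \<in> measurable (M i) (K i)"
 shows "distr (\<Pi>\<^sub>M i\<in>UNIV. M i) (\<Pi>\<^sub>M i\<in>UNIV. K i) (%x i. f i (x i)) = (\<Pi>\<^sub>M i\<in>UNIV. distr (M i) (K i) (f i))"
proof (rule measure_eqI_PiM_infinite[where I=UNIV and M=K])
 have m: "(%x i. f i (x i)) \<in> measurable (\<Pi>\<^sub>M i\<in>UNIV. M i) (\<Pi>\<^sub>M i\<in>UNIV. K i)"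
 proof (rule measurable_PiM_single')
  show "(%x. f i (x i)) \<in> measurable (\<Pi>\<^sub>M i\<in>UNIV. M i) (K i)" for i
   by (rule measurable_compose[OF measurable_component_singleton[of i UNIV M] f]) simp
 qed (use measurable_space[OF f] in \<open>auto simp: space_PiM\<close>)
 interpret P: prob_space "\<Pi>\<^sub>M i\<in>UNIV. M i" by (rule prob_space_PiM[OF M])
 show "finite_measure (distr (\<Pi>\<^sub>M i\<in>UNIV. M i) (\<Pi>\<^sub>M i\<in>UNIV. K i) (%x i. f i (x i)))"
  by (rule prob_space.finite_measure[OF P.prob_space_distr[OF m]])
 fix A and J :: "'a set" assume J: "finite J" and A: "\<And>i. i \<in> J ==> A i \<in> sets (K i)"
 have e: "prod_emb UNIV K J (Pi\<^sub>E J A) = {x \<in> space (\<Pi>\<^sub>M i\<in>UNIV. K i). \<forall>i\<in>J. x i \<in> A i}"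
  by (auto simp: prod_emb_def space_PiM)
 have S: "{x \<in> space (\<Pi>\<^sub>M i\<in>UNIV. K i). \<forall>i\<in>J. x i \<in> A i} \<in> sets (\<Pi>\<^sub>M i\<in>UNIV. K i)"
  unfolding e[symmetric] using J A by (intro sets_PiM_I) auto
 have "emeasure (distr (\<Pi>\<^sub>M i\<in>UNIV. M i) (\<Pi>\<^sub>M i\<in>UNIV. K i) (%x i. f i (x i))) (prod_emb UNIV K J (Pi\<^sub>E J A)) =
   emeasure (\<Pi>\<^sub>M i\<in>UNIV. M i) {x \<in> space (\<Pi>\<^sub>M i\<in>UNIV. M i). \<forall>i\<in>J. x i \<in> f i -` A i \<inter> space (M i)}"
  unfolding e using measurable_space[OF m]
  by (subst emeasure_distr[OF m S]) (auto intro!: arg_cong[where f="emeasure _"] simp: space_PiM)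
 also have "... = (\<Prod>i\<in>J. emeasure (M i) (f i -` A i \<inter> space (M i)))"
  using A f J by (intro emeasure_PiM_Collect'[OF M]) (auto intro: measurable_sets)
 also have "... = (\<Prod>i\<in>J. emeasure (distr (M i) (K i) (f i)) (A i))"
  using A f by (intro prod.cong) (auto simp: emeasure_distr)
 also have "... = emeasure (\<Pi>\<^sub>M i\<in>UNIV. distr (M i) (K i) (f i)) {x \<in> space (\<Pi>\<^sub>M i\<in>UNIV. distr (M i) (K i) (f i)). \<forall>i\<in>J. x i \<in> A i}"
  using A f J M by (intro emeasure_PiM_Collect'[symmetric] prob_space.prob_space_distr) auto
 finally show "emeasure (distr (\<Pi>\<^sub>M i\<in>UNIV. M i) (\<Pi>\<^sub>M i\<in>UNIV. K i) (%x i. f i (x i))) (prod_emb UNIV K J (Pi\<^sub>E J A)) =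
   emeasure (\<Pi>\<^sub>M i\<in>UNIV. distr (M i) (K i) (f i)) (prod_emb UNIV K J (Pi\<^sub>E J A))"
  unfolding e by (simp add: space_PiM)
qed (auto intro!: sets_PiM_cong)

locale iid_env =
 fixes W :: "((nat => real) \<times> nat) measure"
 assumes prob_W: "prob_space W" and sets_W [simp, measurable_cong]: "sets W = sets local_space"
begin

definition N :: "env measure" where "N = (\<Pi>\<^sub>M v\<in>UNIV. W)"

lemma sets_N [simp, measurable_cong]: "sets N = sets env_space"
 unfolding N_def by (rule sets_PiM_cong) auto

lemma space_N [simp]: "space N = UNIV" and space_W [simp]: "space W = UNIV"
 using sets_eq_imp_space_eq[OF sets_N] sets_eq_imp_space_eq[OF sets_W] by simp_all

sublocale N: prob_space N unfolding N_def by (rule prob_space_PiM[OF prob_W])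
sublocale W: prob_space W by (rule prob_W)
sublocale NN: sequence_space N ..

lemma distr_N_at: "distr N W (%z. z v) = W"
 unfolding N_def by (rule distr_PiM_component[OF prob_W]) simp

lemma nn_integral_N_at: assumes "h \<in> bmeas local_space" shows "(\<integral>\<^sup>+z. h (z v) \<partial>N) = (\<integral>\<^sup>+w. h w \<partial>W)"
proof -
 have "(\<integral>\<^sup>+w. h w \<partial>W) = (\<integral>\<^sup>+w. h w \<partial>distr N W (%z. z v))" unfolding distr_N_at ..
 also have "... = (\<integral>\<^sup>+z. h (z v) \<partial>N)"
  using assms by (intro nn_integral_distr) (auto intro!: env_at_measurable[of "%z. z"])
 finally show ?thesis ..
qed

text \<open>Taking the data of vertex \<open>v\<close> from copy number \<open>\<beta> v\<close> of
  the environment gives an environment of the same law. With \<beta> constant on subtrees, this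
  expresses independence of disjoint subtrees.\<close>

lemma distr_select: "distr (\<Pi>\<^sub>M j\<in>(UNIV :: nat set). N) N (%Z v. Z (\<beta> v) v) = N"
proof (rule measure_eqI_PiM_infinite[where I=UNIV and M="%_. W"])
 let ?NN = "\<Pi>\<^sub>M j\<in>(UNIV :: nat set). N"
 have sp: "space ?NN = UNIV" by (simp add: space_PiM)
 have c: "(%Z. Z j) \<in> measurable ?NN env_space" for j
  using measurable_component_singleton[of j UNIV "%_. N"] by simp
 have m: "(%Z v. Z (\<beta> v) v) \<in> measurable ?NN N"
  unfolding measurable_cong_sets[OF refl sets_N] by (intro measurable_PiM_single' env_at_measurable[OF c]) (auto simp: space_PiM)
 show "finite_measure (distr ?NN N (%Z v. Z (\<beta> v) v))"
  by (rule prob_space.finite_measure[OF prob_space.prob_space_distr[OF prob_space_PiM[OF N.prob_space_axioms] m]])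
 fix A and J :: "vertex set" assume J: "finite J" and A: "\<And>i. i \<in> J ==> A i \<in> sets W"
 have e: "prod_emb UNIV (%_. W) J (Pi\<^sub>E J A) = {x. \<forall>i\<in>J. x i \<in> A i}"
  by (auto simp: prod_emb_def space_PiM)
 have S: "{x. \<forall>i\<in>J. x i \<in> A i} \<in> sets N"
  unfolding e[symmetric] N_def using J A by (intro sets_PiM_I) auto
 let ?X = "%j. {z. \<forall>v\<in>{v\<in>J. \<beta> v = j}. z v \<in> A v}"
 have X: "emeasure N (?X j) = (\<Prod>v\<in>{v\<in>J. \<beta> v = j}. emeasure W (A v))" for j
  using emeasure_PiM_Collect'[of "%_. W" "{v\<in>J. \<beta> v = j}" A] prob_W J A by (simp add: N_def[symmetric])
 have Xs: "?X j \<in> sets N" for j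
 proof -
  have "?X j = prod_emb UNIV (%_. W) {v\<in>J. \<beta> v = j} (Pi\<^sub>E {v\<in>J. \<beta> v = j} A)" by (auto simp: prod_emb_def space_PiM)
  then show ?thesis unfolding N_def using J A by (auto intro!: sets_PiM_I)
 qed
 have "emeasure (distr ?NN N (%Z v. Z (\<beta> v) v)) {x. \<forall>i\<in>J. x i \<in> A i} = emeasure ?NN {Z \<in> space ?NN. \<forall>j\<in>\<beta> ` J. Z j \<in> ?X j}"
  by (subst emeasure_distr[OF m S]) (auto intro!: arg_cong[where f="emeasure _"] simp: sp)
 also have "... = (\<Prod>j\<in>\<beta> ` J. emeasure N (?X j))"
  using J Xs by (intro emeasure_PiM_Collect' N.prob_space_axioms) auto
 also have "... = (\<Prod>v\<in>J. emeasure W (A v))"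
  unfolding X using prod.image_gen[OF J, of "%v. emeasure W (A v)" \<beta>] by simp
 also have "... = emeasure N {x. \<forall>i\<in>J. x i \<in> A i}"
  using emeasure_PiM_Collect'[of "%_. W" J A] prob_W J A by (simp add: N_def[symmetric])
 finally show "emeasure (distr ?NN N (%Z v. Z (\<beta> v) v)) (prod_emb UNIV (%_. W) J (Pi\<^sub>E J A)) = emeasure N (prod_emb UNIV (%_. W) J (Pi\<^sub>E J A))"
  unfolding e .
qed (auto simp: N_def)

lemma nn_integral_select:
 assumes F: "F \<in> bmeas env_space"
 shows "(\<integral>\<^sup>+z. F z \<partial>N) = (\<integral>\<^sup>+z. \<integral>\<^sup>+Z. F (%v. case_nat z Z (\<beta> v) v) \<partial>(\<Pi>\<^sub>M j\<in>(UNIV :: nat set). N) \<partial>N)"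
proof -
 let ?NN = "\<Pi>\<^sub>M j\<in>(UNIV :: nat set). N"
 have c: "(%Z. Z j) \<in> measurable ?NN env_space" for j
  using measurable_component_singleton[of j UNIV "%_. N"] by simp
 have m: "(%Z v. Z (\<beta> v) v) \<in> measurable ?NN env_space"
  by (intro measurable_PiM_single' env_at_measurable[OF c]) (auto simp: space_PiM)
 have "(\<integral>\<^sup>+z. F z \<partial>N) = (\<integral>\<^sup>+z. F z \<partial>distr ?NN N (%Z v. Z (\<beta> v) v))" unfolding distr_select ..
 also have "... = (\<integral>\<^sup>+Z. F (%v. Z (\<beta> v) v) \<partial>?NN)"
  using m F by (intro nn_integral_distr) (simp_all add: measurable_cong_sets[OF refl sets_N] measurable_cong_sets[OF sets_N refl])
 also have "... = (\<integral>\<^sup>+z. \<integral>\<^sup>+Z. F (%v. case_nat z Z (\<beta> v) v) \<partial>?NN \<partial>N)"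
  by (rule NN.nn_integral_iter[OF measurable_compose[OF m F]])
 finally show ?thesis .
qed

definition mix :: "vertex => env => env => env" where
 "mix u z z' = (%v. if prefix u v then z' v else z v)"

lemma mix_measurable: "mix u z \<in> measurable env_space env_space"
 unfolding mix_def[abs_def]
 by (rule measurable_PiM_single') (auto intro: env_at_measurable[of "%z. z"])

text \<open>Two copies suffice: one for the subtree of \<open>u\<close>, one for everything
  else.\<close>

lemma resample:
 assumes F: "F \<in> bmeas env_space"
 shows "(\<integral>\<^sup>+z. F z \<partial>N) = (\<integral>\<^sup>+z. \<integral>\<^sup>+z'. F (mix u z z') \<partial>N \<partial>N)"
proof -
 let ?NN = "\<Pi>\<^sub>M j\<in>(UNIV :: nat set). N"
 have "(%v. case_nat z Z (if prefix u v then 1 else 0) v) = mix u z (Z 0)" for z Z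
  by (auto simp: mix_def)
 then have "(\<integral>\<^sup>+z. F z \<partial>N) = (\<integral>\<^sup>+z. \<integral>\<^sup>+Z. F (mix u z (Z 0)) \<partial>?NN \<partial>N)"
  using nn_integral_select[OF F, of "%v. if prefix u v then 1 else 0"] by simp
 also have "... = (\<integral>\<^sup>+z. \<integral>\<^sup>+z'. F (mix u z z') \<partial>N \<partial>N)"
 proof (rule nn_integral_cong)
  fix z
  have "(\<integral>\<^sup>+z'. F (mix u z z') \<partial>N) = (\<integral>\<^sup>+z'. F (mix u z z') \<partial>distr ?NN N (%Z. Z 0))"
   using distr_PiM_component[of UNIV "%_. N" "0 :: nat"] N.prob_space_axioms by simp
  also have "... = (\<integral>\<^sup>+Z. F (mix u z (Z 0)) \<partial>?NN)"
   using measurable_compose[OF mix_measurable F, of u z]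
   by (intro nn_integral_distr) (simp_all add: measurable_cong_sets[OF sets_N refl])
  finally show "(\<integral>\<^sup>+Z. F (mix u z (Z 0)) \<partial>?NN) = (\<integral>\<^sup>+z'. F (mix u z z') \<partial>N)" ..
 qed
 finally show ?thesis .
qed

text \<open>Functionals of the subtrees of the children of \<open>u\<close> are independent of each
  other and of the data at \<open>u\<close>; the common law at all vertices is what makes them
  i.i.d. marks.\<close>

lemma vertex_law:
 fixes \<theta> :: "env => vertex => ereal"
 assumes \<theta>: "\<And>v. (%z. \<theta> z v) \<in> bmeas env_space"
  and local: "\<And>z z' v. (\<And>w. z (v @ w) = z' (v @ w)) ==> \<theta> z v = \<theta> z' v"
  and law: "\<And>v. distr N borel (%z. \<theta> z v) = \<nu>"
  and g: "g \<in> bmeas (local_space \<Otimes>\<^sub>M seq_space)"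
 shows "(\<integral>\<^sup>+z. g (z u, %j. \<theta> z (u @ [j])) \<partial>N) = (\<integral>\<^sup>+w. \<integral>\<^sup>+m. g (w, m) \<partial>(\<Pi>\<^sub>M j\<in>UNIV. \<nu>) \<partial>W)"
proof -
 let ?NN = "\<Pi>\<^sub>M j\<in>(UNIV :: nat set). N" and ?R = "\<Pi>\<^sub>M j\<in>(UNIV :: nat set). (borel :: ereal measure)"
 \<comment> \<open>The subtree of child \<open>j\<close> is drawn from copy \<open>Suc j\<close>;
   the vertex \<open>u\<close> and all else come from copy 0.\<close>
 define \<beta> where "\<beta> v = (if strict_prefix u v then Suc (v ! length u) else 0)" for v
 have \<theta>': "(%z. \<theta> z v) \<in> bmeas N" for v using \<theta> by (simp add: measurable_cong_sets[OF sets_N refl])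
 have p\<nu>: "prob_space \<nu>" using N.prob_space_distr[OF \<theta>'] unfolding law .
 have s\<nu>: "sets \<nu> = sets borel" using sets_distr[of N borel "%z. \<theta> z []"] unfolding law .
 have sm: "sets (\<Pi>\<^sub>M j\<in>(UNIV :: nat set). \<nu>) = sets ?R" by (rule sets_PiM_cong) (auto simp: s\<nu>)
 interpret M: prob_space "\<Pi>\<^sub>M j\<in>(UNIV :: nat set). \<nu>" by (rule prob_space_PiM[OF p\<nu>])
 have t: "(%z j. \<theta> z (u @ [j])) \<in> measurable env_space ?R"
  by (rule measurable_PiM_single') (auto intro: \<theta>)
 have F: "(%z. g (z u, %j. \<theta> z (u @ [j]))) \<in> bmeas env_space"
  by (rule measurable_compose[OF measurable_Pair[OF env_at_measurable[of "%z. z"] t] g]) simp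
 have sel: "(%v. case_nat z Z (\<beta> v) v) u = z u" "\<theta> (%v. case_nat z Z (\<beta> v) v) (u @ [j]) = \<theta> (Z j) (u @ [j])" for z Z j
 proof -
  show "(%v. case_nat z Z (\<beta> v) v) u = z u" by (simp add: \<beta>_def)
  have "\<beta> ((u @ [j]) @ w) = Suc j" for w by (auto simp: \<beta>_def strict_prefix_def nth_append)
  then show "\<theta> (%v. case_nat z Z (\<beta> v) v) (u @ [j]) = \<theta> (Z j) (u @ [j])" by (intro local) simp
 qed
 have D: "distr ?NN ?R (%Z j. \<theta> (Z j) (u @ [j])) = (\<Pi>\<^sub>M j\<in>UNIV. \<nu>)"
  using distr_PiM_map[where M="%_. N" and K="%_. borel" and f="%j z. \<theta> z (u @ [j])"] N.prob_space_axioms \<theta>' law by simp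
 have Dm: "(%Z j. \<theta> (Z j) (u @ [j])) \<in> measurable ?NN ?R"
 proof (rule measurable_PiM_single')
  show "(%Z. \<theta> (Z j) (u @ [j])) \<in> bmeas ?NN" for j
   by (rule measurable_compose[OF measurable_component_singleton[of j UNIV "%_. N"] \<theta>']) simp
 qed auto
 have "(\<integral>\<^sup>+z. g (z u, %j. \<theta> z (u @ [j])) \<partial>N) = (\<integral>\<^sup>+z. \<integral>\<^sup>+Z. g (z u, %j. \<theta> (Z j) (u @ [j])) \<partial>?NN \<partial>N)"
  using nn_integral_select[OF F, of \<beta>] unfolding sel .
 also have "... = (\<integral>\<^sup>+z. \<integral>\<^sup>+m. g (z u, m) \<partial>(\<Pi>\<^sub>M j\<in>UNIV. \<nu>) \<partial>N)"
 proof (rule nn_integral_cong)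
  fix z
  have gz: "(%m. g (z u, m)) \<in> bmeas ?R"
   by (rule measurable_compose[OF measurable_Pair1' g]) simp
  have "(\<integral>\<^sup>+m. g (z u, m) \<partial>(\<Pi>\<^sub>M j\<in>UNIV. \<nu>)) = (\<integral>\<^sup>+m. g (z u, m) \<partial>distr ?NN ?R (%Z j. \<theta> (Z j) (u @ [j])))" unfolding D ..
  also have "... = (\<integral>\<^sup>+Z. g (z u, %j. \<theta> (Z j) (u @ [j])) \<partial>?NN)" using Dm gz by (intro nn_integral_distr) auto
  finally show "(\<integral>\<^sup>+Z. g (z u, %j. \<theta> (Z j) (u @ [j])) \<partial>?NN) = (\<integral>\<^sup>+m. g (z u, m) \<partial>(\<Pi>\<^sub>M j\<in>UNIV. \<nu>))" ..
 qed
 also have "... = (\<integral>\<^sup>+w. \<integral>\<^sup>+m. g (w, m) \<partial>(\<Pi>\<^sub>M j\<in>UNIV. \<nu>) \<partial>W)"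
 proof (rule nn_integral_N_at)
  have "g \<in> bmeas (local_space \<Otimes>\<^sub>M (\<Pi>\<^sub>M j\<in>(UNIV :: nat set). \<nu>))"
   using g by (simp add: measurable_cong_sets[OF sets_pair_measure_cong[OF refl sm] refl])
  from M.borel_measurable_nn_integral_fst[OF this]
  show "(%w. \<integral>\<^sup>+m. g (w, m) \<partial>(\<Pi>\<^sub>M j\<in>(UNIV :: nat set). \<nu>)) \<in> bmeas local_space" .
 qed
 finally show ?thesis .
qed

end

section \<open>Convergence of the iterates and almost sure properties of the environment\<close>

text \<open>Local finiteness appears as unboundedness, which has countable quantifiers only and is
  therefore measurable.\<close>

definition good_seq :: "(nat => real) => bool" where
 "good_seq x \<longleftrightarrow> (\<forall>j. x j < x (Suc j)) & (\<forall>j. 0 < x j) & (\<forall>n :: nat. \<exists>j. real n < x j)"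

lemma good_seq_measurable [measurable]: "Measurable.pred seq_space good_seq"
 unfolding good_seq_def[abs_def] by measurable

lemma good_seq_finite: assumes "good_seq x" shows "strict_mono x" "finite {j. x j <= t}"
proof -
 show sm: "strict_mono x" using assms by (simp add: good_seq_def strict_mono_Suc_iff)
 obtain n :: nat where n: "t <= real n" using real_arch_simple by blast
 obtain m where m: "real n < x m" using assms unfolding good_seq_def by blast
 have "{j. x j <= t} \<subseteq> {..<m}"
 proof (rule subsetI)
  fix j assume "j \<in> {j. x j <= t}"
  then have "x j < x m" using n m by simp
  then show "j \<in> {..<m}" using sm by (simp add: strict_mono_less)
 qed
 then show "finite {j. x j <= t}" by (rule finite_subset) simp
qed

lemma AE_gaps_good_seq: "AE w in gaps. good_seq (psum 0 w)"
 using AE_gaps_pos AE_arrivals_finite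
proof eventually_elim
 case (elim w)
 have "0 < psum 0 w j" for j
  using elim by (induction j) (auto simp: psum_0 psum_Suc intro: add_pos_pos)
 moreover have "\<exists>j. real n < psum 0 w j" for n :: nat
 proof -
  have "finite {j. psum 0 w j <= real n}" using elim by blast
  then obtain j where "j \<notin> {j. psum 0 w j <= real n}" using ex_new_if_finite[OF infinite_UNIV_nat] by blast
  then show ?thesis by (auto simp: not_le)
 qed
 ultimately show ?case using elim by (auto simp: good_seq_def psum_Suc)
qed

lemma gaps_null_shift: "(\<integral>\<^sup>+w. of_bool (psum x w j = c) \<partial>gaps) = (0 :: ennreal)"
proof (induction j arbitrary: x)
 case (0 x)
 have m: "(%w. of_bool (psum x w 0 = c) :: ennreal) \<in> bmeas seq_space" by measurable
 interpret G: prob_space gaps by (rule prob_space_gaps)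
 have "(\<integral>\<^sup>+w. of_bool (psum x w 0 = c) \<partial>gaps) = (\<integral>\<^sup>+s. of_bool (x + s = c) \<partial>expo)"
  by (subst nn_integral_gaps_iter[OF m]) (simp add: G.emeasure_space_1[simplified])
 also have "... = (\<integral>\<^sup>+y. ennreal (exp (- (y - x))) * of_bool (x <= y) * of_bool (y = c) \<partial>lborel)"
  by (rule nn_integral_expo_shift) measurable
 also have "... = (\<integral>\<^sup>+y. 0 \<partial>(lborel :: real measure))"
  using AE_lborel_singleton[of c] by (intro nn_integral_cong_AE, eventually_elim) auto
 finally show ?case by simp
next
 case (Suc j x)
 have m: "(%w. of_bool (psum x w (Suc j) = c) :: ennreal) \<in> bmeas seq_space" by measurable
 show ?case by (subst nn_integral_gaps_iter[OF m]) (simp add: Suc)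
qed

lemma AE_gaps_neq: "AE w in gaps. ereal (psum 0 w j) ~= t"
proof (cases t)
 case (real c)
 have "AE w in gaps. of_bool (psum 0 w j = c) = (0 :: ennreal)"
  using gaps_null_shift[of 0 j c] by (subst (asm) nn_integral_0_iff_AE) auto
 then show ?thesis by eventually_elim (auto simp: real)
qed auto

context
 fixes z :: env assumes fin: "\<And>v t. finite {j. fst (z v) j <= t}"
begin

lemma approx_antimono: "(\<And>v. approx m z v <= approx n z v) ==> approx (Suc n) z v <= approx (Suc m) z v"
 by (simp add: sat_time_antimono[OF fin])

text \<open>The infinite iterate 0 dominates everything; applying the antitone step repeatedly
  narrows the bracket from both sides.\<close>

lemma approx_step: "approx (2 * Suc n) z v <= approx (2 * n) z v" "approx (Suc (2 * n)) z v <= approx (Suc (2 * Suc n)) z v"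
 "approx (Suc (2 * n)) z v <= approx (2 * n) z v"
proof -
 have even: "approx (2 * Suc n) z v <= approx (2 * n) z v" for v n
 proof (induction n arbitrary: v)
  case (Suc n)
  then have "approx (Suc (2 * n)) z v <= approx (Suc (2 * Suc n)) z v" for v by (rule approx_antimono)
  then have "approx (Suc (Suc (2 * Suc n))) z v <= approx (Suc (Suc (2 * n))) z v" for v by (rule approx_antimono)
  then show ?case by simp
 qed simp
 then show "approx (2 * Suc n) z v <= approx (2 * n) z v" .
 show "approx (Suc (2 * n)) z v <= approx (Suc (2 * Suc n)) z v" by (rule approx_antimono[OF even])
 show "approx (Suc (2 * n)) z v <= approx (2 * n) z v"
 proof (induction n arbitrary: v)
  case (Suc n)
  then have "approx (Suc (2 * n)) z v <= approx (Suc (Suc (2 * n))) z v" for v by (rule approx_antimono)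
  then have "approx (Suc (Suc (Suc (2 * n)))) z v <= approx (Suc (Suc (2 * n))) z v" for v by (rule approx_antimono)
  then show ?case by simp
 qed simp
qed

lemma approx_odd_le_even: "approx (Suc (2 * n)) z v <= approx (2 * m) z v"
proof -
 let ?k = "max n m"
 have "approx (Suc (2 * n)) z v <= approx (Suc (2 * ?k)) z v"
  by (rule lift_Suc_mono_le[of "%n. approx (Suc (2 * n)) z v"]) (use approx_step(2) in auto)
 also have "... <= approx (2 * ?k) z v" by (rule approx_step(3))
 also have "... <= approx (2 * m) z v"
  by (rule lift_Suc_antimono_le[of "%n. approx (2 * n) z v"]) (use approx_step(1) in auto)
 finally show ?thesis .
qed

lemma SUP_approx_le: "(SUP n. approx (Suc (2 * n)) z v) <= ptime z v"
 unfolding ptime_def by (intro SUP_least INF_greatest approx_odd_le_even)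

end

context rdcp_ode begin

text \<open>Both sides are the probability that the degree constraint exceeds a Poisson variable of
  mean \<open>x\<close>. Abel summation changes sums over \<open>p\<close> into sums over its tails
  \<open>q\<close>, and the boundary term vanishes as \<open>q\<close> tends to 0.\<close>

lemma tail_mixture:
 assumes x: "0 <= x" shows "(\<Sum>k. ennreal (p (Suc k)) * ennreal (poisson_tail k x)) = ennreal (F x)"
proof -
 define a where "a m = exp (- x) * (x ^ m / fact m)" for m
 have pt: "poisson_tail k x = (\<Sum>m\<le>k. a m)" for k by (simp add: poisson_tail_def a_def)
 have part: "(\<Sum>k<n. p (Suc k) * poisson_tail k x) = (\<Sum>m<n. a m * q m) - q n * (\<Sum>m<n. a m)" for n
 proof (induction n)
  case (Suc n)
  have "poisson_tail n x = (\<Sum>m<n. a m) + a n" by (simp add: pt lessThan_Suc_atMost[symmetric])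
  then show ?case using Suc q_Suc[of n] by (simp add: algebra_simps)
 qed simp
 have "(%n. (\<Sum>m<n. a m * q m)) \<longlonglongrightarrow> F x"
 proof -
  have "(%m. exp (- x) * (x ^ m / fact m * q m)) sums F x"
   unfolding F_def by (intro sums_mult summable_sums summable_q)
  then show ?thesis by (simp add: sums_def a_def mult.assoc)
 qed
 moreover have "(%n. \<Sum>m<n. a m) \<longlonglongrightarrow> 1"
  by (rule LIMSEQ_imp_Suc) (use poisson_tail_tendsto[of x] in \<open>simp add: pt lessThan_Suc_atMost\<close>)
 moreover have "q \<longlonglongrightarrow> 0"
 proof -
  have "q n = 1 - (\<Sum>k<n. p (Suc k))" for n
  proof (induction n)
   case 0 then show ?case by (simp add: q_0[simplified])
  next
   case (Suc n) then show ?case using q_Suc[of n] by simp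
  qed
  moreover have "(%n. 1 - (\<Sum>k<n. p (Suc k))) \<longlonglongrightarrow> 1 - 1"
   using p_sums unfolding sums_def by (intro tendsto_diff tendsto_const)
  ultimately show ?thesis by simp
 qed
 ultimately have "(%n. (\<Sum>m<n. a m * q m) - q n * (\<Sum>m<n. a m)) \<longlonglongrightarrow> F x - 0 * 1"
  by (intro tendsto_diff tendsto_mult)
 then have "(%k. p (Suc k) * poisson_tail k x) sums F x" unfolding sums_def part by simp
 moreover have "0 <= p (Suc k) * poisson_tail k x" for k
  using p_nonneg[of "Suc k"] poisson_tail_nonneg[OF x] by simp
 ultimately have "(\<Sum>k. ennreal (p (Suc k) * poisson_tail k x)) = ennreal (F x)" by (intro suminf_ennreal_eq)
 then show ?thesis using p_nonneg poisson_tail_nonneg[OF x] by (simp add: ennreal_mult)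
qed

definition degree_law :: "nat measure" where
 "degree_law = distr (density (count_space UNIV) (%k. ennreal (p (Suc k)))) (count_space UNIV) Suc"

lemma sets_degree_law [simp, measurable_cong]: "sets degree_law = sets (count_space UNIV)"
 by (simp add: degree_law_def)

lemma space_degree_law [simp]: "space degree_law = UNIV" by (simp add: degree_law_def)

lemma nn_integral_degree_law: "(\<integral>\<^sup>+k. g k \<partial>degree_law) = (\<Sum>k. ennreal (p (Suc k)) * g (Suc k))"
 by (simp add: degree_law_def nn_integral_distr nn_integral_density nn_integral_count_space_nat)

lemma prob_space_degree_law: "prob_space degree_law"
proof
 have "(\<Sum>k. ennreal (p (Suc k))) = ennreal 1"
  using p_sums by (intro suminf_ennreal_eq p_nonneg) auto
 then show "emeasure degree_law (space degree_law) = 1"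
  using nn_integral_degree_law[of "%_. 1"] by simp
qed

lemma AE_degree_law: "AE k in degree_law. 1 <= k"
 unfolding degree_law_def by (subst AE_distr_iff) auto

definition local_law :: "((nat => real) \<times> nat) measure" where
 "local_law = arrivals \<Otimes>\<^sub>M degree_law"

sublocale AD: pair_prob_space arrivals degree_law
 using prob_space_arrivals prob_space_degree_law
 by (simp add: pair_prob_space_def pair_sigma_finite_def prob_space_imp_sigma_finite)

sublocale E: iid_env local_law
proof (rule iid_env.intro)
 show "prob_space local_law" unfolding local_law_def by (rule AD.prob_space_axioms)
 show "sets local_law = sets local_space" unfolding local_law_def by (rule sets_pair_measure_cong) auto
qed

lemma nn_integral_local_law:
 assumes h: "h \<in> bmeas local_space"
 shows "(\<integral>\<^sup>+w. h w \<partial>local_law) = (\<Sum>k. ennreal (p (Suc k)) * (\<integral>\<^sup>+\<omega>. h (psum 0 \<omega>, Suc k) \<partial>gaps))"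
proof -
 have s: "sets (arrivals \<Otimes>\<^sub>M degree_law) = sets local_space" by (rule sets_pair_measure_cong) auto
 have h': "h \<in> bmeas (arrivals \<Otimes>\<^sub>M degree_law)" using h by (simp add: measurable_cong_sets[OF s refl])
 have "(\<integral>\<^sup>+w. h w \<partial>local_law) = (\<integral>\<^sup>+k. \<integral>\<^sup>+x. h (x, k) \<partial>arrivals \<partial>degree_law)"
  unfolding local_law_def using h' by (simp add: AD.nn_integral_snd split_beta')
 also have "... = (\<integral>\<^sup>+k. \<integral>\<^sup>+\<omega>. h (psum 0 \<omega>, k) \<partial>gaps \<partial>degree_law)"
 proof (rule nn_integral_cong)
  fix k
  have "(%x. h (x, k)) \<in> bmeas seq_space" by (rule measurable_compose[OF measurable_Pair2' h]) simp
  then show "(\<integral>\<^sup>+x. h (x, k) \<partial>arrivals) = (\<integral>\<^sup>+\<omega>. h (psum 0 \<omega>, k) \<partial>gaps)"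
   unfolding arrivals_def by (intro nn_integral_distr) auto
 qed
 finally show ?thesis unfolding nn_integral_degree_law .
qed

lemma local_integral:
 assumes M: "marked \<nu> u v" and g: "g \<in> bmeas (local_space \<Otimes>\<^sub>M seq_space)"
 shows "(\<integral>\<^sup>+w. \<integral>\<^sup>+m. g (w, m) \<partial>(\<Pi>\<^sub>M j\<in>UNIV. \<nu>) \<partial>local_law) =
  (\<Sum>k. ennreal (p (Suc k)) * (\<integral>\<^sup>+e. g ((psum 0 (fst e), Suc k), snd e) \<partial>marked.env_law \<nu>))"
proof -
 interpret marked \<nu> u v by fact
 have "g \<in> bmeas (local_space \<Otimes>\<^sub>M marks)"
  using g by (simp add: measurable_cong_sets[OF sets_pair_measure_cong[OF refl sets_marks] refl])
 from K.borel_measurable_nn_integral_fst[OF this]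
 have H: "(%w. \<integral>\<^sup>+m. g (w, m) \<partial>marks) \<in> bmeas local_space" .
 have "(\<integral>\<^sup>+\<omega>. \<integral>\<^sup>+m. g ((psum 0 \<omega>, Suc k), m) \<partial>marks \<partial>gaps) = (\<integral>\<^sup>+e. g ((psum 0 (fst e), Suc k), snd e) \<partial>env_law)" for k
 proof -
  have "(%e. ((psum 0 (fst e), Suc k), snd e)) \<in> measurable seqs (local_space \<Otimes>\<^sub>M seq_space)"
   by (intro measurable_Pair measurable_compose[OF measurable_fst psum_measurable'] measurable_snd) auto
  from nn_integral_env_law[OF measurable_compose[OF this g]] show ?thesis by simp
 qed
 then show ?thesis unfolding nn_integral_local_law[OF H, unfolded marks_def] marks_def by simp
qed

lemma sat_fun_measurable:
 assumes "h \<in> bmeas borel"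
 shows "(%x. h (sat_time (fst (fst x)) (snd x) (snd (fst x)))) \<in> bmeas (local_space \<Otimes>\<^sub>M seq_space)"
proof (rule measurable_compose[OF sat_time_measurable assms])
 show "(%x. fst (fst x) j) \<in> bmeas (local_space \<Otimes>\<^sub>M (seq_space :: (nat => ereal) measure))" for j
  by (rule measurable_compose[OF measurable_compose[OF measurable_fst measurable_fst] measurable_component_singleton]) simp
 show "(%x. snd x j) \<in> bmeas (local_space \<Otimes>\<^sub>M (seq_space :: (nat => ereal) measure))" for j
  by (rule measurable_compose[OF measurable_snd measurable_component_singleton]) simp
 show "(%x. snd (fst x)) \<in> measurable (local_space \<Otimes>\<^sub>M (seq_space :: (nat => ereal) measure)) (count_space UNIV)"
  by (rule measurable_compose[OF measurable_fst measurable_snd])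
qed

definition antideriv :: "(real => real) => real => real" where
 "antideriv c = (SOME g. g 0 = 0 & (\<forall>x. (g has_real_derivative c x) (at x)))"

lemma antideriv:
 assumes "\<And>x. isCont c x" shows "antideriv c 0 = 0" "(antideriv c has_real_derivative c x) (at x)"
proof -
 obtain G where G: "\<And>x. (G has_real_derivative c x) (at x)"
  using einterval_antiderivative[of "-\<infinity>" "\<infinity>" c] assms by (auto simp: has_real_derivative_iff_has_vector_derivative)
 have "\<exists>g. g 0 = 0 & (\<forall>x. (g has_real_derivative c x) (at x))"
  by (rule exI[of _ "%x. G x - G 0"]) (auto intro!: derivative_eq_intros G)
 from someI_ex[OF this] show "antideriv c 0 = 0" "(antideriv c has_real_derivative c x) (at x)"
  unfolding antideriv_def by auto
qed

text \<open>\<open>max 0 t\<close> keeps the argument of \<open>F\<close> nonnegative, so that each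
  iterate is continuous and nonnegative on the whole line and has a global antiderivative.\<close>

primrec picard_v :: "nat => real => real" where
 "picard_v 0 = (%t. 1)"
| "picard_v (Suc n) = (%t. F (antideriv (picard_v n) (max 0 t)))"

definition picard_u :: "nat => real => real" where "picard_u n = antideriv (picard_v n)"

lemma picard_props: "isCont (picard_v n) x" "0 <= picard_v n x"
 "picard_u n 0 = 0" "(picard_u n has_real_derivative picard_v n x) (at x)" "0 <= t ==> 0 <= picard_u n t"
proof -
 have main: "(\<forall>x. isCont (picard_v n) x & 0 <= picard_v n x)" for n
 proof (induction n)
  case (Suc n)
  then have c: "\<And>x. isCont (picard_v n) x" and nn: "\<And>x. 0 <= picard_v n x" by auto
  note a = antideriv[OF c]
  have pos: "0 <= antideriv (picard_v n) t" if "0 <= t" for t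
   using DERIV_nonneg_imp_nondecreasing[OF that, of "antideriv (picard_v n)"] a nn by metis
  have ca: "isCont (antideriv (picard_v n)) x" for x by (rule DERIV_isCont[OF a(2)])
  have "isCont (%t. F (antideriv (picard_v n) (max 0 t))) x" for x
   by (intro isCont_o2[OF _ DERIV_isCont[OF DERIV_F]] isCont_o2[OF _ ca] continuous_intros)
  moreover have "0 <= F (antideriv (picard_v n) (max 0 t))" for t
   by (rule less_imp_le[OF F_pos[OF pos]]) simp
  ultimately show ?case by simp
 qed simp
 then show c: "isCont (picard_v n) x" and nn: "0 <= picard_v n x" for x by auto
 note a = antideriv[OF c, folded picard_u_def]
 show "picard_u n 0 = 0" "(picard_u n has_real_derivative picard_v n x) (at x)" by (rule a)+
 show "0 <= picard_u n t" if "0 <= t"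
  using DERIV_nonneg_imp_nondecreasing[OF that, of "picard_u n"] a nn by metis
qed

lemma picard_v_Suc: "0 <= t ==> picard_v (Suc n) t = F (picard_u n t)"
 by (simp add: picard_u_def)

lemma picard_v_tendsto: "0 <= t ==> (%n. picard_v n t) \<longlonglongrightarrow> F (lam t)"
 by (rule picard[of picard_u picard_v])
  (auto simp: picard_v_Suc picard_props simp del: picard_v.simps(2) intro: has_field_derivative_at_within picard_props)

lemma marked_picard:
 assumes "prob_space \<nu>" "sets \<nu> = sets borel" "\<And>t. 0 <= t ==> emeasure \<nu> {ereal t..} = ennreal (picard_v n t)"
 shows "marked \<nu> (picard_u n) (picard_v n)"
proof (rule marked.intro)
 show "picard_v n t = measure \<nu> {ereal t..}" if "0 <= t" for t
  using assms(3)[OF that] picard_props(2) by (simp add: measure_def)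
 show "picard_v n \<in> bmeas borel"
  by (intro borel_measurable_continuous_onI continuous_at_imp_continuous_on ballI picard_props)
 show "picard_u n \<in> bmeas borel"
  by (intro borel_measurable_continuous_onI continuous_at_imp_continuous_on ballI DERIV_isCont[OF picard_props(4)])
 show "(picard_u n has_real_derivative picard_v n t) (at t within {0..})" for t
  by (rule has_field_derivative_at_within[OF picard_props(4)])
qed (use assms picard_props in auto)

lemma approx_N_measurable: "(%z. approx n z v) \<in> bmeas E.N"
 by (rule approx_measurable) simp

text \<open>One application of the recursion feeds i.i.d. child times of law number \<open>n\<close>
  into a marked Poisson process: \<open>sat_time_prob\<close> gives the survival function for a
  fixed constraint, and \<open>tail_mixture\<close> averages over constraints. Equality of the laws
  at all vertices is carried along because \<open>vertex_law\<close> asks for it.\<close>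

lemma approx_law:
 "distr E.N borel (%z. approx n z v) = distr E.N borel (%z. approx n z [])"
 "0 <= t ==> emeasure E.N {z. ereal t <= approx n z v} = ennreal (picard_v n t)"
proof -
 have tail: "emeasure E.N {z. ereal t <= approx n z v} = emeasure (distr E.N borel (%z. approx n z v)) {ereal t..}" for n v t
  using approx_N_measurable[of n v] by (subst emeasure_distr) (auto intro!: arg_cong[where f="emeasure _"])
 have main: "\<forall>v. distr E.N borel (%z. approx n z v) = distr E.N borel (%z. approx n z []) \<and>
  (\<forall>t\<ge>0. emeasure E.N {z. ereal t <= approx n z v} = ennreal (picard_v n t))" for n
 proof (induction n)
  case 0
  then show ?case using E.N.emeasure_space_1 by simp
 next
  case (Suc n)
  let ?\<nu> = "distr E.N borel (%z. approx n z [])"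
  have m\<nu>: "marked ?\<nu> (picard_u n) (picard_v n)"
   using Suc by (intro marked_picard E.N.prob_space_distr approx_N_measurable) (simp_all add: tail[symmetric])
  have int: "(\<integral>\<^sup>+z. h (approx (Suc n) z v) \<partial>E.N) = (\<integral>\<^sup>+w. \<integral>\<^sup>+m. h (sat_time (fst w) m (snd w)) \<partial>(\<Pi>\<^sub>M j\<in>UNIV. ?\<nu>) \<partial>local_law)"
   if h: "h \<in> bmeas borel" for h :: "ereal => ennreal" and v
  proof -
   let ?g = "%x. h (sat_time (fst (fst x)) (snd x) (snd (fst x)))"
   have lw: "distr E.N borel (%z. approx n z v) = ?\<nu>" for v using Suc by blast
   have "(\<integral>\<^sup>+z. ?g (z v, %j. approx n z (v @ [j])) \<partial>E.N) = (\<integral>\<^sup>+w. \<integral>\<^sup>+m. ?g (w, m) \<partial>(\<Pi>\<^sub>M j\<in>UNIV. ?\<nu>) \<partial>local_law)"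
   proof (rule E.vertex_law[OF _ _ lw sat_fun_measurable[OF h]])
    show "(%z. approx n z v) \<in> bmeas env_space" for v by (rule approx_measurable) simp
   qed (rule approx_cong)
   then show ?thesis by (simp only: approx.simps(2) fst_conv snd_conv)
  qed
  have "distr E.N borel (%z. approx (Suc n) z v) = distr E.N borel (%z. approx (Suc n) z [])" for v
  proof (rule measure_eqI)
   fix A :: "ereal set" assume "A \<in> sets (distr E.N borel (%z. approx (Suc n) z v))"
   then have A: "A \<in> sets borel" by simp
   have "emeasure (distr E.N borel (%z. approx (Suc n) z v)) A = (\<integral>\<^sup>+z. indicator A (approx (Suc n) z v) \<partial>E.N)" for v
    using A nn_integral_distr[OF approx_N_measurable[of "Suc n" v], of "indicator A"]
    by (simp add: nn_integral_indicator del: approx.simps)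
   then show "emeasure (distr E.N borel (%z. approx (Suc n) z v)) A = emeasure (distr E.N borel (%z. approx (Suc n) z [])) A"
    using int[OF borel_measurable_indicator[OF A]] by (simp del: approx.simps)
  qed simp
  moreover have "emeasure E.N {z. ereal t <= approx (Suc n) z v} = ennreal (picard_v (Suc n) t)" if t: "0 <= t" for t v
  proof -
   interpret K: marked ?\<nu> "picard_u n" "picard_v n" by (rule m\<nu>)
   have h: "(%r. of_bool (ereal t <= r) :: ennreal) \<in> bmeas borel" by measurable
   have "{z \<in> space E.N. ereal t <= approx (Suc n) z v} \<in> sets E.N"
    by (intro borel_measurable_le approx_N_measurable) simp
   from nn_integral_of_bool[OF this]
   have "emeasure E.N {z. ereal t <= approx (Suc n) z v} = (\<integral>\<^sup>+z. of_bool (ereal t <= approx (Suc n) z v) \<partial>E.N)" by simp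
   also have "... = (\<Sum>k. ennreal (p (Suc k)) * (\<integral>\<^sup>+e. of_bool (ereal t <= sat_time (psum 0 (fst e)) (snd e) (Suc k)) \<partial>K.env_law))"
    unfolding int[OF h] using local_integral[OF m\<nu> sat_fun_measurable[OF h]] by simp
   also have "... = ennreal (picard_v (Suc n) t)"
    unfolding K.sat_time_prob[OF t] picard_v_Suc[OF t] by (rule tail_mixture[OF picard_props(5)[OF t]])
   finally show ?thesis .
  qed
  ultimately show ?case by blast
 qed
 show "distr E.N borel (%z. approx n z v) = distr E.N borel (%z. approx n z [])"
  "0 <= t ==> emeasure E.N {z. ereal t <= approx n z v} = ennreal (picard_v n t)" using main by auto
qed

lemma AE_N_at:
 assumes P: "AE w in local_law. P w" shows "AE z in E.N. \<forall>v. P (z v)"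
proof -
 have "AE z in E.N. P (z v)" for v
  unfolding E.N_def by (rule AE_PiM_component[where M="%_. local_law"]) (use E.prob_W P in auto)
 then show ?thesis by (simp add: AE_all_countable)
qed

lemma AE_local_good: "AE w in local_law. good_seq (fst w) & 1 <= snd w"
proof -
 have "AE x in arrivals. good_seq x"
  unfolding arrivals_def using AE_gaps_good_seq by (subst AE_distr_iff) auto
 then have "AE x in arrivals. AE k in degree_law. good_seq (fst (x, k)) & 1 <= snd (x, k)"
  by eventually_elim (use AE_degree_law in simp)
 then show ?thesis unfolding local_law_def
 proof (rule AD.AE_pair_measure[rotated])
  show "{w \<in> space (arrivals \<Otimes>\<^sub>M degree_law). good_seq (fst w) & 1 <= snd w} \<in> sets (arrivals \<Otimes>\<^sub>M degree_law)"
   by measurable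
 qed
qed

lemma AE_env_basic: "AE z in E.N. \<forall>v. good_seq (fst (z v)) & 1 <= snd (z v)"
 by (rule AE_N_at[OF AE_local_good])

lemma ptime_N_measurable: "(%z. ptime z v) \<in> bmeas E.N"
 by (rule ptime_measurable) simp

lemma SUP_approx_measurable: "(%z. SUP n. approx (Suc (2 * n)) z v) \<in> bmeas E.N"
 by (intro borel_measurable_SUP approx_N_measurable) auto

text \<open>The survival functions of even and odd iterates have the same Picard limit; the infimum
  and the supremum of the bounds lie between them.\<close>

lemma ptime_tail:
 assumes t: "0 <= t"
 shows "emeasure E.N {z. ereal t <= ptime z v} = ennreal (F (lam t))"
  and "emeasure E.N {z. ereal t <= (SUP n. approx (Suc (2 * n)) z v)} = ennreal (F (lam t))"
proof -
 let ?S = "%z. SUP n. approx (Suc (2 * n)) z v"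
 have ms: "{z. ereal t <= X z} \<in> sets E.N" if "X \<in> bmeas E.N" for X :: "env => ereal"
  using borel_measurable_le[OF _ that, of "%_. ereal t"] by simp
 note m1 = ms[OF ptime_N_measurable[of v]] and m2 = ms[OF SUP_approx_measurable[of v]] and m3 = ms[OF approx_N_measurable]
 have lim: "(%n. ennreal (picard_v (r n) t)) \<longlonglongrightarrow> ennreal (F (lam t))" if "strict_mono r" for r
  using LIMSEQ_subseq_LIMSEQ[OF picard_v_tendsto[OF t] that] by (intro tendsto_ennrealI) (simp add: o_def)
 have up: "emeasure E.N {z. ereal t <= ptime z v} <= ennreal (F (lam t))"
 proof (rule LIMSEQ_le_const[OF lim[of "%n. 2 * n"]])
  have "emeasure E.N {z. ereal t <= ptime z v} <= ennreal (picard_v (2 * n) t)" for n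
   unfolding approx_law(2)[OF t, symmetric, of _ v]
   by (intro emeasure_mono m3) (auto simp: ptime_def intro: order_trans INF_lower)
  then show "\<exists>N. \<forall>n\<ge>N. emeasure E.N {z. ereal t <= ptime z v} <= ennreal (picard_v (2 * n) t)" by blast
 qed (simp add: strict_mono_def)
 have low: "ennreal (F (lam t)) <= emeasure E.N {z. ereal t <= ?S z}"
 proof (rule LIMSEQ_le_const2[OF lim[of "%n. Suc (2 * n)"]])
  have "ennreal (picard_v (Suc (2 * n)) t) <= emeasure E.N {z. ereal t <= ?S z}" for n
   unfolding approx_law(2)[OF t, symmetric, of _ v]
  proof (intro emeasure_mono m2 subsetI)
   fix z assume "z \<in> {z. ereal t <= approx (Suc (2 * n)) z v}"
   then have "ereal t <= approx (Suc (2 * n)) z v" by (simp only: mem_Collect_eq)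
   also have "... <= ?S z" by (rule SUP_upper) simp
   finally show "z \<in> {z. ereal t <= ?S z}" by (simp only: mem_Collect_eq)
  qed
  then show "\<exists>N. \<forall>n\<ge>N. ennreal (picard_v (Suc (2 * n)) t) <= emeasure E.N {z. ereal t <= ?S z}" by blast
 qed (simp add: strict_mono_def)
 have mid: "emeasure E.N {z. ereal t <= ?S z} <= emeasure E.N {z. ereal t <= ptime z v}"
 proof (rule emeasure_mono_AE[OF _ m1], use AE_env_basic in eventually_elim)
  case (elim z)
  then have "?S z <= ptime z v" by (intro SUP_approx_le) (auto intro: good_seq_finite)
  then show ?case by (auto intro: order_trans)
 qed
 show "emeasure E.N {z. ereal t <= ptime z v} = ennreal (F (lam t))" "emeasure E.N {z. ereal t <= ?S z} = ennreal (F (lam t))"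
  using up low mid by (auto intro: antisym order_trans)
qed

text \<open>Two almost surely ordered variables with the same survival function agree almost surely:
  for each rational threshold the event that only the larger one passes it is null, and a gap
  between them would contain a rational.\<close>

lemma AE_lims: "AE z in E.N. \<forall>v. (SUP n. approx (Suc (2 * n)) z v) = ptime z v"
proof -
 let ?S = "%z v. SUP n. approx (Suc (2 * n)) z v"
 have "AE z in E.N. ereal t <= ptime z v --> ereal t <= ?S z v" if t: "0 <= t" for t v
 proof -
  let ?A = "{z. ereal t <= ptime z v}" and ?B = "{z. ereal t <= ?S z v & ereal t <= ptime z v}"
  have ms: "{z. ereal t <= X z} \<in> sets E.N" if "X \<in> bmeas E.N" for X :: "env => ereal"
   using borel_measurable_le[OF _ that, of "%_. ereal t"] by simp
  have A: "?A \<in> sets E.N" by (rule ms[OF ptime_N_measurable])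
  have B: "?B \<in> sets E.N" unfolding Collect_conj_eq by (intro sets.Int ms ptime_N_measurable SUP_approx_measurable)
  have "emeasure E.N ?B = emeasure E.N {z. ereal t <= ?S z v}"
  proof (rule emeasure_eq_AE[OF _ B ms[OF SUP_approx_measurable]], use AE_env_basic in eventually_elim)
   case (elim z)
   then have "?S z v <= ptime z v" by (intro SUP_approx_le) (auto intro: good_seq_finite)
   then show ?case by (auto intro: order_trans)
  qed
  then have "emeasure E.N ?B = emeasure E.N ?A" unfolding ptime_tail[OF t] .
  then have "emeasure E.N (?A - ?B) = 0"
   using A B by (subst emeasure_Diff) (auto simp: E.N.emeasure_eq_measure)
  then have "?A - ?B \<in> null_sets E.N" using A B by auto
  then have "AE z in E.N. z \<notin> ?A - ?B" by (rule AE_not_in)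
  then show ?thesis by eventually_elim auto
 qed
 then have "AE z in E.N. \<forall>v. \<forall>r :: rat. 0 <= r --> ereal (of_rat r) <= ptime z v --> ereal (of_rat r) <= ?S z v"
  by (subst AE_all_countable, intro allI, subst AE_all_countable, intro allI, subst AE_impI) (auto simp del: approx.simps)
 with AE_env_basic show ?thesis
 proof eventually_elim
  case (elim z)
  show ?case
  proof (intro allI antisym)
   fix v
   show "?S z v <= ptime z v" using elim(1) by (intro SUP_approx_le) (auto intro: good_seq_finite)
   show "ptime z v <= ?S z v"
   proof (rule ccontr)
    assume "\<not> ptime z v <= ?S z v"
    then have lt: "?S z v < ptime z v" by simp
    have "0 <= approx (Suc (2 * 0)) z v" by (simp add: sat_time_nonneg)
    also have "... <= ?S z v" by (rule SUP_upper) simp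
    finally have S0: "0 <= ?S z v" .
    from ereal_dense3[OF lt] obtain r :: rat where r: "?S z v < ereal (of_rat r)" "ereal (of_rat r) < ptime z v" by auto
    with S0 have "0 <= ereal (of_rat r)" by (meson less_imp_le order_trans)
    then have "0 <= r" by simp
    with elim(2) r(2) have "ereal (of_rat r) <= ?S z v" by (meson less_imp_le)
    with r(1) show False by simp
   qed
  qed
 qed
qed

text \<open>The open rays form a generator stable under intersection. Rays from a finite nonnegative
  point are increasing unions of closed rays, and rays from a negative point have mass 1 because the
  tail at 0 is \<open>F 0 = 1\<close>.\<close>

lemma sat_law_unique:
 assumes p: "prob_space \<nu>" and s: "sets \<nu> = sets borel" and tl: "\<And>t. 0 <= t ==> emeasure \<nu> {ereal t..} = ennreal (F (lam t))"
 shows "\<nu> = sat_law"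
proof (rule measure_eqI_generator_eq[where E="insert UNIV (range (%a :: ereal. {a<..}))" and \<Omega>=UNIV and A="%_ :: nat. UNIV"])
 interpret N: prob_space \<nu> by fact
 have spN: "space \<nu> = UNIV" using sets_eq_imp_space_eq[OF s] by simp
 have one: "emeasure \<mu> {a<..} = 1" if "prob_space \<mu>" "sets \<mu> = sets borel" "emeasure \<mu> {ereal 0..} = ennreal (F (lam 0))" "a < 0" for \<mu> :: "ereal measure" and a
 proof -
  interpret \<mu>: prob_space \<mu> by fact
  have "1 = emeasure \<mu> {ereal 0..}" using that(3) by (simp add: lam_0 F_0)
  also have "... <= emeasure \<mu> {a<..}"
   using that by (intro emeasure_mono) (auto simp: zero_ereal_def[symmetric] intro: less_le_trans)
  finally show ?thesis using \<mu>.emeasure_le_1[of "{a<..}"] by (intro antisym)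
 qed
 have eq: "emeasure \<nu> {a<..} = emeasure sat_law {a<..}" for a :: ereal
 proof (cases "a < 0")
  case True
  then show ?thesis using one[OF p s tl] one[OF prob_space_sat_law sets_sat_law sat_law_tail] by simp
 next
  case a: False
  show ?thesis
  proof (cases a)
   case (real t)
   have t: "0 <= t" using a real by simp
   have U: "{a<..} = (\<Union>n. {ereal (t + inverse (Suc n))..})"
   proof (rule set_eqI, rule iffI)
    fix x assume "x \<in> {a<..}"
    then have ax: "a < x" by simp
    from ereal_dense2[OF this] obtain r where r: "a < ereal r" "ereal r < x" by auto
    then have "0 < r - t" by (simp add: real)
    from reals_Archimedean[OF this] obtain n where "inverse (real (Suc n)) < r - t" by auto
    then have "ereal (t + inverse (Suc n)) <= ereal r" by simp
    also have "ereal r <= x" using r by simp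
    finally show "x \<in> (\<Union>n. {ereal (t + inverse (Suc n))..})" by auto
   next
    fix x assume "x \<in> (\<Union>n. {ereal (t + inverse (Suc n))..})"
    then obtain n where n: "ereal (t + inverse (Suc n)) <= x" by blast
    have "ereal t < ereal (t + inverse (Suc n))" by simp
    then have "ereal t < x" using n by (rule less_le_trans)
    then show "x \<in> {a<..}" using real by simp
   qed
   have inc: "incseq (%n. {ereal (t + inverse (Suc n))..})"
    by (intro incseq_SucI) (auto elim!: order_trans[rotated])
   have sup: "emeasure \<mu> {a<..} = (SUP n. emeasure \<mu> {ereal (t + inverse (Suc n))..})"
    if "sets \<mu> = sets borel" for \<mu>
   proof -
    have "range (%n. {ereal (t + inverse (Suc n))..}) \<subseteq> sets \<mu>" unfolding that by auto
    from SUP_emeasure_incseq[OF this inc] show ?thesis unfolding U by (rule sym)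
   qed
   have "emeasure \<nu> {ereal (t + inverse (Suc n))..} = emeasure sat_law {ereal (t + inverse (Suc n))..}" for n
   proof -
    have "0 <= t + inverse (Suc n)" using t by simp
    then show ?thesis by (simp only: tl sat_law_tail)
   qed
   then show ?thesis unfolding sup[OF s] sup[OF sets_sat_law] by (simp only:)
  next
   case PInf
   then have "{a<..} = {}" by auto
   then show ?thesis by simp
  qed (use a in auto)
 qed
 show "Int_stable (insert UNIV (range (%a :: ereal. {a<..})))"
 proof (rule Int_stableI)
  fix A B :: "ereal set" assume "A \<in> insert UNIV (range greaterThan)" "B \<in> insert UNIV (range greaterThan)"
  moreover have "{a<..} \<inter> {b<..} = {max a b<..}" for a b :: ereal by auto
  ultimately show "A \<inter> B \<in> insert UNIV (range greaterThan)" by auto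
 qed
 show "emeasure \<nu> X = emeasure sat_law X" if "X \<in> insert UNIV (range (%a :: ereal. {a<..}))" for X
  using that eq N.emeasure_space_1 prob_space.emeasure_space_1[OF prob_space_sat_law] spN sets_eq_imp_space_eq[OF sets_sat_law] by auto
 have "sigma_sets UNIV (insert UNIV (range (%a :: ereal. {a<..}))) = sigma_sets UNIV (range (%a :: ereal. {a<..}))"
  by (rule sigma_sets_eqI) (auto intro: sigma_sets_top)
 then show "sets \<nu> = sigma_sets UNIV (insert UNIV (range (%a :: ereal. {a<..})))" "sets sat_law = sigma_sets UNIV (insert UNIV (range (%a :: ereal. {a<..})))"
  unfolding s sets_sat_law borel_Ioi by simp_all
qed (use prob_space.emeasure_space_1[OF p] sets_eq_imp_space_eq[OF s] in auto)

lemma ptime_law: "distr E.N borel (%z. ptime z v) = sat_law"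
proof (rule sat_law_unique)
 show "prob_space (distr E.N borel (%z. ptime z v))" by (rule E.N.prob_space_distr[OF ptime_N_measurable])
 show "emeasure (distr E.N borel (%z. ptime z v)) {ereal t..} = ennreal (F (lam t))" if "0 <= t" for t
  unfolding ptime_tail(1)[OF that, of v, symmetric]
  by (subst emeasure_distr[OF ptime_N_measurable]) (auto intro!: arg_cong[where f="emeasure _"])
qed simp

lemma vertex_integral:
 assumes g: "g \<in> bmeas (local_space \<Otimes>\<^sub>M seq_space)"
 shows "(\<integral>\<^sup>+z. g (z u, %j. ptime z (u @ [j])) \<partial>E.N) =
  (\<Sum>k. ennreal (p (Suc k)) * (\<integral>\<^sup>+e. g ((psum 0 (fst e), Suc k), snd e) \<partial>mk.env_law))"
proof -
 have "(\<integral>\<^sup>+z. g (z u, %j. ptime z (u @ [j])) \<partial>E.N) = (\<integral>\<^sup>+w. \<integral>\<^sup>+m. g (w, m) \<partial>(\<Pi>\<^sub>M j\<in>UNIV. sat_law) \<partial>local_law)"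
  by (rule E.vertex_law[OF _ _ ptime_law g]) (auto intro: ptime_measurable ptime_cong)
 also have "... = (\<Sum>k. ennreal (p (Suc k)) * (\<integral>\<^sup>+e. g ((psum 0 (fst e), Suc k), snd e) \<partial>mk.env_law))"
  by (rule local_integral[OF mk.marked_axioms g])
 finally show ?thesis .
qed

text \<open>Lifts an almost sure property of one marked vertex to all vertices of the tree at
  once.\<close>

lemma AE_vertex:
 assumes Q: "Measurable.pred (local_space \<Otimes>\<^sub>M seq_space) Q"
  and ae: "\<And>k. AE e in mk.env_law. Q ((psum 0 (fst e), Suc k), snd e)"
 shows "AE z in E.N. \<forall>u. Q (z u, %j. ptime z (u @ [j]))"
proof -
 have "AE z in E.N. Q (z u, %j. ptime z (u @ [j]))" for u
 proof -
  have g: "(%x. of_bool (\<not> Q x) :: ennreal) \<in> bmeas (local_space \<Otimes>\<^sub>M seq_space)"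
   using Q by measurable
  have z: "(\<integral>\<^sup>+e. of_bool (\<not> Q ((psum 0 (fst e), Suc k), snd e)) \<partial>mk.env_law) = (0 :: ennreal)" for k
   using nn_integral_cong_AE[of "%e. of_bool (\<not> Q ((psum 0 (fst e), Suc k), snd e)) :: ennreal" "%_. 0" mk.env_law] ae[of k] by simp
  have t: "(%z j. ptime z (u @ [j])) \<in> measurable E.N seq_space"
   by (rule measurable_PiM_single') (auto intro: ptime_N_measurable)
  have zu: "(%z. z u) \<in> measurable E.N local_space" by (rule env_at_measurable) simp
  have "(\<integral>\<^sup>+z. of_bool (\<not> Q (z u, %j. ptime z (u @ [j]))) \<partial>E.N) = 0"
   unfolding vertex_integral[OF g] z by simp
  then have "AE z in E.N. of_bool (\<not> Q (z u, %j. ptime z (u @ [j]))) = (0 :: ennreal)"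
   by (subst (asm) nn_integral_0_iff_AE[OF measurable_compose[OF measurable_Pair[OF zu t] g]])
  then show ?thesis by eventually_elim simp
 qed
 then show ?thesis by (simp add: AE_all_countable)
qed

lemma sat_law_atomless: "(\<integral>\<^sup>+r. of_bool (c = r) \<partial>sat_law) = (0 :: ennreal)"
proof -
 have "(\<integral>\<^sup>+r. of_bool (c = r) \<partial>sat_law) = (\<integral>\<^sup>+t. ennreal (f t) * of_bool (c = ereal t) \<partial>lborel)"
  unfolding sat_law_def by (simp add: nn_integral_distr nn_integral_density)
 also have "... = (\<integral>\<^sup>+t. 0 \<partial>(lborel :: real measure))"
  using AE_lborel_singleton[of "real_of_ereal c"] by (intro nn_integral_cong_AE, eventually_elim) auto
 finally show ?thesis by simp
qed

lemma AE_noties: "AE z in E.N. \<forall>u j. ereal (fst (z u) j) ~= ptime z (u @ [j])"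
proof -
 let ?R = "local_space \<Otimes>\<^sub>M (seq_space :: (nat => ereal) measure)"
 have x: "(%x. fst (fst x) j) \<in> bmeas ?R" for j
  by (rule measurable_compose[OF measurable_compose[OF measurable_fst measurable_fst] measurable_component_singleton]) simp
 have m: "(%x. snd x j) \<in> bmeas ?R" for j
  by (rule measurable_compose[OF measurable_snd measurable_component_singleton]) simp
 have Q: "Measurable.pred ?R (%x. \<forall>j. ereal (fst (fst x) j) ~= snd x j)"
  using x m by measurable
 have "AE e in mk.env_law. ereal (psum 0 (fst e) j) ~= snd e j" for j
 proof -
  have mz: "(\<integral>\<^sup>+m. of_bool (ereal c = m j) \<partial>mk.marks) = (0 :: ennreal)" for c
  proof -
   have "(\<integral>\<^sup>+m. of_bool (ereal c = m j) \<partial>mk.marks) = (\<integral>\<^sup>+r. of_bool (ereal c = r) \<partial>distr mk.marks sat_law (%m. m j))"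
    unfolding mk.marks_def
    by (intro nn_integral_distr[symmetric] measurable_component_singleton) auto
   also have "... = 0"
    unfolding mk.marks_def by (subst distr_PiM_component) (auto simp: sat_law_atomless intro: prob_space_sat_law)
   finally show ?thesis .
  qed
  have h: "(%e. of_bool (ereal (psum 0 (fst e) j) = snd e j) :: ennreal) \<in> bmeas seqs"
  proof -
   have [measurable]: "(%e. psum 0 (fst e) j) \<in> bmeas seqs" by (rule psum_measurable2) measurable
   have [measurable]: "(%e. snd e j) \<in> bmeas seqs" by (rule component_measurable2) measurable
   show ?thesis by measurable
  qed
  have "(\<integral>\<^sup>+e. of_bool (ereal (psum 0 (fst e) j) = snd e j) \<partial>mk.env_law) = 0"
   unfolding mk.nn_integral_env_law[OF h] fst_conv snd_conv mz by simp
  moreover have "(%e. of_bool (ereal (psum 0 (fst e) j) = snd e j) :: ennreal) \<in> bmeas mk.env_law"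
   using h by (simp only: measurable_cong_sets[OF mk.sets_env_law refl])
  ultimately have "AE e in mk.env_law. of_bool (ereal (psum 0 (fst e) j) = snd e j) = (0 :: ennreal)"
   by (simp only: nn_integral_0_iff_AE)
  then show ?thesis by eventually_elim auto
 qed
 then have "AE e in mk.env_law. \<forall>j. ereal (psum 0 (fst e) j) ~= snd e j" by (simp add: AE_all_countable)
 then have "AE e in mk.env_law. \<forall>j. ereal (fst (fst ((psum 0 (fst e), Suc k), snd e)) j) ~= snd ((psum 0 (fst e), Suc k), snd e) j" for k
  by simp
 from AE_vertex[OF Q this] show ?thesis by simp
qed

text \<open>Supplies the hypothesis of \<open>rdcp_tree_eq\<close> at the fixed time
  \<open>t\<close>.\<close>

lemma AE_labels_neq: "AE z in E.N. \<forall>u j. ereal (fst (z u) j) ~= t"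
proof -
 have "AE x in arrivals. \<forall>j. ereal (x j) ~= t"
  unfolding arrivals_def using AE_gaps_neq[of _ t] by (subst AE_distr_iff) (auto simp: AE_all_countable)
 then have "AE x in arrivals. AE k in degree_law. \<forall>j. ereal (fst (x, k) j) ~= t" by eventually_elim simp
 then have "AE w in local_law. \<forall>j. ereal (fst w j) ~= t" unfolding local_law_def
 proof (rule AD.AE_pair_measure[rotated])
  have x: "(%w. fst w j) \<in> bmeas (arrivals \<Otimes>\<^sub>M degree_law)" for j
   by (rule measurable_compose[OF measurable_fst component_measurable2[of "%x. x"]]) simp
  show "{w \<in> space (arrivals \<Otimes>\<^sub>M degree_law). \<forall>j. ereal (fst w j) ~= t} \<in> sets (arrivals \<Otimes>\<^sub>M degree_law)"
   using x by measurable
 qed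
 from AE_N_at[OF this] show ?thesis .
qed

lemma has_nth_infinite: assumes "\<And>k. has_nth A k" shows "infinite A"
proof
 assume "finite A"
 then have "card {j\<in>A. j < ridx A (Suc (card A))} <= card A" by (intro card_mono) auto
 moreover have "card {j\<in>A. j < ridx A (Suc (card A))} = Suc (card A)" using below_ridx[OF assms] by blast
 ultimately show False by simp
qed

text \<open>\<open>lam\<close> tends to infinity, so the mean number of kept points is unbounded and
  the probability of at most \<open>k\<close> of them tends to 0.\<close>

lemma AE_has_nth: "AE e in mk.env_law. has_nth (avs e) (Suc k)"
proof -
 have S: "{e \<in> space mk.env_law. has_nth (avs e) (Suc k)} \<in> sets mk.env_law"
  using has_nth_measurable[OF avs_measurable, of "Suc k"]
  unfolding pred_def sets_eq_imp_space_eq[OF mk.sets_env_law] mk.sets_env_law .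
 have "(%n. ennreal (1 - poisson_tail k (L (real n)))) \<longlonglongrightarrow> ennreal (1 - 0)"
 proof (intro tendsto_ennrealI tendsto_diff tendsto_const)
  have "filterlim (%n. L (real n)) at_top sequentially"
   using filterlim_compose[OF lam_tendsto filterlim_real_sequentially] by (simp add: L_eq)
  from filterlim_compose[OF poisson_tail_at_top this] show "(%n. poisson_tail k (L (real n))) \<longlonglongrightarrow> 0" .
 qed
 moreover have "ennreal (1 - poisson_tail k (L (real n))) <= emeasure mk.env_law {e \<in> space mk.env_law. has_nth (avs e) (Suc k)}" for n
  unfolding mk.nth_before_prob[of "real n" k, symmetric, OF of_nat_0_le_iff] nn_integral_of_bool[OF S, symmetric]
  by (intro nn_integral_mono) auto
 ultimately have "1 <= emeasure mk.env_law {e \<in> space mk.env_law. has_nth (avs e) (Suc k)}"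
  by (intro LIMSEQ_le_const2) auto
 then have "emeasure mk.env_law {e \<in> space mk.env_law. has_nth (avs e) (Suc k)} = 1"
  using mk.E.emeasure_le_1 by (rule antisym[rotated])
 moreover have "Measurable.pred mk.env_law (%e. has_nth (avs e) (Suc k))" using S by (simp add: pred_def)
 ultimately show ?thesis by (subst mk.E.AE_iff_emeasure_eq_1)
qed

lemma AE_avail_infinite: "AE z in E.N. \<forall>u. infinite (avail z u)"
proof -
 let ?R = "local_space \<Otimes>\<^sub>M (seq_space :: (nat => ereal) measure)"
 have x: "(%x. fst (fst x) j) \<in> bmeas ?R" for j
  by (rule measurable_compose[OF measurable_compose[OF measurable_fst measurable_fst] measurable_component_singleton]) simp
 have m: "(%x. snd x j) \<in> bmeas ?R" for j
  by (rule measurable_compose[OF measurable_snd measurable_component_singleton]) simp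
 have "Measurable.pred ?R (%x. i \<in> {j. ereal (fst (fst x) j) <= snd x j})" for i
  unfolding pred_def mem_Collect_eq by (intro borel_measurable_le borel_measurable_ereal x m)
 then have Q: "Measurable.pred ?R (%x. \<forall>k. has_nth {j. ereal (fst (fst x) j) <= snd x j} (Suc k))"
  by (intro pred_intros_countable has_nth_measurable)
 have "AE e in mk.env_law. \<forall>k. has_nth (avs e) (Suc k)" by (simp add: AE_all_countable AE_has_nth)
 then have "AE e in mk.env_law. \<forall>k. has_nth {j. ereal (fst (fst ((psum 0 (fst e), Suc l), snd e)) j) <= snd ((psum 0 (fst e), Suc l), snd e) j} (Suc k)" for l
  unfolding avs_def av_def by simp
 from AE_vertex[OF Q this] have "AE z in E.N. \<forall>u k. has_nth (avail z u) (Suc k)"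
  by (simp add: avail_def)
 then show ?thesis
 proof eventually_elim
  case (elim z)
  have "has_nth (avail z u) k" for u k using elim by (cases k) auto
  then have "infinite (avail z u)" for u by (intro has_nth_infinite)
  then show ?case by blast
 qed
qed

lemma AE_good_env: "AE z in E.N. good_env z"
 using AE_env_basic AE_lims AE_noties AE_avail_infinite
proof eventually_elim
 case (elim z)
 then show ?case
  by (intro good_env.intro) (auto intro: good_seq_finite simp: good_seq_def simp del: approx.simps)
qed

end

section \<open>The generation property\<close>

definition placed_children :: "nat => env => vertex => nat => real \<times> real" where
 "placed_children m z u = (\<lambda>j\<in>{..<m}. (fst (z u) (nth_elt (avail z u) j), real_of_ereal (ptime z (u @ [nth_elt (avail z u) j]))))"

lemma placed_children_measurable:
 "(%z. placed_children m z u) \<in> measurable env_space (pair_seqs m)"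
 unfolding placed_children_def
proof (rule measurable_restrict)
 fix j
 have i: "(%z. z) \<in> measurable env_space env_space" by simp
 have c: "(%z. nth_elt (avail z u) j) \<in> measurable env_space (count_space UNIV)"
  using child_of_measurable[OF i ptimes_measurable[OF i], of u j] by (simp add: avail_of_ptime)
 have "(%z. (fst (z u) i, real_of_ereal (ptime z (u @ [i])))) \<in> measurable env_space (borel \<Otimes>\<^sub>M borel)" for i
  by (intro measurable_Pair env_pts_measurable[of "%z. z"] borel_measurable_real_of_ereal ptime_measurable[of "%z. z"]) auto
 from measurable_compose_countable[OF this c]
 show "(%z. (fst (z u) (nth_elt (avail z u) j), real_of_ereal (ptime z (u @ [nth_elt (avail z u) j])))) \<in> bmeas env_space"
  by (simp only: borel_prod)
qed

lemma placed_children_cong: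
 assumes "\<And>w. z (u @ w) = z' (u @ w)" shows "placed_children m z u = placed_children m z' u"
proof -
 have 1: "z u = z' u" using assms[of "[]"] by simp
 have 2: "ptime z (u @ [j]) = ptime z' (u @ [j])" for j by (rule ptime_cong) (use assms[of "j # _"] in simp)
 then have "avail z u = avail z' u" using 1 by (simp add: avail_def)
 with 1 2 show ?thesis by (simp add: placed_children_def)
qed

context rdcp_ode begin

lemma nn_integral_ptime:
 assumes h: "h \<in> bmeas borel"
 shows "(\<integral>\<^sup>+z. h (ptime z u) \<partial>E.N) = (\<integral>\<^sup>+t. ennreal (f t) * h (ereal t) \<partial>lborel)"
proof -
 have "(\<integral>\<^sup>+z. h (ptime z u) \<partial>E.N) = (\<integral>\<^sup>+r. h r \<partial>distr E.N borel (%z. ptime z u))"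
  using h by (intro nn_integral_distr[symmetric] ptime_N_measurable) simp
 also have "... = (\<integral>\<^sup>+t. ennreal (f t) * h (ereal t) \<partial>lborel)"
  unfolding ptime_law using h unfolding sat_law_def by (simp add: nn_integral_distr nn_integral_density)
 finally show ?thesis .
qed

text \<open>The case of the generation property for a single vertex with nothing known but its time.
  On good environments the time is the last used label, so \<open>children_match\<close> applies; a
  factor \<open>h\<close> of the time is kept to allow conditioning on it.\<close>

lemma one_vertex:
 assumes h: "h \<in> bmeas borel" and k: "1 <= k"
  and B: "B \<in> sets (pair_seqs (num_children v k))"
 shows "(\<integral>\<^sup>+z. h (ptime z u) * (of_bool (snd (z u) = k) * indicator B (placed_children (num_children v k) z u)) \<partial>E.N) =
  (\<integral>\<^sup>+z. h (ptime z u) * kern v k B (real_of_ereal (ptime z u)) \<partial>E.N)"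
proof -
 obtain m where km: "k = Suc m" using k by (cases k) auto
 let ?nc = "num_children v (Suc m)"
 have nc: "?nc <= Suc m" by (simp add: num_children_def)
 let ?R = "local_space \<Otimes>\<^sub>M (seq_space :: (nat => ereal) measure)"
 define A where "A x = {j. ereal (fst (fst x) j) <= snd x j}" for x :: "((nat => real) \<times> nat) \<times> (nat => ereal)"
 define g :: "((nat => real) \<times> nat) \<times> (nat => ereal) => ennreal" where
  "g x = of_bool (snd (fst x) = Suc m) * (of_bool (has_nth (A x) (Suc m)) * (h (ereal (fst (fst x) (nth_elt (A x) m))) *
   indicator B (\<lambda>j\<in>{..<?nc}. (fst (fst x) (nth_elt (A x) j), real_of_ereal (snd x (nth_elt (A x) j))))))" for x
 have x: "(%x. fst (fst x) j) \<in> bmeas ?R" for j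
  by (rule measurable_compose[OF measurable_compose[OF measurable_fst measurable_fst] measurable_component_singleton]) simp
 have mm: "(%x. snd x j) \<in> bmeas ?R" for j
  by (rule measurable_compose[OF measurable_snd measurable_component_singleton]) simp
 have Am: "Measurable.pred ?R (%x. i \<in> A x)" for i
  unfolding A_def pred_def mem_Collect_eq by (intro borel_measurable_le borel_measurable_ereal x mm)
 have nm: "(%x. nth_elt (A x) j) \<in> measurable ?R (count_space UNIV)" for j by (rule nth_elt_measurable[OF Am])
 have hm: "Measurable.pred ?R (%x. has_nth (A x) (Suc m))" by (rule has_nth_measurable[OF Am])
 have dm: "Measurable.pred ?R (%x. snd (fst x) = Suc m)" by measurable
 have gm: "g \<in> bmeas ?R"
 proof -
  have 1: "(%x. h (ereal (fst (fst x) (nth_elt (A x) m)))) \<in> bmeas ?R"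
   by (rule measurable_compose[OF borel_measurable_ereal[OF measurable_compose_countable[OF x nm]] h])
  have 2: "(%x. \<lambda>j\<in>{..<?nc}. (fst (fst x) (nth_elt (A x) j), real_of_ereal (snd x (nth_elt (A x) j)))) \<in> measurable ?R (pair_seqs (?nc))"
   unfolding borel_prod[symmetric]
   by (intro measurable_restrict measurable_Pair measurable_compose_countable[OF x nm] borel_measurable_real_of_ereal measurable_compose_countable[OF mm nm])
  show ?thesis unfolding g_def
   using 1 measurable_compose[OF 2 borel_measurable_indicator[OF B[unfolded km]]] hm dm
   by (intro borel_measurable_times_ennreal) (auto simp: pred_def)
 qed
 have "(\<integral>\<^sup>+z. h (ptime z u) * (of_bool (snd (z u) = k) * indicator B (placed_children (num_children v k) z u)) \<partial>E.N) =
  (\<integral>\<^sup>+z. g (z u, %j. ptime z (u @ [j])) \<partial>E.N)"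
 proof (rule nn_integral_cong_AE, use AE_good_env in eventually_elim)
  case (elim z)
  interpret good_env z by fact
  have a: "A (z u, %j. ptime z (u @ [j])) = avail z u" by (simp add: A_def avail_def)
  have "has_nth (avail z u) (Suc m)" using not_has_nth[of "avail z u" "Suc m"] avail_inf[of u] by blast
  moreover have "ptime z u = ereal (fst (z u) (nth_elt (avail z u) m))" if "snd (z u) = Suc m"
   using ptime_eq[of u] that by (simp add: ix_def)
  ultimately show ?case unfolding g_def a km by (simp add: placed_children_def mult_ac)
 qed
 also have "... = (\<Sum>l. ennreal (p (Suc l)) * (\<integral>\<^sup>+e. g ((psum 0 (fst e), Suc l), snd e) \<partial>mk.env_law))"
  by (rule vertex_integral[OF gm])
 also have "... = (\<Sum>l\<in>{m}. ennreal (p (Suc l)) * (\<integral>\<^sup>+e. g ((psum 0 (fst e), Suc l), snd e) \<partial>mk.env_law))"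
  by (rule suminf_finite) (auto simp: g_def)
 also have "... = ennreal (p (Suc m)) * (\<integral>\<^sup>+e. g ((psum 0 (fst e), Suc m), snd e) \<partial>mk.env_law)" by simp
 also have "(\<integral>\<^sup>+e. g ((psum 0 (fst e), Suc m), snd e) \<partial>mk.env_law) =
  (\<integral>\<^sup>+e. of_bool (has_nth (avs e) (Suc m)) * ((%t. h (ereal t)) (psum 0 (fst e) (nth_elt (avs e) m)) *
   indicator B (\<lambda>j\<in>{..<?nc}. (fst (pairs e (Suc m) j), real_of_ereal (snd (pairs e (Suc m) j))))) \<partial>mk.env_law)"
 proof (rule nn_integral_cong)
  fix e
  have a: "A ((psum 0 (fst e), Suc m), snd e) = avs e" by (simp add: A_def avs_def av_def)
  have "(\<lambda>j\<in>{..<?nc}. (fst (pairs e (Suc m) j), real_of_ereal (snd (pairs e (Suc m) j)))) =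
   (\<lambda>j\<in>{..<?nc}. (psum 0 (fst e) (nth_elt (avs e) j), real_of_ereal (snd e (nth_elt (avs e) j))))"
   using nc by (auto simp: fun_eq_iff pairs_def at_pos_def)
  then show "g ((psum 0 (fst e), Suc m), snd e) = of_bool (has_nth (avs e) (Suc m)) * ((%t. h (ereal t)) (psum 0 (fst e) (nth_elt (avs e) m)) *
   indicator B (\<lambda>j\<in>{..<?nc}. (fst (pairs e (Suc m) j), real_of_ereal (snd (pairs e (Suc m) j)))))"
   unfolding g_def a by simp
 qed
 also have "ennreal (p (Suc m)) * ... = (\<integral>\<^sup>+t. ennreal (f t) * ((%t. h (ereal t)) t * kern v (Suc m) B t) \<partial>lborel)"
  using h by (intro children_match B[unfolded km]) simp
 also have "... = (\<integral>\<^sup>+t. ennreal (f t) * ((%r. h r * kern v (Suc m) B (real_of_ereal r)) (ereal t)) \<partial>lborel)" by simp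
 also have "... = (\<integral>\<^sup>+z. (%r. h r * kern v (Suc m) B (real_of_ereal r)) (ptime z u) \<partial>E.N)"
 proof (rule nn_integral_ptime[symmetric])
  show "(%r. h r * kern v (Suc m) B (real_of_ereal r)) \<in> bmeas borel"
   using h measurable_compose[OF borel_measurable_real_of_ereal[of "%x. x"] kern_measurable[OF _ B[unfolded km]], of borel]
   by (intro borel_measurable_times_ennreal) auto
 qed
 finally show ?thesis by (simp add: km)
qed

text \<open>Resampling the subtree of \<open>u\<close> leaves \<open>G\<close> unchanged except
  through the time at \<open>u\<close>, so for fixed outer environment the claim is
  \<open>one_vertex\<close>.\<close>

lemma one_vertex_given:
 assumes G: "(%(z, s). G z s) \<in> bmeas (env_space \<Otimes>\<^sub>M (borel :: ereal measure))"
  and loc: "\<And>z z' s. G (E.mix u z z') s = G z s"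
  and k: "1 <= k" and B: "B \<in> sets (pair_seqs (num_children v k))"
 shows "(\<integral>\<^sup>+z. G z (ptime z u) * (of_bool (snd (z u) = k) * indicator B (placed_children (num_children v k) z u)) \<partial>E.N) =
  (\<integral>\<^sup>+z. G z (ptime z u) * kern v k B (real_of_ereal (ptime z u)) \<partial>E.N)"
proof -
 have i: "(%z. z) \<in> measurable env_space env_space" by simp
 have G1: "(%z. G z (ptime z u)) \<in> bmeas env_space"
  using measurable_compose[OF measurable_Pair[OF i ptime_measurable[OF i]] G] by simp
 have Gz: "G z \<in> bmeas borel" for z
  using measurable_compose[OF measurable_Pair1' G, of z] by simp
 have d: "Measurable.pred env_space (%z. snd (z u) = k)"
  using env_deg_measurable[OF i, of u] by measurable
 have F1: "(%z. G z (ptime z u) * (of_bool (snd (z u) = k) * indicator B (placed_children (num_children v k) z u))) \<in> bmeas env_space"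
  using G1 d measurable_compose[OF placed_children_measurable borel_measurable_indicator[OF B]]
  by (intro borel_measurable_times_ennreal) auto
 have F2: "(%z. G z (ptime z u) * kern v k B (real_of_ereal (ptime z u))) \<in> bmeas env_space"
  using G1 measurable_compose[OF borel_measurable_real_of_ereal[OF ptime_measurable[OF i]] kern_measurable[OF k B]]
  by (intro borel_measurable_times_ennreal) auto
 have m: "E.mix u z z' (u @ w) = z' (u @ w)" for z z' w by (simp add: E.mix_def)
 have m0: "E.mix u z z' u = z' u" for z z' using m[of z z' "[]"] by simp
 have e: "ptime (E.mix u z z') u = ptime z' u" "placed_children l (E.mix u z z') u = placed_children l z' u" for z z' l
  by (rule ptime_cong, rule m) (rule placed_children_cong, rule m)
 show ?thesis
  unfolding E.resample[OF F1, of u] E.resample[OF F2, of u] loc e m0 one_vertex[OF Gz k B] ..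
qed

lemma mix_outside: assumes "length v = length u" "v ~= u" shows "E.mix u z z' (v @ w) = z (v @ w)"
proof -
 have "\<not> prefix u (v @ w)" using assms by (auto simp: prefix_def append_eq_append_conv)
 then show ?thesis by (simp add: E.mix_def)
qed

text \<open>The vertices are at the same depth, so their subtrees are disjoint and can be treated
  one after another. Once treated, a vertex contributes a function of its time alone, which may be
  absorbed into \<Psi>.\<close>

lemma many_vertices:
 assumes "finite I" "inj_on u I" "\<And>w. w \<in> I ==> length (u w) = n" "\<And>w. w \<in> I ==> 1 <= k w"
  "\<And>w. w \<in> I ==> B w \<in> sets (pair_seqs (num_children w (k w)))"
  and "\<Psi> \<in> bmeas (env_space \<Otimes>\<^sub>M time_space)"
  and "\<And>y \<theta> y' \<theta>'. agree n n y \<theta> y' \<theta>' ==> \<Psi> (y, \<theta>) = \<Psi> (y', \<theta>')"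
 shows "(\<integral>\<^sup>+z. \<Psi> (z, ptime z) * (\<Prod>w\<in>I. of_bool (snd (z (u w)) = k w) * indicator (B w) (placed_children (num_children w (k w)) z (u w))) \<partial>E.N) =
  (\<integral>\<^sup>+z. \<Psi> (z, ptime z) * (\<Prod>w\<in>I. kern w (k w) (B w) (real_of_ereal (ptime z (u w)))) \<partial>E.N)"
 using assms
proof (induction I arbitrary: \<Psi> rule: finite_induct)
 case (insert w I)
 define ev :: "vertex => env => ennreal" where
  "ev w z = of_bool (snd (z (u w)) = k w) * indicator (B w) (placed_children (num_children w (k w)) z (u w))" for w z
 define kr where "kr w r = kern w (k w) (B w) (real_of_ereal r)" for w r
 \<comment> \<open>The time at \<open>u w\<close> is cut out of \<open>ptime z\<close> and passed
   separately; what remains does not look into the subtree of \<open>u w\<close>.\<close>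
 define G where "G z s = \<Psi> (z, (ptime z)(u w := s)) * (\<Prod>w'\<in>I. ev w' z)" for z s
 have i: "(%z. z) \<in> measurable env_space env_space" by simp
 have lw: "length (u w) = n" using insert.prems(2) by simp
 have ne: "u w' ~= u w" if "w' \<in> I" for w' using insert.prems(1) insert.hyps(2) that by (auto simp: inj_on_def)
 have evm: "ev w' \<in> bmeas env_space" if "w' \<in> I" for w'
 proof -
  have d: "Measurable.pred env_space (%z. snd (z (u w')) = k w')"
   using env_deg_measurable[OF i, of "u w'"] by measurable
  have "B w' \<in> sets (pair_seqs (num_children w' (k w')))" using insert.prems(4) that by simp
  from measurable_compose[OF placed_children_measurable borel_measurable_indicator[OF this]] d
  show ?thesis unfolding ev_def[abs_def] by (intro borel_measurable_times_ennreal) auto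
 qed
 have krm: "(%r. kr w r) \<in> bmeas borel"
  unfolding kr_def using insert.prems(3,4)
  by (intro measurable_compose[OF borel_measurable_real_of_ereal[of "%x. x"] kern_measurable]) auto
 have Gm: "(%(z, s). G z s) \<in> bmeas (env_space \<Otimes>\<^sub>M (borel :: ereal measure))"
 proof -
  have "(%x. (ptime (fst x))(u w := snd x)) \<in> measurable (env_space \<Otimes>\<^sub>M (borel :: ereal measure)) time_space"
   by (rule measurable_fun_upd[of UNIV UNIV]) (auto intro: measurable_compose[OF measurable_fst ptimes_measurable[OF i]])
  from measurable_compose[OF measurable_Pair[OF measurable_fst this] insert.prems(5)]
  show ?thesis unfolding G_def split_beta'
   by (intro borel_measurable_times_ennreal borel_measurable_prod_ennreal measurable_compose[OF measurable_fst evm])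
 qed
 have Gl: "G (E.mix (u w) z z') s = G z s" for z z' s
 proof -
  have "agree n n (E.mix (u w) z z') ((ptime (E.mix (u w) z z'))(u w := s)) z ((ptime z)(u w := s))"
   unfolding agree_def
  proof (intro conjI allI impI)
   fix v :: vertex assume "length v < n"
   then have "\<not> prefix (u w) v" using lw prefix_length_le[of "u w" v] by auto
   then show "E.mix (u w) z z' v = z v" by (simp add: E.mix_def)
  next
   fix v :: vertex assume "n <= length v & length v <= n"
   then have "length v = length (u w)" using lw by simp
   then show "((ptime (E.mix (u w) z z'))(u w := s)) v = ((ptime z)(u w := s)) v"
    by (cases "v = u w") (auto intro!: ptime_cong mix_outside)
  qed
  then have 1: "\<Psi> (E.mix (u w) z z', (ptime (E.mix (u w) z z'))(u w := s)) = \<Psi> (z, (ptime z)(u w := s))"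
   by (rule insert.prems(6))
  have "ev w' (E.mix (u w) z z') = ev w' z" if w': "w' \<in> I" for w'
  proof -
   have m: "E.mix (u w) z z' (u w' @ x) = z (u w' @ x)" for x
    using insert.prems(2) w' ne by (intro mix_outside) auto
   from placed_children_cong[of "E.mix (u w) z z'" "u w'" z, OF m] m[of "[]"] show ?thesis by (simp add: ev_def)
  qed
  then have 2: "(\<Prod>w'\<in>I. ev w' (E.mix (u w) z z')) = (\<Prod>w'\<in>I. ev w' z)" by (intro prod.cong refl)
  show ?thesis unfolding G_def 1 2 ..
 qed
 have sG: "\<Psi> (z, ptime z) * (\<Prod>w'\<in>insert w I. ev w' z) = G z (ptime z (u w)) * ev w z" for z
  using insert.hyps by (simp add: G_def mult_ac)
 have "(\<integral>\<^sup>+z. \<Psi> (z, ptime z) * (\<Prod>w'\<in>insert w I. ev w' z) \<partial>E.N) = (\<integral>\<^sup>+z. G z (ptime z (u w)) * kr w (ptime z (u w)) \<partial>E.N)"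
 proof -
  have "(\<integral>\<^sup>+z. G z (ptime z (u w)) * ev w z \<partial>E.N) = (\<integral>\<^sup>+z. G z (ptime z (u w)) * kr w (ptime z (u w)) \<partial>E.N)"
   unfolding ev_def kr_def by (rule one_vertex_given[OF Gm Gl insert.prems(3)[OF insertI1] insert.prems(4)[OF insertI1]])
  then show ?thesis by (simp only: sG)
 qed
 also have "... = (\<integral>\<^sup>+z. (%(y, \<theta>). \<Psi> (y, \<theta>) * kr w (\<theta> (u w))) (z, ptime z) * (\<Prod>w'\<in>I. ev w' z) \<partial>E.N)"
  by (intro nn_integral_cong) (simp add: G_def mult_ac)
 also have "... = (\<integral>\<^sup>+z. (%(y, \<theta>). \<Psi> (y, \<theta>) * kr w (\<theta> (u w))) (z, ptime z) * (\<Prod>w'\<in>I. kr w' (ptime z (u w'))) \<partial>E.N)"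
  unfolding ev_def kr_def
 proof (rule insert.IH)
  show "inj_on u I" using insert.prems(1) by simp
  have "(%x. snd x (u w)) \<in> bmeas (env_space \<Otimes>\<^sub>M time_space)" by (rule time_at_measurable) simp
  from measurable_compose[OF this krm]
  show "(%(y, \<theta>). \<Psi> (y, \<theta>) * kern w (k w) (B w) (real_of_ereal (\<theta> (u w)))) \<in> bmeas (env_space \<Otimes>\<^sub>M time_space)"
   unfolding split_beta' kr_def using insert.prems(5) by (intro borel_measurable_times_ennreal) auto
  show "(%(y, \<theta>). \<Psi> (y, \<theta>) * kern w (k w) (B w) (real_of_ereal (\<theta> (u w)))) (y, \<theta>) =
    (%(y, \<theta>). \<Psi> (y, \<theta>) * kern w (k w) (B w) (real_of_ereal (\<theta> (u w)))) (y', \<theta>')" if "agree n n y \<theta> y' \<theta>'" for y \<theta> y' \<theta>'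
   using insert.prems(6)[OF that] that lw by (simp add: agree_def)
 qed (use insert.prems in auto)
 also have "... = (\<integral>\<^sup>+z. \<Psi> (z, ptime z) * (\<Prod>w'\<in>insert w I. kr w' (ptime z (u w'))) \<partial>E.N)"
  using insert.hyps by (intro nn_integral_cong) (simp add: mult_ac)
 finally show ?case unfolding ev_def kr_def .
qed simp

text \<open>Allows an identity to be checked on the pieces where a countably valued random element
  is constant, here the random placement.\<close>

lemma nn_integral_partition:
 assumes X: "X \<in> measurable M (count_space C)" and C: "countable C"
  and m: "g \<in> bmeas M" "h \<in> bmeas M"
  and eq: "\<And>c. c \<in> C ==> (\<integral>\<^sup>+x. of_bool (X x = c) * g x \<partial>M) = (\<integral>\<^sup>+x. of_bool (X x = c) * (h x :: ennreal) \<partial>M)"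
 shows "(\<integral>\<^sup>+x. g x \<partial>M) = (\<integral>\<^sup>+x. h x \<partial>M)"
proof -
 have "(\<integral>\<^sup>+x. g x \<partial>M) = (\<integral>\<^sup>+c. \<integral>\<^sup>+x. of_bool (X x = c) * g x \<partial>M \<partial>count_space C)" if g: "g \<in> bmeas M" for g
 proof -
  have "(\<integral>\<^sup>+x. g x \<partial>M) = (\<integral>\<^sup>+x. \<integral>\<^sup>+c. of_bool (X x = c) * g x \<partial>count_space C \<partial>M)"
  proof (rule nn_integral_cong)
   fix x assume "x \<in> space M"
   then have XC: "X x \<in> C" using measurable_space[OF X] by simp
   have "(\<integral>\<^sup>+c. of_bool (X x = c) * g x \<partial>count_space C) = (\<integral>\<^sup>+c. g x * indicator {X x} c \<partial>count_space C)"
    by (intro nn_integral_cong) (auto simp: indicator_def)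
   also have "... = g x" using XC by (simp add: nn_integral_cmult_indicator)
   finally show "g x = (\<integral>\<^sup>+c. of_bool (X x = c) * g x \<partial>count_space C)" ..
  qed
  also have "... = (\<integral>\<^sup>+c. \<integral>\<^sup>+x. of_bool (X x = c) * g x \<partial>M \<partial>count_space C)"
  proof (rule nn_integral_count_space_nn_integral[OF C])
   fix c assume "c \<in> C"
   then have "{x\<in>space M. X x = c} \<in> sets M" using measurable_sets[OF X, of "{c}"] by (simp add: vimage_def Int_def conj_commute)
   then have "indicator {x\<in>space M. X x = c} \<in> bmeas M" by (rule borel_measurable_indicator)
   then have "(%x. of_bool (X x = c) :: ennreal) \<in> bmeas M"
    by (rule measurable_cong[THEN iffD1, rotated]) (simp add: indicator_def)
   then show "(%x. of_bool (X x = c) * g x) \<in> bmeas M" using g by (rule borel_measurable_times_ennreal)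
  qed
  finally show ?thesis .
 qed
 from this[OF m(1)] this[OF m(2)] show ?thesis using eq by (simp cong: nn_integral_cong_simp)
qed

lemma placed_measurable:
 "(%z. placed_type z w) \<in> bmeas env_space" "(%z. placed_degree z w) \<in> measurable env_space (count_space UNIV)"
 "(%z. placed_label z w) \<in> bmeas env_space" "(%z. place z w) \<in> measurable env_space (count_space UNIV)"
proof -
 have i: "(%z. z) \<in> measurable env_space env_space" by simp
 note p = ptimes_measurable[OF i]
 have l: "label_of z (ptime z) w = placed_label z w" for z
  by (simp add: label_of_def placed_label_def place_of_ptime avail_of_ptime)
 show "(%z. placed_type z w) \<in> bmeas env_space"
  using type_of_measurable[OF i p, of w] by (simp add: placed_type_def place_of_ptime)
 show "(%z. placed_degree z w) \<in> measurable env_space (count_space UNIV)"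
  using degree_of_measurable[OF i p, of w] by (simp add: placed_degree_def place_of_ptime)
 show "(%z. placed_label z w) \<in> bmeas env_space"
  using label_of_measurable[OF i p, of w] by (simp add: l)
 show "(%z. place z w) \<in> measurable env_space (count_space UNIV)"
  using place_of_measurable[OF i p, of w] by (simp add: place_of_ptime)
qed

text \<open>The placements of the vertices in \<open>I\<close> are random and correlated with the
  subtrees. On each event \<open>X z = c\<close> they are replaced by fixed vertices, to which
  \<open>many_vertices\<close> applies.\<close>

lemma placed_generation:
 assumes I: "finite I" "I \<subseteq> {v. length v = n}" and k: "\<And>v. v \<in> I ==> 1 <= k v"
  and B: "\<And>v. v \<in> I ==> B v \<in> sets (pair_seqs (num_children v (k v)))" and E: "E \<in> sets hist_space"
 defines "H \<equiv> %z. mtbp_history n (placed_type z) (placed_degree z) (placed_label z)"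
 shows "emeasure E.N {z \<in> space E.N. H z \<in> E & (\<forall>v\<in>I. v \<in> mtbp_vertices (placed_degree z) & placed_degree z v = k v \<and>
   (\<lambda>j\<in>{..<num_children v (k v)}. (placed_label z (v @ [j]), placed_type z (v @ [j]))) \<in> B v)} =
  (\<integral>\<^sup>+z. indicator {z. H z \<in> E & I \<subseteq> mtbp_vertices (placed_degree z)} z *
   (\<Prod>v\<in>I. ennreal (degree_prob p lam (placed_type z v) (k v)) * emeasure (children_law p lam v (placed_type z v) (k v)) (B v)) \<partial>E.N)"
proof -
 define P where "P y T = (of_bool (hist_of n y T \<in> E) * (\<Prod>v\<in>I. of_bool (v \<in> vert_of y T)) :: ennreal)" for y T
 define ev :: "vertex => vertex => env => ennreal" where
  "ev w u z = of_bool (snd (z u) = k w) * indicator (B w) (placed_children (num_children w (k w)) z u)" for w u z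
 define kr where "kr w r = kern w (k w) (B w) (real_of_ereal r)" for w r
 define X where "X z = restrict (place z) I" for z
 let ?C = "PiE I (%_. UNIV :: vertex set)"
 have i: "(%z. z) \<in> measurable env_space env_space" by simp
 have Pm: "(%\<omega>. P (g \<omega>) (T \<omega>)) \<in> bmeas K" if g: "g \<in> measurable K env_space" and T: "T \<in> measurable K time_space" for g T K
 proof -
  have "Measurable.pred K (%\<omega>. hist_of n (g \<omega>) (T \<omega>) \<in> E)"
   using measurable_sets[OF hist_of_measurable[OF g T] E] by (simp add: pred_def vimage_def Int_def conj_commute)
  moreover note vert_of_measurable[OF g T]
  ultimately show ?thesis unfolding P_def by (intro borel_measurable_times_ennreal borel_measurable_prod_ennreal) auto
 qed
 have evm: "ev w u \<in> bmeas env_space" if "w \<in> I" for w u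
 proof -
  have d: "Measurable.pred env_space (%z. snd (z u) = k w)"
   using env_deg_measurable[OF i, of u] by measurable
  from measurable_compose[OF placed_children_measurable borel_measurable_indicator[OF B[OF that]]] d
  show ?thesis unfolding ev_def[abs_def] by (intro borel_measurable_times_ennreal) auto
 qed
 have krm: "kr w \<in> bmeas borel" if "w \<in> I" for w
  unfolding kr_def[abs_def] using k[OF that] B[OF that]
  by (intro measurable_compose[OF borel_measurable_real_of_ereal[of "%x. x"] kern_measurable]) auto
 have evpm: "(%z. ev w (place z w) z) \<in> bmeas env_space" if "w \<in> I" for w
  by (rule measurable_compose_countable[OF evm[OF that] placed_measurable(4)])
 have krpm: "(%z. kr w (ptime z (place z w))) \<in> bmeas env_space" if "w \<in> I" for w
  by (rule measurable_compose[OF measurable_compose_countable[OF ptime_measurable[OF i] placed_measurable(4)] krm[OF that]])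
 have gm: "(%z. P z (ptime z) * (\<Prod>w\<in>I. ev w (place z w) z)) \<in> bmeas env_space"
  by (intro borel_measurable_times_ennreal borel_measurable_prod_ennreal evpm Pm i ptimes_measurable[OF i])
 have hm: "(%z. P z (ptime z) * (\<Prod>w\<in>I. kr w (ptime z (place z w)))) \<in> bmeas env_space"
  by (intro borel_measurable_times_ennreal borel_measurable_prod_ennreal krpm Pm i ptimes_measurable[OF i])
 have Pz: "P z (ptime z) = of_bool (H z \<in> E & I \<subseteq> mtbp_vertices (placed_degree z))" for z
  unfolding P_def hist_of_ptime vert_of_ptime H_def prod_of_bool[OF I(1)] of_bool_conj[symmetric]
  by (intro arg_cong[where f=of_bool]) auto
 have lhs: "of_bool (H z \<in> E & (\<forall>v\<in>I. v \<in> mtbp_vertices (placed_degree z) & placed_degree z v = k v \<and>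
   (\<lambda>j\<in>{..<num_children v (k v)}. (placed_label z (v @ [j]), placed_type z (v @ [j]))) \<in> B v)) =
   P z (ptime z) * (\<Prod>w\<in>I. ev w (place z w) z)" for z
 proof -
  have evq: "ev w (place z w) z = of_bool (placed_degree z w = k w \<and>
   (\<lambda>j\<in>{..<num_children w (k w)}. (placed_label z (w @ [j]), placed_type z (w @ [j]))) \<in> B w)" for w
  proof -
   have "placed_children (num_children w (k w)) z (place z w) = (\<lambda>j\<in>{..<num_children w (k w)}. (placed_label z (w @ [j]), placed_type z (w @ [j])))"
    by (simp add: placed_children_def placed_label_snoc placed_type_def place_snoc)
   then show ?thesis by (simp add: ev_def placed_degree_def indicator_def of_bool_def)
  qed
  show ?thesis unfolding Pz evq prod_of_bool[OF I(1)] of_bool_conj[symmetric]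
   by (intro arg_cong[where f=of_bool]) auto
 qed
 have S: "{z \<in> space E.N. H z \<in> E & (\<forall>v\<in>I. v \<in> mtbp_vertices (placed_degree z) & placed_degree z v = k v \<and>
   (\<lambda>j\<in>{..<num_children v (k v)}. (placed_label z (v @ [j]), placed_type z (v @ [j]))) \<in> B v)} \<in> sets E.N"
 proof -
  have "{z \<in> space env_space. P z (ptime z) * (\<Prod>w\<in>I. ev w (place z w) z) ~= 0} \<in> sets env_space"
   using gm by measurable
  then show ?thesis unfolding lhs[symmetric] by (simp only: E.sets_N E.space_N space_env of_bool_eq_0_iff not_not)
 qed
 have main: "(\<integral>\<^sup>+z. P z (ptime z) * (\<Prod>w\<in>I. ev w (place z w) z) \<partial>E.N) = (\<integral>\<^sup>+z. P z (ptime z) * (\<Prod>w\<in>I. kr w (ptime z (place z w))) \<partial>E.N)"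
 proof (rule nn_integral_partition)
  show C: "countable ?C" using I(1) by (intro countable_PiE) auto
  show "X \<in> measurable E.N (count_space ?C)"
  proof (rule measurable_count_space_eq_countable[THEN iffD2, OF C], intro conjI ballI)
   show "X \<in> space E.N \<rightarrow> ?C" by (auto simp: X_def)
   fix c assume c: "c \<in> ?C"
   have "X -` {c} \<inter> space E.N = {z \<in> space env_space. \<forall>w\<in>I. place z w = c w}"
    using c by (auto simp: X_def fun_eq_iff restrict_def PiE_iff extensional_def)
   also have "... \<in> sets env_space"
   proof (rule sets.sets_Collect_finite_All[OF _ I(1)])
    fix w
    show "{z \<in> space env_space. place z w = c w} \<in> sets env_space"
     using measurable_sets[OF placed_measurable(4)[of w], of "{c w}"] by (simp add: vimage_def Int_def conj_commute)
   qed
   finally show "X -` {c} \<inter> space E.N \<in> sets E.N" by simp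
  qed
  show "(%z. P z (ptime z) * (\<Prod>w\<in>I. ev w (place z w) z)) \<in> bmeas E.N"
   "(%z. P z (ptime z) * (\<Prod>w\<in>I. kr w (ptime z (place z w)))) \<in> bmeas E.N"
   using gm hm by (simp_all only: measurable_cong_sets[OF E.sets_N refl])
  fix c assume c: "c \<in> ?C"
  show "(\<integral>\<^sup>+z. of_bool (X z = c) * (P z (ptime z) * (\<Prod>w\<in>I. ev w (place z w) z)) \<partial>E.N) =
   (\<integral>\<^sup>+z. of_bool (X z = c) * (P z (ptime z) * (\<Prod>w\<in>I. kr w (ptime z (place z w)))) \<partial>E.N)"
  proof (cases "inj_on c I & (\<forall>w\<in>I. length (c w) = n)")
   \<comment> \<open>On good environments the placement is injective and preserves length, so such
     values \<open>c\<close> occur with probability 0.\<close>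
   case False
   have "AE z in E.N. X z ~= c"
    using AE_good_env
   proof eventually_elim
    case (elim z)
    interpret good_env z by fact
    show ?case
    proof
     assume "X z = c"
     then have "\<And>w. w \<in> I ==> c w = place z w" by (auto simp: X_def)
     then have "inj_on c I & (\<forall>w\<in>I. length (c w) = n)" using I(2) place_inj by (auto simp: inj_on_def)
     then show False using False by blast
    qed
   qed
   then show ?thesis by (intro nn_integral_cong_AE, eventually_elim) simp
  next
   case True
   \<comment> \<open>Placement and history are computed from lifted times, so \<Psi> depends only on
     the data allowed in \<open>many_vertices\<close>. On good environments lifting
     \<open>ptime z\<close> gives back \<open>ptime z\<close>.\<close>
   define \<Psi> :: "env \<times> (vertex => ereal) => ennreal" where
    "\<Psi> x = (\<Prod>w\<in>I. of_bool (place_of (fst x) (lift n (fst x) (snd x)) w = c w)) * P (fst x) (lift n (fst x) (snd x))" for x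
   have lm: "(%x. lift n (fst x) (snd x)) \<in> measurable (env_space \<Otimes>\<^sub>M time_space) time_space"
    by (rule lift_measurable) auto
   have \<Psi>m: "\<Psi> \<in> bmeas (env_space \<Otimes>\<^sub>M time_space)"
   proof -
    have [measurable]: "(%x. place_of (fst x) (lift n (fst x) (snd x)) w) \<in> measurable (env_space \<Otimes>\<^sub>M time_space) (count_space UNIV)" for w
     by (rule place_of_measurable[OF measurable_fst lm])
    have "(%x. of_bool (place_of (fst x) (lift n (fst x) (snd x)) w = c w) :: ennreal) \<in> bmeas (env_space \<Otimes>\<^sub>M time_space)" for w
     by measurable
    then show ?thesis unfolding \<Psi>_def[abs_def]
     by (intro borel_measurable_times_ennreal borel_measurable_prod_ennreal Pm measurable_fst lm)
   qed
   have \<Psi>l: "\<Psi> (y, \<theta>) = \<Psi> (y', \<theta>')" if a: "agree n n y \<theta> y' \<theta>'" for y \<theta> y' \<theta>'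
   proof -
    note al = agree_lift[OF a]
    have "place_of y (lift n y \<theta>) w = place_of y' (lift n y' \<theta>') w" "w \<in> vert_of y (lift n y \<theta>) \<longleftrightarrow> w \<in> vert_of y' (lift n y' \<theta>')" if "w \<in> I" for w
     using I(2) that agree_place[OF al, of w] agree_vert[OF al, of w] by auto
    then show ?thesis unfolding \<Psi>_def P_def fst_conv snd_conv agree_hist[OF al] by (simp cong: prod.cong)
   qed
   have \<Psi>z: "\<Psi> (z, ptime z) = of_bool (X z = c) * P z (ptime z)" if "good_env z" for z
   proof -
    have "X z = c \<longleftrightarrow> (\<forall>w\<in>I. place z w = c w)"
     using c by (auto simp: X_def fun_eq_iff restrict_def PiE_iff extensional_def)
    then show ?thesis
     unfolding \<Psi>_def fst_conv snd_conv good_env.lift_ptime[OF that] place_of_ptime prod_of_bool[OF I(1)] by simp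
   qed
   have "(\<integral>\<^sup>+z. of_bool (X z = c) * (P z (ptime z) * (\<Prod>w\<in>I. ev w (place z w) z)) \<partial>E.N) = (\<integral>\<^sup>+z. \<Psi> (z, ptime z) * (\<Prod>w\<in>I. ev w (c w) z) \<partial>E.N)"
   proof (rule nn_integral_cong_AE, use AE_good_env in eventually_elim)
    case (elim z)
    show ?case unfolding \<Psi>z[OF elim] by (cases "X z = c") (auto simp: X_def mult.assoc intro!: arg_cong2[where f="(*)"] prod.cong)
   qed
   also have "... = (\<integral>\<^sup>+z. \<Psi> (z, ptime z) * (\<Prod>w\<in>I. kr w (ptime z (c w))) \<partial>E.N)"
    unfolding ev_def kr_def using True I k B by (intro many_vertices[OF _ _ _ _ _ \<Psi>m \<Psi>l]) auto
   also have "... = (\<integral>\<^sup>+z. of_bool (X z = c) * (P z (ptime z) * (\<Prod>w\<in>I. kr w (ptime z (place z w)))) \<partial>E.N)"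
   proof (rule nn_integral_cong_AE, use AE_good_env in eventually_elim)
    case (elim z)
    show ?case unfolding \<Psi>z[OF elim] by (cases "X z = c") (auto simp: X_def mult.assoc intro!: arg_cong2[where f="(*)"] prod.cong)
   qed
   finally show ?thesis .
  qed
 qed
 have "emeasure E.N {z \<in> space E.N. H z \<in> E & (\<forall>v\<in>I. v \<in> mtbp_vertices (placed_degree z) & placed_degree z v = k v \<and>
   (\<lambda>j\<in>{..<num_children v (k v)}. (placed_label z (v @ [j]), placed_type z (v @ [j]))) \<in> B v)} =
   (\<integral>\<^sup>+z. P z (ptime z) * (\<Prod>w\<in>I. ev w (place z w) z) \<partial>E.N)"
  unfolding lhs[symmetric] by (rule nn_integral_of_bool[OF S, symmetric])
 also note main
 also have "(\<integral>\<^sup>+z. P z (ptime z) * (\<Prod>w\<in>I. kr w (ptime z (place z w))) \<partial>E.N) =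
  (\<integral>\<^sup>+z. indicator {z. H z \<in> E & I \<subseteq> mtbp_vertices (placed_degree z)} z *
   (\<Prod>v\<in>I. ennreal (degree_prob p lam (placed_type z v) (k v)) * emeasure (children_law p lam v (placed_type z v) (k v)) (B v)) \<partial>E.N)"
 proof (rule nn_integral_cong_AE, use AE_good_env in eventually_elim)
  case (elim z)
  interpret good_env z by fact
  have "0 < placed_type z v" for v using pos by (simp add: placed_type_def ptime_eq)
  then have "kr v (ptime z (place z v)) = ennreal (degree_prob p lam (placed_type z v) (k v)) * emeasure (children_law p lam v (placed_type z v) (k v)) (B v)" for v
   unfolding kr_def kern_def placed_type_def[symmetric] by simp
  moreover have "P z (ptime z) = indicator {z. H z \<in> E & I \<subseteq> mtbp_vertices (placed_degree z)} z"
   unfolding Pz by (simp add: indicator_def)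
  ultimately show ?case by simp
 qed
 finally show ?thesis .
qed

lemma rdcp_mtbp_placed:
 "rdcp_mtbp E.N p lam (%v z. placed_type z v) (%v z. placed_degree z v) (%v z. placed_label z v)"
proof (intro rdcp_mtbp.intro edge_labelled_mtbp.intro edge_labelled_mtbp_axioms.intro)
 show "rdcp_ode p lam" by (rule rdcp_ode_axioms)
 show "prob_space E.N" by (rule E.N.prob_space_axioms)
 show "E.N.random_variable borel (%z. placed_type z v)" "E.N.random_variable (count_space UNIV) (%z. placed_degree z v)"
  "E.N.random_variable borel (%z. placed_label z v)" for v
  using placed_measurable[of v] by (simp_all only: measurable_cong_sets[OF E.sets_N refl])
 show "distributed E.N lborel (%z. placed_type z []) (%t. ennreal (f t))"
  unfolding distributed_def
 proof (intro conjI)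
  have m: "(%z. placed_type z []) \<in> bmeas E.N"
   using placed_measurable(1)[of "[]"] by (simp only: measurable_cong_sets[OF E.sets_N refl])
  then show "E.N.random_variable lborel (%z. placed_type z [])" by simp
  show "(%t. ennreal (f t)) \<in> bmeas lborel" by simp
  show "distr E.N lborel (%z. placed_type z []) = density lborel (%t. ennreal (f t))"
  proof (rule measure_eqI)
   fix A assume "A \<in> sets (distr E.N lborel (%z. placed_type z []))"
   then have A: "A \<in> sets borel" by simp
   have im: "(%r. indicator A (real_of_ereal r) :: ennreal) \<in> bmeas borel"
    by (rule measurable_compose[OF borel_measurable_real_of_ereal[of "%x. x"] borel_measurable_indicator[OF A]]) simp
   have "emeasure (distr E.N lborel (%z. placed_type z [])) A = (\<integral>\<^sup>+t. indicator A t \<partial>distr E.N lborel (%z. placed_type z []))"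
    using A by simp
   also have "... = (\<integral>\<^sup>+z. indicator A (placed_type z []) \<partial>E.N)"
    using m A by (intro nn_integral_distr) auto
   also have "... = (\<integral>\<^sup>+z. (%r. indicator A (real_of_ereal r)) (ptime z []) \<partial>E.N)" by (simp add: placed_type_def)
   also have "... = (\<integral>\<^sup>+t. ennreal (f t) * indicator A t \<partial>lborel)" unfolding nn_integral_ptime[OF im] by simp
   also have "... = emeasure (density lborel (%t. ennreal (f t))) A" using A by (simp add: emeasure_density)
   finally show "emeasure (distr E.N lborel (%z. placed_type z [])) A = emeasure (density lborel (%t. ennreal (f t))) A" .
  qed simp
 qed
qed (rule placed_generation)

end

section \<open>Transfer to the PWIT\<close>

lemma Int_stable_vimage: "Int_stable {h -` B \<inter> space M |B. B \<in> sets K}"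
proof (rule Int_stableI)
 fix a b assume "a \<in> {h -` B \<inter> space M |B. B \<in> sets K}" "b \<in> {h -` B \<inter> space M |B. B \<in> sets K}"
 then obtain B B' where "B \<in> sets K" "B' \<in> sets K" "a = h -` B \<inter> space M" "b = h -` B' \<inter> space M" by blast
 then have "a \<inter> b = h -` (B \<inter> B') \<inter> space M" "B \<inter> B' \<in> sets K" by auto
 then show "a \<inter> b \<in> {h -` B \<inter> space M |B. B \<in> sets K}" by blast
qed

context rdcp_ode begin

text \<open>The weights of the positive values already sum to 1, which excludes the value 0.\<close>

lemma degree_distr:
 assumes "pwit_rdcp M p \<tau> d" shows "distr M (count_space UNIV) (d v) = degree_law"
proof -
 interpret pwit_rdcp M p \<tau> d by fact
 let ?D = "distr M (count_space UNIV) (d v)"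
 interpret D: prob_space ?D by (rule prob_space_distr[OF degrees_measurable])
 have D1: "emeasure ?D {Suc k} = ennreal (p (Suc k))" for k
 proof -
  have "emeasure ?D {Suc k} = emeasure M {w\<in>space M. d v w = Suc k}"
   by (subst emeasure_distr[OF degrees_measurable]) (auto intro!: arg_cong[where f="emeasure M"])
  also have "... = ennreal (p (Suc k))" unfolding emeasure_eq_measure by (simp add: degrees)
  finally show ?thesis .
 qed
 have L1: "emeasure degree_law {Suc k} = ennreal (p (Suc k))" for k
 proof -
  have "emeasure degree_law {Suc k} = (\<integral>\<^sup>+l. indicator {Suc k} l \<partial>degree_law)" by simp
  also have "... = (\<Sum>l\<in>{k}. ennreal (p (Suc l)) * indicator {Suc k} (Suc l))"
   unfolding nn_integral_degree_law by (rule suminf_finite) (auto simp: indicator_def)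
  finally show ?thesis by simp
 qed
 have "emeasure ?D {k \<in> space ?D. 1 <= k} = 1"
 proof -
  have "{k \<in> space ?D. 1 <= k} = (\<Union>k. {Suc k})" by (auto simp: Suc_le_eq gr0_conv_Suc)
  then have "emeasure ?D {k \<in> space ?D. 1 <= k} = (\<Sum>k. emeasure ?D {Suc k})"
   by (simp add: suminf_emeasure[symmetric, of "%k. {Suc k}"] disjoint_family_on_def)
  also have "... = ennreal 1"
   unfolding D1 using p_sums by (intro suminf_ennreal_eq p_nonneg) auto
  finally show ?thesis by simp
 qed
 then have "AE k in ?D. 1 <= k" by (subst D.AE_iff_emeasure_eq_1) auto
 then have a1: "AE k in ?D. k \<in> {1..}" by simp
 have a2: "AE k in degree_law. k \<in> {1..}" using AE_degree_law by simp
 show ?thesis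
 proof (rule measure_eqI_countable_AE[OF _ _ a1 a2])
  fix k :: nat assume "k \<in> {1..}"
  then obtain l where "k = Suc l" by (auto simp: Suc_le_eq gr0_conv_Suc)
  then show "emeasure ?D {k} = emeasure degree_law {k}" using D1 L1 by simp
 qed auto
qed

text \<open>Labels below a vertex and its constraint are two separate members of the independent
  family; grouping them in pairs gives independence over the vertices, and each pair has law
  \<open>local_law\<close>.\<close>

lemma pwit_env:
 assumes pw: "pwit_rdcp M p \<tau> d"
 defines "Y \<equiv> %w v. ((%j. \<tau> (v @ [j]) w), d v w)"
 shows "Y \<in> measurable M env_space" "distr M E.N Y = E.N"
proof -
 interpret pwit_rdcp M p \<tau> d by fact
 define X where "X v w = (%j. \<tau> (v @ [j]) w)" for v w
 define Ev :: "vertex + vertex => 'a set set" where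
  "Ev i = (case i of Inl v => {X v -` B \<inter> space M |B. B \<in> sets seq_space}
    | Inr v => {d v -` B \<inter> space M |B. B \<in> sets (count_space UNIV)})" for i
 have Y: "Y w v = (X v w, d v w)" for w v by (simp add: Y_def X_def)
 have ind: "indep_sets Ev UNIV" using independence unfolding Ev_def[abs_def] X_def[abs_def] .
 have Xm: "X v \<in> measurable M seq_space" for v
  unfolding X_def[abs_def] using labels[of v] by (intro measurable_PiM_single') (auto simp: poisson_points_def)
 have Xd: "distr M seq_space (X v) = arrivals" for v
  unfolding X_def[abs_def] by (rule poisson_points_distr[OF labels])
 have Ym: "(%w. Y w v) \<in> measurable M local_space" for v
  unfolding Y by (intro measurable_Pair Xm degrees_measurable)
 show YM: "Y \<in> measurable M env_space"
  by (rule measurable_PiM_single') (use Ym in \<open>auto\<close>)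
 have law: "distr M local_space (%w. Y w v) = local_law" for v
  unfolding local_law_def
 proof (rule pair_measure_eqI[symmetric])
  show "sigma_finite_measure arrivals" "sigma_finite_measure degree_law"
   using prob_space_arrivals prob_space_degree_law by (auto intro: prob_space_imp_sigma_finite)
  show "sets (arrivals \<Otimes>\<^sub>M degree_law) = sets (distr M local_space (%w. Y w v))"
   by (simp, rule sets_pair_measure_cong) auto
  fix A B assume A: "A \<in> sets arrivals" and B: "B \<in> sets degree_law"
  then have A': "A \<in> sets seq_space" by simp
  let ?J = "{Inl v, Inr v} :: (vertex + vertex) set"
  let ?S = "%i. case i of Inl _ => X v -` A \<inter> space M | Inr (_ :: vertex) => d v -` B \<inter> space M"
  have "prob (\<Inter>i\<in>?J. ?S i) = (\<Prod>i\<in>?J. prob (?S i))"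
  proof (rule indep_setsD[OF ind])
   show "\<forall>j\<in>?J. ?S j \<in> Ev j" using A' B by (auto simp: Ev_def)
  qed auto
  then have pr: "prob ((X v -` A \<inter> space M) \<inter> (d v -` B \<inter> space M)) = prob (X v -` A \<inter> space M) * prob (d v -` B \<inter> space M)" by simp
  have AB: "A \<times> B \<in> sets local_space" using A' B by (intro pair_measureI) auto
  have "emeasure (distr M local_space (%w. Y w v)) (A \<times> B) = emeasure M ((X v -` A \<inter> space M) \<inter> (d v -` B \<inter> space M))"
   by (subst emeasure_distr[OF Ym AB]) (auto simp: Y intro!: arg_cong[where f="emeasure M"])
  also have "... = emeasure M (X v -` A \<inter> space M) * emeasure M (d v -` B \<inter> space M)"
   unfolding emeasure_eq_measure pr by (simp add: ennreal_mult)
  also have "emeasure M (X v -` A \<inter> space M) = emeasure arrivals A"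
   unfolding Xd[of v, symmetric] using A' by (simp add: emeasure_distr[OF Xm])
  also have "emeasure M (d v -` B \<inter> space M) = emeasure degree_law B"
   unfolding degree_distr[OF pw, of v, symmetric] by (simp add: emeasure_distr[OF degrees_measurable])
  finally show "emeasure arrivals A * emeasure degree_law B = emeasure (distr M local_space (%w. Y w v)) (A \<times> B)" ..
 qed
 \<comment> \<open>The sigma algebra generated by the two families that belong to
   \<open>v\<close>.\<close>
 let ?G = "%v. sigma_sets (space M) (\<Union>i\<in>{Inl v, Inr v}. Ev i)"
 have indG: "indep_sets ?G UNIV"
 proof (rule indep_sets_collect_sigma)
  have "(\<Union>v. {Inl v, Inr v}) = (UNIV :: (vertex + vertex) set)"
  proof (intro set_eqI iffI UNIV_I)
   fix i :: "vertex + vertex"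
   show "i \<in> (\<Union>v. {Inl v, Inr v})" by (cases i) auto
  qed
  then show "indep_sets Ev (\<Union>v. {Inl v, Inr v})" using ind by simp
  show "Int_stable (Ev i)" for i unfolding Ev_def by (cases i) (simp_all only: sum.case Int_stable_vimage)
  show "disjoint_family_on (%v :: vertex. {Inl v, Inr v}) UNIV" by (auto simp: disjoint_family_on_def)
 qed
 have YG: "(%w. Y w v) -` A \<inter> space M \<in> ?G v" if A: "A \<in> sets local_space" for v A
 proof -
  let ?S = "sigma (space M) (\<Union>i\<in>{Inl v, Inr v}. Ev i)"
  have sub: "(\<Union>i\<in>{Inl v, Inr v}. Ev i) \<subseteq> Pow (space M)" by (auto simp: Ev_def)
  have sp: "space ?S = space M" by (rule space_measure_of[OF sub])
  have se: "sets ?S = ?G v" by (rule sets_measure_of[OF sub])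
  have 1: "X v \<in> measurable ?S seq_space"
  proof (rule measurableI)
   fix B :: "(nat => real) set" assume "B \<in> sets seq_space"
   then have "X v -` B \<inter> space M \<in> Ev (Inl v)" by (auto simp: Ev_def)
   then show "X v -` B \<inter> space ?S \<in> sets ?S" unfolding sp se by (intro sigma_sets.Basic) auto
  qed (simp add: space_PiM)
  have 2: "d v \<in> measurable ?S (count_space UNIV)"
  proof (rule measurableI)
   fix B :: "nat set"
   have "d v -` B \<inter> space M \<in> Ev (Inr v)" by (auto simp: Ev_def)
   then show "d v -` B \<inter> space ?S \<in> sets ?S" unfolding sp se by (intro sigma_sets.Basic) auto
  qed simp
  have "(%w. Y w v) \<in> measurable ?S local_space" unfolding Y by (intro measurable_Pair 1 2)
  from measurable_sets[OF this A] show ?thesis unfolding sp se .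
 qed
 have YN: "Y \<in> measurable M E.N" using YM by (simp only: measurable_cong_sets[OF refl E.sets_N])
 show "distr M E.N Y = E.N"
 proof (rule measure_eqI_PiM_infinite[where I=UNIV and M="%_. local_law"])
  show "finite_measure (distr M E.N Y)" by (rule prob_space.finite_measure[OF prob_space_distr[OF YN]])
  fix A and J :: "vertex set" assume J: "finite J" and A: "\<And>i. i \<in> J ==> A i \<in> sets local_law"
  have A': "A i \<in> sets local_space" if "i \<in> J" for i using A[OF that] by simp
  have e: "prod_emb UNIV (%_. local_law) J (Pi\<^sub>E J A) = {x. \<forall>i\<in>J. x i \<in> A i}"
   by (auto simp: prod_emb_def space_PiM)
  have S: "{x. \<forall>i\<in>J. x i \<in> A i} \<in> sets E.N"
   unfolding e[symmetric] E.N_def using J A by (intro sets_PiM_I) auto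
  have R: "emeasure E.N {x. \<forall>i\<in>J. x i \<in> A i} = (\<Prod>i\<in>J. emeasure local_law (A i))"
   using emeasure_PiM_Collect'[of "%_. local_law" J A] E.prob_W J A by (simp add: E.N_def[symmetric])
  have Le: "emeasure (distr M E.N Y) {x. \<forall>i\<in>J. x i \<in> A i} = emeasure M {w\<in>space M. \<forall>i\<in>J. Y w i \<in> A i}"
   by (subst emeasure_distr[OF YN S]) (auto intro!: arg_cong[where f="emeasure M"])
  have "emeasure M {w\<in>space M. \<forall>i\<in>J. Y w i \<in> A i} = (\<Prod>i\<in>J. emeasure local_law (A i))"
  proof (cases "J = {}")
   case True
   then show ?thesis by (simp add: emeasure_space_1)
  next
   case False
   have "{w\<in>space M. \<forall>i\<in>J. Y w i \<in> A i} = (\<Inter>i\<in>J. (%w. Y w i) -` A i \<inter> space M)" using False by auto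
   then have "emeasure M {w\<in>space M. \<forall>i\<in>J. Y w i \<in> A i} = ennreal (\<Prod>i\<in>J. prob ((%w. Y w i) -` A i \<inter> space M))"
    using indep_setsD[OF indG _ False J, of "%i. (%w. Y w i) -` A i \<inter> space M"] YG[OF A'] by (simp add: emeasure_eq_measure)
   also have "... = (\<Prod>i\<in>J. emeasure M ((%w. Y w i) -` A i \<inter> space M))"
    by (simp add: emeasure_eq_measure prod_ennreal)
   also have "... = (\<Prod>i\<in>J. emeasure local_law (A i))"
   proof (rule prod.cong[OF refl])
    fix i assume "i \<in> J"
    then show "emeasure M ((%w. Y w i) -` A i \<inter> space M) = emeasure local_law (A i)"
     using emeasure_distr[OF Ym A', of i i] unfolding law by simp
   qed
   finally show ?thesis .
  qed
  then show "emeasure (distr M E.N Y) (prod_emb UNIV (%_. local_law) J (Pi\<^sub>E J A)) = emeasure E.N (prod_emb UNIV (%_. local_law) J (Pi\<^sub>E J A))"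
   unfolding e Le R .
 qed (auto simp: E.N_def)
qed

end

theorem theorem1p41:
  fixes p :: "nat \<Rightarrow> real" and lam :: "real \<Rightarrow> real" and t_hat :: ereal
    and M :: "'a measure" and \<tau> :: "vertex \<Rightarrow> 'a \<Rightarrow> real" and d :: "vertex \<Rightarrow> 'a \<Rightarrow> nat"
    and M' :: "'b measure" and T' :: "vertex \<Rightarrow> 'b \<Rightarrow> real" and d' :: "vertex \<Rightarrow> 'b \<Rightarrow> nat"
    and \<tau>' :: "vertex \<Rightarrow> 'b \<Rightarrow> real"
  assumes "0 \<le> t_hat"
    and "\<And>k. 1 \<le> k \<Longrightarrow> 0 \<le> p k"
    and "(\<lambda>k. p (Suc k)) sums 1"
    and "solves_rdcp_ode p lam"
    and "pwit_rdcp M p \<tau> d"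
    and "edge_labelled_mtbp M' p lam T' d' \<tau>'"
  shows "(\<lambda>\<omega>. rdcp_tree (\<lambda>v. \<tau> v \<omega>) (\<lambda>v. d v \<omega>) t_hat)
           \<in> measurable (completion M) tree_space \<and>
         (\<lambda>\<omega>. mtbp_tree (\<lambda>v. T' v \<omega>) (\<lambda>v. d' v \<omega>) (\<lambda>v. \<tau>' v \<omega>) t_hat)
           \<in> measurable M' tree_space \<and>
         distr M' tree_space
           (\<lambda>\<omega>. mtbp_tree (\<lambda>v. T' v \<omega>) (\<lambda>v. d' v \<omega>) (\<lambda>v. \<tau>' v \<omega>) t_hat) =
         distr (completion M) tree_space
           (\<lambda>\<omega>. rdcp_tree (\<lambda>v. \<tau> v \<omega>) (\<lambda>v. d v \<omega>) t_hat)"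
proof -
  interpret O: rdcp_ode p lam
    using assms(2-4) by (simp add: rdcp_ode_def rdcp_ode_axioms_def degree_dist_def)
  interpret B: edge_labelled_mtbp M' p lam T' d' \<tau>' by fact
  have B: "rdcp_mtbp M' p lam T' d' \<tau>'"
    by (rule rdcp_mtbp.intro[OF O.rdcp_ode_axioms B.edge_labelled_mtbp_axioms])
  define Y :: "'a \<Rightarrow> env" where "Y = (\<lambda>\<omega> v. ((\<lambda>j. \<tau> (v @ [j]) \<omega>), d v \<omega>))"
  define X where "X \<omega> = rdcp_tree (\<lambda>v. \<tau> v \<omega>) (\<lambda>v. d v \<omega>) t_hat" for \<omega>
  define g where "g z = mtbp_tree (placed_type z) (placed_degree z) (placed_label z) t_hat" for z
  have Ym: "Y \<in> measurable M O.E.N" and Yd: "distr M O.E.N Y = O.E.N"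
    using O.pwit_env[OF assms(5)] unfolding Y_def by (simp_all only: measurable_cong_sets[OF refl O.E.sets_N])
  have gm: "g \<in> measurable O.E.N tree_space"
    unfolding g_def[abs_def]
    by (rule mtbp_tree_measurable)
      (simp_all only: measurable_cong_sets[OF O.E.sets_N refl] O.placed_measurable)
  have gY: "(\<lambda>\<omega>. g (Y \<omega>)) \<in> measurable M tree_space" by (rule measurable_compose[OF Ym gm])
  \<comment> \<open>Almost sure statements about the model environment are pulled back to the given
    probability space along \<open>Y\<close>.\<close>
  have "AE z in distr M O.E.N Y. good_env z \<and> (\<forall>u j. ereal (fst (z u) j) \<noteq> t_hat)"
    unfolding Yd using O.AE_good_env O.AE_labels_neq[of t_hat] by eventually_elim simp
  from AE_distrD[OF Ym this] have ae: "AE \<omega> in M. X \<omega> = g (Y \<omega>)"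
  proof eventually_elim
    case (elim \<omega>)
    then have "good_tree (Y \<omega>) (\<lambda>v. \<tau> v \<omega>) (\<lambda>v. d v \<omega>)"
      by (simp add: good_tree_def good_tree_axioms_def Y_def)
    from good_tree.rdcp_tree_eq[OF this] elim show ?case by (simp add: X_def g_def)
  qed
  have gYc: "(\<lambda>\<omega>. g (Y \<omega>)) \<in> measurable (completion M) tree_space" by (rule measurable_completion[OF gY])
  have aec: "AE \<omega> in completion M. X \<omega> = g (Y \<omega>)" by (rule AE_completion[OF ae])
  \<comment> \<open>\<open>X\<close> equals a measurable function outside a null set, which suffices
    for measurability on the completion.\<close>
  have Xm: "X \<in> measurable (completion M) tree_space"
  proof (rule measurableI)
    show "X \<omega> \<in> space tree_space" for \<omega> by (auto simp: tree_space_def space_PiM space_pair_measure)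
    fix A assume A: "A \<in> sets tree_space"
    show "X -` A \<inter> space (completion M) \<in> sets (completion M)"
    proof (rule completion.in_sets_AE)
      show "(\<lambda>\<omega>. g (Y \<omega>)) -` A \<inter> space (completion M) \<in> sets (completion M)" by (rule measurable_sets[OF gYc A])
      show "AE \<omega> in completion M. \<omega> \<in> (\<lambda>\<omega>. g (Y \<omega>)) -` A \<inter> space (completion M) \<longleftrightarrow> \<omega> \<in> X -` A \<inter> space (completion M)"
        using aec by eventually_elim auto
    qed simp
  qed
  have mt: "(\<lambda>\<omega>. mtbp_tree (\<lambda>v. T' v \<omega>) (\<lambda>v. d' v \<omega>) (\<lambda>v. \<tau>' v \<omega>) t_hat) \<in> measurable M' tree_space"
    by (rule mtbp_tree_measurable) (rule B.types_measurable B.degrees_measurable B.labels_measurable)+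
  have "distr (completion M) tree_space X = distr (completion M) tree_space (\<lambda>\<omega>. g (Y \<omega>))"
    by (rule distr_cong_AE[OF refl refl aec Xm gYc])
  also have "\<dots> = distr M tree_space (\<lambda>\<omega>. g (Y \<omega>))" by (rule distr_completion[OF gY])
  also have "\<dots> = distr (distr M O.E.N Y) tree_space g"
    using distr_distr[OF gm Ym] by (simp add: comp_def)
  also have "\<dots> = distr O.E.N tree_space g" unfolding Yd ..
  also have "\<dots> = distr M' tree_space (\<lambda>\<omega>. mtbp_tree (\<lambda>v. T' v \<omega>) (\<lambda>v. d' v \<omega>) (\<lambda>v. \<tau>' v \<omega>) t_hat)"
    unfolding g_def[abs_def] by (rule mtbp_tree_distr_unique[OF O.rdcp_mtbp_placed B])
  finally show ?thesis using Xm mt unfolding X_def[abs_def] by simp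
qed

end
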